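(* Let $K$ be an algebraically closed field and let $\Theta$ be a finite simple oriented graph such that $K[\mathrm{HK}_\Theta]$ is a PI-algebra. Let $\Theta'$ be the subgraph of $\Theta$ obtained by deleting all arrows $x\to y$ that are not contained in any cyclic subgraph of $\Theta$, and let $\Theta_1,\ldots,\Theta_m$ be the connected components of $\Theta'$. Then the maximal ideals of $K[\mathrm{HK}_\Theta]$ are in a bijection with the maximal ideals of $K[\mathrm{HK}_{\Theta'}]$. Under the identification $K[\mathrm{HK}_{\Theta'}]=K[\mathrm{HK}_{\Theta_1}]\otimes\cdots\otimes K[\mathrm{HK}_{\Theta_m}]$, the maximal ideals of $K[\mathrm{HK}_{\Theta'}]$ are of the form $$\sum_{i=1}^{m}K[\mathrm{HK}_{\Theta_1}]\otimes\cdots\otimes K[\mathrm{HK}_{\Theta_{i-1}}]\otimes P_i\otimes K[\mathrm{HK}_{\Theta_{i+1}}]\otimes\cdots\otimes K[\mathrm{HK}_{\Theta_m}]$$ for maximal ideals $P_i$ of $K[\mathrm{HK}_{\Theta_i}]$, $i=1,\ldots,m$. Conversely, every ideal of $K[\mathrm{HK}_{\Theta'}]$ of this form is maximal.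
   Context: For a finite simple oriented graph $\Theta$ with vertices $1,\ldots,n$ (no loops, at most one arrow between two vertices), the Hecke--Kiselman monoid $\mathrm{HK}_\Theta$ is the monoid generated by $x_1,\ldots,x_n$ with relations $x_i^2=x_i$; $x_ix_j=x_jx_i$ if $i,j$ are not connected in $\Theta$; and $x_ix_jx_i=x_jx_ix_j=x_ix_j$ if there is an arrow $i\to j$ in $\Theta$. $K[\mathrm{HK}_\Theta]$ is its monoid algebra over $K$. A PI-algebra is an algebra satisfying a nonzero polynomial identity. A cyclic subgraph is a subgraph that is an oriented cycle. It is known that $K[\mathrm{HK}_\Theta]$ is a PI-algebra if and only if $\Theta$ does not contain two cyclic subgraphs connected by an oriented path, and that in this case each connected component of $\Theta'$ is either a singleton or an oriented cycle. Tensor products are over $K$; generators of distinct connected components of $\Theta'$ commute, so $K[\mathrm{HK}_{\Theta'}]$ is the tensor product of the algebras $K[\mathrm{HK}_{\Theta_i}]$. *)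

theory Defs
  imports
    "HOL-Algebra.QuotRing"
    "HOL-Algebra.Module"
    "HOL-Algebra.Product_Groups"
    "HOL-Computational_Algebra.Polynomial"
    "HOL-Library.Poly_Mapping"
    "Graph_Theory.Graph_Theory"
begin

section \<open>Oriented graphs\<close>

locale oriented_graph = pair_digraph +
  assumes antiparallel_free: "(u, v) \<in> parcs G \<Longrightarrow> (v, u) \<notin> parcs G"

text \<open>All vertices are kept; only the arrows lying on no oriented cycle are deleted.\<close>

definition cyclic_part :: "'v pair_pre_digraph \<Rightarrow> 'v pair_pre_digraph" where
  "cyclic_part G =
    \<lparr>pverts = pverts G, parcs = {e \<in> parcs G. \<exists>p. pre_digraph.cycle (with_proj G) p \<and> e \<in> set p}\<rparr>"

text \<open>\<^const>\<open>Digraph_Component.connected\<close> ignores the orientation of the arrows and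
  excludes the null graph.\<close>

definition connected_components :: "'v pair_pre_digraph \<Rightarrow> 'v pair_pre_digraph set" where
  "connected_components G =
    {H. pre_digraph.max_subgraph (with_proj G) Digraph_Component.connected (with_proj H)}"


section \<open>Monoids given by generators and relations\<close>

inductive_set presentation_cong :: "'x set \<Rightarrow> ('x list \<times> 'x list) set \<Rightarrow> ('x list \<times> 'x list) set"
  for X :: "'x set" and R :: "('x list \<times> 'x list) set" where
  base: "\<lbrakk>(u, v) \<in> R; u \<in> lists X; v \<in> lists X\<rbrakk> \<Longrightarrow> (u, v) \<in> presentation_cong X R"
| refl: "u \<in> lists X \<Longrightarrow> (u, u) \<in> presentation_cong X R"
| sym: "(u, v) \<in> presentation_cong X R \<Longrightarrow> (v, u) \<in> presentation_cong X R"
| trans: "\<lbrakk>(u, v) \<in> presentation_cong X R; (v, w) \<in> presentation_cong X R\<rbrakk>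
    \<Longrightarrow> (u, w) \<in> presentation_cong X R"
| append: "\<lbrakk>(u, v) \<in> presentation_cong X R; (u', v') \<in> presentation_cong X R\<rbrakk>
    \<Longrightarrow> (u @ u', v @ v') \<in> presentation_cong X R"

definition presented_monoid :: "'x set \<Rightarrow> ('x list \<times> 'x list) set \<Rightarrow> 'x list set monoid" where
  "presented_monoid X R =
    \<lparr>carrier = lists X // presentation_cong X R,
     monoid.mult = (\<lambda>a b. presentation_cong X R `` {u @ v | u v. u \<in> a \<and> v \<in> b}),
     one = presentation_cong X R `` {[]}\<rparr>"

definition hk_relations :: "'v pair_pre_digraph \<Rightarrow> ('v list \<times> 'v list) set" where
  "hk_relations G =
      {([i, i], [i]) | i. i \<in> pverts G}
    \<union> {([i, j], [j, i]) | i j.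
         i \<in> pverts G \<and> j \<in> pverts G \<and> (i, j) \<notin> parcs G \<and> (j, i) \<notin> parcs G}
    \<union> {([i, j, i], [i, j]) | i j. (i, j) \<in> parcs G}
    \<union> {([j, i, j], [i, j]) | i j. (i, j) \<in> parcs G}"

definition hk_monoid :: "'v pair_pre_digraph \<Rightarrow> 'v list set monoid" where
  "hk_monoid G = presented_monoid (pverts G) (hk_relations G)"


section \<open>Algebras over a field\<close>

text \<open>A \<open>K\<close>-algebra is represented by a \<^typ>\<open>('k, 'a) module\<close> record, whose ring part need
  not be commutative.\<close>

definition algebra_iso :: "('k::field, 'a) module \<Rightarrow> ('k, 'b) module \<Rightarrow> ('a \<Rightarrow> 'b) set" where
  "algebra_iso A B =
    {h \<in> ring_iso A B. \<forall>c. \<forall>a \<in> carrier A. h (c \<odot>\<^bsub>A\<^esub> a) = c \<odot>\<^bsub>B\<^esub> h a}"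

inductive_set lin_span :: "('k::field, 'a) module \<Rightarrow> 'a set \<Rightarrow> 'a set"
  for A :: "('k, 'a) module" and S :: "'a set" where
  zero: "\<zero>\<^bsub>A\<^esub> \<in> lin_span A S"
| base: "a \<in> S \<Longrightarrow> a \<in> lin_span A S"
| add: "\<lbrakk>a \<in> lin_span A S; b \<in> lin_span A S\<rbrakk> \<Longrightarrow> a \<oplus>\<^bsub>A\<^esub> b \<in> lin_span A S"
| smult: "a \<in> lin_span A S \<Longrightarrow> c \<odot>\<^bsub>A\<^esub> a \<in> lin_span A S"

definition list_product :: "('a, 'm) monoid_scheme \<Rightarrow> 'a list \<Rightarrow> 'a" where
  "list_product A as = foldr (\<otimes>\<^bsub>A\<^esub>) as \<one>\<^bsub>A\<^esub>"

text \<open>The linear map sending the basis element \<open>x\<close> to \<open>h x\<close>.\<close>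

definition lin_ext :: "('k::field, 'a) module \<Rightarrow> ('x \<Rightarrow> 'a) \<Rightarrow> ('x \<Rightarrow>\<^sub>0 'k) \<Rightarrow> 'a" where
  "lin_ext A h f = (\<Oplus>\<^bsub>A\<^esub>x \<in> Poly_Mapping.keys f. Poly_Mapping.lookup f x \<odot>\<^bsub>A\<^esub> h x)"

text \<open>Noncommutative polynomials in countably many variables are formal linear combinations of
  words of variable indices.\<close>

definition PI_algebra :: "('k::field, 'a) module \<Rightarrow> bool" where
  "PI_algebra A \<longleftrightarrow>
    (\<exists>f :: nat list \<Rightarrow>\<^sub>0 'k. f \<noteq> 0 \<and>
      (\<forall>a :: nat \<Rightarrow> 'a. range a \<subseteq> carrier A \<longrightarrow>
         lin_ext A (\<lambda>w. list_product A (map a w)) f = \<zero>\<^bsub>A\<^esub>))"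

definition monoid_algebra :: "('x, 'm) monoid_scheme \<Rightarrow> ('k::field, 'x \<Rightarrow>\<^sub>0 'k) module" where
  "monoid_algebra M =
    \<lparr>carrier = {f. Poly_Mapping.keys f \<subseteq> carrier M},
     monoid.mult = (\<lambda>f g. \<Sum>x \<in> Poly_Mapping.keys f. \<Sum>y \<in> Poly_Mapping.keys g.
        Poly_Mapping.single (x \<otimes>\<^bsub>M\<^esub> y) (Poly_Mapping.lookup f x * Poly_Mapping.lookup g y)),
     one = Poly_Mapping.single \<one>\<^bsub>M\<^esub> 1,
     zero = 0,
     add = (+),
     module.smult = (\<lambda>c f. Poly_Mapping.map ((*) c) f)\<rparr>"

definition hk_algebra ::
    "'k itself \<Rightarrow> 'v pair_pre_digraph \<Rightarrow> ('k::field, 'v list set \<Rightarrow>\<^sub>0 'k) module" where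
  "hk_algebra K G = monoid_algebra (hk_monoid G)"

text \<open>For \<open>H\<close> a connected component of \<open>G\<close>: the algebra map sending each generator to the
  generator of the same name. A class of words over \<open>H\<close> goes to the class over \<open>G\<close>
  containing it.\<close>

definition hk_incl ::
    "'k::field itself \<Rightarrow> 'v pair_pre_digraph \<Rightarrow> ('v list set \<Rightarrow>\<^sub>0 'k) \<Rightarrow> ('v list set \<Rightarrow>\<^sub>0 'k)" where
  "hk_incl K G = lin_ext (hk_algebra K G)
    (\<lambda>X. Poly_Mapping.single (presentation_cong (pverts G) (hk_relations G) `` X) 1)"


section \<open>Tensor products of finite families of algebras\<close>

text \<open>The vector space with basis the set of tuples, multiplied componentwise
  (\<^const>\<open>product_group\<close> only uses the monoid structure).\<close>

definition tensor_free ::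
    "'i set \<Rightarrow> ('i \<Rightarrow> ('k::field, 'a) module) \<Rightarrow> ('k, ('i \<Rightarrow> 'a) \<Rightarrow>\<^sub>0 'k) module" where
  "tensor_free I A = monoid_algebra (product_group I A)"

definition tensor_relations ::
    "'i set \<Rightarrow> ('i \<Rightarrow> ('k::field, 'a) module) \<Rightarrow> (('i \<Rightarrow> 'a) \<Rightarrow>\<^sub>0 'k) set" where
  "tensor_relations I A =
      {Poly_Mapping.single (t(i := x \<oplus>\<^bsub>A i\<^esub> y)) 1
         - Poly_Mapping.single (t(i := x)) 1 - Poly_Mapping.single (t(i := y)) 1 | t i x y.
         t \<in> (\<Pi>\<^sub>E j\<in>I. carrier (A j)) \<and> i \<in> I \<and> x \<in> carrier (A i) \<and> y \<in> carrier (A i)}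
    \<union> {Poly_Mapping.single (t(i := c \<odot>\<^bsub>A i\<^esub> x)) 1 - Poly_Mapping.single (t(i := x)) c | t i c x.
         t \<in> (\<Pi>\<^sub>E j\<in>I. carrier (A j)) \<and> i \<in> I \<and> x \<in> carrier (A i)}"

definition tensor_null ::
    "'i set \<Rightarrow> ('i \<Rightarrow> ('k::field, 'a) module) \<Rightarrow> (('i \<Rightarrow> 'a) \<Rightarrow>\<^sub>0 'k) set" where
  "tensor_null I A = lin_span (tensor_free I A) (tensor_relations I A)"

text \<open>The span of the multilinearity relations is a two-sided ideal of the free algebra on tuples,
  so the quotient vector space carries the usual componentwise multiplication.\<close>

definition tensor_product ::
    "'i set \<Rightarrow> ('i \<Rightarrow> ('k::field, 'a) module) \<Rightarrow> ('k, (('i \<Rightarrow> 'a) \<Rightarrow>\<^sub>0 'k) set) module" where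
  "tensor_product I A =
    ring.extend (tensor_free I A Quot tensor_null I A)
      (module.fields (\<lambda>c X. \<Union>x\<in>X. tensor_null I A +>\<^bsub>tensor_free I A\<^esub> (c \<odot>\<^bsub>tensor_free I A\<^esub> x)))"

definition pure_tensor ::
    "'i set \<Rightarrow> ('i \<Rightarrow> ('k::field, 'a) module) \<Rightarrow> ('i \<Rightarrow> 'a) \<Rightarrow> (('i \<Rightarrow> 'a) \<Rightarrow>\<^sub>0 'k) set" where
  "pure_tensor I A t = tensor_null I A +>\<^bsub>tensor_free I A\<^esub> Poly_Mapping.single t 1"

text \<open>The subspace \<open>\<Otimes>\<^sub>i U i\<close> of \<open>\<Otimes>\<^sub>i A i\<close>, for subspaces \<open>U i\<close> of \<open>A i\<close>; over a field it is
  the injective image of the abstract tensor product of the \<open>U i\<close>.\<close>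

definition tensor_subspace ::
    "'i set \<Rightarrow> ('i \<Rightarrow> ('k::field, 'a) module) \<Rightarrow> ('i \<Rightarrow> 'a set) \<Rightarrow> (('i \<Rightarrow> 'a) \<Rightarrow>\<^sub>0 'k) set set" where
  "tensor_subspace I A U =
    lin_span (tensor_product I A) (pure_tensor I A ` (\<Pi>\<^sub>E i\<in>I. U i))"

text \<open>\<open>\<Sum>\<^sub>i A 1 \<otimes> \<dots> \<otimes> A (i - 1) \<otimes> P i \<otimes> A (i + 1) \<otimes> \<dots>\<close>\<close>

definition tensor_ideal ::
    "'i set \<Rightarrow> ('i \<Rightarrow> ('k::field, 'a) module) \<Rightarrow> ('i \<Rightarrow> 'a set) \<Rightarrow> (('i \<Rightarrow> 'a) \<Rightarrow>\<^sub>0 'k) set set" where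
  "tensor_ideal I A P =
    {\<Oplus>\<^bsub>tensor_product I A\<^esub>i\<in>I. s i | s.
       \<forall>i\<in>I. s i \<in> tensor_subspace I A ((\<lambda>j. carrier (A j))(i := P i))}"

text \<open>The map \<open>a\<^sub>1 \<otimes> \<dots> \<otimes> a\<^sub>m \<mapsto> h 1 a\<^sub>1 \<cdots> h m a\<^sub>m\<close> to \<open>B\<close>. An element of the tensor product
  is a coset, on which the underlying linear map is constant when the \<open>h i\<close> are linear.\<close>

definition tensor_mult_map ::
    "('k::field, 'b) module \<Rightarrow> nat \<Rightarrow> (nat \<Rightarrow> 'a \<Rightarrow> 'b) \<Rightarrow> ((nat \<Rightarrow> 'a) \<Rightarrow>\<^sub>0 'k) set \<Rightarrow> 'b" where
  "tensor_mult_map B m h X =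
    the_elem (lin_ext B (\<lambda>t. list_product B (map (\<lambda>i. h i (t i)) [1..<Suc m])) ` X)"

end

theory Submission
  imports Defs "HOL-Library.Multiset"
begin

text \<open>If a vertex has two out-neighbours from which it can be reached again, or if one of two disjoint
  cycles is reachable from the other, then \<open>HK\<^sub>\<Theta>\<close> acts on states of the vertices, each vertex updating
  its state from those of its out-neighbours, in such a way that infinitely many words act freely.
  Then \<open>K[HK\<^sub>\<Theta>]\<close> contains a free algebra of infinite rank and satisfies no identity. So in the PI case
  \<open>\<Theta>'\<close> consists of disjoint oriented cycles and isolated vertices.

  In a simple quotient of \<open>K[HK\<^sub>\<Theta>]\<close> the vertices acting neither as \<open>0\<close> nor as \<open>1\<close> have in- and
  out-neighbours of the same kind. Since no cycle of \<open>\<Theta>\<close> leads to another one, the arrows between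
  such vertices lie in \<open>\<Theta>'\<close>, and all deleted arrows join vertices whose images commute. Hence
  \<open>K[HK\<^sub>\<Theta>]\<close> and \<open>K[HK\<^sub>\<Theta>\<^sub>']\<close> have the same maximal ideals when these are pulled back to the
  free algebra.

  Over \<open>\<Theta>'\<close>, a word moves particles along the cycles. In a simple quotient \<open>R\<close> there is a nonzero
  idempotent word \<open>e\<close> such that \<open>e R e\<close> is spanned by the monomials in finitely many commuting
  elements. Being simple as well, \<open>e R e\<close> is a finitely generated field extension, so \<open>e R e = K e\<close>
  by the Nullstellensatz. With such corners in every factor, a tensor product of simple algebras
  is simple, the product of the words \<open>e\<close> being an element of every nonzero ideal; and, conversely,
  restricting a maximal ideal to a factor gives a maximal ideal.\<close>

section \<open>Places and the Nullstellensatz\<close>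

text \<open>All ideal theory takes place in the free algebra on the type of vertices: an ideal of
  any of the algebras involved is replaced by its preimage, and equality by membership of a
  difference. So the algebras of \<Theta>, of \<Theta>' and of all components are compared inside
  one ring. For the same reason the Nullstellensatz concerns a prime ideal of a commutative ring
  instead of a domain, and it delivers a K-valued point instead of a statement on field extensions.
  Such a point of e R e induces a functional lam on the whole free algebra. The largest ideal in its
  kernel is proper and contains the given maximal ideal, hence equals it, and e x e = lam(x) e
  follows without showing that e R e is a field. These functionals also carry the argument on tensor
  products: their product over the components shows that the ideal generated by the P_i is proper,
  and applying lam to all letters outside one component maps a maximal ideal into its restriction to
  that component. The obstacle in finding e is that words may lose particles; e is taken with as few
  particles as possible, so that every loss gives 0.\<close>

lemma infinite_alg_closed_UNIV: "infinite (UNIV :: 'k::alg_closed_field set)"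
proof
  assume fin: "finite (UNIV :: 'k set)"
  \<comment> \<open>Takes the value 1 everywhere and yet is not constant.\<close>
  define p :: "'k poly" where "p = (\<Prod>a\<in>UNIV. [:- a, 1:]) + 1"
  have deg: "degree (\<Prod>a\<in>(UNIV::'k set). [:- a, 1:]) = card (UNIV :: 'k set)"
    by (subst degree_prod_eq_sum_degree) auto
  have "card (UNIV :: 'k set) > 0"
    using fin by (simp add: card_gt_0_iff)
  then have "degree p > 0"
    unfolding p_def by (subst degree_add_eq_left) (auto simp: deg)
  then obtain x where "poly p x = 0"
    using alg_closed_imp_poly_has_root by blast
  moreover have "poly (\<Prod>a\<in>(UNIV::'k set). [:- a, 1:]) x = 0"
    using fin by (auto simp: poly_prod)
  ultimately show False by (simp add: p_def)
qed

definition subring_set :: "'a::comm_ring_1 set \<Rightarrow> bool" where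
  "subring_set A \<longleftrightarrow> 1 \<in> A \<and> (\<forall>a\<in>A. \<forall>b\<in>A. a - b \<in> A \<and> a * b \<in> A)"

text \<open>A prime ideal \<open>P\<close> of the type-level ring stands for the domain obtained by
  dividing it out; membership of a difference in \<open>P\<close> replaces equality in that
  domain.\<close>

definition prime_set :: "'a::comm_ring_1 set \<Rightarrow> bool" where
  "prime_set P \<longleftrightarrow> 0 \<in> P \<and> 1 \<notin> P \<and> (\<forall>a\<in>P. \<forall>b\<in>P. a + b \<in> P) \<and> (\<forall>a. \<forall>b\<in>P. a * b \<in> P)
     \<and> (\<forall>a b. a * b \<in> P \<longrightarrow> a \<in> P \<or> b \<in> P)"

definition poly_over :: "'a::comm_ring_1 set \<Rightarrow> 'a poly set" where
  "poly_over A = {p. \<forall>i. coeff p i \<in> A}"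

context
  fixes A :: "'a::comm_ring_1 set"
  assumes A: "subring_set A"
begin

lemma subring_set_0: "0 \<in> A" and subring_set_1: "1 \<in> A"
  and subring_set_diff: "a \<in> A \<Longrightarrow> b \<in> A \<Longrightarrow> a - b \<in> A"
  and subring_set_mult: "a \<in> A \<Longrightarrow> b \<in> A \<Longrightarrow> a * b \<in> A"
  using A unfolding subring_set_def by (auto, metis cancel_comm_monoid_add_class.diff_cancel)

lemma subring_set_uminus: "a \<in> A \<Longrightarrow> - a \<in> A"
  using subring_set_diff[OF subring_set_0, of a] by simp

lemma subring_set_add: "a \<in> A \<Longrightarrow> b \<in> A \<Longrightarrow> a + b \<in> A"
  using subring_set_diff[of a "- b"] subring_set_uminus by simp

lemma subring_set_sum: "(\<And>i. i \<in> S \<Longrightarrow> g i \<in> A) \<Longrightarrow> sum g S \<in> A"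
  by (induction S rule: infinite_finite_induct) (auto intro: subring_set_add subring_set_0)

lemma subring_set_power: "a \<in> A \<Longrightarrow> a ^ n \<in> A"
  by (induction n) (auto intro: subring_set_mult subring_set_1)

lemma poly_over_diff: "p \<in> poly_over A \<Longrightarrow> q \<in> poly_over A \<Longrightarrow> p - q \<in> poly_over A"
  by (auto simp: poly_over_def intro: subring_set_diff)

lemma poly_over_add: "p \<in> poly_over A \<Longrightarrow> q \<in> poly_over A \<Longrightarrow> p + q \<in> poly_over A"
  by (auto simp: poly_over_def intro: subring_set_add)

lemma poly_over_mult: "p \<in> poly_over A \<Longrightarrow> q \<in> poly_over A \<Longrightarrow> p * q \<in> poly_over A"
  by (auto simp: poly_over_def coeff_mult intro!: subring_set_sum subring_set_mult)

lemma poly_over_smult: "a \<in> A \<Longrightarrow> q \<in> poly_over A \<Longrightarrow> smult a q \<in> poly_over A"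
  by (auto simp: poly_over_def intro!: subring_set_mult)

lemma poly_over_monom: "a \<in> A \<Longrightarrow> monom a n \<in> poly_over A"
  by (auto simp: poly_over_def subring_set_0)

lemma poly_over_const: "a \<in> A \<Longrightarrow> [:a:] \<in> poly_over A"
  using poly_over_monom[of a 0] by (simp add: monom_0)

lemma poly_over_cutoff: "p \<in> poly_over A \<Longrightarrow> poly_cutoff n p \<in> poly_over A"
  by (auto simp: poly_over_def coeff_poly_cutoff subring_set_0)

text \<open>Without division in \<open>A\<close>, every cancellation of a leading term costs a
  factor \<open>lead_coeff g\<close>. The bound on the degree of \<open>q\<close> is there because a
  minimality argument will be applied to a quotient, not only to a remainder.\<close>

lemma poly_over_pseudo_division:
  assumes g: "g \<in> poly_over A" "g \<noteq> 0" and f: "f \<in> poly_over A"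
  shows "\<exists>k q r. q \<in> poly_over A \<and> r \<in> poly_over A \<and> smult (lead_coeff g ^ k) f = g * q + r
      \<and> (r = 0 \<or> degree r < degree g) \<and> degree q \<le> degree f - degree g"
  using f
proof (induction "degree f" arbitrary: f rule: less_induct)
  case less
  show ?case
  proof (cases "f = 0 \<or> degree f < degree g")
    case True
    then show ?thesis
      using less.prems by (intro exI[of _ 0] exI[of _ 0] exI[of _ f])
        (auto simp: poly_over_def subring_set_0)
  next
    case False
    define d where "d = degree f - degree g"
    define m where "m = monom (lead_coeff f) d"
    define f' where "f' = smult (lead_coeff g) f - g * m"
    have lc: "lead_coeff g \<in> A" "lead_coeff f \<in> A"
      using g less.prems by (auto simp: poly_over_def)
    have m: "m \<in> poly_over A" using lc by (auto simp: m_def poly_over_monom)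
    have f'A: "f' \<in> poly_over A"
      unfolding f'_def by (intro poly_over_diff poly_over_smult poly_over_mult g m lc less.prems)
    have degf: "degree f = d + degree g" using False by (simp add: d_def)
    have degm: "degree (g * m) \<le> degree f"
      using degree_mult_le[of g m] degree_monom_le[of "lead_coeff f" d] degf
      by (simp add: m_def)
    have cgm: "coeff (g * m) (degree f) = lead_coeff g * lead_coeff f"
    proof -
      have "degree m = d" "lead_coeff m = lead_coeff f"
        using False by (auto simp: m_def degree_monom_eq)
      then show ?thesis
        using coeff_mult_degree_sum[of g m] degf by (simp add: add.commute)
    qed
    have "degree f' \<le> degree f"
      unfolding f'_def using degm by (intro degree_diff_le) (auto simp: degree_smult_le)
    moreover have "coeff f' (degree f) = 0" by (simp add: f'_def cgm)
    ultimately have small: "f' = 0 \<or> degree f' < degree f"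
      by (metis leading_coeff_0_iff le_neq_implies_less)
    consider "f' = 0" | "f' \<noteq> 0" "degree f = 0" | "degree f' < degree f"
      using small by auto
    then show ?thesis
    proof cases
      case 1
      have "smult (lead_coeff g ^ 1) f = g * m + 0"
        using 1 by (simp add: f'_def)
      moreover have "degree m \<le> degree f - degree g"
        by (simp add: m_def d_def degree_monom_le)
      ultimately show ?thesis using m by (metis poly_over_smult poly_over_diff cancel_comm_monoid_add_class.diff_cancel m)
    next
      case 2
      then show ?thesis using small by auto
    next
      case 3
      from less.hyps[OF 3 f'A] obtain k q r where *: "q \<in> poly_over A" "r \<in> poly_over A"
        "smult (lead_coeff g ^ k) f' = g * q + r" "r = 0 \<or> degree r < degree g"
        "degree q \<le> degree f' - degree g" by blast
      define q' where "q' = q + smult (lead_coeff g ^ k) m"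
      have "smult (lead_coeff g ^ Suc k) f = g * q' + r"
      proof -
        have "smult (lead_coeff g ^ Suc k) f = smult (lead_coeff g ^ k) (f' + g * m)"
          by (simp add: f'_def mult.commute)
        also have "\<dots> = g * q' + r"
          by (simp add: smult_add_right *(3) q'_def algebra_simps)
        finally show ?thesis .
      qed
      moreover have "q' \<in> poly_over A"
        unfolding q'_def using * lc m by (intro poly_over_add poly_over_smult subring_set_power)
      moreover have "degree q' \<le> degree f - degree g"
        unfolding q'_def
        using *(5) 3 degree_smult_le[of "lead_coeff g ^ k" m] degree_monom_le[of "lead_coeff f" d]
        by (intro degree_add_le) (auto simp: m_def d_def)
      ultimately show ?thesis using * by blast
    qed
  qed
qed

end

text \<open>A \<open>k\<close>-valued point of the image of the subring \<open>A\<close> modulo \<open>P\<close>.\<close>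

definition place :: "('k::field \<Rightarrow> 'a::comm_ring_1) \<Rightarrow> 'a set \<Rightarrow> 'a set \<Rightarrow> ('a \<Rightarrow> 'k) \<Rightarrow> bool" where
  "place \<kappa> P A f \<longleftrightarrow> (\<forall>a\<in>A. \<forall>b\<in>A. f (a + b) = f a + f b \<and> f (a * b) = f a * f b)
     \<and> (\<forall>k. f (\<kappa> k) = k) \<and> (\<forall>a\<in>A \<inter> P. f a = 0)"

context
  fixes \<kappa> :: "'k::field \<Rightarrow> 'a::comm_ring_1" and P A :: "'a set" and f :: "'a \<Rightarrow> 'k" and \<xi> :: 'k
  assumes A: "subring_set A" and f: "place \<kappa> P A f"
begin

lemma place_add: "a \<in> A \<Longrightarrow> b \<in> A \<Longrightarrow> f (a + b) = f a + f b"
  and place_mult: "a \<in> A \<Longrightarrow> b \<in> A \<Longrightarrow> f (a * b) = f a * f b"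
  and place_const: "f (\<kappa> k) = k"
  and place_null: "a \<in> A \<Longrightarrow> a \<in> P \<Longrightarrow> f a = 0"
  using f by (auto simp: place_def)

lemma place_0: "f 0 = 0"
proof -
  have "f 0 + f 0 = f 0 + 0"
    using place_add[of 0 0] subring_set_0[OF A] by simp
  then show ?thesis by (simp only: add_left_cancel)
qed

lemma place_uminus: "a \<in> A \<Longrightarrow> f (- a) = - f a"
  using place_add[of a "- a"] subring_set_uminus[OF A] place_0 by (simp add: add_eq_0_iff)

lemma place_diff: "a \<in> A \<Longrightarrow> b \<in> A \<Longrightarrow> f (a - b) = f a - f b"
  using place_add[of a "- b"] subring_set_uminus[OF A] place_uminus by simp

lemma place_power: "a \<in> A \<Longrightarrow> f 1 = 1 \<Longrightarrow> f (a ^ n) = f a ^ n"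
  by (induction n) (auto simp: place_mult subring_set_power[OF A])

lemma place_sum: "(\<And>i. i \<in> S \<Longrightarrow> g i \<in> A) \<Longrightarrow> f (sum g S) = (\<Sum>i\<in>S. f (g i))"
  by (induction S rule: infinite_finite_induct)
    (auto simp: place_0 place_add subring_set_sum[OF A])

lemma coeff_map_place: "coeff (map_poly f p) i = f (coeff p i)"
  by (simp add: coeff_map_poly place_0)

lemma map_place_add: "p \<in> poly_over A \<Longrightarrow> q \<in> poly_over A \<Longrightarrow>
    map_poly f (p + q) = map_poly f p + map_poly f q"
  by (rule poly_eqI) (auto simp: coeff_map_place poly_over_def place_add)

lemma map_place_mult: "p \<in> poly_over A \<Longrightarrow> q \<in> poly_over A \<Longrightarrow>
    map_poly f (p * q) = map_poly f p * map_poly f q"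
  by (rule poly_eqI) (auto simp: coeff_map_place poly_over_def place_mult coeff_mult place_sum
      subring_set_mult[OF A])

lemma map_place_smult: "a \<in> A \<Longrightarrow> q \<in> poly_over A \<Longrightarrow> map_poly f (smult a q) = smult (f a) (map_poly f q)"
  by (rule poly_eqI) (auto simp: coeff_map_place poly_over_def place_mult)

lemma map_place_const: "map_poly f [:a:] = [:f a:]"
  by (rule poly_eqI) (auto simp: coeff_map_place coeff_pCons place_0 split: nat.splits)

lemma map_place_null: "q \<in> poly_over A \<Longrightarrow> q \<in> poly_over P \<Longrightarrow> map_poly f q = 0"
  by (rule poly_eqI) (auto simp: coeff_map_place poly_over_def place_null)

end

lemma prime_setD:
  assumes "prime_set P"
  shows "0 \<in> P" "1 \<notin> P" "a \<in> P \<Longrightarrow> b \<in> P \<Longrightarrow> a + b \<in> P" "b \<in> P \<Longrightarrow> a * b \<in> P" "a \<in> P \<Longrightarrow> a * b \<in> P"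
    "a * b \<in> P \<Longrightarrow> a \<in> P \<or> b \<in> P"
proof -
  show "a \<in> P \<Longrightarrow> a * b \<in> P"
    using assms unfolding prime_set_def by (subst mult.commute) blast
qed (use assms in \<open>auto simp: prime_set_def\<close>)

lemma prime_set_uminus: "prime_set P \<Longrightarrow> a \<in> P \<Longrightarrow> - a \<in> P"
  using prime_setD(4)[of P a "-1"] by simp

lemma prime_set_diff: "prime_set P \<Longrightarrow> a \<in> P \<Longrightarrow> b \<in> P \<Longrightarrow> a - b \<in> P"
  using prime_setD(3)[of P a "- b"] prime_set_uminus[of P b] by simp

lemma prime_set_power: "prime_set P \<Longrightarrow> a ^ n \<in> P \<Longrightarrow> a \<in> P"
  by (induction n) (auto dest: prime_setD)

lemma prime_set_sum: "prime_set P \<Longrightarrow> (\<And>i. i \<in> S \<Longrightarrow> g i \<in> P) \<Longrightarrow> sum g S \<in> P"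
  by (induction S rule: infinite_finite_induct) (auto dest: prime_setD)

lemma poly_over_prime_set: "prime_set P \<Longrightarrow> p \<in> poly_over P \<Longrightarrow> poly p x \<in> P"
  unfolding poly_altdef
  by (rule prime_set_sum) (auto simp: poly_over_def intro: prime_setD)

text \<open>It suffices that the coefficientwise extension of a place vanishes on the relations of \<open>x\<close>.\<close>

lemma place_extend:
  fixes \<kappa> :: "'k::field \<Rightarrow> 'a::comm_ring_1"
  assumes A: "subring_set A" and f: "place \<kappa> P A f" and \<kappa>: "range \<kappa> \<subseteq> A"
    and null: "\<And>p. p \<in> poly_over A \<Longrightarrow> poly p x \<in> P \<Longrightarrow> poly (map_poly f p) \<xi> = 0"
    and P: "prime_set P"
  shows "\<exists>g. place \<kappa> P {poly p x | p. p \<in> poly_over A} g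
      \<and> (\<forall>p\<in>poly_over A. g (poly p x) = poly (map_poly f p) \<xi>)"
proof -
  define h where "h p = poly (map_poly f p) \<xi>" for p
  define g where "g b = h (SOME p. p \<in> poly_over A \<and> poly p x = b)" for b
  have hadd: "h (p + q) = h p + h q" and hmult: "h (p * q) = h p * h q"
    if "p \<in> poly_over A" "q \<in> poly_over A" for p q
    using that by (simp_all add: h_def map_place_add[OF A f] map_place_mult[OF A f])
  \<comment> \<open>The value does not depend on the polynomial chosen: two choices differ by a
    relation of \<open>x\<close>, on which \<open>null\<close> makes \<open>h\<close>
    vanish.\<close>
  have g: "g (poly p x) = h p" if p: "p \<in> poly_over A" for p
  proof -
    define q where "q = (SOME q. q \<in> poly_over A \<and> poly q x = poly p x)"
    have q: "q \<in> poly_over A \<and> poly q x = poly p x"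
      unfolding q_def by (rule someI[where x = p]) (use p in simp)
    then have "h (p - q) = 0"
      unfolding h_def using p by (intro null poly_over_diff[OF A]) (auto simp: prime_setD[OF P])
    moreover have "h p = h (p - q) + h q"
      using hadd[of "p - q" q] p q poly_over_diff[OF A] by auto
    ultimately show ?thesis by (simp add: g_def q_def)
  qed
  have "place \<kappa> P {poly p x | p. p \<in> poly_over A} g"
    unfolding place_def
  proof (intro conjI ballI allI)
    fix a b assume "a \<in> {poly p x | p. p \<in> poly_over A}" "b \<in> {poly p x | p. p \<in> poly_over A}"
    then obtain p q where pq: "a = poly p x" "b = poly q x" "p \<in> poly_over A" "q \<in> poly_over A"
      by auto
    have "g (poly (p + q) x) = g (poly p x) + g (poly q x)"
      using pq by (simp only: g hadd poly_over_add[OF A])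
    then show "g (a + b) = g a + g b" by (simp add: pq)
    have "g (poly (p * q) x) = g (poly p x) * g (poly q x)"
      using pq by (simp only: g hmult poly_over_mult[OF A])
    then show "g (a * b) = g a * g b" by (simp add: pq)
  next
    fix k
    have "g (poly [:\<kappa> k:] x) = h [:\<kappa> k:]"
      using \<kappa> by (intro g poly_over_const[OF A]) auto
    then show "g (\<kappa> k) = k"
      by (simp add: h_def map_place_const[OF A f] place_const[OF A f])
  next
    fix a assume "a \<in> {poly p x | p. p \<in> poly_over A} \<inter> P"
    then obtain p where "p \<in> poly_over A" "a = poly p x" "poly p x \<in> P" by auto
    then show "g a = 0" using null g by (simp add: h_def)
  qed
  then show ?thesis using g by (auto simp: h_def)
qed

lemma subring_set_adjoin:
  assumes A: "subring_set A"
  shows "subring_set {poly p x | p. p \<in> poly_over A}"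
  unfolding subring_set_def
proof (intro conjI ballI)
  show "1 \<in> {poly p x | p. p \<in> poly_over A}"
    using poly_over_const[OF A subring_set_1[OF A]] by (force intro: exI[of _ "[:1:]"])
next
  fix a b assume "a \<in> {poly p x | p. p \<in> poly_over A}" "b \<in> {poly p x | p. p \<in> poly_over A}"
  then obtain p q where "a = poly p x" "b = poly q x" "p \<in> poly_over A" "q \<in> poly_over A"
    by auto
  then show "a - b \<in> {poly p x | p. p \<in> poly_over A}" "a * b \<in> {poly p x | p. p \<in> poly_over A}"
    using poly_over_diff[OF A] poly_over_mult[OF A] by (force intro: exI[of _ "p - q"], force intro: exI[of _ "p * q"])
qed

text \<open>The existence of a single place is not inductive: extending it to an algebraic element
  requires that a leading coefficient is not killed. Being able to avoid the vanishing of any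
  prescribed element outside \<open>P\<close> is a property that survives the adjunction of an
  element.\<close>

definition many_places :: "('k::field \<Rightarrow> 'a::comm_ring_1) \<Rightarrow> 'a set \<Rightarrow> 'a set \<Rightarrow> bool" where
  "many_places \<kappa> P A \<longleftrightarrow> (\<forall>v\<in>A - P. \<exists>f. place \<kappa> P A f \<and> f v \<noteq> 0)"

text \<open>As \<open>x\<close> satisfies no relation modulo \<open>P\<close>, a place of
  \<open>A\<close> extends with an arbitrary value at \<open>x\<close>. Over an infinite field this
  value can be kept away from the roots of the image of a given polynomial.\<close>

lemma many_places_transcendental:
  fixes \<kappa> :: "'k::alg_closed_field \<Rightarrow> 'a::comm_ring_1"
  assumes A: "subring_set A" and P: "prime_set P" and \<kappa>: "range \<kappa> \<subseteq> A"
    and ext: "many_places \<kappa> P A"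
    and tr: "\<And>p. p \<in> poly_over A \<Longrightarrow> poly p x \<in> P \<Longrightarrow> p \<in> poly_over P"
  shows "many_places \<kappa> P {poly p x | p. p \<in> poly_over A}"
  unfolding many_places_def
proof
  fix v assume "v \<in> {poly p x | p. p \<in> poly_over A} - P"
  then obtain p where p: "p \<in> poly_over A" "v = poly p x" "poly p x \<notin> P" by auto
  then obtain i where i: "coeff p i \<notin> P"
    using poly_over_prime_set[OF P, of p x] by (auto simp: poly_over_def)
  then obtain f where f: "place \<kappa> P A f" "f (coeff p i) \<noteq> 0"
    using ext p by (auto simp: many_places_def poly_over_def)
  then have "map_poly f p \<noteq> 0"
    by (metis coeff_map_place[OF A f(1)] coeff_0)
  then have "finite {\<xi>. poly (map_poly f p) \<xi> = 0}"
    by (rule poly_roots_finite)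
  then obtain \<xi> where \<xi>: "poly (map_poly f p) \<xi> \<noteq> 0"
    by (metis (mono_tags, lifting) infinite_alg_closed_UNIV UNIV_I finite_subset mem_Collect_eq subsetI)
  have "\<exists>g. place \<kappa> P {poly p x | p. p \<in> poly_over A} g
      \<and> (\<forall>p\<in>poly_over A. g (poly p x) = poly (map_poly f p) \<xi>)"
    by (rule place_extend[OF A f(1) \<kappa> _ P]) (simp add: map_place_null[OF A f(1)] tr)
  then show "\<exists>f. place \<kappa> P {poly p x | p. p \<in> poly_over A} f \<and> f v \<noteq> 0"
    using p \<xi> by auto
qed

text \<open>A place that does not kill the leading coefficient of a minimal polynomial of
  \<open>x\<close> extends to each root of the image of that polynomial. To keep \<open>v\<close>
  alive as well, a multiple of \<open>v\<close> is found that is congruent modulo \<open>P\<close>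
  to some \<open>c\<close> in \<open>A\<close> outside \<open>P\<close>, and the place is chosen not
  to kill \<open>c\<close> either.\<close>

lemma many_places_algebraic:
  fixes \<kappa> :: "'k::alg_closed_field \<Rightarrow> 'a::comm_ring_1"
  assumes A: "subring_set A" and P: "prime_set P" and \<kappa>: "range \<kappa> \<subseteq> A"
    and ext: "many_places \<kappa> P A"
    and alg: "p0 \<in> poly_over A" "poly p0 x \<in> P" "p0 \<notin> poly_over P"
  shows "many_places \<kappa> P {poly p x | p. p \<in> poly_over A}"
proof -
  \<comment> \<open>Leading terms with coefficients in \<open>P\<close> are cut off, so that degrees
    and leading coefficients become meaningful modulo \<open>P\<close>.\<close>
  have cut: "\<exists>q\<in>poly_over A. poly q x - poly p x \<in> P \<and> lead_coeff q \<notin> P \<and> degree q \<le> degree p"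
    if p: "p \<in> poly_over A" "p \<notin> poly_over P" for p
  proof -
    define I where "I = {i. coeff p i \<notin> P}"
    have "I \<subseteq> {..degree p}"
      using prime_setD(1)[OF P] by (auto simp: I_def intro: le_degree)
    then have fin: "finite I" by (rule finite_subset) simp
    have ne: "I \<noteq> {}" using p by (auto simp: I_def poly_over_def)
    define n where "n = Max I"
    have n: "n \<in> I" "\<And>i. i > n \<Longrightarrow> coeff p i \<in> P"
      using Max_in[OF fin ne] Max_ge[OF fin] by (auto simp: n_def I_def) (meson leD)
    define q where "q = poly_cutoff (Suc n) p"
    have qc: "coeff q i = (if i \<le> n then coeff p i else 0)" for i
      by (auto simp: q_def coeff_poly_cutoff less_Suc_eq_le)
    have "coeff q n \<noteq> 0" using n(1) prime_setD(1)[OF P] by (auto simp: qc I_def)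
    then have deg: "degree q = n"
      by (intro antisym degree_le le_degree) (auto simp: qc)
    have "q - p \<in> poly_over P"
      using n(2) prime_setD(1)[OF P] prime_set_uminus[OF P] by (auto simp: poly_over_def qc)
    then have "poly q x - poly p x \<in> P"
      using poly_over_prime_set[OF P, of "q - p" x] by simp
    moreover have "q \<in> poly_over A"
      unfolding q_def by (rule poly_over_cutoff[OF A p(1)])
    moreover have "lead_coeff q \<notin> P" using n(1) by (simp add: deg qc I_def)
    moreover have "degree q \<le> degree p" using n(1) \<open>I \<subseteq> _\<close> by (auto simp: deg)
    ultimately show ?thesis by blast
  qed
  define N where "N = {p \<in> poly_over A. poly p x \<in> P \<and> lead_coeff p \<notin> P}"
  obtain p1 where "p1 \<in> N"
  proof -
    obtain q where "q \<in> poly_over A" "poly q x - poly p0 x \<in> P" "lead_coeff q \<notin> P"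
      using cut[OF alg(1,3)] by blast
    moreover from this have "poly q x \<in> P"
      using prime_setD(3)[OF P _ alg(2)] by fastforce
    ultimately show ?thesis using that by (auto simp: N_def)
  qed
  then obtain p where pN: "p \<in> N" and pmin: "\<And>q. q \<in> N \<Longrightarrow> degree p \<le> degree q"
    using arg_min_nat_lemma[of "\<lambda>p. p \<in> N" p1 degree] by blast
  then have p: "p \<in> poly_over A" "poly p x \<in> P" "lead_coeff p \<notin> P" by (auto simp: N_def)
  define n where "n = degree p"
  have lcA: "lead_coeff p \<in> A" using p by (auto simp: poly_over_def)
  have p0: "p \<noteq> 0" using p prime_setD(1)[OF P] by auto
  have n0: "n > 0"
  proof (rule ccontr)
    assume "\<not> n > 0"
    then obtain c where "p = [:c:]" unfolding n_def using degree_eq_zeroE by blast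
    then show False using p by auto
  qed
  \<comment> \<open>By minimality of \<open>p\<close>, a polynomial of smaller degree vanishing at
    \<open>x\<close> modulo \<open>P\<close> is zero modulo \<open>P\<close>.\<close>
  have low: "q \<in> poly_over P" if q: "q \<in> poly_over A" "poly q x \<in> P" "degree q < n" for q
  proof (rule ccontr)
    assume "q \<notin> poly_over P"
    then obtain q' where q': "q' \<in> poly_over A" "poly q' x - poly q x \<in> P" "lead_coeff q' \<notin> P"
      "degree q' \<le> degree q" using cut[OF q(1)] by blast
    then have "poly q' x \<in> P"
      using prime_setD(3)[OF P _ q(2)] by fastforce
    then have "q' \<in> N" using q' by (auto simp: N_def)
    then show False using pmin q q' n_def by fastforce
  qed
  have null: "poly (map_poly f b) \<xi> = 0"
    if f: "place \<kappa> P A f" "f (lead_coeff p) \<noteq> 0" and \<xi>: "poly (map_poly f p) \<xi> = 0"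
      and b: "b \<in> poly_over A" "poly b x \<in> P" for f \<xi> b
  proof -
    obtain k q r where *: "q \<in> poly_over A" "r \<in> poly_over A" "smult (lead_coeff p ^ k) b = p * q + r"
      "r = 0 \<or> degree r < degree p"
      using poly_over_pseudo_division[OF A p(1) p0 b(1)] by blast
    have "poly r x = lead_coeff p ^ k * poly b x - poly p x * poly q x"
      using arg_cong[OF *(3), of "\<lambda>p. poly p x"] by simp
    then have "poly r x \<in> P"
      using prime_set_diff[OF P prime_setD(4)[OF P b(2)] prime_setD(5)[OF P p(2)]] by simp
    then have "r \<in> poly_over P"
      using *(4) low[OF *(2)] n0 n_def by auto
    then have r0: "map_poly f r = 0"
      using map_place_null[OF A f(1) *(2)] by simp
    have f1: "f 1 = 1"
      using place_mult[OF A f(1) lcA subring_set_1[OF A]] f(2) by simp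
    have "smult (f (lead_coeff p ^ k)) (map_poly f b) = map_poly f p * map_poly f q + map_poly f r"
      using arg_cong[OF *(3), of "map_poly f"] *(1,2) p(1) b lcA
      by (simp add: map_place_smult[OF A f(1)] map_place_add[OF A f(1)] map_place_mult[OF A f(1)]
          subring_set_power[OF A] poly_over_mult[OF A])
    then have "f (lead_coeff p) ^ k * poly (map_poly f b) \<xi> = 0"
      using arg_cong[where f = "\<lambda>p. poly p \<xi>"] \<xi> r0 place_power[OF A f(1) lcA f1, of k]
      by (metis add.right_neutral mult_zero_left poly_mult poly_smult)
    then show ?thesis using f(2) by simp
  qed
  show ?thesis
    unfolding many_places_def
  proof
    fix v assume "v \<in> {poly p x | p. p \<in> poly_over A} - P"
    then obtain b where b: "b \<in> poly_over A" "v = poly b x" "v \<notin> P" by auto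
    \<comment> \<open>Multiples of \<open>v\<close> modulo \<open>P\<close>, written as polynomials
      in \<open>x\<close> of degree below \<open>n\<close>. One of least degree will turn out to be
      constant.\<close>
    define M where "M = {r \<in> poly_over A. poly r x \<notin> P \<and> degree r < n
        \<and> (\<exists>s\<in>poly_over A. poly s x * v - poly r x \<in> P)}"
    obtain r1 where "r1 \<in> M"
    proof -
      obtain k q r where *: "q \<in> poly_over A" "r \<in> poly_over A" "smult (lead_coeff p ^ k) b = p * q + r"
        "r = 0 \<or> degree r < degree p"
        using poly_over_pseudo_division[OF A p(1) p0 b(1)] by blast
      have eq: "lead_coeff p ^ k * v = poly p x * poly q x + poly r x"
        using arg_cong[OF *(3), of "\<lambda>p. poly p x"] b by simp
      have "lead_coeff p ^ k * v \<notin> P"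
        using prime_setD(6)[OF P] prime_set_power[OF P] p(3) b(3) by blast
      then have "poly r x \<notin> P"
        using p(2) eq prime_setD(3,5)[OF P] by metis
      moreover have "poly [:lead_coeff p ^ k:] x * v - poly r x \<in> P"
        using p(2) by (simp add: eq prime_setD(5)[OF P])
      moreover have "[:lead_coeff p ^ k:] \<in> poly_over A"
        by (intro poly_over_const[OF A] subring_set_power[OF A] lcA)
      ultimately have "r \<in> M" using *(2,4) n0 n_def unfolding M_def by fastforce
      then show ?thesis using that by blast
    qed
    then obtain r where rM: "r \<in> M" and rmin: "\<And>q. q \<in> M \<Longrightarrow> degree r \<le> degree q"
      using arg_min_nat_lemma[of "\<lambda>p. p \<in> M" r1 degree] by blast
    then obtain s where r: "r \<in> poly_over A" "poly r x \<notin> P" "degree r < n" "s \<in> poly_over A"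
      "poly s x * v - poly r x \<in> P" by (auto simp: M_def)
    have deg0: "degree r = 0"
    proof (rule ccontr)
      assume d: "degree r \<noteq> 0"
      have "r \<notin> poly_over P" using poly_over_prime_set[OF P] r(2) by blast
      then obtain r' where r': "r' \<in> poly_over A" "poly r' x - poly r x \<in> P" "lead_coeff r' \<notin> P"
        "degree r' \<le> degree r" using cut r(1) by blast
      have r'P: "poly r' x \<notin> P"
        using r(2) r'(2) prime_set_diff[OF P] by (metis add_diff_cancel_left' diff_add_cancel)
      have sr': "poly s x * v - poly r' x \<in> P"
        using prime_set_diff[OF P r(5) r'(2)] by simp
      have "r' \<in> M" using r r' r'P sr' by (auto simp: M_def)
      then have dr': "degree r' = degree r" using rmin r'(4) by fastforce
      have "r' \<noteq> 0" using r' prime_setD(1)[OF P] by auto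
      then obtain k q t where *: "q \<in> poly_over A" "t \<in> poly_over A" "smult (lead_coeff r' ^ k) p = r' * q + t"
        "t = 0 \<or> degree t < degree r'" "degree q \<le> degree p - degree r'"
        using poly_over_pseudo_division[OF A r'(1) _ p(1)] by blast
      have eq: "poly t x = lead_coeff r' ^ k * poly p x - poly r' x * poly q x"
        using arg_cong[OF *(3), of "\<lambda>p. poly p x"] by simp
      have "poly t x \<in> P"
      proof (rule ccontr)
        assume t: "poly t x \<notin> P"
        \<comment> \<open>The remainder of \<open>p\<close> on division by \<open>r'\<close> is
          again a multiple of \<open>v\<close>, with this cofactor; its degree would contradict the
          choice of \<open>r\<close>.\<close>
        define s' where "s' = - (q * s)"
        have "poly s' x * v - poly t x
            = (- poly q x) * (poly s x * v - poly r' x) - lead_coeff r' ^ k * poly p x"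
          by (simp add: s'_def eq algebra_simps)
        also have "\<dots> \<in> P"
          by (rule prime_set_diff[OF P prime_setD(4)[OF P sr'] prime_setD(4)[OF P p(2)]])
        finally have "poly s' x * v - poly t x \<in> P" .
        moreover have "s' \<in> poly_over A"
          using poly_over_diff[OF A _ poly_over_mult[OF A *(1) r(4)], of 0] subring_set_0[OF A]
          by (auto simp: s'_def poly_over_def)
        moreover have "degree t < degree r"
          using *(4) t dr' prime_setD(1)[OF P] by auto
        ultimately show False
          using rmin[of t] * t r(3) by (auto simp: M_def)
      qed
      then have "poly r' x * poly q x \<in> P"
        using eq p(2) prime_set_diff[OF P prime_setD(4)[OF P p(2)] ]
        by (metis (no_types, lifting) add_diff_cancel_left' diff_add_cancel)
      then have "poly q x \<in> P" using r'P prime_setD(6)[OF P] by blast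
      then have "q \<in> poly_over P"
        using *(1,5) d dr' n0 n_def by (intro low) auto
      \<comment> \<open>Compare coefficients of degree \<open>n\<close> in the division of
        \<open>p\<close> by \<open>r'\<close>: on the left stands an element outside
        \<open>P\<close>, on the right one inside, since all coefficients of \<open>q\<close> are in
        \<open>P\<close>.\<close>
      moreover have "coeff t n = 0"
        using *(4) dr' r(3) by (auto intro: coeff_eq_0)
      then have "coeff (r' * q) n = lead_coeff r' ^ k * lead_coeff p"
        using arg_cong[OF *(3), of "\<lambda>p. coeff p n"] by (simp add: n_def)
      moreover have "coeff (r' * q) n \<in> P" if "q \<in> poly_over P"
        unfolding coeff_mult using that
        by (intro prime_set_sum[OF P] prime_setD(4)[OF P]) (auto simp: poly_over_def)
      ultimately show False
        using prime_setD(6)[OF P] prime_set_power[OF P] p(3) r'(3) by metis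
    qed
    then obtain c where c: "r = [:c:]" using degree_eq_zeroE by blast
    have cA: "c \<in> A" using r(1) c by (auto simp: poly_over_def dest: spec[of _ 0])
    have "lead_coeff p * c \<in> A - P"
      using r(2) p(3) prime_setD(6)[OF P] subring_set_mult[OF A lcA cA] c by auto
    then obtain f where f: "place \<kappa> P A f" "f (lead_coeff p * c) \<noteq> 0"
      using ext by (auto simp: many_places_def)
    then have fc: "f (lead_coeff p) \<noteq> 0" "f c \<noteq> 0"
      using place_mult[OF A f(1) lcA cA] by auto
    have "coeff (map_poly f p) n \<noteq> 0"
      using fc(1) by (simp add: coeff_map_place[OF A f(1)] n_def)
    then have "degree (map_poly f p) > 0"
      using n0 by (metis le_degree less_le_trans)
    then obtain \<xi> where \<xi>: "poly (map_poly f p) \<xi> = 0"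
      using alg_closed_imp_poly_has_root by blast
    obtain g where g: "place \<kappa> P {poly p x | p. p \<in> poly_over A} g"
      "\<forall>p\<in>poly_over A. g (poly p x) = poly (map_poly f p) \<xi>"
      using place_extend[OF A f(1) \<kappa> _ P, of x \<xi>] null[OF f(1) fc(1) \<xi>] by blast
    have sb: "s * b \<in> poly_over A" using poly_over_mult[OF A] r(4) b(1) by blast
    have "s * b - [:c:] \<in> poly_over A"
      using sb poly_over_const[OF A cA] by (rule poly_over_diff[OF A])
    moreover have "poly (s * b - [:c:]) x \<in> P" using r(5) b(2) c by simp
    ultimately have "poly (map_poly f (s * b - [:c:])) \<xi> = 0"
      by (rule null[OF f(1) fc(1) \<xi>])
    moreover have "map_poly f (s * b) = map_poly f (s * b - [:c:]) + map_poly f [:c:]"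
      using map_place_add[OF A f(1) \<open>s * b - [:c:] \<in> poly_over A\<close> poly_over_const[OF A cA]] by simp
    ultimately have "poly (map_poly f s) \<xi> * poly (map_poly f b) \<xi> = f c"
      by (simp add: map_place_mult[OF A f(1) r(4) b(1)] map_place_const[OF A f(1)] flip: poly_mult)
    then have "g v \<noteq> 0" using fc(2) g(2) b by auto
    then show "\<exists>f. place \<kappa> P {poly p x | p. p \<in> poly_over A} f \<and> f v \<noteq> 0"
      using g(1) by blast
  qed
qed

text \<open>The elements of \<open>X\<close> are adjoined to the constants one by one, maintaining
  \<open>many_places\<close>. In the end only the element 1 has to survive.\<close>

theorem weak_nullstellensatz:
  fixes \<kappa> :: "'k::alg_closed_field \<Rightarrow> 'a::comm_ring_1"
  assumes hom: "\<kappa> 1 = 1" "\<And>a b. \<kappa> (a - b) = \<kappa> a - \<kappa> b" "\<And>a b. \<kappa> (a * b) = \<kappa> a * \<kappa> b"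
    and P: "prime_set P" and fin: "finite X"
  shows "\<exists>A f. subring_set A \<and> range \<kappa> \<subseteq> A \<and> X \<subseteq> A \<and> place \<kappa> P A f"
proof -
  have nz: "\<kappa> k \<notin> P" if "k \<noteq> 0" for k
  proof
    assume "\<kappa> k \<in> P"
    then have "\<kappa> (inverse k) * \<kappa> k \<in> P" by (rule prime_setD(4)[OF P])
    then show False using that hom(3)[of "inverse k" k] hom(1) prime_setD(2)[OF P] by simp
  qed
  have inj: "a = b" if "\<kappa> a = \<kappa> b" for a b
    using nz[of "a - b"] that prime_setD(1)[OF P] by (auto simp: hom(2))
  have \<kappa>0: "\<kappa> 0 = 0" using hom(2)[of 0 0] by simp
  have \<kappa>add: "\<kappa> (a + b) = \<kappa> a + \<kappa> b" for a b
    using hom(2)[of "a + b" b] by simp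
  have "\<exists>A. subring_set A \<and> range \<kappa> \<subseteq> A \<and> X \<subseteq> A \<and> many_places \<kappa> P A"
    using fin
  proof induction
    case empty
    have "subring_set (range \<kappa>)"
      unfolding subring_set_def by (auto simp flip: hom)
    \<comment> \<open>On the constants the place is the inverse of \<open>\<kappa>\<close>, which is
      injective because nonzero constants are units and \<open>P\<close> is proper.\<close>
    moreover have "place \<kappa> P (range \<kappa>) (inv_into UNIV \<kappa>)"
    proof -
      have "inv_into UNIV \<kappa> (\<kappa> k) = k" for k
        using inj by (intro inv_f_f) (auto simp: inj_def)
      then show ?thesis using nz
        by (auto simp: place_def simp flip: hom \<kappa>add) (use nz in blast)
    qed
    moreover have "inv_into UNIV \<kappa> v \<noteq> 0" if "v \<in> range \<kappa> - P" for v
      using that prime_setD(1)[OF P] \<kappa>0 by (metis DiffE f_inv_into_f)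
    ultimately show ?case by (auto simp: many_places_def intro!: exI[of _ "range \<kappa>"])
  next
    case (insert x X)
    then obtain A where A: "subring_set A" "range \<kappa> \<subseteq> A" "X \<subseteq> A" "many_places \<kappa> P A" by blast
    let ?B = "{poly p x | p. p \<in> poly_over A}"
    have "a \<in> ?B" if "a \<in> A" for a
      using poly_over_const[OF A(1) that] by (force intro: exI[of _ "[:a:]"])
    moreover have "x \<in> ?B"
      using poly_over_monom[OF A(1) subring_set_1[OF A(1)], of 1] by (force simp: poly_monom intro: exI[of _ "monom 1 1"])
    moreover have "many_places \<kappa> P ?B"
      using many_places_transcendental[OF A(1) P A(2,4)] many_places_algebraic[OF A(1) P A(2,4)]
      by (metis (no_types, lifting))
    ultimately show ?case
      using subring_set_adjoin[OF A(1)] A by (intro exI[of _ ?B]) auto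
  qed
  then obtain A where A: "subring_set A" "range \<kappa> \<subseteq> A" "X \<subseteq> A" "many_places \<kappa> P A" by blast
  then obtain f where "place \<kappa> P A f"
    using subring_set_1[OF A(1)] prime_setD(2)[OF P] by (auto simp: many_places_def)
  then show ?thesis using A by blast
qed

section \<open>Words over a disjoint union of cycles\<close>

text \<open>The relations are required for all letters of the type. In the instances a letter that
  is not a vertex is congruent to the empty word, which respects them. \<open>E\<close> and
  \<open>R\<close> are parameters because the same word calculus serves the given graph, its cyclic
  part and the components.\<close>

locale hk_cong =
  fixes E :: "('v \<times> 'v) set" and R :: "'v list \<Rightarrow> 'v list \<Rightarrow> bool" (infix \<open>\<doteq>\<close> 50)
  assumes rfl: "u \<doteq> u"
    and sm: "u \<doteq> v \<Longrightarrow> v \<doteq> u"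
    and tr [trans]: "u \<doteq> v \<Longrightarrow> v \<doteq> w \<Longrightarrow> u \<doteq> w"
    and app: "u \<doteq> v \<Longrightarrow> u' \<doteq> v' \<Longrightarrow> u @ u' \<doteq> v @ v'"
    and idem: "[i, i] \<doteq> [i]"
    and comm: "(i, j) \<notin> E \<Longrightarrow> (j, i) \<notin> E \<Longrightarrow> [i, j] \<doteq> [j, i]"
    and arc1: "(i, j) \<in> E \<Longrightarrow> [i, j, i] \<doteq> [i, j]"
    and arc2: "(i, j) \<in> E \<Longrightarrow> [j, i, j] \<doteq> [i, j]"
begin

lemma ctx: "u \<doteq> v \<Longrightarrow> a @ u @ b \<doteq> a @ v @ b"
  by (intro app rfl)

lemma ctxl: "u \<doteq> v \<Longrightarrow> a @ u \<doteq> a @ v"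
  by (intro app rfl)

lemma ctxr: "u \<doteq> v \<Longrightarrow> u @ b \<doteq> v @ b"
  by (intro app rfl)

text \<open>The first \<open>s\<close> can be carried through \<open>w\<close> until it meets the
  last one: past a letter \<open>z\<close> with an arrow from \<open>s\<close> because
  \<open>s z = s z s\<close>, and past any other letter because the two commute.\<close>

lemma absorb_right:
  assumes "\<forall>z\<in>set w. (z, s) \<notin> E"
  shows "s # w @ [s] \<doteq> s # w"
  using assms
proof (induction w)
  case Nil
  show ?case using idem by simp
next
  case (Cons z w)
  then have IH: "s # w @ [s] \<doteq> s # w" and z: "(z, s) \<notin> E" by auto
  show ?case
  proof (cases "(s, z) \<in> E")
    case True
    have "s # (z # w) @ [s] \<doteq> [s, z, s] @ w @ [s]"
      using ctxr[OF sm[OF arc1[OF True]], of "w @ [s]"] by simp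
    also have "\<dots> \<doteq> [s, z] @ s # w" using ctxl[OF IH, of "[s, z]"] by simp
    also have "\<dots> \<doteq> s # z # w" using ctxr[OF arc1[OF True], of w] by simp
    finally show ?thesis .
  next
    case False
    have "s # (z # w) @ [s] \<doteq> [z, s] @ w @ [s]"
      using ctxr[OF comm[OF False z], of "w @ [s]"] by simp
    also have "\<dots> \<doteq> [z] @ s # w" using ctxl[OF IH, of "[z]"] by simp
    also have "\<dots> \<doteq> s # z # w" using ctxr[OF comm[OF z False], of w] by simp
    finally show ?thesis .
  qed
qed

text \<open>The mirror image: the last \<open>s\<close> is carried to the left, and now arrows into
  \<open>s\<close> are harmless.\<close>

lemma absorb_left:
  assumes "\<forall>z\<in>set w. (s, z) \<notin> E"
  shows "s # w @ [s] \<doteq> w @ [s]"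
  using assms
proof (induction w rule: rev_induct)
  case Nil
  show ?case using idem by simp
next
  case (snoc z w)
  then have IH: "s # w @ [s] \<doteq> w @ [s]" and z: "(s, z) \<notin> E" by auto
  show ?case
  proof (cases "(z, s) \<in> E")
    case True
    have "s # (w @ [z]) @ [s] \<doteq> (s # w) @ [s, z, s]"
      using ctxl[OF sm[OF arc2[OF True]], of "s # w"] by simp
    also have "\<dots> \<doteq> w @ [s, z, s]" using ctxr[OF IH, of "[z, s]"] by simp
    also have "\<dots> \<doteq> (w @ [z]) @ [s]" using ctxl[OF arc2[OF True], of w] by simp
    finally show ?thesis .
  next
    case False
    have "s # (w @ [z]) @ [s] \<doteq> (s # w) @ [s, z]"
      using ctxl[OF comm[OF False z], of "s # w"] by simp
    also have "\<dots> \<doteq> w @ [s, z]" using ctxr[OF IH, of "[z]"] by simp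
    also have "\<dots> \<doteq> (w @ [z]) @ [s]" using ctxl[OF comm[OF z False], of w] by simp
    finally show ?thesis .
  qed
qed

text \<open>A topological order: no arrow leads from a letter to an earlier one. Such a word absorbs
  each of its letters on either side, and so it is idempotent.\<close>

abbreviation topo :: "'v list \<Rightarrow> bool" where
  "topo e \<equiv> distinct e \<and> sorted_wrt (\<lambda>a b. (b, a) \<notin> E) e"

lemma topo_absorb:
  assumes "topo e" "s \<in> set e"
  shows "s # e \<doteq> e" "e @ [s] \<doteq> e"
proof -
  obtain a b where e: "e = a @ s # b" using assms(2) by (auto simp: in_set_conv_decomp)
  have "\<forall>z\<in>set a. (s, z) \<notin> E" "\<forall>z\<in>set b. (z, s) \<notin> E"
    using assms by (auto simp: e sorted_wrt_append)
  from ctxr[OF absorb_left[OF this(1)], of b] ctxl[OF absorb_right[OF this(2)], of a]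
  show "s # e \<doteq> e" "e @ [s] \<doteq> e" by (simp_all add: e)
qed

lemma absorb_word: "(\<And>s. s \<in> set w \<Longrightarrow> v @ [s] \<doteq> v) \<Longrightarrow> v @ w \<doteq> v"
proof (induction w)
  case (Cons s w)
  have "v @ s # w \<doteq> v @ w" using ctxr[OF Cons.prems[of s], of w] by simp
  also have "\<dots> \<doteq> v" using Cons by simp
  finally show ?case .
qed (simp add: rfl)

text \<open>The hypothesis is acyclicity in the form that every nonempty part has a source; sources
  are removed one at a time.\<close>

lemma topo_exists:
  assumes "finite S" "\<And>S'. S' \<subseteq> S \<Longrightarrow> S' \<noteq> {} \<Longrightarrow> \<exists>s\<in>S'. \<forall>t\<in>S'. (t, s) \<notin> E"
  shows "\<exists>e. topo e \<and> set e = S"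
  using assms
proof (induction "card S" arbitrary: S)
  case 0
  then have "S = {}" by simp
  then show ?case by (intro exI[of _ "[]"]) simp
next
  case (Suc n)
  have "S \<noteq> {}" using Suc.hyps(2) by auto
  then obtain s where s: "s \<in> S" "\<forall>t\<in>S. (t, s) \<notin> E"
    using Suc.prems(2)[of S] by blast
  have "\<exists>e. topo e \<and> set e = S - {s}"
  proof (rule Suc.hyps(1))
    show "n = card (S - {s})" using Suc.hyps(2) Suc.prems(1) s(1) by simp
    show "finite (S - {s})" using Suc.prems(1) by simp
    show "\<exists>s\<in>S'. \<forall>t\<in>S'. (t, s) \<notin> E" if "S' \<subseteq> S - {s}" "S' \<noteq> {}" for S'
      by (rule Suc.prems(2)) (use that in auto)
  qed
  then obtain e where "topo e" "set e = S - {s}" by blast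
  then have "topo (s # e) \<and> set (s # e) = S" using s by auto
  then show ?case by blast
qed

end

text \<open>A word acts on configurations \<open>A\<close> of particles on the vertices: the letter \<open>i\<close> moves a
  particle at \<open>i\<close> to \<open>\<sigma> i\<close>, and fails if it has no free site to move to.\<close>

locale tasep = hk_cong E R for E :: "('v \<times> 'v) set" and R :: "'v list \<Rightarrow> 'v list \<Rightarrow> bool" (infix \<open>\<doteq>\<close> 50) +
  fixes V W :: "'v set" and \<sigma> :: "'v \<Rightarrow> 'v"
  assumes E_iff: "(i, j) \<in> E \<longleftrightarrow> i \<in> W \<and> j = \<sigma> i"
    and finV: "finite V" and WV: "W \<subseteq> V" and bij: "bij_betw \<sigma> W W"
    and noloop: "i \<in> W \<Longrightarrow> \<sigma> i \<noteq> i"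
    and triv: "i \<notin> V \<Longrightarrow> [i] \<doteq> []"
begin

section \<open>Particle configurations and the words acting on them\<close>

lemma \<sigma>W: "i \<in> W \<Longrightarrow> \<sigma> i \<in> W" and \<sigma>inj: "i \<in> W \<Longrightarrow> j \<in> W \<Longrightarrow> \<sigma> i = \<sigma> j \<Longrightarrow> i = j"
  using bij by (auto simp: bij_betw_def inj_on_def)

text \<open>Every cycle carries at least one particle, so that the empty sites can be ordered
  topologically. Nonempty closed sets \<open>C\<close>, the unions of cycles, spare naming the
  cycles themselves.\<close>

definition good :: "'v set \<Rightarrow> bool" where
  "good A \<longleftrightarrow> A \<subseteq> V \<and> (\<forall>C. C \<subseteq> W \<and> C \<noteq> {} \<and> \<sigma> ` C \<subseteq> C \<longrightarrow> C \<inter> A \<noteq> {})"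

text \<open>The state of a product in progress: after \<open>v\<close>, only the letters at sites of
  \<open>A\<close> can still have an effect.\<close>

definition supp :: "'v set \<Rightarrow> 'v list \<Rightarrow> bool" where
  "supp A v \<longleftrightarrow> (\<forall>i. i \<notin> A \<longrightarrow> v @ [i] \<doteq> v)"

text \<open>A set of empty sites without a source is contained in the image under
  \<open>\<sigma>\<close> of its part in \<open>W\<close>. By counting it is then a closed subset of
  \<open>W\<close>, and it carries no particle.\<close>

lemma good_topo:
  assumes "good A"
  shows "\<exists>e. topo e \<and> set e = V - A"
proof (rule topo_exists)
  fix S' assume S': "S' \<subseteq> V - A" "S' \<noteq> {}"
  show "\<exists>s\<in>S'. \<forall>t\<in>S'. (t, s) \<notin> E"
  proof (rule ccontr)
    assume "\<not> ?thesis"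
    then have *: "\<forall>s\<in>S'. \<exists>t\<in>S'. t \<in> W \<and> s = \<sigma> t" by (auto simp: E_iff)
    then have "S' \<subseteq> \<sigma> ` (S' \<inter> W)" by blast
    have fin: "finite S'" using S' finV finite_subset by blast
    have "card S' \<le> card (\<sigma> ` (S' \<inter> W))"
      by (rule card_mono) (use fin \<open>S' \<subseteq> \<sigma> ` (S' \<inter> W)\<close> in auto)
    also have "\<dots> \<le> card (S' \<inter> W)" using fin by (intro card_image_le) auto
    finally have "S' \<inter> W = S'" using fin by (intro card_seteq) auto
    then have "\<sigma> ` S' = S'"
      using \<open>S' \<subseteq> \<sigma> ` (S' \<inter> W)\<close> fin card_image_le[OF fin, of \<sigma>]
      by (metis card_seteq finite_imageI)
    then show False
      using assms S' \<open>S' \<inter> W = S'\<close> unfolding good_def by (metis Diff_disjoint Int_commute Int_lower2 disjoint_iff order_refl subsetD)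
  qed
qed (use finV in auto)

lemma supp_topo:
  assumes "topo e" "set e = V - A"
  shows "supp A e"
  unfolding supp_def
proof (intro allI impI)
  fix i assume "i \<notin> A"
  then show "e @ [i] \<doteq> e"
    using topo_absorb(2)[OF assms(1), of i] assms(2) ctxl[OF triv, of i e] by (cases "i \<in> V") auto
qed

lemma supp_absorb: "supp A v \<Longrightarrow> set w \<inter> A = {} \<Longrightarrow> v @ w \<doteq> v"
  by (rule absorb_word) (auto simp: supp_def)

definition step :: "'v set \<Rightarrow> 'v \<Rightarrow> 'v set option" where
  "step A i = (if i \<notin> A then Some A else if i \<in> W \<and> \<sigma> i \<notin> A then Some (insert (\<sigma> i) (A - {i})) else None)"

fun run :: "'v set \<Rightarrow> 'v list \<Rightarrow> 'v set option" where
  "run A [] = Some A"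
| "run A (i # w) = (case step A i of None \<Rightarrow> None | Some B \<Rightarrow> run B w)"

text \<open>The letters that find a particle. Blocking is not checked; the function is meant for
  words whose run succeeds, where it yields a legal word with the same effect.\<close>

fun moves :: "'v set \<Rightarrow> 'v list \<Rightarrow> 'v list" where
  "moves A [] = []"
| "moves A (i # w) = (if i \<in> A then i # moves (insert (\<sigma> i) (A - {i})) w else moves A w)"

fun legal :: "'v set \<Rightarrow> 'v list \<Rightarrow> 'v set \<Rightarrow> bool" where
  "legal A [] B \<longleftrightarrow> A = B"
| "legal A (i # u) B \<longleftrightarrow> i \<in> A \<and> i \<in> W \<and> \<sigma> i \<notin> A \<and> legal (insert (\<sigma> i) (A - {i})) u B"

lemma run_append: "run A (u @ w) = (case run A u of None \<Rightarrow> None | Some B \<Rightarrow> run B w)"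
  by (induction u arbitrary: A) (auto split: option.splits)

lemma moves_append: "run A u = Some B \<Longrightarrow> moves A (u @ w) = moves A u @ moves B w"
  by (induction u arbitrary: A) (auto simp: step_def split: option.splits if_splits)

lemma run_legal: "run A w = Some B \<Longrightarrow> legal A (moves A w) B"
  by (induction w arbitrary: A) (auto simp: step_def split: option.splits if_splits)

lemma legal_append: "legal A u B \<Longrightarrow> legal B v C \<Longrightarrow> legal A (u @ v) C"
  by (induction u arbitrary: A) auto

text \<open>A letter \<open>j \<noteq> i\<close> of this kind is absorbed by \<open>v\<close>, so a
  copy of it can be inserted before \<open>i\<close> and then contracts with the \<open>j\<close>
  after \<open>i\<close>. Only an arrow from \<open>i\<close> to \<open>j\<close> prevents this; it
  is the one way in which a silent letter is revived.\<close>

lemma supp_nudge: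
  assumes v: "supp A v" and j: "j \<notin> A - {i}" "\<not> (i \<in> W \<and> j = \<sigma> i)"
  shows "v @ [i, j] \<doteq> v @ [i]"
proof (cases "j = i")
  case True
  then show ?thesis using ctxl[OF idem] by simp
next
  case False
  then have vj: "v @ [j] \<doteq> v" using v j by (auto simp: supp_def)
  show ?thesis
  proof (cases "(j, i) \<in> E")
    case True
    have "v @ [i, j] \<doteq> v @ [j, i, j]" using ctxr[OF sm[OF vj], of "[i, j]"] by simp
    also have "\<dots> \<doteq> v @ [j, i]" using ctxl[OF arc1[OF True]] by simp
    also have "\<dots> \<doteq> v @ [i]" using ctxr[OF vj, of "[i]"] by simp
    finally show ?thesis .
  next
    case False
    then have "v @ [i, j] \<doteq> v @ [j, i]"
      using j by (intro ctxl comm) (auto simp: E_iff)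
    also have "\<dots> \<doteq> v @ [i]" using ctxr[OF vj, of "[i]"] by simp
    finally show ?thesis .
  qed
qed

lemma step_Some:
  assumes "supp A v" "step A i = Some B"
  shows "supp B (v @ [i])"
proof (cases "i \<in> A")
  case True
  then have "i \<in> W" "\<sigma> i \<notin> A" "B = insert (\<sigma> i) (A - {i})"
    using assms(2) by (auto simp: step_def split: if_splits)
  then show ?thesis using supp_nudge[OF assms(1), of _ i] unfolding supp_def by auto
next
  case False
  then have B: "B = A" and vi: "v @ [i] \<doteq> v" using assms by (auto simp: step_def supp_def)
  show ?thesis unfolding supp_def B
  proof (intro allI impI)
    fix j assume "j \<notin> A"
    have "(v @ [i]) @ [j] \<doteq> v @ [j]" by (rule ctxr[OF vi])
    also have "\<dots> \<doteq> v" using assms(1) \<open>j \<notin> A\<close> by (simp add: supp_def)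
    also have "\<dots> \<doteq> v @ [i]" by (rule sm[OF vi])
    finally show "(v @ [i]) @ [j] \<doteq> v @ [i]" .
  qed
qed

text \<open>A blocked letter annihilates its particle: the target, if there is one, already counts
  as active, so that no letter is revived while \<open>i\<close> itself falls silent.\<close>

lemma step_None:
  assumes "supp A v" "step A i = None"
  shows "supp (A - {i}) (v @ [i])"
  unfolding supp_def
proof (intro allI impI)
  fix j assume j: "j \<notin> A - {i}"
  have "i \<in> A" "i \<in> W \<Longrightarrow> \<sigma> i \<in> A" using assms(2) by (auto simp: step_def split: if_splits)
  then have "\<not> (i \<in> W \<and> j = \<sigma> i)" using j noloop by auto
  from supp_nudge[OF assms(1) j this] show "(v @ [i]) @ [j] \<doteq> v @ [i]" by simp
qed

lemma good_finite: "good A \<Longrightarrow> finite A"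
  using finV finite_subset by (auto simp: good_def)

lemma step_good:
  assumes "good A" "step A i = Some B"
  shows "good B" "card B = card A"
proof -
  have "good B \<and> card B = card A"
  proof (cases "i \<in> A")
    case True
    then have i: "i \<in> W" "\<sigma> i \<notin> A" and B: "B = insert (\<sigma> i) (A - {i})"
      using assms(2) by (auto simp: step_def split: if_splits)
    have "C \<inter> B \<noteq> {}" if C: "C \<subseteq> W" "C \<noteq> {}" "\<sigma> ` C \<subseteq> C" for C
    proof -
      obtain a where "a \<in> C" "a \<in> A" using assms(1) C unfolding good_def by blast
      then show ?thesis using C B by (cases "a = i") auto
    qed
    moreover have "B \<subseteq> V" using assms(1) i WV \<sigma>W by (auto simp: B good_def)
    moreover have "card B = card A"
    proof -
      have "card B = Suc (card (A - {i}))"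
        unfolding B using good_finite[OF assms(1)] i by (intro card_insert_disjoint) auto
      then show ?thesis using card_Suc_Diff1[OF good_finite[OF assms(1)] True] by simp
    qed
    ultimately show ?thesis by (auto simp: good_def)
  next
    case False
    then show ?thesis using assms by (auto simp: step_def)
  qed
  then show "good B" "card B = card A" by auto
qed

text \<open>The cycle through \<open>i\<close> keeps the particle at \<open>\<sigma> i\<close> that
  caused the blockage.\<close>

lemma step_None_good:
  assumes "good A" "step A i = None"
  shows "good (A - {i})" "card (A - {i}) < card A"
proof -
  have i: "i \<in> A" "i \<in> W \<Longrightarrow> \<sigma> i \<in> A" using assms(2) by (auto simp: step_def split: if_splits)
  then show "card (A - {i}) < card A"
    using good_finite[OF assms(1)] by (intro psubset_card_mono) auto
  have "C \<inter> (A - {i}) \<noteq> {}" if C: "C \<subseteq> W" "C \<noteq> {}" "\<sigma> ` C \<subseteq> C" for C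
  proof -
    obtain a where "a \<in> C" "a \<in> A" using assms(1) C unfolding good_def by blast
    then show ?thesis using C i noloop[of i] by (cases "a = i") auto
  qed
  then show "good (A - {i})" using assms(1) by (auto simp: good_def)
qed

lemma run_Some:
  assumes "supp A v" "run A w = Some B"
  shows "supp B (v @ w)"
  using assms
proof (induction w arbitrary: A v)
  case (Cons i w)
  then obtain A' where "step A i = Some A'" "run A' w = Some B" by (auto split: option.splits)
  then show ?case using Cons.IH[OF step_Some[OF Cons.prems(1)]] by fastforce
qed simp

lemma run_good: "good A \<Longrightarrow> run A w = Some B \<Longrightarrow> good B \<and> card B = card A"
proof (induction w arbitrary: A)
  case (Cons i w)
  then obtain A' where "step A i = Some A'" "run A' w = Some B" by (auto split: option.splits)
  then show ?case using Cons step_good by metis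
qed simp

lemma run_moves: "supp A v \<Longrightarrow> run A w = Some B \<Longrightarrow> v @ w \<doteq> v @ moves A w"
proof (induction w arbitrary: A v)
  case (Cons i w)
  then obtain A' where A': "step A i = Some A'" "run A' w = Some B" by (auto split: option.splits)
  show ?case
  proof (cases "i \<in> A")
    case True
    then have "A' = insert (\<sigma> i) (A - {i})" using A' by (auto simp: step_def split: if_splits)
    then show ?thesis using Cons.IH[OF step_Some[OF Cons.prems(1) A'(1)] A'(2)] True by simp
  next
    case False
    then have "A' = A" "v @ [i] \<doteq> v" using A' Cons.prems by (auto simp: step_def supp_def)
    have "v @ i # w \<doteq> v @ w" using ctxr[OF \<open>v @ [i] \<doteq> v\<close>, of w] by simp
    also have "\<dots> \<doteq> v @ moves A w" using Cons.IH[OF Cons.prems(1)] A' \<open>A' = A\<close> by simp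
    finally show ?thesis using False by simp
  qed
qed (simp add: rfl)

lemma legal_letters: "legal A u B \<Longrightarrow> set u \<subseteq> W"
  by (induction u arbitrary: A) auto

text \<open>Conservation of particles at the site \<open>\<sigma> i\<close>: the letter
  \<open>i\<close> brings one in, the letter \<open>\<sigma> i\<close> takes one out.\<close>

lemma legal_flux:
  assumes "legal A u B" "i \<in> W"
  shows "int (count (mset u) i) - int (count (mset u) (\<sigma> i)) = of_bool (\<sigma> i \<in> B) - of_bool (\<sigma> i \<in> A)"
  using assms
proof (induction u arbitrary: A)
  case (Cons j u)
  then have j: "j \<in> A" "j \<in> W" "\<sigma> j \<notin> A" and l: "legal (insert (\<sigma> j) (A - {j})) u B" by auto
  note IH = Cons.IH[OF l Cons.prems(2)]
  have "\<sigma> i = \<sigma> j \<longleftrightarrow> i = j" using \<sigma>inj Cons.prems(2) j(2) by auto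
  then show ?case using IH j noloop[of j] by (auto simp: of_bool_def split: if_splits)
qed simp

text \<open>Until the jump at \<open>i\<close> takes place, \<open>i\<close> stays occupied and
  \<open>\<sigma> i\<close> stays empty. So no letter of \<open>w\<close> is a neighbour of
  \<open>i\<close>, all of them commute with it, and the jump can be made first.\<close>

lemma legal_pull:
  assumes "legal A (w @ i # w') B" "i \<in> A" "i \<in> W" "\<sigma> i \<notin> A" "i \<notin> set w"
  shows "i # w \<doteq> w @ [i] \<and> legal A (i # w @ w') B"
  using assms
proof (induction w arbitrary: A)
  case (Cons z w)
  define A' where "A' = insert (\<sigma> z) (A - {z})"
  have z: "z \<in> A" "z \<in> W" "\<sigma> z \<notin> A" "z \<noteq> i" "legal A' (w @ i # w') B"
    using Cons.prems by (auto simp: A'_def)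
  have ne: "z \<noteq> \<sigma> i" "i \<noteq> \<sigma> z" "\<sigma> z \<noteq> \<sigma> i"
    using z Cons.prems \<sigma>inj by auto
  have IH: "i # w \<doteq> w @ [i] \<and> legal A' (i # w @ w') B"
    using Cons.prems z ne by (intro Cons.IH) (auto simp: A'_def)
  have "[i, z] \<doteq> [z, i]" using ne by (intro comm) (auto simp: E_iff)
  then have "i # z # w \<doteq> z # i # w" using ctxr[of "[i, z]" "[z, i]" w] by simp
  also have "\<dots> \<doteq> z # w @ [i]" using ctxl[of "i # w" "w @ [i]" "[z]"] IH by simp
  finally have "i # z # w \<doteq> (z # w) @ [i]" by simp
  moreover have "insert (\<sigma> i) (A' - {i}) = insert (\<sigma> z) (insert (\<sigma> i) (A - {i}) - {z})"
    using ne z by (auto simp: A'_def)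
  ultimately show ?case using IH z ne Cons.prems by auto
qed (auto simp: rfl)

text \<open>The first jump of one word can be pulled to the front of the other, so the order of the
  jumps does not matter. Legal words from a given configuration are thereby classified by their
  letter counts.\<close>

lemma legal_unique:
  assumes "legal A u B" "legal A u' B'" "mset u = mset u'"
  shows "u \<doteq> u'"
  using assms
proof (induction u arbitrary: A u')
  case (Cons i u)
  have "i \<in> set u'" using Cons.prems(3) by (metis list.set_intros(1) set_mset_mset)
  then obtain w w' where u': "u' = w @ i # w'" "i \<notin> set w" by (meson split_list_first)
  have pull: "i # w \<doteq> w @ [i] \<and> legal A (i # w @ w') B'"
    using Cons.prems u' by (intro legal_pull) auto
  have "u \<doteq> w @ w'"
    using Cons.prems pull u' by (intro Cons.IH) auto
  then have "i # u \<doteq> i # w @ w'" using ctxl[of u "w @ w'" "[i]"] by simp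
  also have "\<dots> \<doteq> u'" using ctxr[OF conjunct1[OF pull], of w'] u' by simp
  finally show ?case .
qed (simp add: rfl)

lemma legal_full:
  assumes "legal A u B" "C \<subseteq> A" "\<And>i. i \<in> C \<Longrightarrow> \<sigma> i \<in> C"
  shows "set u \<inter> C = {}"
  using assms(1,2)
proof (induction u arbitrary: A)
  case (Cons i u)
  then have "i \<notin> C" using assms(3) by auto
  then show ?case using Cons by auto
qed simp

lemma run_leaves: "s \<notin> A \<Longrightarrow> \<forall>t\<in>set w. (t, s) \<notin> E \<Longrightarrow> run A w = Some B \<Longrightarrow> s \<notin> B"
proof (induction w arbitrary: A)
  case (Cons t w)
  then obtain A' where A': "step A t = Some A'" "run A' w = Some B" by (auto split: option.splits)
  then have "s \<notin> A'" using Cons.prems by (auto simp: step_def E_iff split: if_splits)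
  then show ?case using Cons A' by auto
qed simp

text \<open>Each letter empties its own site, and no later letter can refill it, having no arrow
  into it.\<close>

lemma topo_clears: "topo w \<Longrightarrow> run A w = Some B \<Longrightarrow> B \<inter> set w = {}"
proof (induction w arbitrary: A)
  case (Cons s w)
  then obtain A' where A': "step A s = Some A'" "run A' w = Some B" by (auto split: option.splits)
  then have "s \<notin> A'" using noloop by (auto simp: step_def split: if_splits)
  then show ?case using run_leaves[OF _ _ A'(2), of s] Cons A' by auto
qed simp

fun chain :: "'v \<Rightarrow> 'v list \<Rightarrow> bool" where
  "chain h [] \<longleftrightarrow> True"
| "chain h (l # L) \<longleftrightarrow> l \<in> W \<and> \<sigma> l = h \<and> chain l L"

text \<open>The sites of \<open>L\<close> are listed against the arrows, with the free site
  \<open>h\<close> ahead of the first one. Served in this order, the particles all advance by one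
  step without blocking each other.\<close>

lemma run_chain:
  assumes "chain h L" "distinct (h # L)" "h \<notin> A"
  shows "run A L = Some ((A - set L) \<union> \<sigma> ` (A \<inter> set L)) \<and> moves A L = filter (\<lambda>l. l \<in> A) L"
  using assms
proof (induction L arbitrary: h A)
  case (Cons l L)
  define A' where "A' = (if l \<in> A then insert h (A - {l}) else A)"
  have l: "l \<in> W" "\<sigma> l = h" "chain l L" "l \<noteq> h" "l \<notin> set L" "h \<notin> set L" "h \<notin> A"
    using Cons.prems by auto
  then have st: "step A l = Some A'" by (auto simp: step_def A'_def)
  have IH: "run A' L = Some ((A' - set L) \<union> \<sigma> ` (A' \<inter> set L)) \<and> moves A' L = filter (\<lambda>l. l \<in> A') L"
    using l Cons.prems by (intro Cons.IH) (auto simp: A'_def)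
  have cfg: "(A' - set L) \<union> \<sigma> ` (A' \<inter> set L) = (A - set (l # L)) \<union> \<sigma> ` (A \<inter> set (l # L))"
    using l by (auto simp: A'_def)
  have "x \<in> A' \<longleftrightarrow> x \<in> A" if "x \<in> set L" for x
    using that l(4-6) by (auto simp: A'_def)
  then have "filter (\<lambda>l. l \<in> A') L = filter (\<lambda>l. l \<in> A) L"
    by (rule filter_cong[OF HOL.refl])
  moreover have "moves A (l # L) = (if l \<in> A then l # moves A' L else moves A' L)"
    by (simp add: A'_def l(2))
  moreover have "run A (l # L) = run A' L" using st by simp
  ultimately show ?case using IH cfg by simp
qed simp

text \<open>For \<open>h\<close> in \<open>W\<close> this is the cycle through \<open>h\<close>,
  since \<open>\<sigma>\<close> permutes the finite set \<open>W\<close>.\<close>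

definition orbit :: "'v \<Rightarrow> 'v set" where
  "orbit h = range (\<lambda>k. (\<sigma> ^^ k) h)"

lemma iter_W: "h \<in> W \<Longrightarrow> (\<sigma> ^^ k) h \<in> W"
  by (induction k) (auto simp: \<sigma>W)

lemma orbit_self: "h \<in> orbit h"
  unfolding orbit_def by (rule range_eqI[of _ _ 0]) simp

lemma orbit_sub: "h \<in> W \<Longrightarrow> orbit h \<subseteq> W"
  by (auto simp: orbit_def iter_W)

lemma orbit_step: "i \<in> orbit h \<Longrightarrow> \<sigma> i \<in> orbit h"
  unfolding orbit_def
proof safe
  fix k
  show "\<sigma> ((\<sigma> ^^ k) h) \<in> range (\<lambda>k. (\<sigma> ^^ k) h)" by (rule range_eqI[of _ _ "Suc k"]) simp
qed

lemma iter_inj: "h \<in> W \<Longrightarrow> k \<in> W \<Longrightarrow> (\<sigma> ^^ n) h = (\<sigma> ^^ n) k \<Longrightarrow> h = k"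
  by (induction n) (auto dest: \<sigma>inj[OF iter_W iter_W])

lemma iter_period:
  assumes h: "h \<in> W"
  shows "\<exists>n>0. (\<sigma> ^^ n) h = h \<and> inj_on (\<lambda>k. (\<sigma> ^^ k) h) {..<n} \<and> orbit h = (\<lambda>k. (\<sigma> ^^ k) h) ` {..<n}"
proof -
  have "finite W" using finV WV finite_subset by blast
  moreover have "range (\<lambda>k. (\<sigma> ^^ k) h) \<subseteq> W" using iter_W[OF h] by blast
  ultimately have ninj: "\<not> inj (\<lambda>k. (\<sigma> ^^ k) h)"
    by (meson finite_imageD finite_subset infinite_UNIV_nat)
  have "\<exists>i j. i < j \<and> (\<sigma> ^^ i) h = (\<sigma> ^^ j) h"
  proof (rule ccontr)
    assume "\<not> ?thesis"
    then have "inj (\<lambda>k. (\<sigma> ^^ k) h)" by (intro linorder_injI) blast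
    then show False using ninj by blast
  qed
  then obtain i j where ij: "i < j" "(\<sigma> ^^ i) h = (\<sigma> ^^ j) h" by blast
  then have "(\<sigma> ^^ i) ((\<sigma> ^^ (j - i)) h) = (\<sigma> ^^ i) h"
    by (metis comp_apply funpow_add le_add_diff_inverse less_imp_le_nat)
  then have "(\<sigma> ^^ (j - i)) h = h" by (rule iter_inj[OF iter_W[OF h] h])
  then have ex: "0 < j - i \<and> (\<sigma> ^^ (j - i)) h = h"
    using ij by simp
  define n where "n = (LEAST n. 0 < n \<and> (\<sigma> ^^ n) h = h)"
  have n: "0 < n" "(\<sigma> ^^ n) h = h"
    using LeastI[of "\<lambda>n. 0 < n \<and> (\<sigma> ^^ n) h = h", OF ex] by (auto simp: n_def)
  have min: "(\<sigma> ^^ k) h \<noteq> h" if "0 < k" "k < n" for k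
    using not_less_Least[of k "\<lambda>n. 0 < n \<and> (\<sigma> ^^ n) h = h"] that by (auto simp: n_def)
  have "inj_on (\<lambda>k. (\<sigma> ^^ k) h) {..<n}"
  proof (rule linorder_inj_onI)
    fix a b assume ab: "a < b" "a \<in> {..<n}" "b \<in> {..<n}"
    show "(\<sigma> ^^ a) h \<noteq> (\<sigma> ^^ b) h"
    proof
      assume "(\<sigma> ^^ a) h = (\<sigma> ^^ b) h"
      then have "(\<sigma> ^^ a) ((\<sigma> ^^ (b - a)) h) = (\<sigma> ^^ a) h"
        using ab by (metis comp_apply funpow_add le_add_diff_inverse less_imp_le_nat)
      then have "(\<sigma> ^^ (b - a)) h = h" by (rule iter_inj[OF iter_W[OF h] h])
      then show False using min[of "b - a"] ab by (simp add: less_imp_diff_less)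
    qed
  qed auto
  moreover have "orbit h = (\<lambda>k. (\<sigma> ^^ k) h) ` {..<n}"
  proof -
    have "(\<sigma> ^^ (k mod n)) h = (\<sigma> ^^ k) h" for k
      by (rule funpow_mod_eq[OF n(2)])
    then show ?thesis using n(1) unfolding orbit_def
      by (auto simp: image_iff) (metis lessThan_iff mod_less_divisor)
  qed
  ultimately show ?thesis using n by blast
qed

lemma orbit_eq: "h \<in> W \<Longrightarrow> i \<in> orbit h \<Longrightarrow> orbit i = orbit h"
proof -
  assume h: "h \<in> W" "i \<in> orbit h"
  obtain n where n: "n > 0" "(\<sigma> ^^ n) h = h" "orbit h = (\<lambda>k. (\<sigma> ^^ k) h) ` {..<n}"
    using iter_period[OF h(1)] by blast
  then obtain k where k: "k < n" "i = (\<sigma> ^^ k) h" using h by auto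
  have "(\<sigma> ^^ (n - k)) i = h"
    using k n(2) by (metis comp_apply funpow_add le_add_diff_inverse2 less_imp_le_nat)
  moreover have "(\<sigma> ^^ l) x \<in> orbit y" if "x \<in> orbit y" for l x y
    using that by (induction l) (auto simp: orbit_step)
  ultimately show "orbit i = orbit h"
    using h(2) orbit_self by (metis (no_types, lifting) orbit_def image_subsetI subset_antisym)
qed

lemma chain_iter:
  assumes "h \<in> W"
  shows "chain ((\<sigma> ^^ Suc k) h) (rev (map (\<lambda>j. (\<sigma> ^^ j) h) [1..<Suc k]))"
proof (induction k)
  case (Suc k)
  have "rev (map (\<lambda>j. (\<sigma> ^^ j) h) [1..<Suc (Suc k)])
      = (\<sigma> ^^ Suc k) h # rev (map (\<lambda>j. (\<sigma> ^^ j) h) [1..<Suc k])" by simp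
  then show ?case using Suc iter_W[OF assms, of "Suc k"] by simp
qed simp

text \<open>The hypothesis says that no letter of \<open>w\<close> finds its particle blocked: letters on \<open>c\<close>
  have a free target, and letters off \<open>c\<close> have no particle.\<close>

lemma run_free:
  assumes "distinct w" "\<forall>s\<in>set w. (s \<in> c \<and> \<sigma> s \<notin> A) \<or> (s \<notin> c \<and> s \<notin> A)"
    "c \<subseteq> W" "\<And>i. i \<in> c \<Longrightarrow> \<sigma> i \<in> c"
  shows "\<exists>B. run A w = Some B \<and> set (moves A w) \<subseteq> c"
  using assms(1,2)
proof (induction w arbitrary: A)
  case (Cons l w)
  define A' where "A' = (if l \<in> A then insert (\<sigma> l) (A - {l}) else A)"
  have st: "step A l = Some A'" using Cons.prems assms(3) by (auto simp: step_def A'_def)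
  have "(s \<in> c \<and> \<sigma> s \<notin> A') \<or> (s \<notin> c \<and> s \<notin> A')" if "s \<in> set w" for s
  proof -
    have "s \<noteq> l" using that Cons.prems by auto
    moreover have "l \<in> A \<Longrightarrow> l \<in> c" using Cons.prems by auto
    ultimately show ?thesis
      using Cons.prems that assms(3,4) \<sigma>inj[of s l] by (auto simp: A'_def)
  qed
  then obtain B where "run A' w = Some B \<and> set (moves A' w) \<subseteq> c"
    using Cons.IH[of A'] Cons.prems by auto
  then show ?case using st Cons.prems by (auto simp: A'_def split: if_splits)
qed simp

text \<open>A word that returns to its initial configuration has no net flux at any site, so the
  counts of successive sites agree.\<close>

lemma closed_const:
  assumes "legal F u F" "h \<in> W" "i \<in> orbit h"
  shows "count (mset u) i = count (mset u) h"
proof -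
  have "count (mset u) ((\<sigma> ^^ k) h) = count (mset u) h" for k
  proof (induction k)
    case (Suc k)
    then show ?case using legal_flux[OF assms(1) iter_W[OF assms(2), of k]] by simp
  qed simp
  then show ?thesis using assms(3) by (auto simp: orbit_def)
qed

text \<open>The elementary circulation of a cycle with an empty site \<open>h\<close>: the list
  \<open>L\<close> advances all particles of the cycle by one step, beginning just behind
  \<open>h\<close>, and a topological word \<open>e\<close> on the complement of \<open>F\<close>
  pushes them on until they occupy \<open>F\<close> again.\<close>

lemma rotation_exists:
  assumes F: "good F" and h: "h \<in> W" "h \<notin> F"
  shows "\<exists>z. legal F z F \<and> (\<forall>i. count (mset z) i = of_bool (i \<in> orbit h))"
proof -
  obtain n where n: "n > 0" "(\<sigma> ^^ n) h = h" "inj_on (\<lambda>k. (\<sigma> ^^ k) h) {..<n}"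
    "orbit h = (\<lambda>k. (\<sigma> ^^ k) h) ` {..<n}"
    using iter_period[OF h(1)] by blast
  define L where "L = rev (map (\<lambda>j. (\<sigma> ^^ j) h) [1..<n])"
  have ch: "chain h L"
    using chain_iter[OF h(1), of "n - 1"] n(1,2) by (simp add: L_def del: funpow.simps)
  have n_eq: "{..<n} = insert 0 (set [1..<n])" using n(1) by auto
  have dist: "distinct (h # L)"
    using n(3) unfolding n_eq by (auto simp: L_def distinct_map)
  have setL: "insert h (set L) = orbit h"
    using n(4) unfolding n_eq by (auto simp: L_def)
  define B where "B = (F - set L) \<union> \<sigma> ` (F \<inter> set L)"
  have runL: "run F L = Some B" "moves F L = filter (\<lambda>l. l \<in> F) L"
    using run_chain[OF ch dist h(2)] by (auto simp: B_def)
  have inter: "F \<inter> set L = F \<inter> orbit h" using setL h(2) by auto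
  obtain e where e: "topo e" "set e = V - F" using good_topo[OF F] by blast
  have cW: "orbit h \<subseteq> W" by (rule orbit_sub[OF h(1)])
  have "(s \<in> orbit h \<and> \<sigma> s \<notin> B) \<or> (s \<notin> orbit h \<and> s \<notin> B)" if "s \<in> set e" for s
  proof -
    have s: "s \<notin> F" using that e by auto
    have B': "B = (F - orbit h) \<union> \<sigma> ` (F \<inter> orbit h)"
      using inter h(2) setL by (auto simp: B_def)
    show ?thesis
    proof (cases "s \<in> orbit h")
      case True
      have "\<sigma> s \<in> orbit h" by (rule orbit_step[OF True])
      moreover have "\<sigma> s \<notin> \<sigma> ` (F \<inter> orbit h)" using s True cW \<sigma>inj by blast
      ultimately show ?thesis using True by (auto simp: B')
    next
      case False
      then show ?thesis using s orbit_step by (auto simp: B')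
    qed
  qed
  then obtain C where C: "run B e = Some C" "set (moves B e) \<subseteq> orbit h"
    using run_free[of e "orbit h" B] e cW orbit_step by blast
  have "good C \<and> card C = card F"
    using run_good[OF F, of "L @ e" C] runL C by (simp add: run_append)
  \<comment> \<open>No particle is lost and none is left outside \<open>F\<close>; by counting, the
    configuration is \<open>F\<close> again.\<close>
  moreover have "C \<inter> set e = {}" by (rule topo_clears[OF e(1) C(1)])
  ultimately have "C = F"
    using e good_finite[OF F] by (intro card_seteq) (auto simp: good_def)
  then have run: "run F (L @ e) = Some F" using runL C by (simp add: run_append)
  define z where "z = moves F (L @ e)"
  have z: "legal F z F" using run_legal[OF run] by (simp add: z_def)
  have z_eq: "z = filter (\<lambda>l. l \<in> F) L @ moves B e"
    by (simp add: z_def moves_append[OF runL(1)] runL(2))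
  have "count (mset z) i = of_bool (i \<in> orbit h)" for i
  proof (cases "i \<in> orbit h")
    case False
    then have "i \<notin> set z" using C(2) setL by (auto simp: z_eq)
    then show ?thesis using False by (simp add: count_eq_zero_iff)
  next
    case True
    \<comment> \<open>The common count of all letters of the cycle is read off at an occupied site:
      \<open>f\<close> occurs once in \<open>L\<close> and not at all in \<open>e\<close>.\<close>
    obtain f where f: "f \<in> F" "f \<in> orbit h"
      using F orbit_self orbit_step cW unfolding good_def by (metis disjoint_iff empty_iff image_subsetI)
    have sub: "set (moves B w) \<subseteq> set w" for w B
      by (induction w arbitrary: B) (auto split: if_splits)
    have "f \<notin> set (moves B e)" using sub[of B e] e f by auto
    moreover have "f \<in> set L" using f setL h by auto
    ultimately have "count (mset (moves B e)) f = 0" "count (mset L) f = 1"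
      using dist distinct_count_atmost_1[of L] by (auto simp: count_eq_zero_iff)
    then have "count (mset z) f = 1" using f by (simp add: z_eq)
    moreover have "count (mset z) i = count (mset z) h" "count (mset z) f = count (mset z) h"
      using closed_const[OF z h(1)] True f by auto
    ultimately show ?thesis using True by simp
  qed
  then show ?thesis using z by blast
qed

text \<open>The counts of a closed word are constant on each cycle and zero on the fully occupied
  ones, so by \<open>legal_unique\<close> the word is a product of powers of elementary
  circulations. Exponents are finitely supported functions on cycles because the monoid ring over
  them is a polynomial ring, to which the Nullstellensatz will apply. Exponents of cycles outside
  \<open>H\<close> are ignored by \<open>Wd\<close>.\<close>

lemma closed_generated:
  assumes F: "good F"
  shows "\<exists>H Wd. finite (H :: 'v set set) \<and> Wd (0 :: 'v set \<Rightarrow>\<^sub>0 nat) = [] \<and> (\<forall>\<mu> \<nu>. Wd (\<mu> + \<nu>) \<doteq> Wd \<mu> @ Wd \<nu>)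
     \<and> (\<forall>\<mu>. legal F (Wd \<mu>) F)
     \<and> (\<forall>u. legal F u F \<longrightarrow> (\<exists>\<mu>. Poly_Mapping.keys \<mu> \<subseteq> H \<and> u \<doteq> Wd \<mu>))"
proof -
  define H where "H = orbit ` (W - F)"
  have finW: "finite W" using finV WV finite_subset by blast
  then have finH: "finite H" by (simp add: H_def)
  then obtain hs where hs: "set hs = H" "distinct hs" using finite_distinct_list by blast
  have "\<forall>c\<in>H. \<exists>z. legal F z F \<and> (\<forall>i. count (mset z) i = of_bool (i \<in> c))"
    using rotation_exists[OF F] by (auto simp: H_def)
  then obtain z where z: "\<And>c. c \<in> H \<Longrightarrow> legal F (z c) F"
    "\<And>c i. c \<in> H \<Longrightarrow> count (mset (z c)) i = of_bool (i \<in> c)" by metis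
  define Wd where "Wd \<mu> = concat (map (\<lambda>c. concat (replicate (Poly_Mapping.lookup \<mu> c) (z c))) hs)"
    for \<mu> :: "'v set \<Rightarrow>\<^sub>0 nat"
  have legr: "legal F (concat (replicate k (z c))) F" if "c \<in> H" for k c
    using z(1)[OF that] by (induction k) (auto intro: legal_append)
  have "legal F (concat (map (\<lambda>c. concat (replicate (Poly_Mapping.lookup \<mu> c) (z c))) cs)) F"
    if "set cs \<subseteq> H" for \<mu> cs
    using that by (induction cs) (auto intro: legal_append legr)
  then have leg: "legal F (Wd \<mu>) F" for \<mu> by (simp add: Wd_def hs)
  have cr: "count (mset (concat (replicate k w))) i = k * count (mset w) i" for k i and w :: "'v list"
    by (induction k) auto
  have "count (mset (concat (map (\<lambda>c. concat (replicate (Poly_Mapping.lookup \<mu> c) (z c))) cs))) i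
      = (\<Sum>c\<leftarrow>cs. Poly_Mapping.lookup \<mu> c * count (mset (z c)) i)" for \<mu> cs i
    by (induction cs) (auto simp: cr)
  then have cnt: "count (mset (Wd \<mu>)) i = (\<Sum>c\<in>H. Poly_Mapping.lookup \<mu> c * of_bool (i \<in> c))" for \<mu> i
    using z(2) hs by (simp add: Wd_def sum_list_distinct_conv_sum_set)
  have "Wd (\<mu> + \<nu>) \<doteq> Wd \<mu> @ Wd \<nu>" for \<mu> \<nu>
    by (rule legal_unique[OF leg legal_append[OF leg leg]])
      (rule multiset_eqI, simp add: cnt lookup_add algebra_simps sum.distrib)
  moreover have "\<exists>\<mu>. Poly_Mapping.keys \<mu> \<subseteq> H \<and> u \<doteq> Wd \<mu>" if u: "legal F u F" for u
  proof -
    \<comment> \<open>The exponent of a cycle is the count of any one of its letters.\<close>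
    define r where "r c = (if c \<in> H then count (mset u) (SOME h. h \<in> c) else 0)" for c
    define \<mu> where "\<mu> = Abs_poly_mapping r"
    have "finite {c. r c \<noteq> 0}" by (rule finite_subset[OF _ finH]) (auto simp: r_def)
    then have look: "Poly_Mapping.lookup \<mu> = r" by (simp add: \<mu>_def)
    have "Poly_Mapping.keys \<mu> \<subseteq> H"
    proof
      fix x assume "x \<in> Poly_Mapping.keys \<mu>"
      then have "r x \<noteq> 0" by (simp add: in_keys_iff look)
      then show "x \<in> H" by (auto simp: r_def split: if_splits)
    qed
    moreover have "u \<doteq> Wd \<mu>"
    proof (rule legal_unique[OF u leg], rule multiset_eqI)
      fix i
      show "count (mset u) i = count (mset (Wd \<mu>)) i"
      proof (cases "\<exists>c\<in>H. i \<in> c")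
        case True
        then obtain h where h: "h \<in> W" "h \<notin> F" "i \<in> orbit h" by (auto simp: H_def)
        have cH: "orbit h \<in> H" using h by (auto simp: H_def)
        have uniq: "i \<in> c \<longleftrightarrow> c = orbit h" if "c \<in> H" for c
          using that h orbit_eq unfolding H_def by blast
        have "count (mset (Wd \<mu>)) i = (\<Sum>c\<in>H. if c = orbit h then r c else 0)"
          unfolding cnt look by (rule sum.cong) (auto simp: uniq)
        also have "\<dots> = r (orbit h)" using finH cH by simp
        also have "\<dots> = count (mset u) h"
          using closed_const[OF u h(1)] cH someI[of "\<lambda>x. x \<in> orbit h", OF orbit_self]
          by (simp add: r_def)
        also have "\<dots> = count (mset u) i" using closed_const[OF u h(1,3)] by simp
        finally show ?thesis by simp
      next
        case False
        then have "count (mset (Wd \<mu>)) i = 0" by (auto simp: cnt)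
        moreover have "i \<notin> set u"
        proof
          assume "i \<in> set u"
          then have i: "i \<in> W" using legal_letters[OF u] by auto
          have "orbit i \<subseteq> F"
          proof
            fix j assume j: "j \<in> orbit i"
            show "j \<in> F"
            proof (rule ccontr)
              assume "j \<notin> F"
              then have "orbit j \<in> H" using orbit_sub[OF i] j by (auto simp: H_def)
              then show False using False orbit_eq[OF i j] orbit_self by auto
            qed
          qed
          then have "set u \<inter> orbit i = {}" using legal_full[OF u] orbit_step by blast
          then show False using \<open>i \<in> set u\<close> orbit_self by auto
        qed
        ultimately show ?thesis by (metis count_eq_zero_iff set_mset_mset)
      qed
    qed
    ultimately show ?thesis by blast
  qed
  moreover have "Wd 0 = []" by (simp add: Wd_def)
  ultimately show ?thesis using finH leg by blast
qed

text \<open>\<open>D\<close> will be the set of words vanishing in a simple quotient. Among the good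
  configurations for which a topological word on the empty sites survives, one with the fewest
  particles is taken. Then every run that loses a particle vanishes, and what survives of
  \<open>e w e\<close> brings all particles back.\<close>

theorem corner_words:
  fixes D :: "'v list \<Rightarrow> bool"
  assumes D: "\<And>a w b. D w \<Longrightarrow> D (a @ w @ b)" "\<And>u w. u \<doteq> w \<Longrightarrow> D u \<Longrightarrow> D w" "\<not> D []"
  shows "\<exists>e H Wd. e @ e \<doteq> e \<and> \<not> D e \<and> finite (H :: 'v set set) \<and> Wd (0 :: 'v set \<Rightarrow>\<^sub>0 nat) = []
     \<and> (\<forall>\<mu> \<nu>. Wd (\<mu> + \<nu>) \<doteq> Wd \<mu> @ Wd \<nu>) \<and> (\<forall>\<mu>. e @ Wd \<mu> @ e \<doteq> e @ Wd \<mu>)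
     \<and> (\<forall>w. D (e @ w @ e) \<or> (\<exists>\<mu>. Poly_Mapping.keys \<mu> \<subseteq> H \<and> e @ w @ e \<doteq> e @ Wd \<mu>))"
proof -
  define Q where "Q A \<longleftrightarrow> good A \<and> (\<exists>e. topo e \<and> set e = V - A \<and> \<not> D e)" for A
  have "good V" using WV by (auto simp: good_def)
  then have "Q V" using D(3) by (auto simp: Q_def intro!: exI[of _ "[]"])
  then obtain F where QF: "Q F" and min: "\<And>A. Q A \<Longrightarrow> card F \<le> card A"
    using arg_min_nat_lemma[of Q V card] by blast
  then obtain e where F: "good F" and e: "topo e" "set e = V - F" "\<not> D e" by (auto simp: Q_def)
  have se: "supp F e" by (rule supp_topo[OF e(1,2)])
  \<comment> \<open>At the first blocked letter a particle is annihilated. A topological word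
    \<open>e'\<close> for the smaller configuration vanishes by minimality; but
    \<open>v @ [i]\<close> absorbs it and therefore vanishes too.\<close>
  have dead: "D (v @ w)" if "supp A v" "good A" "card A = card F" "run A w = None" for A v w
    using that
  proof (induction w arbitrary: A v)
    case (Cons i w)
    show ?case
    proof (cases "step A i")
      case None
      obtain e' where e': "topo e'" "set e' = V - (A - {i})"
        using good_topo[OF step_None_good(1)[OF Cons.prems(2) None]] by blast
      have "D e'" using min[of "A - {i}"] step_None_good[OF Cons.prems(2) None] Cons.prems(3) e'
        unfolding Q_def by fastforce
      moreover have "(v @ [i]) @ e' \<doteq> v @ [i]"
        using supp_absorb[OF step_None[OF Cons.prems(1) None], of e'] e' by auto
      ultimately have "D (v @ [i])" using D(1)[of e' "v @ [i]" "[]"] D(2) by auto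
      then show ?thesis using D(1)[of "v @ [i]" "[]" w] by simp
    next
      case (Some B)
      then show ?thesis
        using Cons.IH[OF step_Some[OF Cons.prems(1) Some]] step_good[OF Cons.prems(2) Some] Cons.prems
        by simp
    qed
  qed simp
  obtain H Wd where H: "finite (H :: 'v set set)" "Wd (0 :: 'v set \<Rightarrow>\<^sub>0 nat) = []"
    "\<And>\<mu> \<nu>. Wd (\<mu> + \<nu>) \<doteq> Wd \<mu> @ Wd \<nu>" "\<And>\<mu>. legal F (Wd \<mu>) F"
    "\<And>u. legal F u F \<Longrightarrow> \<exists>\<mu>. Poly_Mapping.keys \<mu> \<subseteq> H \<and> u \<doteq> Wd \<mu>"
    using closed_generated[OF F] by blast
  have runl: "run A u = Some B" if "legal A u B" for A u B
    using that by (induction u arbitrary: A) (auto simp: step_def)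
  have ee: "e @ e \<doteq> e" using supp_absorb[OF se] e(2) by blast
  have "e @ Wd \<mu> @ e \<doteq> e @ Wd \<mu>" for \<mu>
    using supp_absorb[OF run_Some[OF se runl[OF H(4)]], of e \<mu>] e(2) by auto
  moreover have "D (e @ w @ e) \<or> (\<exists>\<mu>. Poly_Mapping.keys \<mu> \<subseteq> H \<and> e @ w @ e \<doteq> e @ Wd \<mu>)" for w
  proof (cases "run F (w @ e)")
    case None
    then show ?thesis using dead[OF se F HOL.refl] by blast
  next
    case (Some B)
    then obtain A where A: "run F w = Some A" "run A e = Some B"
      by (auto simp: run_append split: option.splits)
    have "good B \<and> card B = card F" by (rule run_good[OF F Some])
    moreover have "B \<inter> set e = {}" by (rule topo_clears[OF e(1) A(2)])
    ultimately have "B = F"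
      using e good_finite[OF F] by (intro card_seteq) (auto simp: good_def)
    then have "legal F (moves F (w @ e)) F" using run_legal[OF Some] by simp
    then obtain \<mu> where "Poly_Mapping.keys \<mu> \<subseteq> H" "moves F (w @ e) \<doteq> Wd \<mu>" using H(5) by blast
    moreover have "e @ w @ e \<doteq> e @ moves F (w @ e)" by (rule run_moves[OF se Some])
    ultimately show ?thesis using tr ctxl by blast
  qed
  ultimately show ?thesis using ee e(3) H(1-3) by blast
qed

end

section \<open>Finitely supported functions and the linear maps induced by maps of bases\<close>

lemma poly_mapping_single_induct [case_names zero add]:
  assumes "P 0" "\<And>f k v. P f \<Longrightarrow> k \<notin> Poly_Mapping.keys f \<Longrightarrow> v \<noteq> 0 \<Longrightarrow> P (f + Poly_Mapping.single k v)"
  shows "P (f :: 'x \<Rightarrow>\<^sub>0 'k::monoid_add)"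
proof (induction f rule: update_induct)
  case (update f a b)
  have "Poly_Mapping.update a b f = f + Poly_Mapping.single a b"
    using update(1) by (intro poly_mapping_eqI) (auto simp: lookup_update lookup_add lookup_single when_def in_keys_iff)
  then show ?case using update assms(2) by simp
qed (rule assms(1))

definition push :: "('x \<Rightarrow> 'y) \<Rightarrow> ('x \<Rightarrow>\<^sub>0 'k::comm_monoid_add) \<Rightarrow> ('y \<Rightarrow>\<^sub>0 'k)" where
  "push h f = (\<Sum>x\<in>Poly_Mapping.keys f. Poly_Mapping.single (h x) (Poly_Mapping.lookup f x))"

lemma push_0 [simp]: "push h 0 = 0"
  by (simp add: push_def)

lemma push_single [simp]: "push h (Poly_Mapping.single x c) = Poly_Mapping.single (h x) c"
  by (cases "c = 0") (auto simp: push_def)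

lemma push_add: "push h (f + g) = push h f + push h g"
  unfolding push_def by (rule setsum_keys_plus_distrib) (auto simp: single_add)

lemma push_uminus: "push h (- f) = - push h (f :: 'x \<Rightarrow>\<^sub>0 'k::ab_group_add)"
  by (metis (no_types) add.right_inverse add_eq_0_iff push_0 push_add)

lemma push_diff: "push h (f - g) = push h f - push h (g :: 'x \<Rightarrow>\<^sub>0 'k::ab_group_add)"
  by (metis diff_conv_add_uminus push_add push_uminus)

lemma push_push: "push g (push h f) = push (\<lambda>x. g (h x)) f"
  by (induction f rule: poly_mapping_single_induct) (auto simp: push_add)

lemma push_keys: "Poly_Mapping.keys (push h f) \<subseteq> h ` Poly_Mapping.keys f"
  unfolding push_def by (rule order_trans[OF Poly_Mapping.keys_sum]) (auto split: if_splits)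

section \<open>Two-sided ideals and the free algebra\<close>

definition two_ideal :: "'a::ring_1 set \<Rightarrow> bool" where
  "two_ideal I \<longleftrightarrow> 0 \<in> I \<and> (\<forall>a\<in>I. \<forall>b\<in>I. a + b \<in> I) \<and> (\<forall>x. \<forall>a\<in>I. x * a \<in> I \<and> a * x \<in> I)"

definition maximal_two_ideal :: "'a::ring_1 set \<Rightarrow> bool" where
  "maximal_two_ideal I \<longleftrightarrow> two_ideal I \<and> 1 \<notin> I \<and> (\<forall>L. two_ideal L \<longrightarrow> I \<subseteq> L \<longrightarrow> 1 \<notin> L \<longrightarrow> L = I)"

context
  fixes I :: "'a::ring_1 set"
  assumes I: "two_ideal I"
begin

lemma two_ideal_0: "0 \<in> I" and two_ideal_add: "a \<in> I \<Longrightarrow> b \<in> I \<Longrightarrow> a + b \<in> I"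
  and two_ideal_l: "a \<in> I \<Longrightarrow> x * a \<in> I" and two_ideal_r: "a \<in> I \<Longrightarrow> a * x \<in> I"
  using I by (auto simp: two_ideal_def)

lemma two_ideal_refl: "a - a \<in> I"
  by (simp add: two_ideal_0)

lemma two_ideal_uminus: "a \<in> I \<Longrightarrow> - a \<in> I"
  using two_ideal_l[of a "-1"] by simp

lemma two_ideal_diff: "a \<in> I \<Longrightarrow> b \<in> I \<Longrightarrow> a - b \<in> I"
  using two_ideal_add[of a "- b"] two_ideal_uminus by simp

lemma two_ideal_cong: "a - b \<in> I \<Longrightarrow> a \<in> I \<longleftrightarrow> b \<in> I"
  using two_ideal_add[of "a - b" b] two_ideal_diff[of a "a - b"] by auto

lemma two_ideal_trans: "a - b \<in> I \<Longrightarrow> b - c \<in> I \<Longrightarrow> a - c \<in> I"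
  using two_ideal_add[of "a - b" "b - c"] by simp

lemma two_ideal_sym: "a - b \<in> I \<Longrightarrow> b - a \<in> I"
  using two_ideal_uminus[of "a - b"] by simp

lemma two_ideal_mult: "a - b \<in> I \<Longrightarrow> c - d \<in> I \<Longrightarrow> a * c - b * d \<in> I"
  using two_ideal_add[OF two_ideal_r[of "a - b" c] two_ideal_l[of "c - d" b]]
  by (simp add: algebra_simps)

lemma two_ideal_plus: "a - b \<in> I \<Longrightarrow> c - d \<in> I \<Longrightarrow> (a + c) - (b + d) \<in> I"
  using two_ideal_add[of "a - b" "c - d"] by (simp add: algebra_simps)

end

lemma maximal_two_idealD:
  assumes "maximal_two_ideal I"
  shows "two_ideal I" "1 \<notin> I" "two_ideal L \<Longrightarrow> I \<subseteq> L \<Longrightarrow> a \<in> L \<Longrightarrow> a \<notin> I \<Longrightarrow> 1 \<in> L"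
  using assms by (auto simp: maximal_two_ideal_def)

lemma two_ideal_left_annihilator:
  assumes "two_ideal I"
  shows "two_ideal {x. \<forall>t. x * t * b \<in> I}"
  unfolding two_ideal_def
proof (intro conjI ballI allI)
  fix x a assume "a \<in> {x. \<forall>t. x * t * b \<in> I}"
  then have *: "a * t * b \<in> I" for t by simp
  show "x * a \<in> {x. \<forall>t. x * t * b \<in> I}"
    using two_ideal_l[OF assms *] by (simp add: mult.assoc)
  show "a * x \<in> {x. \<forall>t. x * t * b \<in> I}" using *[of "x * t" for t] by (simp add: mult.assoc)
qed (use assms in \<open>auto simp: two_ideal_def distrib_right\<close>)

lemma two_ideal_right_annihilator:
  assumes "two_ideal I"
  shows "two_ideal {x. \<forall>t. a * t * x \<in> I}"
  unfolding two_ideal_def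
proof (intro conjI ballI allI)
  fix x y assume y: "y \<in> {x. \<forall>t. a * t * x \<in> I}"
  then have *: "a * t * y \<in> I" for t by simp
  show "x * y \<in> {x. \<forall>t. a * t * x \<in> I}"
    using *[of "t * x" for t] by (simp add: mult.assoc)
  show "y * x \<in> {x. \<forall>t. a * t * x \<in> I}"
    using two_ideal_r[OF assms *] by (simp add: mult.assoc)
qed (use assms in \<open>auto simp: two_ideal_def distrib_left\<close>)

text \<open>If \<open>b\<close> is outside \<open>I\<close>, the elements \<open>x\<close> with
  \<open>x t b\<close> in \<open>I\<close> for all \<open>t\<close> form an ideal that contains
  \<open>I\<close> and not 1, so there are no others than those of \<open>I\<close>.\<close>

lemma maximal_two_ideal_prime:
  assumes I: "maximal_two_ideal I" and ab: "\<And>t. a * t * b \<in> I"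
  shows "a \<in> I \<or> b \<in> I"
proof (rule ccontr)
  assume "\<not> ?thesis"
  then have a: "a \<notin> I" and b: "b \<notin> I" by auto
  note tI = maximal_two_idealD(1)[OF I]
  have "I \<subseteq> {x. \<forall>t. x * t * b \<in> I}" using two_ideal_r[OF tI] by blast
  moreover have "a \<in> {x. \<forall>t. x * t * b \<in> I}" using ab by blast
  ultimately have "1 \<in> {x. \<forall>t. x * t * b \<in> I}"
    using maximal_two_idealD(3)[OF I two_ideal_left_annihilator[OF tI]] a by blast
  then have "1 * 1 * b \<in> I" by blast
  then show False using b by simp
qed

text \<open>With concatenation as addition of exponents, \<^typ>\<open>'v list \<Rightarrow>\<^sub>0 'k\<close> is the free algebra on \<open>'v\<close>.\<close>

instantiation list :: (type) monoid_add
begin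

definition zero_list :: "'a list" where "zero_list = []"
definition plus_list :: "'a list \<Rightarrow> 'a list \<Rightarrow> 'a list" where "plus_list = (@)"

instance by standard (auto simp: zero_list_def plus_list_def)

end

abbreviation wrd :: "'v list \<Rightarrow> ('v list \<Rightarrow>\<^sub>0 'k::comm_ring_1)" where
  "wrd w \<equiv> Poly_Mapping.single w 1"

abbreviation cst :: "'k::comm_ring_1 \<Rightarrow> ('v list \<Rightarrow>\<^sub>0 'k)" where
  "cst c \<equiv> Poly_Mapping.single [] c"

lemma single_times: "Poly_Mapping.single u a * Poly_Mapping.single v b = Poly_Mapping.single (u @ v) (a * b :: 'k::comm_ring_1)"
  by (simp add: mult_single plus_list_def)

lemma wrd_Nil: "wrd [] = 1"
  by (metis single_one zero_list_def)

lemma single_cst: "Poly_Mapping.single w c = cst c * wrd w"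
  by (simp add: single_times)

lemma cst_comm: "cst c * x = x * cst c"
  by (induction x rule: poly_mapping_single_induct) (auto simp: distrib_left distrib_right single_times mult.commute)

lemma cst_1: "cst 1 = 1"
  by (rule wrd_Nil)

lemma cst_add: "cst (a + b) = cst a + cst b"
  by (rule single_add)

lemma cst_mult: "cst (a * b) = cst a * cst b"
  by (simp add: single_times)

lemma cst_diff: "cst (a - b) = cst a - cst b"
  by (rule single_diff)

lemma two_ideal_single: "two_ideal I \<Longrightarrow> wrd u - wrd v \<in> I \<Longrightarrow> Poly_Mapping.single u c - Poly_Mapping.single v c \<in> I"
  using two_ideal_l[of I "wrd u - wrd v" "cst c"] by (simp add: right_diff_distrib single_times)

lemma two_ideal_cst:
  assumes "two_ideal I" "cst c * x \<in> I" "(c :: 'k::field) \<noteq> 0"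
  shows "x \<in> I"
proof -
  have "cst (inverse c) * (cst c * x) \<in> I" by (rule two_ideal_l[OF assms(1,2)])
  then show ?thesis using assms(3) by (simp add: mult.assoc[symmetric] single_times cst_1)
qed

section \<open>The corner\<close>

theorem corner_exists:
  fixes I :: "('v list \<Rightarrow>\<^sub>0 'k::alg_closed_field) set"
  assumes tasep: "tasep E R V W \<sigma>" and maxI: "maximal_two_ideal I"
    and R: "\<And>u v. R u v \<Longrightarrow> wrd u - wrd v \<in> I"
  shows "\<exists>e lam. R (e @ e) e \<and> wrd e \<notin> I \<and> (\<forall>x. wrd e * x * wrd e - cst (lam x) * wrd e \<in> I)"
proof -
  interpret tasep E R V W \<sigma> by (rule tasep)
  note I = maximal_two_idealD(1)[OF maxI]
  have "\<exists>e H Wd. R (e @ e) e \<and> wrd e \<notin> I \<and> finite (H :: 'v set set) \<and> Wd (0 :: 'v set \<Rightarrow>\<^sub>0 nat) = []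
     \<and> (\<forall>\<mu> \<nu>. R (Wd (\<mu> + \<nu>)) (Wd \<mu> @ Wd \<nu>)) \<and> (\<forall>\<mu>. R (e @ Wd \<mu> @ e) (e @ Wd \<mu>))
     \<and> (\<forall>w. wrd (e @ w @ e) \<in> I \<or> (\<exists>\<mu>. Poly_Mapping.keys \<mu> \<subseteq> H \<and> R (e @ w @ e) (e @ Wd \<mu>)))"
  proof (rule corner_words)
    fix a w b assume "wrd w \<in> I"
    then have "wrd a * wrd w * wrd b \<in> I" by (intro two_ideal_r[OF I] two_ideal_l[OF I])
    then show "wrd (a @ w @ b) \<in> I" by (simp add: single_times)
  next
    show "wrd w \<in> I" if "R u w" "wrd u \<in> I" for u w
      using R[OF that(1)] that(2) two_ideal_cong[OF I] by blast
    show "wrd [] \<notin> I" using maximal_two_idealD(2)[OF maxI] by (simp add: wrd_Nil)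
  qed
  then obtain e H Wd where e: "R (e @ e) e" "wrd e \<notin> I" and H: "finite (H :: 'v set set)"
    and Wd0: "Wd (0 :: 'v set \<Rightarrow>\<^sub>0 nat) = []"
    and Wd_add: "\<And>\<mu> \<nu>. R (Wd (\<mu> + \<nu>)) (Wd \<mu> @ Wd \<nu>)"
    and Wd_e: "\<And>\<mu>. R (e @ Wd \<mu> @ e) (e @ Wd \<mu>)"
    and span: "\<And>w. wrd (e @ w @ e) \<in> I \<or> (\<exists>\<mu>. Poly_Mapping.keys \<mu> \<subseteq> H \<and> R (e @ w @ e) (e @ Wd \<mu>))"
    by blast
  let ?e = "wrd e :: 'v list \<Rightarrow>\<^sub>0 'k"
  \<comment> \<open>\<open>\<psi>\<close> maps the polynomial ring in the elementary circulations
    onto the corner modulo \<open>I\<close>. The congruences that follow say that it is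
    multiplicative and that \<open>e\<close> acts as a unit on its values.\<close>
  define \<psi> :: "(('v set \<Rightarrow>\<^sub>0 nat) \<Rightarrow>\<^sub>0 'k) \<Rightarrow> ('v list \<Rightarrow>\<^sub>0 'k)" where "\<psi> = push (\<lambda>\<mu>. e @ Wd \<mu>)"
  have \<psi>add: "\<psi> (p + q) = \<psi> p + \<psi> q" and \<psi>diff: "\<psi> (p - q) = \<psi> p - \<psi> q" and \<psi>0: "\<psi> 0 = 0" for p q
    by (auto simp: \<psi>_def push_add push_diff)
  have \<psi>s: "\<psi> (Poly_Mapping.single \<mu> c) = Poly_Mapping.single (e @ Wd \<mu>) c" for \<mu> c
    by (simp add: \<psi>_def)
  have \<psi>mult: "\<psi> (p * q) - \<psi> p * \<psi> q \<in> I" for p q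
  proof (induction p rule: poly_mapping_single_induct)
    case (add p \<mu> a)
    have "\<psi> (Poly_Mapping.single \<mu> a * q) - \<psi> (Poly_Mapping.single \<mu> a) * \<psi> q \<in> I"
    proof (induction q rule: poly_mapping_single_induct)
      case (add q \<nu> b)
      have "R (e @ Wd (\<mu> + \<nu>)) ((e @ Wd \<mu>) @ Wd \<nu>)" using ctxl[OF Wd_add] by simp
      also have "R \<dots> ((e @ Wd \<mu>) @ e @ Wd \<nu>)" using ctxr[OF sm[OF Wd_e[of \<mu>]], of "Wd \<nu>"] by simp
      finally have "R (e @ Wd (\<mu> + \<nu>)) ((e @ Wd \<mu>) @ e @ Wd \<nu>)" .
      from two_ideal_single[OF I R[OF this], of "a * b"]
      have "\<psi> (Poly_Mapping.single \<mu> a * Poly_Mapping.single \<nu> b)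
          - \<psi> (Poly_Mapping.single \<mu> a) * \<psi> (Poly_Mapping.single \<nu> b) \<in> I"
        by (simp add: \<psi>s mult_single plus_list_def)
      from two_ideal_plus[OF I add(1) this] show ?case by (simp add: \<psi>add distrib_left)
    qed (simp add: \<psi>0 two_ideal_0[OF I])
    from two_ideal_plus[OF I add(1) this] show ?case by (simp add: \<psi>add distrib_right)
  qed (simp add: \<psi>0 two_ideal_0[OF I])
  have \<psi>e: "\<psi> p * ?e - \<psi> p \<in> I" for p
  proof (induction p rule: poly_mapping_single_induct)
    case (add p \<mu> a)
    have "\<psi> (Poly_Mapping.single \<mu> a) * ?e - \<psi> (Poly_Mapping.single \<mu> a) \<in> I"
      using two_ideal_single[OF I R[OF Wd_e[of \<mu>]], of a] by (simp add: \<psi>s single_times)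
    from two_ideal_plus[OF I add(1) this] show ?case by (simp add: \<psi>add distrib_right)
  qed (simp add: \<psi>0 two_ideal_0[OF I])
  have e\<psi>: "?e * \<psi> p - \<psi> p \<in> I" for p
  proof (induction p rule: poly_mapping_single_induct)
    case (add p \<mu> a)
    have "R (e @ e @ Wd \<mu>) (e @ Wd \<mu>)" using ctxr[OF e(1), of "Wd \<mu>"] by simp
    from two_ideal_single[OF I R[OF this], of a]
    have "?e * \<psi> (Poly_Mapping.single \<mu> a) - \<psi> (Poly_Mapping.single \<mu> a) \<in> I"
      by (simp add: \<psi>s single_times)
    from two_ideal_plus[OF I add(1) this] show ?case by (simp add: \<psi>add distrib_left)
  qed (simp add: \<psi>0 two_ideal_0[OF I])
  define mono where "mono \<mu> = (Poly_Mapping.single \<mu> 1 :: ('v set \<Rightarrow>\<^sub>0 nat) \<Rightarrow>\<^sub>0 'k)" for \<mu>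
  define \<iota> where "\<iota> c = (Poly_Mapping.single 0 c :: ('v set \<Rightarrow>\<^sub>0 nat) \<Rightarrow>\<^sub>0 'k)" for c
  \<comment> \<open>\<open>A\<close> is left open because the spanning property is used twice: with
    the whole polynomial ring to show that \<open>P\<close> is prime, and with the subring on which
    the Nullstellensatz provides a place.\<close>
  have spanA: "\<exists>s\<in>A. ?e * t * ?e - \<psi> s \<in> I"
    if A: "subring_set A" "range \<iota> \<subseteq> A" "(\<lambda>c. mono (Poly_Mapping.single c 1)) ` H \<subseteq> A" for A t
  proof (induction t rule: poly_mapping_single_induct)
    case zero
    show ?case using subring_set_0[OF A(1)] two_ideal_0[OF I] \<psi>0 by (intro bexI[of _ 0]) auto
  next
    case (add t w k)
    then obtain s where s: "s \<in> A" "?e * t * ?e - \<psi> s \<in> I" by blast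
    have monoA: "mono \<mu> \<in> A" if "Poly_Mapping.keys \<mu> \<subseteq> H" for \<mu>
      using that
    proof (induction \<mu> rule: poly_mapping_single_induct)
      case zero
      show ?case using subring_set_1[OF A(1)] by (simp add: mono_def)
    next
      case (add \<mu> c n)
      have "insert c (Poly_Mapping.keys \<mu>) \<subseteq> Poly_Mapping.keys (\<mu> + Poly_Mapping.single c n)"
        using add(3) by (auto simp: in_keys_iff lookup_add)
      then have "c \<in> H" "Poly_Mapping.keys \<mu> \<subseteq> H" using add(4) by auto
      have "mono (Poly_Mapping.single c n) = mono (Poly_Mapping.single c 1) ^ n"
      proof (induction n)
        case (Suc n)
        have "mono (Poly_Mapping.single c (Suc n)) = mono (Poly_Mapping.single c 1) * mono (Poly_Mapping.single c n)"
          by (simp add: mono_def mult_single flip: single_add)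
        then show ?case using Suc by simp
      qed (simp add: mono_def)
      then have "mono (Poly_Mapping.single c n) \<in> A"
        using A(3) \<open>c \<in> H\<close> by (auto intro: subring_set_power[OF A(1)])
      moreover have "mono (\<mu> + Poly_Mapping.single c n) = mono \<mu> * mono (Poly_Mapping.single c n)"
        by (simp add: mono_def mult_single)
      ultimately show ?case using add(1) \<open>Poly_Mapping.keys \<mu> \<subseteq> H\<close> subring_set_mult[OF A(1)] by simp
    qed
    have "\<exists>s'\<in>A. ?e * Poly_Mapping.single w k * ?e - \<psi> s' \<in> I"
    proof (cases "wrd (e @ w @ e) \<in> I")
      case True
      from two_ideal_l[OF I this, of "cst k"] show ?thesis
        using subring_set_0[OF A(1)] by (intro bexI[of _ 0]) (auto simp: \<psi>0 single_times)
    next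
      case False
      then obtain \<mu> where \<mu>: "Poly_Mapping.keys \<mu> \<subseteq> H" "R (e @ w @ e) (e @ Wd \<mu>)" using span by blast
      have "Poly_Mapping.single \<mu> k = \<iota> k * mono \<mu>" by (simp add: \<iota>_def mono_def mult_single)
      then have "Poly_Mapping.single \<mu> k \<in> A"
        using A(2) monoA[OF \<mu>(1)] subring_set_mult[OF A(1)] by auto
      then show ?thesis
        using two_ideal_single[OF I R[OF \<mu>(2)], of k]
        by (intro bexI[of _ "Poly_Mapping.single \<mu> k"]) (auto simp: \<psi>s single_times)
    qed
    then obtain s' where s': "s' \<in> A" "?e * Poly_Mapping.single w k * ?e - \<psi> s' \<in> I" by blast
    from two_ideal_plus[OF I s(2) s'(2)] show ?case
      using subring_set_add[OF A(1) s(1) s'(1)]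
      by (intro bexI[of _ "s + s'"]) (auto simp: \<psi>add distrib_left distrib_right)
  qed
  define P where "P = {p. \<psi> p \<in> I}"
  have \<psi>1: "\<psi> 1 = ?e" using \<psi>s[of 0 1] Wd0 by simp
  have P: "prime_set P"
    unfolding prime_set_def
  proof (intro conjI allI ballI impI)
    show "0 \<in> P" by (simp add: P_def \<psi>0 two_ideal_0[OF I])
    show "1 \<notin> P" using e(2) by (simp add: P_def \<psi>1)
    show "a + b \<in> P" if "a \<in> P" "b \<in> P" for a b
      using that two_ideal_add[OF I] by (simp add: P_def \<psi>add)
    show "a * b \<in> P" if "b \<in> P" for a b
      using that two_ideal_cong[OF I \<psi>mult] two_ideal_l[OF I] by (simp add: P_def)
  next
    fix p q assume pq: "p * q \<in> P"
    \<comment> \<open>Here \<open>t\<close> matters only through \<open>e t e\<close>, which is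
      represented by \<open>\<psi> s\<close>. As polynomials commute, the product is then a multiple
      of the image of \<open>p * q\<close>.\<close>
    have "\<psi> p * t * \<psi> q \<in> I" for t
    proof -
      obtain s where s: "?e * t * ?e - \<psi> s \<in> I" using spanA[of UNIV t] by (auto simp: subring_set_def)
      have h1: "\<psi> p * t * \<psi> q - (\<psi> p * ?e) * t * (?e * \<psi> q) \<in> I"
        by (rule two_ideal_mult[OF I two_ideal_mult[OF I two_ideal_sym[OF I \<psi>e] two_ideal_refl[OF I]]
              two_ideal_sym[OF I e\<psi>]])
      have h2: "(\<psi> p * ?e) * t * (?e * \<psi> q) - \<psi> p * \<psi> s * \<psi> q \<in> I"
        using two_ideal_l[OF I two_ideal_r[OF I s, of "\<psi> q"], of "\<psi> p"]
        by (simp add: algebra_simps)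
      have h3: "\<psi> p * \<psi> s * \<psi> q - \<psi> (p * s) * \<psi> q \<in> I"
        by (rule two_ideal_mult[OF I two_ideal_sym[OF I \<psi>mult] two_ideal_refl[OF I]])
      have h4: "\<psi> (p * s) * \<psi> q - \<psi> (p * s * q) \<in> I"
        by (rule two_ideal_sym[OF I \<psi>mult])
      have h5: "\<psi> (p * s * q) - \<psi> s * \<psi> (p * q) \<in> I"
        using \<psi>mult[of s "p * q"] by (simp add: ac_simps)
      have "\<psi> s * \<psi> (p * q) \<in> I" using pq two_ideal_l[OF I] by (simp add: P_def)
      then show ?thesis
        using two_ideal_cong[OF I two_ideal_trans[OF I h1 two_ideal_trans[OF I h2
              two_ideal_trans[OF I h3 two_ideal_trans[OF I h4 h5]]]]] by blast
    qed
    then show "p \<in> P \<or> q \<in> P" using maximal_two_ideal_prime[OF maxI] by (auto simp: P_def)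
  qed
  have "\<exists>A f. subring_set A \<and> range \<iota> \<subseteq> A \<and> (\<lambda>c. mono (Poly_Mapping.single c 1)) ` H \<subseteq> A \<and> place \<iota> P A f"
    by (rule weak_nullstellensatz) (auto simp: \<iota>_def single_diff mult_single P H)
  then obtain A f where A: "subring_set A" "range \<iota> \<subseteq> A" "(\<lambda>c. mono (Poly_Mapping.single c 1)) ` H \<subseteq> A"
    and f: "place \<iota> P A f" by blast
  \<comment> \<open>The value of the place at the corner element \<open>e t e\<close>. Two
    representatives \<open>s\<close> differ by an element of \<open>P\<close>, where the place
    vanishes.\<close>
  define lam where "lam t = f (SOME s. s \<in> A \<and> ?e * t * ?e - \<psi> s \<in> I)" for t
  have lam: "lam t = f s" if s: "s \<in> A" "?e * t * ?e - \<psi> s \<in> I" for s t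
  proof -
    define s' where "s' = (SOME s. s \<in> A \<and> ?e * t * ?e - \<psi> s \<in> I)"
    have s': "s' \<in> A \<and> ?e * t * ?e - \<psi> s' \<in> I"
      unfolding s'_def by (rule someI[where x = s]) (use s in simp)
    have "\<psi> (s' - s) \<in> I"
      using two_ideal_trans[OF I two_ideal_sym[OF I conjunct2[OF s']] s(2)] by (simp add: \<psi>diff)
    then have "f (s' - s) = 0"
      using place_null[OF A(1) f subring_set_diff[OF A(1)]] s s' by (simp add: P_def)
    then show ?thesis using place_diff[OF A(1) f] s s' by (simp add: lam_def s'_def)
  qed
  obtain rep where rep: "\<And>t. rep t \<in> A" "\<And>t. ?e * t * ?e - \<psi> (rep t) \<in> I"
    using spanA[OF A] by metis
  have lamrep: "lam t = f (rep t)" for t by (rule lam[OF rep])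
  have lamadd: "lam (s + t) = lam s + lam t" for s t
  proof -
    have "lam (s + t) = f (rep s + rep t)"
      using two_ideal_plus[OF I rep(2)[of s] rep(2)[of t]] subring_set_add[OF A(1) rep(1) rep(1)]
      by (intro lam) (auto simp: \<psi>add distrib_left distrib_right)
    then show ?thesis by (simp add: lamrep place_add[OF A(1) f rep(1) rep(1)])
  qed
  have lammult: "lam (s * ?e * t) = lam s * lam t" for s t
  proof -
    have "?e * s * (?e * ?e) * t * ?e - ?e * s * ?e * t * ?e \<in> I"
      using R[OF e(1)] by (intro two_ideal_mult[OF I]) (auto simp: single_times two_ideal_0[OF I])
    then have "?e * (s * ?e * t) * ?e - (?e * s * ?e) * (?e * t * ?e) \<in> I"
      using two_ideal_sym[OF I] by (simp add: mult.assoc)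
    moreover have "(?e * s * ?e) * (?e * t * ?e) - \<psi> (rep s) * \<psi> (rep t) \<in> I"
      by (intro two_ideal_mult[OF I] rep)
    moreover have "\<psi> (rep s) * \<psi> (rep t) - \<psi> (rep s * rep t) \<in> I"
      by (rule two_ideal_sym[OF I \<psi>mult])
    ultimately have "?e * (s * ?e * t) * ?e - \<psi> (rep s * rep t) \<in> I"
      using two_ideal_trans[OF I] by blast
    then have "lam (s * ?e * t) = f (rep s * rep t)"
      by (intro lam subring_set_mult[OF A(1)] rep)
    then show ?thesis by (simp add: lamrep place_mult[OF A(1) f rep(1) rep(1)])
  qed
  have lamI: "lam t = 0" if "t \<in> I" for t
  proof -
    have "lam t = f 0"
      using that by (intro lam) (auto simp: subring_set_0[OF A(1)] \<psi>0 intro: two_ideal_r[OF I] two_ideal_l[OF I])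
    then show ?thesis by (simp add: place_0[OF A(1) f])
  qed
  have lam0: "lam 0 = 0" by (rule lamI[OF two_ideal_0[OF I]])
  have lamcst: "lam (cst c * t) = c * lam t" for c t
  proof -
    have "\<psi> (\<iota> c * s) = cst c * \<psi> s" for s
      by (induction s rule: poly_mapping_single_induct)
        (auto simp: \<psi>0 \<psi>add distrib_left \<psi>s \<iota>_def mult_single plus_list_def)
    then have "lam (cst c * t) = f (\<iota> c * rep t)"
      using two_ideal_l[OF I rep(2)[of t], of "cst c"] A(2) rep(1) cst_comm[of c ?e]
      by (intro lam subring_set_mult[OF A(1)])
        (auto simp: right_diff_distrib mult.assoc[symmetric])
    then show ?thesis
      using A(2) place_mult[OF A(1) f _ rep(1), of "\<iota> c"] place_const[OF A(1) f] by (auto simp: lamrep)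
  qed
  have lam1: "lam 1 = 1"
  proof -
    have "lam 1 = f 1"
      using R[OF e(1)] by (intro lam subring_set_1[OF A(1)]) (simp add: \<psi>1 single_times)
    also have "\<dots> = 1" using place_const[OF A(1) f, of 1] by (simp add: \<iota>_def)
    finally show ?thesis .
  qed
  \<comment> \<open>The largest ideal inside the kernel of \<open>lam\<close>. Once it is identified
    with \<open>I\<close>, congruence modulo \<open>I\<close> can be tested by \<open>lam\<close>,
    which is multiplicative across a factor \<open>e\<close>.\<close>
  define L where "L = {x. \<forall>s t. lam (s * x * t) = 0}"
  have "two_ideal L"
    unfolding two_ideal_def
  proof (intro conjI ballI allI)
    show "0 \<in> L" by (simp add: L_def lam0)
    show "a + b \<in> L" if "a \<in> L" "b \<in> L" for a b
      using that by (simp add: L_def distrib_left distrib_right lamadd)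
    fix x a assume a: "a \<in> L"
    then have a': "lam (s * a * t) = 0" for s t by (simp add: L_def)
    show "x * a \<in> L" using a'[of "s * x" for s] by (simp add: L_def mult.assoc)
    show "a * x \<in> L" using a'[of _ "x * t" for t] by (simp add: L_def mult.assoc)
  qed
  moreover have "I \<subseteq> L" by (auto simp: L_def intro!: lamI two_ideal_r[OF I two_ideal_l[OF I]])
  moreover have "1 \<notin> L" using lam1 by (auto simp: L_def intro!: exI[of _ 1])
  ultimately have LI: "L = I" using maxI by (auto simp: maximal_two_ideal_def)
  have "?e * x * ?e - cst (lam x) * ?e \<in> I" for x
  proof -
    have "lam (s * (?e * x * ?e - cst (lam x) * ?e) * t) = 0" for s t
    proof -
      have "lam (s * (?e * x * ?e) * t) = lam s * (lam x * lam t)"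
        using lammult[of s "x * ?e * t"] lammult[of x t] by (simp add: mult.assoc)
      moreover have "lam (s * (cst (lam x) * ?e) * t) = lam x * (lam s * lam t)"
      proof -
        have "s * (cst (lam x) * ?e) * t = cst (lam x) * (s * ?e * t)"
          by (metis cst_comm mult.assoc)
        then show ?thesis by (simp add: lamcst lammult)
      qed
      moreover have "lam (a - b) = lam a - lam b" for a b
        using lamadd[of "a - b" b] by simp
      ultimately show ?thesis by (simp add: left_diff_distrib right_diff_distrib)
    qed
    then have "?e * x * ?e - cst (lam x) * ?e \<in> L" by (simp add: L_def)
    then show ?thesis using LI by simp
  qed
  then show ?thesis using e by blast
qed

section \<open>Monoid algebras and presented monoids\<close>

lemma keys_add_single:
  "k \<notin> Poly_Mapping.keys f \<Longrightarrow> v \<noteq> 0 \<Longrightarrow>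
    Poly_Mapping.keys (f + Poly_Mapping.single k v) = insert k (Poly_Mapping.keys (f :: 'x \<Rightarrow>\<^sub>0 'k::comm_monoid_add))"
  by (auto simp: in_keys_iff lookup_add lookup_single when_def split: if_splits)

lemma keys_subset_induct [consumes 1, case_names zero add]:
  assumes "Poly_Mapping.keys (f :: 'x \<Rightarrow>\<^sub>0 'k::comm_monoid_add) \<subseteq> C" "P 0"
    "\<And>f k v. P f \<Longrightarrow> Poly_Mapping.keys f \<subseteq> C \<Longrightarrow> k \<in> C \<Longrightarrow> P (f + Poly_Mapping.single k v)"
  shows "P f"
  using assms(1)
  by (induction f rule: poly_mapping_single_induct) (auto simp: keys_add_single assms)

lemma keys_add_subset:
  "Poly_Mapping.keys f \<subseteq> C \<Longrightarrow> Poly_Mapping.keys g \<subseteq> C \<Longrightarrow>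
    Poly_Mapping.keys (f + g :: 'x \<Rightarrow>\<^sub>0 'k::comm_monoid_add) \<subseteq> C"
  using Poly_Mapping.keys_add[of f g] by blast

lemma monoid_algebra_simps [simp]:
  "carrier (monoid_algebra M) = {f. Poly_Mapping.keys f \<subseteq> carrier M}"
  "\<one>\<^bsub>monoid_algebra M\<^esub> = Poly_Mapping.single \<one>\<^bsub>M\<^esub> 1"
  "\<zero>\<^bsub>monoid_algebra M\<^esub> = 0"
  "f \<oplus>\<^bsub>monoid_algebra M\<^esub> g = f + g"
  "c \<odot>\<^bsub>monoid_algebra M\<^esub> f = Poly_Mapping.map ((*) c) f"
  by (simp_all add: monoid_algebra_def)

lemma lookup_map_times: "Poly_Mapping.lookup (Poly_Mapping.map ((*) (c::'k::field)) f) x = c * Poly_Mapping.lookup f x"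
  by (auto simp: map.rep_eq when_def)

lemma map_times_add: "Poly_Mapping.map ((*) c) (f + g) = Poly_Mapping.map ((*) c) f + Poly_Mapping.map ((*) (c::'k::field)) g"
  by (intro poly_mapping_eqI) (simp add: lookup_add lookup_map_times distrib_left)

lemma map_times_0 [simp]: "Poly_Mapping.map ((*) (c::'k::field)) 0 = 0"
  by (intro poly_mapping_eqI) (simp add: lookup_map_times)

lemma map_times_single [simp]: "Poly_Mapping.map ((*) (c::'k::field)) (Poly_Mapping.single x a) = Poly_Mapping.single x (c * a)"
  by simp

lemma keys_map_times: "Poly_Mapping.keys (Poly_Mapping.map ((*) (c::'k::field)) f) \<subseteq> Poly_Mapping.keys f"
  by (auto simp: in_keys_iff lookup_map_times)

lemma map_times_zero_left [simp]: "Poly_Mapping.map ((*) (0::'k::field)) f = 0"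
  by (intro poly_mapping_eqI) (auto simp: lookup_map_times)

lemma map_times_push: "Poly_Mapping.map ((*) (c::'k::field)) (push h f) = push h (Poly_Mapping.map ((*) c) f)"
  by (induction f rule: poly_mapping_single_induct) (auto simp: push_add map_times_add)

lemma map_times_1 [simp]: "Poly_Mapping.map ((*) (1::'k::field)) f = f"
  by (intro poly_mapping_eqI) (auto simp: lookup_map_times)

lemma map_times_uminus: "Poly_Mapping.map ((*) (-1::'k::field)) f = - f"
  by (intro poly_mapping_eqI) (auto simp: lookup_map_times)

context
  fixes M :: "('x, 'm) monoid_scheme"
begin

abbreviation ma_mult :: "('x \<Rightarrow>\<^sub>0 'k::field) \<Rightarrow> ('x \<Rightarrow>\<^sub>0 'k) \<Rightarrow> ('x \<Rightarrow>\<^sub>0 'k)" where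
  "ma_mult f g \<equiv> f \<otimes>\<^bsub>monoid_algebra M\<^esub> g"

lemma ma_mult_def: "ma_mult f g = (\<Sum>x \<in> Poly_Mapping.keys f. \<Sum>y \<in> Poly_Mapping.keys g.
        Poly_Mapping.single (x \<otimes>\<^bsub>M\<^esub> y) (Poly_Mapping.lookup f x * Poly_Mapping.lookup g y))"
  by (simp add: monoid_algebra_def)

lemma ma_mult_add_left: "ma_mult (f + f') g = ma_mult f g + ma_mult f' g"
  unfolding ma_mult_def
  by (rule setsum_keys_plus_distrib) (auto simp: distrib_right single_add sum.distrib)

lemma ma_mult_add_right: "ma_mult f (g + g') = ma_mult f g + ma_mult f g'"
proof -
  have "(\<Sum>y \<in> Poly_Mapping.keys (g + g').
        Poly_Mapping.single (x \<otimes>\<^bsub>M\<^esub> y) (Poly_Mapping.lookup f x * Poly_Mapping.lookup (g + g') y))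
    = (\<Sum>y \<in> Poly_Mapping.keys g. Poly_Mapping.single (x \<otimes>\<^bsub>M\<^esub> y) (Poly_Mapping.lookup f x * Poly_Mapping.lookup g y))
    + (\<Sum>y \<in> Poly_Mapping.keys g'. Poly_Mapping.single (x \<otimes>\<^bsub>M\<^esub> y) (Poly_Mapping.lookup f x * Poly_Mapping.lookup g' y))" for x
    by (rule setsum_keys_plus_distrib) (auto simp: distrib_left single_add)
  then show ?thesis by (simp add: ma_mult_def sum.distrib)
qed

lemma ma_mult_0 [simp]: "ma_mult 0 g = 0" "ma_mult f 0 = 0"
  by (simp_all add: ma_mult_def)

lemma ma_mult_single [simp]:
  "ma_mult (Poly_Mapping.single x a) (Poly_Mapping.single y b) = Poly_Mapping.single (x \<otimes>\<^bsub>M\<^esub> y) (a * b)"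
  by (auto simp: ma_mult_def)

lemma ma_mult_smult_left: "ma_mult (Poly_Mapping.map ((*) c) f) g = Poly_Mapping.map ((*) c) (ma_mult f g)"
proof (induction f rule: poly_mapping_single_induct)
  case (add f x a)
  have "ma_mult (Poly_Mapping.single x (c * a)) g = Poly_Mapping.map ((*) c) (ma_mult (Poly_Mapping.single x a) g)"
    by (induction g rule: poly_mapping_single_induct) (auto simp: ma_mult_add_right map_times_add mult.assoc)
  then show ?case using add by (simp add: ma_mult_add_left map_times_add)
qed simp

lemma ma_mult_smult_right: "ma_mult f (Poly_Mapping.map ((*) c) g) = Poly_Mapping.map ((*) c) (ma_mult f g)"
proof (induction g rule: poly_mapping_single_induct)
  case (add g x a)
  have "ma_mult f (Poly_Mapping.single x (c * a)) = Poly_Mapping.map ((*) c) (ma_mult f (Poly_Mapping.single x a))"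
    by (induction f rule: poly_mapping_single_induct) (auto simp: ma_mult_add_left map_times_add mult.left_commute)
  then show ?case using add by (simp add: ma_mult_add_right map_times_add)
qed simp

end

lemma ma_mult_closed:
  assumes "monoid M" "Poly_Mapping.keys f \<subseteq> carrier M" "Poly_Mapping.keys g \<subseteq> carrier M"
  shows "Poly_Mapping.keys (ma_mult M f g) \<subseteq> carrier M"
  using assms(2)
proof (induction f rule: keys_subset_induct)
  case (add f x a)
  have "Poly_Mapping.keys (ma_mult M (Poly_Mapping.single x a) g) \<subseteq> carrier M"
    using assms(3)
  proof (induction g rule: keys_subset_induct)
    case (add g y b)
    then show ?case using \<open>x \<in> carrier M\<close> assms(1)
      by (simp add: ma_mult_add_right keys_add_subset monoid.m_closed)
  qed simp
  then show ?case using add by (simp add: ma_mult_add_left keys_add_subset)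
qed simp

lemma ma_mult_assoc:
  assumes M: "monoid M" and "Poly_Mapping.keys f \<subseteq> carrier M" "Poly_Mapping.keys g \<subseteq> carrier M"
    "Poly_Mapping.keys h \<subseteq> carrier M"
  shows "ma_mult M (ma_mult M f g) h = ma_mult M f (ma_mult M g h)"
  using assms(2)
proof (induction f rule: keys_subset_induct)
  case (add f x a)
  have "ma_mult M (ma_mult M (Poly_Mapping.single x a) g) h = ma_mult M (Poly_Mapping.single x a) (ma_mult M g h)"
    using assms(3)
  proof (induction g rule: keys_subset_induct)
    case (add g y b)
    have "ma_mult M (ma_mult M (Poly_Mapping.single x a) (Poly_Mapping.single y b)) h
        = ma_mult M (Poly_Mapping.single x a) (ma_mult M (Poly_Mapping.single y b) h)"
      using assms(4)
    proof (induction h rule: keys_subset_induct)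
      case (add h z c)
      then show ?case
        using monoid.m_assoc[OF M \<open>x \<in> carrier M\<close> \<open>y \<in> carrier M\<close> add(3)]
        by (simp add: ma_mult_add_right mult.assoc)
    qed simp
    then show ?case using add by (simp add: ma_mult_add_left ma_mult_add_right)
  qed simp
  then show ?case using add by (simp add: ma_mult_add_left)
qed simp

lemma ma_mult_one:
  assumes M: "monoid M" and "Poly_Mapping.keys f \<subseteq> carrier M"
  shows "ma_mult M (Poly_Mapping.single \<one>\<^bsub>M\<^esub> 1) f = f" "ma_mult M f (Poly_Mapping.single \<one>\<^bsub>M\<^esub> 1) = f"
  using assms(2) by (induction f rule: keys_subset_induct)
    (auto simp: ma_mult_add_left ma_mult_add_right monoid.l_one[OF M] monoid.r_one[OF M])

lemma ring_monoid_algebra: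
  assumes M: "monoid M"
  shows "ring (monoid_algebra M :: ('k::field, _) module)"
proof (rule ringI)
  show "abelian_group (monoid_algebra M :: ('k, _) module)"
  proof (rule abelian_groupI)
    fix x :: "_ \<Rightarrow>\<^sub>0 'k" assume "x \<in> carrier (monoid_algebra M)"
    then show "\<exists>y\<in>carrier (monoid_algebra M). y \<oplus>\<^bsub>monoid_algebra M\<^esub> x = \<zero>\<^bsub>monoid_algebra M\<^esub>"
      by (intro bexI[of _ "- x"]) (auto simp: in_keys_iff)
  qed (auto intro: keys_add_subset[THEN subsetD] simp: add_ac)
  show "Group.monoid (monoid_algebra M :: ('k, _) module)"
    using M by (intro monoidI) (auto simp: ma_mult_assoc ma_mult_one intro: ma_mult_closed[THEN subsetD] split: if_splits)
qed (auto simp: ma_mult_add_left ma_mult_add_right)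

section \<open>Presented monoids as quotients of free monoids\<close>

context
  fixes X :: "'x set" and R :: "('x list \<times> 'x list) set"
begin

abbreviation pcls :: "'x list \<Rightarrow> 'x list set" where
  "pcls u \<equiv> presentation_cong X R `` {u}"

lemma presentation_cong_lists: "(u, v) \<in> presentation_cong X R \<Longrightarrow> u \<in> lists X \<and> v \<in> lists X"
  by (induction rule: presentation_cong.induct) auto

lemma equiv_presentation_cong: "equiv (lists X) (presentation_cong X R)"
proof (rule equivI)
  show "presentation_cong X R \<subseteq> lists X \<times> lists X" using presentation_cong_lists by auto
  show "refl_on (lists X) (presentation_cong X R)"
    using presentation_cong_lists by (auto simp: refl_on_def intro: presentation_cong.refl)
  show "sym (presentation_cong X R)" by (auto simp: sym_def intro: presentation_cong.sym)
  show "trans (presentation_cong X R)" by (auto simp: trans_def intro: presentation_cong.trans)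
qed

lemma pcls_eq_iff: "u \<in> lists X \<Longrightarrow> v \<in> lists X \<Longrightarrow> pcls u = pcls v \<longleftrightarrow> (u, v) \<in> presentation_cong X R"
  by (rule eq_equiv_class_iff[OF equiv_presentation_cong])

lemma pcls_self: "u \<in> lists X \<Longrightarrow> u \<in> pcls u"
  by (auto intro: presentation_cong.refl)

text \<open>Needed for sets that are not saturated: the products of the members of two classes, and
  a class of words over fewer generators.\<close>

lemma pcls_Image: "A \<noteq> {} \<Longrightarrow> A \<subseteq> pcls u \<Longrightarrow> presentation_cong X R `` A = pcls u"
proof -
  assume A: "A \<noteq> {}" "A \<subseteq> pcls u"
  then obtain x where x: "x \<in> A" "(x, u) \<in> presentation_cong X R" by (auto intro: presentation_cong.sym)
  show ?thesis
  proof
    show "presentation_cong X R `` A \<subseteq> pcls u"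
      using A(2) by (auto intro: presentation_cong.trans)
    show "pcls u \<subseteq> presentation_cong X R `` A"
      using x by (auto intro: presentation_cong.trans)
  qed
qed

lemma presented_monoid_mult:
  assumes "u \<in> lists X" "v \<in> lists X"
  shows "pcls u \<otimes>\<^bsub>presented_monoid X R\<^esub> pcls v = pcls (u @ v)"
proof -
  have "pcls u \<otimes>\<^bsub>presented_monoid X R\<^esub> pcls v
      = presentation_cong X R `` {u' @ v' | u' v'. u' \<in> pcls u \<and> v' \<in> pcls v}"
    by (simp add: presented_monoid_def)
  also have "\<dots> = pcls (u @ v)"
    using pcls_self[OF assms(1)] pcls_self[OF assms(2)]
    by (intro pcls_Image) (auto intro: presentation_cong.append)
  finally show ?thesis .
qed

lemma presented_monoid_carrier: "carrier (presented_monoid X R) = pcls ` lists X"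
  by (auto simp: presented_monoid_def quotient_def)

lemma presented_monoid_one: "\<one>\<^bsub>presented_monoid X R\<^esub> = pcls []"
  by (simp add: presented_monoid_def)

lemma monoid_presented_monoid: "Group.monoid (presented_monoid X R)"
proof (rule monoidI)
  show "\<one>\<^bsub>presented_monoid X R\<^esub> \<in> carrier (presented_monoid X R)"
    unfolding presented_monoid_carrier presented_monoid_one by (rule imageI) simp
next
  fix x y z
  assume "x \<in> carrier (presented_monoid X R)" "y \<in> carrier (presented_monoid X R)" "z \<in> carrier (presented_monoid X R)"
  then obtain u v w where *: "u \<in> lists X" "v \<in> lists X" "w \<in> lists X" "x = pcls u" "y = pcls v" "z = pcls w"
    unfolding presented_monoid_carrier by blast
  then show "x \<otimes>\<^bsub>presented_monoid X R\<^esub> y \<otimes>\<^bsub>presented_monoid X R\<^esub> z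
      = x \<otimes>\<^bsub>presented_monoid X R\<^esub> (y \<otimes>\<^bsub>presented_monoid X R\<^esub> z)"
    by (simp add: presented_monoid_mult)
next
  fix x y assume "x \<in> carrier (presented_monoid X R)" "y \<in> carrier (presented_monoid X R)"
  then obtain u v where "u \<in> lists X" "v \<in> lists X" "x = pcls u" "y = pcls v"
    unfolding presented_monoid_carrier by blast
  then show "x \<otimes>\<^bsub>presented_monoid X R\<^esub> y \<in> carrier (presented_monoid X R)"
    unfolding presented_monoid_carrier by (simp add: presented_monoid_mult)
next
  fix x assume "x \<in> carrier (presented_monoid X R)"
  then obtain u where "u \<in> lists X" "x = pcls u" unfolding presented_monoid_carrier by blast
  then show "\<one>\<^bsub>presented_monoid X R\<^esub> \<otimes>\<^bsub>presented_monoid X R\<^esub> x = x"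
    "x \<otimes>\<^bsub>presented_monoid X R\<^esub> \<one>\<^bsub>presented_monoid X R\<^esub> = x"
    by (simp_all add: presented_monoid_one presented_monoid_mult)
qed

end

section \<open>Ideals along a surjection from a type-level ring\<close>

text \<open>Ideals of \<open>B\<close> are studied through their preimages under \<open>h\<close>,
  which are the ideals containing the kernel; maximality passes in both directions. Algebras covered
  by the same free algebra thereby become comparable.\<close>

locale onto_hom = ring B for h :: "'a::ring_1 \<Rightarrow> 'b" and B :: "('b, 'm) ring_scheme" (structure) +
  assumes h_closed: "h x \<in> carrier B" and h_add: "h (x + y) = h x \<oplus> h y"
    and h_mult: "h (x * y) = h x \<otimes> h y" and h_one: "h 1 = \<one>"
    and h_onto: "b \<in> carrier B \<Longrightarrow> \<exists>x. h x = b"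
begin

lemma h_zero: "h 0 = \<zero>"
  using h_add[of 0 0] h_closed[of 0] by simp

lemma h_uminus: "h (- x) = \<ominus> h x"
  using h_add[of x "- x"] h_closed h_zero by (metis add.right_inverse minus_equality add.inv_unique' h_closed a_comm)

lemma h_diff_zero: "h x = h y \<longleftrightarrow> h (x - y) = \<zero>"
proof -
  have "h x = h (x - y) \<oplus> h y" by (simp flip: h_add)
  then show ?thesis using h_closed by (metis add.l_cancel_one' r_zero a_comm)
qed

lemma two_ideal_vimage:
  assumes "ideal J B"
  shows "two_ideal (h -` J)"
proof -
  interpret J: ideal J B by (rule assms)
  show ?thesis
    by (auto simp: two_ideal_def h_zero h_add h_mult J.I_l_closed J.I_r_closed h_closed
        J.additive_subgroup_axioms additive_subgroup.zero_closed additive_subgroup.a_closed)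
qed

lemma ker_vimage: "ideal J B \<Longrightarrow> h x = \<zero> \<Longrightarrow> x \<in> h -` J"
  by (simp add: ideal.axioms(1) additive_subgroup.zero_closed)

lemma image_vimage: "ideal J B \<Longrightarrow> h ` (h -` J) = J"
  using h_onto ideal.Icarr[of J B] by blast

lemma vimage_image:
  assumes "two_ideal I" "\<And>x. h x = \<zero> \<Longrightarrow> x \<in> I"
  shows "h -` (h ` I) = I"
proof
  show "h -` (h ` I) \<subseteq> I"
  proof
    fix x assume "x \<in> h -` (h ` I)"
    then obtain y where "y \<in> I" "h x = h y" by auto
    then show "x \<in> I" using assms(2)[of "x - y"] h_diff_zero two_ideal_cong[OF assms(1)] by blast
  qed
qed auto

lemma ideal_image:
  assumes I: "two_ideal I"
  shows "ideal (h ` I) B"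
proof (rule idealI)
  show "subgroup (h ` I) (add_monoid B)"
  proof (rule group.subgroupI)
    show "group (add_monoid B)" by (rule a_group)
    show "h ` I \<subseteq> carrier (add_monoid B)" using h_closed by auto
    show "h ` I \<noteq> {}" using two_ideal_0[OF I] by auto
    fix a assume "a \<in> h ` I"
    then obtain x where x: "x \<in> I" "a = h x" by auto
    then have "\<ominus> a = h (- x)" by (simp add: h_uminus)
    then show "inv\<^bsub>add_monoid B\<^esub> a \<in> h ` I"
      using two_ideal_uminus[OF I x(1)] by (simp add: a_inv_def)
  next
    fix a b assume "a \<in> h ` I" "b \<in> h ` I"
    then show "a \<otimes>\<^bsub>add_monoid B\<^esub> b \<in> h ` I"
      using two_ideal_add[OF I] h_add by (force simp flip: h_add)
  qed
  fix a x assume "a \<in> h ` I" "x \<in> carrier B"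
  then obtain a' x' where "a' \<in> I" "a = h a'" "x = h x'" using h_onto by blast
  then show "x \<otimes> a \<in> h ` I" "a \<otimes> x \<in> h ` I"
    using two_ideal_l[OF I] two_ideal_r[OF I] by (auto simp flip: h_mult)
qed (rule ring_axioms)

lemma maximal_vimage:
  assumes "maximalideal J B"
  shows "maximal_two_ideal (h -` J)"
  unfolding maximal_two_ideal_def
proof (intro conjI allI impI)
  interpret J: maximalideal J B by (rule assms)
  show "two_ideal (h -` J)" by (rule two_ideal_vimage[OF J.ideal_axioms])
  show "1 \<notin> h -` J" using J.I_notcarr J.one_imp_carrier h_one by auto
  fix L assume L: "two_ideal L" "h -` J \<subseteq> L" "1 \<notin> L"
  have ker: "x \<in> L" if "h x = \<zero>" for x using ker_vimage[OF J.ideal_axioms that] L(2) by blast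
  have "J \<subseteq> h ` L" using image_vimage[OF J.ideal_axioms] L(2) by blast
  moreover have "h ` L \<subseteq> carrier B" using h_closed by auto
  ultimately have "h ` L = J \<or> h ` L = carrier B"
    using J.I_maximal[OF ideal_image[OF L(1)]] by blast
  moreover have "h ` L \<noteq> carrier B"
  proof
    assume "h ` L = carrier B"
    then have "h 1 \<in> h ` L" using h_closed by auto
    then have "1 \<in> h -` (h ` L)" by simp
    then show False using vimage_image[OF L(1) ker] L(3) by simp
  qed
  ultimately show "L = h -` J" using vimage_image[OF L(1) ker] by blast
qed

lemma maximal_image:
  assumes I: "maximal_two_ideal I" and ker: "\<And>x. h x = \<zero> \<Longrightarrow> x \<in> I"
  shows "maximalideal (h ` I) B"
proof (rule maximalidealI)
  note tI = maximal_two_idealD(1)[OF I]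
  note vi = vimage_image[OF tI ker]
  show "ideal (h ` I) B" by (rule ideal_image[OF tI])
  show "carrier B \<noteq> h ` I"
  proof
    assume "carrier B = h ` I"
    then have "1 \<in> h -` (h ` I)" using h_closed by auto
    then show False using vi maximal_two_idealD(2)[OF I] by simp
  qed
  fix J assume J: "ideal J B" "h ` I \<subseteq> J" "J \<subseteq> carrier B"
  have sub: "I \<subseteq> h -` J" using J(2) by auto
  show "J = h ` I \<or> J = carrier B"
  proof (cases "1 \<in> h -` J")
    case True
    then show ?thesis using h_one ideal.one_imp_carrier[OF J(1)] by auto
  next
    case False
    then have "h -` J = I"
      using I two_ideal_vimage[OF J(1)] sub unfolding maximal_two_ideal_def by blast
    then show ?thesis using image_vimage[OF J(1)] by auto
  qed
qed

end

section \<open>Hecke--Kiselman algebras\<close>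

definition hk_class :: "'v pair_pre_digraph \<Rightarrow> 'v list \<Rightarrow> 'v list set" where
  "hk_class G w = presentation_cong (pverts G) (hk_relations G) `` {filter (\<lambda>x. x \<in> pverts G) w}"

text \<open>Letters that are not vertices of \<open>G\<close> are sent to \<open>1\<close>, which makes the free algebra on
  the whole type \<open>'v\<close> map onto every \<open>K[HK\<^sub>G]\<close>.\<close>

definition hk_eval :: "'v pair_pre_digraph \<Rightarrow> ('v list \<Rightarrow>\<^sub>0 'k::field) \<Rightarrow> ('v list set \<Rightarrow>\<^sub>0 'k)" where
  "hk_eval G = push (hk_class G)"

lemma filter_lists [simp]: "filter (\<lambda>x. x \<in> X) w \<in> lists X"
  by auto

lemma hk_class_eq_iff: "hk_class G u = hk_class G v \<longleftrightarrow>
    (filter (\<lambda>x. x \<in> pverts G) u, filter (\<lambda>x. x \<in> pverts G) v) \<in> presentation_cong (pverts G) (hk_relations G)"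
  unfolding hk_class_def by (rule pcls_eq_iff) auto

lemma hk_monoid_mult: "hk_class G u \<otimes>\<^bsub>hk_monoid G\<^esub> hk_class G v = hk_class G (u @ v)"
  unfolding hk_class_def hk_monoid_def by (subst presented_monoid_mult) auto

lemma hk_monoid_one: "\<one>\<^bsub>hk_monoid G\<^esub> = hk_class G []"
  by (simp add: hk_class_def hk_monoid_def presented_monoid_one)

lemma hk_monoid_carrier: "carrier (hk_monoid G) = range (hk_class G)"
proof -
  have "hk_class G w = presentation_cong (pverts G) (hk_relations G) `` {w}" if "w \<in> lists (pverts G)" for w
    using that by (auto simp: hk_class_def filter_id_conv[THEN iffD2] in_lists_conv_set)
  then show ?thesis
    unfolding hk_monoid_def presented_monoid_carrier
    by (auto simp: hk_class_def image_iff)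
qed

lemma monoid_hk: "Group.monoid (hk_monoid G)"
  unfolding hk_monoid_def by (rule monoid_presented_monoid)

lemma hk_eval_simps [simp]:
  "hk_eval G (Poly_Mapping.single w c) = Poly_Mapping.single (hk_class G w) c"
  "hk_eval G 0 = 0"
  by (simp_all add: hk_eval_def)

lemma hk_eval_add: "hk_eval G (x + y) = hk_eval G x + hk_eval G y"
  and hk_eval_diff: "hk_eval G (x - y) = hk_eval G x - hk_eval G y"
  by (simp_all add: hk_eval_def push_add push_diff)

lemma hk_eval_mult: "hk_eval G (x * y) = hk_eval G x \<otimes>\<^bsub>hk_algebra K G\<^esub> hk_eval G y"
proof (induction x rule: poly_mapping_single_induct)
  case (add x u a)
  have "hk_eval G (Poly_Mapping.single u a * y) = hk_eval G (Poly_Mapping.single u a) \<otimes>\<^bsub>hk_algebra K G\<^esub> hk_eval G y"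
    by (induction y rule: poly_mapping_single_induct)
      (auto simp: distrib_left hk_eval_add hk_algebra_def ma_mult_add_right single_times hk_monoid_mult)
  then show ?case using add by (simp add: hk_algebra_def hk_eval_add distrib_right ma_mult_add_left)
qed (simp add: hk_algebra_def)

lemma hk_eval_cst: "hk_eval G (cst c * x) = Poly_Mapping.map ((*) c) (hk_eval G x)"
  by (induction x rule: poly_mapping_single_induct)
    (auto simp: distrib_left hk_eval_add map_times_add single_times)

lemma onto_hk_eval: "onto_hom (hk_eval G) (hk_algebra K G)"
proof -
  interpret ring "hk_algebra K G"
    unfolding hk_algebra_def by (rule ring_monoid_algebra[OF monoid_hk])
  show ?thesis
  proof unfold_locales
    fix b assume "b \<in> carrier (hk_algebra K G)"
    then have "Poly_Mapping.keys b \<subseteq> range (hk_class G)"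
      by (simp add: hk_algebra_def hk_monoid_carrier)
    then show "\<exists>x. hk_eval G x = b"
    proof (induction b rule: keys_subset_induct)
      case zero
      show ?case by (intro exI[of _ 0]) simp
    next
      case (add b k v)
      then obtain x w where "hk_eval G x = b" "k = hk_class G w" by blast
      then show ?case by (intro exI[of _ "x + Poly_Mapping.single w v"]) (simp add: hk_eval_add)
    qed
  next
    show "hk_eval G 1 = \<one>\<^bsub>hk_algebra K G\<^esub>"
      by (simp add: hk_algebra_def hk_monoid_one flip: wrd_Nil)
  next
    show "hk_eval G x \<in> carrier (hk_algebra K G)" for x
      using push_keys[of "hk_class G" x] by (auto simp: hk_algebra_def hk_monoid_carrier hk_eval_def)
  qed (auto simp: hk_eval_mult[of _ _ _ K] hk_eval_add, simp_all add: hk_algebra_def)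
qed

text \<open>The universal property of the presentation in terms of ideals: the kernel of
  \<open>hk_eval\<close> is generated by the defining relations together with \<open>x - 1\<close>
  for all letters \<open>x\<close> that are not vertices. Below it replaces the construction of
  homomorphisms, an ideal \<open>I\<close> playing the role of the kernel of the desired
  map.\<close>

lemma hk_eval_kernel:
  assumes I: "two_ideal I"
    and rel: "\<And>u v. (u, v) \<in> hk_relations G \<Longrightarrow> wrd u - wrd v \<in> I"
    and out: "\<And>x. x \<notin> pverts G \<Longrightarrow> wrd [x] - 1 \<in> I"
    and x: "hk_eval G x = 0"
  shows "x \<in> I"
proof -
  have cong: "wrd u - wrd v \<in> I" if "(u, v) \<in> presentation_cong (pverts G) (hk_relations G)" for u v
    using that
  proof induction
    case (append u v u' v')
    then show ?case using two_ideal_mult[OF I, of "wrd u" "wrd v" "wrd u'" "wrd v'"] by (simp add: single_times)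
  next
    case (base u v)
    then show ?case by (intro rel)
  next
    case (refl u)
    then show ?case by (simp add: two_ideal_0[OF I])
  next
    case (sym u v)
    show ?case by (rule two_ideal_sym[OF I sym.IH])
  next
    case (trans u v w)
    show ?case by (rule two_ideal_trans[OF I trans.IH])
  qed
  have filt: "wrd w - wrd (filter (\<lambda>x. x \<in> pverts G) w) \<in> I" for w
  proof (induction w)
    case Nil
    then show ?case by (simp add: two_ideal_0[OF I])
  next
    case (Cons a w)
    show ?case
    proof (cases "a \<in> pverts G")
      case True
      then show ?thesis
        using two_ideal_mult[OF I _ Cons, of "wrd [a]" "wrd [a]"] by (simp add: single_times two_ideal_0[OF I])
    next
      case False
      then show ?thesis using two_ideal_mult[OF I out[OF False] Cons] by (simp add: single_times)
    qed
  qed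
  \<comment> \<open>A choice of representatives. Modulo \<open>I\<close> each element is congruent
    to the same combination of representatives, which is zero if \<open>hk_eval\<close>
    vanishes.\<close>
  define r where "r X = (SOME w. hk_class G w = X)" for X
  have r: "hk_class G (r (hk_class G w)) = hk_class G w" for w
    unfolding r_def by (rule someI[where x = w]) simp
  have "wrd w - wrd (r (hk_class G w)) \<in> I" for w
    using two_ideal_trans[OF I filt two_ideal_trans[OF I cong two_ideal_sym[OF I filt]]] r[of w]
    by (metis hk_class_eq_iff)
  then have "Poly_Mapping.single w c - Poly_Mapping.single (r (hk_class G w)) c \<in> I" for w c
    by (rule two_ideal_single[OF I])
  then have "y - push r (hk_eval G y) \<in> I" for y
    by (induction y rule: poly_mapping_single_induct)
      (auto simp: two_ideal_0[OF I] hk_eval_add push_add intro: two_ideal_plus[OF I])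
  from this[of x] x show ?thesis by simp
qed

lemma hk_relations_class:
  assumes "(u, v) \<in> hk_relations G" "pair_wf_digraph G"
  shows "hk_class G u = hk_class G v"
proof -
  have "u \<in> lists (pverts G)" "v \<in> lists (pverts G)"
    using assms pair_wf_digraph.in_arcsD1[OF assms(2)] pair_wf_digraph.in_arcsD2[OF assms(2)]
    by (auto simp: hk_relations_def)
  then show ?thesis
    using presentation_cong.base[OF assms(1)]
    by (simp add: hk_class_eq_iff filter_id_conv[THEN iffD2] in_lists_conv_set)
qed

lemma hk_class_append: "hk_class G u = hk_class G v \<Longrightarrow> hk_class G u' = hk_class G v' \<Longrightarrow>
    hk_class G (u @ u') = hk_class G (v @ v')"
  by (simp flip: hk_monoid_mult)

lemma hk_class_outside: "x \<notin> pverts G \<Longrightarrow> hk_class G [x] = hk_class G []"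
  by (simp add: hk_class_def)

lemma hk_cong_class:
  assumes "pair_wf_digraph G"
  shows "hk_cong (parcs G) (\<lambda>u v. hk_class G u = hk_class G v)"
proof
  note rel = hk_relations_class[OF _ assms]
  show "hk_class G [i, i] = hk_class G [i]" for i
  proof (cases "i \<in> pverts G")
    case True
    then show ?thesis by (intro rel) (auto simp: hk_relations_def)
  qed (simp add: hk_class_def)
  show "hk_class G [i, j] = hk_class G [j, i]" if "(i, j) \<notin> parcs G" "(j, i) \<notin> parcs G" for i j
  proof (cases "i \<in> pverts G \<and> j \<in> pverts G")
    case True
    then show ?thesis using that by (intro rel) (auto simp: hk_relations_def)
  qed (auto simp: hk_class_def)
  show "hk_class G [i, j, i] = hk_class G [i, j]" "hk_class G [j, i, j] = hk_class G [i, j]"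
    if "(i, j) \<in> parcs G" for i j
    using that by (auto intro!: rel simp: hk_relations_def)
  show "hk_class G (u @ u') = hk_class G (v @ v')"
    if "hk_class G u = hk_class G v" "hk_class G u' = hk_class G v'" for u v u' v'
    by (rule hk_class_append[OF that])
qed simp_all

section \<open>Consequences of the polynomial identity\<close>

lemma finsum_monoid_algebra:
  assumes M: "Group.monoid M" and F: "\<And>x. x \<in> S \<Longrightarrow> Poly_Mapping.keys (F x) \<subseteq> carrier M"
  shows "finsum (monoid_algebra M) F S = sum F S"
proof -
  interpret ring "monoid_algebra M :: ('k::field, _) module" by (rule ring_monoid_algebra[OF M])
  show ?thesis
    using F by (induction S rule: infinite_finite_induct) (auto simp: Pi_def)
qed

lemma lin_ext_monoid_algebra:
  assumes M: "Group.monoid M" and h: "\<And>x. x \<in> Poly_Mapping.keys f \<Longrightarrow> Poly_Mapping.keys (h x) \<subseteq> carrier M"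
  shows "lin_ext (monoid_algebra M) h f
    = (\<Sum>x\<in>Poly_Mapping.keys f. Poly_Mapping.map ((*) (Poly_Mapping.lookup f x)) (h x))"
  unfolding lin_ext_def monoid_algebra_simps
  by (rule finsum_monoid_algebra[OF M]) (rule order_trans[OF keys_map_times h])

lemma push_inj_eq_0:
  assumes "inj h" "push h f = (0 :: 'y \<Rightarrow>\<^sub>0 'k::ab_group_add)"
  shows "f = 0"
proof (rule poly_mapping_eqI)
  fix x
  have "Poly_Mapping.lookup (push h f) (h x) = (\<Sum>y\<in>Poly_Mapping.keys f. if y = x then Poly_Mapping.lookup f y else 0)"
    unfolding push_def lookup_sum using assms(1)
    by (intro sum.cong) (auto simp: lookup_single when_def inj_eq)
  also have "\<dots> = Poly_Mapping.lookup f x" by (auto simp: in_keys_iff)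
  finally show "Poly_Mapping.lookup f x = Poly_Mapping.lookup 0 x" using assms(2) by simp
qed

text \<open>Substituting the classes of the words \<open>g n\<close> into an identity
  \<open>f\<close> gives the image of \<open>f\<close> under the linear map induced by an injection
  of bases, so \<open>f\<close> would be 0.\<close>

lemma not_PI_free_words:
  fixes G :: "'v pair_pre_digraph" and K :: "'k::field itself" and g :: "nat \<Rightarrow> 'v list"
  assumes PI: "PI_algebra (hk_algebra K G)" and inj: "inj (\<lambda>ns. hk_class G (concat (map g ns)))"
  shows False
proof -
  interpret A: onto_hom "hk_eval G" "hk_algebra K G" by (rule onto_hk_eval)
  obtain f :: "nat list \<Rightarrow>\<^sub>0 'k" where f: "f \<noteq> 0"
    and van: "\<And>a. range a \<subseteq> carrier (hk_algebra K G) \<Longrightarrow>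
      lin_ext (hk_algebra K G) (\<lambda>w. list_product (hk_algebra K G) (map a w)) f = \<zero>\<^bsub>hk_algebra K G\<^esub>"
    using PI unfolding PI_algebra_def by blast
  define a where "a n = hk_eval G (wrd (g n) :: 'v list \<Rightarrow>\<^sub>0 'k)" for n
  have prod: "list_product (hk_algebra K G) (map a ns) = hk_eval G (wrd (concat (map g ns)))" for ns
  proof (induction ns)
    case Nil
    show ?case using A.h_one by (simp add: list_product_def wrd_Nil del: hk_eval_simps)
  next
    case (Cons n ns)
    have "list_product (hk_algebra K G) (map a (n # ns)) = a n \<otimes>\<^bsub>hk_algebra K G\<^esub> list_product (hk_algebra K G) (map a ns)"
      by (simp add: list_product_def)
    also have "\<dots> = hk_eval G (wrd (g n) * wrd (concat (map g ns)))"
      unfolding Cons a_def by (rule A.h_mult[symmetric])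
    finally show ?case by (simp add: single_times)
  qed
  have "lin_ext (hk_algebra K G) (\<lambda>w. list_product (hk_algebra K G) (map a w)) f
      = push (\<lambda>ns. hk_class G (concat (map g ns))) f"
    unfolding prod unfolding hk_algebra_def
    by (subst lin_ext_monoid_algebra[OF monoid_hk]) (auto simp: hk_monoid_carrier push_def)
  moreover have "range a \<subseteq> carrier (hk_algebra K G)" unfolding a_def using A.h_closed by blast
  ultimately have "push (\<lambda>ns. hk_class G (concat (map g ns))) f = 0"
    using van[of a] by (simp add: hk_algebra_def)
  then show False using push_inj_eq_0[OF inj] f by blast
qed

text \<open>A vertex outside \<open>U\<close> acts trivially, and a vertex of \<open>U\<close> updates its own state from the
  states of its out-neighbours.\<close>

locale update_system =
  fixes G :: "'v pair_pre_digraph" and U :: "'v set" and F :: "'v \<Rightarrow> ('v \<Rightarrow> 's) \<Rightarrow> 's"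
  assumes og: "oriented_graph G"
    and local_dep: "i \<in> U \<Longrightarrow> (i, j) \<notin> parcs G \<Longrightarrow> F i (s(j := c)) = F i s"
begin

definition act :: "'v \<Rightarrow> ('v \<Rightarrow> 's) \<Rightarrow> ('v \<Rightarrow> 's)" where
  "act i s = (if i \<in> U then s(i := F i s) else s)"

lemma no_loop: "(i, i) \<notin> parcs G" and no_anti: "(i, j) \<in> parcs G \<Longrightarrow> (j, i) \<notin> parcs G"
proof -
  interpret oriented_graph G by (rule og)
  show "(i, i) \<notin> parcs G" using pair_no_loops by fastforce
  show "(i, j) \<in> parcs G \<Longrightarrow> (j, i) \<notin> parcs G" by (rule antiparallel_free)
qed

lemma act_comm: "(i, j) \<notin> parcs G \<Longrightarrow> (j, i) \<notin> parcs G \<Longrightarrow> act i (act j s) = act j (act i s)"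
  by (cases "i = j") (auto simp: act_def local_dep fun_upd_twist)

lemma act_idem: "act i (act i s) = act i s"
  using no_loop[of i] by (auto simp: act_def local_dep)

text \<open>Words act from the right. Neither the update of \<open>j\<close> nor that of
  \<open>i\<close> reads the state of \<open>i\<close>: so an earlier update of \<open>i\<close> is
  overwritten without trace, and a second update of \<open>j\<close> reproduces the value of the
  first.\<close>

lemma act_arc:
  assumes "(i, j) \<in> parcs G"
  shows "act i (act j (act i s)) = act i (act j s)" "act j (act i (act j s)) = act i (act j s)"
proof -
  have ij: "(j, i) \<notin> parcs G" "i \<noteq> j" "(i, i) \<notin> parcs G" "(j, j) \<notin> parcs G"
    using assms no_anti no_loop by auto
  define s1 where "s1 = act j s"
  have s1_i: "act j (s(i := c)) = s1(i := c)" for c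
    using ij local_dep by (auto simp: s1_def act_def fun_upd_twist)
  have "act i (s1(i := c)) = act i s1" if "i \<in> U" for c
    using ij that local_dep by (simp add: act_def)
  then show "act i (act j (act i s)) = act i (act j s)"
    unfolding s1_def[symmetric] using s1_i by (cases "i \<in> U") (auto simp: act_def[of i s] s1_def)
  have "act j (s1(i := c)) = s1(i := c)" for c
  proof (cases "j \<in> U")
    case True
    then have "F j (s1(i := c)) = F j s" using ij local_dep by (simp add: s1_def act_def)
    then show ?thesis using True ij(2) by (auto simp: act_def s1_def fun_upd_twist)
  qed (simp add: act_def)
  moreover have "act j s1 = s1" by (simp add: s1_def act_idem)
  ultimately show "act j (act i (act j s)) = act i (act j s)"
    unfolding s1_def[symmetric] by (simp add: act_def[of i s1])
qed

lemma foldr_act_cong: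
  assumes "(u, v) \<in> presentation_cong (pverts G) (hk_relations G)"
  shows "foldr act u s = foldr act v s"
  using assms
proof (induction arbitrary: s)
  case (base u v)
  then show ?case by (auto simp: hk_relations_def act_idem act_arc act_comm)
qed auto

lemma foldr_act_class:
  assumes "hk_class G u = hk_class G v" "set u \<subseteq> pverts G" "set v \<subseteq> pverts G"
  shows "foldr act u s = foldr act v s"
  using assms foldr_act_cong[of u v] by (simp add: hk_class_eq_iff filter_id_conv[THEN iffD2] subset_iff)

end

text \<open>It suffices to separate the products of the words \<open>g n\<close> by their effect on
  a single state.\<close>

lemma not_PI_action:
  fixes G :: "'v pair_pre_digraph" and K :: "'k::field itself" and g :: "nat \<Rightarrow> 'v list"
  assumes "update_system G U F" and PI: "PI_algebra (hk_algebra K G)" and g: "\<And>n. set (g n) \<subseteq> pverts G"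
    and inj: "\<And>ns ms. foldr (update_system.act U F) (concat (map g ns)) ini = foldr (update_system.act U F) (concat (map g ms)) ini \<Longrightarrow> ns = ms"
  shows False
proof (rule not_PI_free_words[OF PI, of g], rule injI, rule inj)
  fix ns ms assume "hk_class G (concat (map g ns)) = hk_class G (concat (map g ms))"
  then show "foldr (update_system.act U F) (concat (map g ns)) ini = foldr (update_system.act U F) (concat (map g ms)) ini"
    by (rule update_system.foldr_act_class[OF assms(1)]) (use g in auto)
qed

text \<open>The vertex \<open>u\<close> lies on a cycle through \<open>a\<close> and on one through \<open>b\<close>. The state of \<open>u\<close> is copied
  back to \<open>a\<close> and \<open>b\<close> along shortest paths, and \<open>u\<close> combines the two copies; refreshing both
  and then \<open>n\<close> times only \<open>b\<close> turns the state \<open>l\<close> of \<open>u\<close> into \<open>n # l\<close>.\<close>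

lemma PI_out_degree_aux:
  fixes G :: "'v pair_pre_digraph" and K :: "'k::field itself"
  assumes og: "oriented_graph G" and PI: "PI_algebra (hk_algebra K G)"
    and arcs: "(u, a) \<in> parcs G" "(u, b) \<in> parcs G" and ab: "a \<noteq> b"
    and ra: "(a, u) \<in> (parcs G) ^^ k" "\<And>i. (a, u) \<in> (parcs G) ^^ i \<Longrightarrow> k \<le> i"
    and rb: "(b, u) \<in> (parcs G) ^^ l" "\<And>i. (b, u) \<in> (parcs G) ^^ i \<Longrightarrow> l \<le> i"
    and lk: "l \<le> k"
  shows False
proof -
  interpret oriented_graph G by (rule og)
  define E where "E = parcs G"
  \<comment> \<open>\<open>\<delta>\<close> is the distance to \<open>u\<close>, and
    \<open>nxt\<close> the next vertex on a shortest path to \<open>u\<close>. Vertices that do not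
    reach \<open>u\<close> are inert.\<close>
  define U where "U = {v. (v, u) \<in> E\<^sup>*}"
  define \<delta> where "\<delta> v = (LEAST n. (v, u) \<in> E ^^ n)" for v
  define nxt where "nxt v = (SOME w. (v, w) \<in> E \<and> (w, u) \<in> E ^^ (\<delta> v - 1))" for v
  have \<delta>: "(v, u) \<in> E ^^ \<delta> v" if "v \<in> U" for v
    using that LeastI_ex[of "\<lambda>n. (v, u) \<in> E ^^ n"] by (auto simp: U_def \<delta>_def rtrancl_power)
  have \<delta>le: "\<delta> v \<le> n" if "(v, u) \<in> E ^^ n" for v n
    unfolding \<delta>_def using that by (rule Least_le)
  have \<delta>0: "\<delta> v = 0 \<longleftrightarrow> v = u" if "v \<in> U" for v
  proof
    assume "\<delta> v = 0"
    then show "v = u" using \<delta>[OF that] by simp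
  next
    assume "v = u"
    then show "\<delta> v = 0" using \<delta>le[of v 0] by simp
  qed
  have nxt: "(v, nxt v) \<in> E \<and> nxt v \<in> U \<and> \<delta> v = Suc (\<delta> (nxt v))" if v: "v \<in> U" "v \<noteq> u" for v
  proof -
    obtain n where n: "\<delta> v = Suc n" using \<delta>0[OF v(1)] v(2) by (cases "\<delta> v") auto
    then obtain w where "(v, w) \<in> E" "(w, u) \<in> E ^^ n"
      using \<delta>[OF v(1)] by (metis relpow_Suc_D2)
 
    then have ex: "\<exists>w. (v, w) \<in> E \<and> (w, u) \<in> E ^^ (\<delta> v - 1)" using n by auto
    have *: "(v, nxt v) \<in> E" "(nxt v, u) \<in> E ^^ n"
      using someI_ex[OF ex] n by (simp_all add: nxt_def)
    then have "nxt v \<in> U" by (auto simp: U_def relpow_imp_rtrancl)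
    moreover have "\<delta> (nxt v) = n"
    proof (rule antisym)
      show "\<delta> (nxt v) \<le> n" by (rule \<delta>le[OF *(2)])
      have "(v, u) \<in> E ^^ Suc (\<delta> (nxt v))"
        using relpow_Suc_I2[OF *(1) \<delta>[OF \<open>nxt v \<in> U\<close>]] .
      from \<delta>le[OF this] n show "n \<le> \<delta> (nxt v)" by simp
    qed
    ultimately show ?thesis using * n by simp
  qed
  \<comment> \<open>If \<open>a\<close> and \<open>b\<close> hold the same list \<open>l\<close>,
    both have just been refreshed and \<open>u\<close> becomes \<open>0 # l\<close>. If
    \<open>a\<close> holds \<open>l\<close> and \<open>b\<close> holds \<open>k # l\<close>, only
    \<open>b\<close> has been refreshed since, and \<open>u\<close> becomes
    \<open>Suc k # l\<close>.\<close>
  define F :: "'v \<Rightarrow> ('v \<Rightarrow> nat list) \<Rightarrow> nat list" where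
    "F v s = (if v = u then (if s b = s a then 0 else Suc (hd (s b))) # s a else s (nxt v))" for v s
  have sys: "update_system G U F"
  proof unfold_locales
    fix i j s c assume "i \<in> U" "(i, j) \<notin> parcs G"
    show "F i (s(j := c)) = F i s"
    proof (cases "i = u")
      case True
      then have "j \<noteq> a" "j \<noteq> b" using arcs \<open>(i, j) \<notin> parcs G\<close> by auto
      then show ?thesis using True by (simp add: F_def)
    next
      case False
      then have "j \<noteq> nxt i" using nxt[OF \<open>i \<in> U\<close> False] \<open>(i, j) \<notin> parcs G\<close> by (auto simp only: E_def)
      then show ?thesis using False by (simp add: F_def)
    qed
  qed
  interpret update_system G U F by (rule sys)
  \<comment> \<open>For \<open>n = \<delta> v\<close>, the shortest path from \<open>v\<close> to
    \<open>u\<close> without its end \<open>u\<close>. As words act from the right, it hands the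
    state of \<open>u\<close> back to \<open>v\<close>.\<close>
  define P where "P n v = map (\<lambda>i. (nxt ^^ i) v) [0..<n]" for n v
  have P_Suc: "P (Suc n) v = v # P n (nxt v)" for n v
  proof -
    have "[0..<Suc n] = 0 # map Suc [0..<n]" by (simp add: map_Suc_upt upt_conv_Cons)
    then show ?thesis by (simp add: P_def funpow_swap1 comp_def)
  qed
  have P: "foldr act (P (\<delta> v) v) s v = s u \<and> set (P (\<delta> v) v) \<subseteq> U
     \<and> (\<forall>w. w \<notin> set (P (\<delta> v) v) \<longrightarrow> foldr act (P (\<delta> v) v) s w = s w)
     \<and> (\<forall>w\<in>set (P (\<delta> v) v). w = v \<or> \<delta> w < \<delta> v) \<and> u \<notin> set (P (\<delta> v) v)" if "v \<in> U" for v s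
    using that
  proof (induction "\<delta> v" arbitrary: v)
    case 0
    then show ?case using \<delta>0 by (auto simp: P_def)
  next
    case (Suc n)
    have "v \<noteq> u" using \<delta>0[OF Suc.prems] Suc.hyps(2) by simp
    note nx = nxt[OF Suc.prems this]
    have IH: "n = \<delta> (nxt v)" "nxt v \<in> U" using Suc.hyps(2) nx by auto
    note IHs = Suc.hyps(1)[OF IH]
    have Pv: "P (\<delta> v) v = v # P (\<delta> (nxt v)) (nxt v)" using nx by (simp add: P_Suc)
    show ?case
      unfolding Pv using IHs nx \<open>v \<noteq> u\<close> Suc.prems by (auto simp: act_def F_def)
  qed
  have aU: "a \<in> U" "b \<in> U" "u \<in> U" using ra rb by (auto simp: U_def E_def relpow_imp_rtrancl)
  have \<delta>ab: "\<delta> a = k" "\<delta> b = l"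
  proof -
    show "\<delta> a = k" unfolding \<delta>_def E_def
      by (rule Least_equality[where P = "\<lambda>n. (a, u) \<in> parcs G ^^ n"]) (rule ra, assumption?)+
    show "\<delta> b = l" unfolding \<delta>_def E_def
      by (rule Least_equality[where P = "\<lambda>n. (b, u) \<in> parcs G ^^ n"]) (rule rb, assumption?)+
  qed
  \<comment> \<open>This is where \<open>l \<le> k\<close> enters: refreshing \<open>b\<close> alone
    must leave \<open>a\<close> untouched.\<close>
  have aPb: "a \<notin> set (P (\<delta> b) b)" 
  proof
    assume "a \<in> set (P (\<delta> b) b)"
    then have "a = b \<or> \<delta> a < \<delta> b" using P[OF aU(2), of "\<lambda>_. []"] by blast
    then show False using \<delta>ab lk ab by simp
  qed
  have bu: "a \<noteq> u" "b \<noteq> u" using pair_no_loops[OF arcs(1)] pair_no_loops[OF arcs(2)] by auto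
  \<comment> \<open>\<open>Bw\<close> refreshes \<open>b\<close> only, \<open>Aw\<close> refreshes
    both, and each then updates \<open>u\<close>. Acting from the right, \<open>g n\<close> performs
    \<open>Aw\<close> before the \<open>n\<close> copies of \<open>Bw\<close>.\<close>
  define Bw where "Bw = u # P (\<delta> b) b"
  define Aw where "Aw = u # P (\<delta> a) a @ P (\<delta> b) b"
  define g where "g n = concat (replicate n Bw) @ Aw" for n
  have B: "foldr act Bw s u = (if s u = s a then 0 else Suc (hd (s u))) # s a \<and> foldr act Bw s a = s a" for s
    using P[OF aU(2), of s] aPb aU(3) bu by (auto simp: Bw_def act_def F_def)
  have A: "foldr act Aw s u = 0 # s u \<and> foldr act Aw s a = s u" for s
  proof -
    define t where "t = foldr act (P (\<delta> b) b) s"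
    have t: "t b = s u" "t u = s u" using P[OF aU(2), of s] by (auto simp: t_def)
    define r where "r = foldr act (P (\<delta> a) a) t"
    have r: "r a = s u" "r u = s u" using P[OF aU(1), of t] t by (auto simp: r_def)
    \<comment> \<open>The path from \<open>a\<close> may pass through \<open>b\<close>; then
      \<open>b\<close> is written a second time, but again with the state of
      \<open>u\<close>.\<close>
    have "r b = s u"
    proof -
      have "\<forall>w\<in>set (P n v). foldr act (P n v) t w = t u" if "v \<in> U" "n = \<delta> v" for n v
        using that
      proof (induction n arbitrary: v)
        case (Suc n)
        have "v \<noteq> u" using \<delta>0[OF Suc.prems(1)] Suc.prems(2) by simp
        note nx = nxt[OF Suc.prems(1) this]
        have nU: "nxt v \<in> U" "n = \<delta> (nxt v)" using Suc.prems(2) nx by auto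
        have "act v r = r(v := r (nxt v))" for r
          using Suc.prems(1) \<open>v \<noteq> u\<close> by (simp add: act_def F_def)
        then show ?case
          using Suc.IH[OF nU] P[OF nU(1), of t] nU(2) by (simp add: P_Suc)
      qed (simp add: P_def)
      from this[OF aU(1) HOL.refl] P[OF aU(1), of t] t show ?thesis
        unfolding r_def by (cases "b \<in> set (P (\<delta> a) a)") auto
    qed
    have "foldr act Aw s = act u r" by (simp add: Aw_def r_def t_def)
    then show ?thesis using r \<open>r b = s u\<close> bu aU(3) by (simp add: act_def F_def)
  qed
  have g_eff: "foldr act (g n) s u = n # s u \<and> foldr act (g n) s a = s u" for n s
  proof (induction n)
    case 0
    show ?case using A by (simp add: g_def)
  next
    case (Suc n)
    have "g (Suc n) = Bw @ g n" by (simp add: g_def)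
    then show ?case using B[of "foldr act (g n) s"] Suc by simp
  qed
  have all: "foldr act (concat (map g ns)) s u = ns @ s u" for ns s
    by (induction ns) (auto simp: g_eff)
  have "U \<subseteq> pverts G"
  proof
    fix v assume "v \<in> U"
    then have "v = u \<or> (\<exists>w. (v, w) \<in> E)" using nxt by blast
    then show "v \<in> pverts G" using arcs in_arcsD1 by (auto simp: E_def)
  qed
  moreover have "set (P (\<delta> a) a) \<subseteq> U" "set (P (\<delta> b) b) \<subseteq> U"
    using P[OF aU(1), of "\<lambda>_. []"] P[OF aU(2), of "\<lambda>_. []"] by blast+
  ultimately have gV: "set (g n) \<subseteq> pverts G" for n
    using aU(3) by (auto simp: g_def Bw_def Aw_def)
  show False
    by (rule not_PI_action[OF sys PI, where g = g and ini = "\<lambda>_. []", OF gV]) (metis all append_Nil2)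
qed

text \<open>Of the two vertices, the one farther from \<open>u\<close> takes the role of
  \<open>a\<close> in the construction above.\<close>

lemma PI_out_degree:
  fixes G :: "'v pair_pre_digraph" and K :: "'k::field itself"
  assumes og: "oriented_graph G" and PI: "PI_algebra (hk_algebra K G)"
    and arcs: "(u, a) \<in> parcs G" "(u, b) \<in> parcs G"
    and ret: "(a, u) \<in> (parcs G)\<^sup>*" "(b, u) \<in> (parcs G)\<^sup>*"
  shows "a = b"
proof (rule ccontr)
  assume ab: "a \<noteq> b"
  define k where "k = (LEAST n. (a, u) \<in> (parcs G) ^^ n)"
  define l where "l = (LEAST n. (b, u) \<in> (parcs G) ^^ n)"
  have k: "(a, u) \<in> (parcs G) ^^ k" "\<And>i. (a, u) \<in> (parcs G) ^^ i \<Longrightarrow> k \<le> i"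
    using LeastI_ex[of "\<lambda>n. (a, u) \<in> parcs G ^^ n"] Least_le[of "\<lambda>n. (a, u) \<in> parcs G ^^ n"] ret
    by (auto simp: k_def rtrancl_power)
  have l: "(b, u) \<in> (parcs G) ^^ l" "\<And>i. (b, u) \<in> (parcs G) ^^ i \<Longrightarrow> l \<le> i"
    using LeastI_ex[of "\<lambda>n. (b, u) \<in> parcs G ^^ n"] Least_le[of "\<lambda>n. (b, u) \<in> parcs G ^^ n"] ret
    by (auto simp: l_def rtrancl_power)
  show False
    using PI_out_degree_aux[OF og PI arcs ab k l] PI_out_degree_aux[OF og PI arcs(2,1) ab[symmetric] l k]
    by linarith
qed

text \<open>A cycle through the \<open>d i\<close> is reachable from a disjoint cycle through the \<open>v i\<close>. The states
  of the former count (as lengths) how often it has been traversed, and a traversal of the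
  latter appends the current count to its own state.\<close>

lemma PI_no_bridge_aux:
  fixes G :: "'v pair_pre_digraph" and K :: "'k::field itself" and v d :: "nat \<Rightarrow> 'v"
  assumes og: "oriented_graph G" and PI: "PI_algebra (hk_algebra K G)"
    and v: "inj_on v {..<b}" "a < b" "\<And>i. Suc i < b \<Longrightarrow> (v (Suc i), v i) \<in> parcs G" "(v a, v (b - 1)) \<in> parcs G"
    and d: "inj_on d {..<q}" "p < q" "\<And>i. Suc i < q \<Longrightarrow> (d i, d (Suc i)) \<in> parcs G" "(d (q - 1), d p) \<in> parcs G"
    and vd: "(v 0, d 0) \<in> parcs G" and disj: "\<And>i j. v i \<noteq> d j"
  shows False
proof -
  interpret oriented_graph G by (rule og)
  define vi where "vi = inv_into {..<b} v"
  define di where "di = inv_into {..<q} d"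
  have vi: "vi (v i) = i" if "i < b" for i
    using that v(1) by (simp add: vi_def inv_into_f_f)
  have di: "di (d i) = i" if "i < q" for i
    using that d(1) by (simp add: di_def inv_into_f_f)
  define U where "U = d ` {..<q} \<union> v ` {..<b}"
  define inp where "inp i s = (if i = 0 then s (d 0) else s (v (i - 1)))" for i and s :: "'v \<Rightarrow> nat list"
  \<comment> \<open>States are copied against the arrows, with one exception on each cycle: the last
    \<open>d\<close> makes the list of \<open>d p\<close> longer by one, and \<open>v a\<close> puts
    the length of its input in front of the list held by \<open>v (b - 1)\<close>.\<close>
  define F :: "'v \<Rightarrow> ('v \<Rightarrow> nat list) \<Rightarrow> nat list" where
    "F x s = (if x \<in> d ` {..<q} then if Suc (di x) < q then s (d (Suc (di x))) else 0 # s (d p)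
      else if vi x = a then length (inp (vi x) s) # s (v (b - 1)) else inp (vi x) s)" for x s
  have Fd: "F (d i) s = (if Suc i < q then s (d (Suc i)) else 0 # s (d p))" if "i < q" for i s
    using that by (simp add: F_def di)
  have Fv: "F (v i) s = (if i = a then length (inp i s) # s (v (b - 1)) else inp i s)" if "i < b" for i s
    using that disj by (auto simp: F_def vi)
  have sys: "update_system G U F"
  proof unfold_locales
    fix x j s c assume x: "x \<in> U" "(x, j) \<notin> parcs G"
    show "F x (s(j := c)) = F x s"
    proof (cases "x \<in> d ` {..<q}")
      case True
      then obtain i where i: "x = d i" "i < q" by auto
      have "Suc i < q \<Longrightarrow> j \<noteq> d (Suc i)" using d(3)[of i] x i by auto
      moreover have "\<not> Suc i < q \<Longrightarrow> i = q - 1" using i by simp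
      then have "\<not> Suc i < q \<Longrightarrow> j \<noteq> d p" using d(4) x i by auto
      ultimately show ?thesis by (cases "Suc i < q") (simp_all add: i Fd)
    next
      case False
      then obtain i where i: "x = v i" "i < b" using x by (auto simp: U_def)
      have "i = 0 \<Longrightarrow> j \<noteq> d 0" using vd x i by auto
      moreover have "i \<noteq> 0 \<Longrightarrow> j \<noteq> v (i - 1)" using v(3)[of "i - 1"] x i by auto
      ultimately have "inp i (s(j := c)) = inp i s" by (cases "i = 0") (simp_all add: inp_def)
      moreover have "i = a \<Longrightarrow> j \<noteq> v (b - 1)" using v(4) x i by auto
      ultimately show ?thesis using i by (cases "i = a") (simp_all add: Fv)
    qed
  qed
  interpret update_system G U F by (rule sys)
  \<comment> \<open>Each word serves the vertices in the order in which the states are handed on, so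
    that one pass updates its whole walk.\<close>
  define Dw where "Dw = map d [0..<q]"
  define Vw where "Vw = rev (map v [0..<b])"
  have D: "foldr act (map d [k..<q]) s = (\<lambda>x. if \<exists>i. k \<le> i \<and> i < q \<and> x = d i then 0 # s (d p) else s x)"
    if "k \<le> q" for k s
    using that
  proof (induction k rule: inc_induct)
    case base
    have "\<not> (\<exists>i. q \<le> i \<and> i < q \<and> x = d i)" for x by auto
    then show ?case by (simp only: if_False) simp
  next
    case (step k)
    define t where "t = foldr act (map d [Suc k..<q]) s"
    have t: "t x = (if \<exists>i. Suc k \<le> i \<and> i < q \<and> x = d i then 0 # s (d p) else s x)" for x
      by (simp add: t_def step.IH)
    have "F (d k) t = 0 # s (d p)"
    proof (cases "Suc k < q")
      case True
      then show ?thesis using step.hyps by (auto simp: Fd t)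
    next
      case False
      then have "\<not> (\<exists>i. Suc k \<le> i \<and> i < q \<and> x = d i)" for x by auto
      then have "t = s" by (intro ext) (simp only: t if_False)
      then show ?thesis using False step.hyps by (simp add: Fd)
    qed
    moreover have "d k \<in> U" using step.hyps by (auto simp: U_def)
    ultimately have "act (d k) t = t(d k := 0 # s (d p))" by (simp add: act_def)
    moreover have "foldr act (map d [k..<q]) s = act (d k) t"
      using step.hyps by (simp add: t_def upt_conv_Cons)
    moreover have "(t(d k := 0 # s (d p))) x = (if \<exists>i. k \<le> i \<and> i < q \<and> x = d i then 0 # s (d p) else s x)" for x
      using step.hyps by (auto simp: t) (metis Suc_leI le_neq_implies_less)
    ultimately show ?case by auto
  qed
  have V: "foldr act (rev (map v [0..<k])) s = (\<lambda>x. if \<exists>i<k. x = v i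
      then (if vi x < a then s (d 0) else length (s (d 0)) # s (v (b - 1))) else s x)"
    if "k \<le> b" for k s
    using that
  proof (induction k)
    case 0
    show ?case by auto
  next
    case (Suc k)
    define t where "t = foldr act (rev (map v [0..<k])) s"
    have t: "t x = (if \<exists>i<k. x = v i
      then (if vi x < a then s (d 0) else length (s (d 0)) # s (v (b - 1))) else s x)" for x
      using Suc by (simp add: t_def)
    have td: "t (d 0) = s (d 0)" 
    proof -
      have "\<not> (\<exists>i<k. d 0 = v i)" using disj by metis
      then show ?thesis by (simp only: t if_False)
    qed
    have tb: "t (v (b - 1)) = s (v (b - 1))" if "k \<le> a"
    proof -
      have "v (b - 1) \<noteq> v i" if "i < k" for i
        using inj_onD[OF v(1), of "b - 1" i] that \<open>k \<le> a\<close> v(2) by auto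
      then show ?thesis by (auto simp: t)
    qed
    have tk: "t (v (k - 1)) = (if k - 1 < a then s (d 0) else length (s (d 0)) # s (v (b - 1)))" if "k \<noteq> 0"
    proof -
      have "\<exists>i<k. v (k - 1) = v i" using that by (intro exI[of _ "k - 1"]) simp
      moreover have "vi (v (k - 1)) = k - 1" using Suc.prems by (intro vi) simp
      ultimately show ?thesis by (simp only: t if_True)
    qed
    have "F (v k) t = (if k < a then s (d 0) else length (s (d 0)) # s (v (b - 1)))"
      using Suc.prems td tb tk by (auto simp: Fv inp_def)
    moreover have "v k \<in> U" using Suc.prems by (auto simp: U_def)
    then have "act (v k) t = t(v k := F (v k) t)" by (simp add: act_def)
    moreover have "foldr act (rev (map v [0..<Suc k])) s = act (v k) t" by (simp add: t_def)
    ultimately show ?case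
      using Suc.prems by (auto simp: t vi less_Suc_eq fun_eq_iff)
  qed
  \<comment> \<open>The counter is raised by \<open>Suc n\<close> and then recorded. At least one
    pass is made, after which all the \<open>d i\<close> with \<open>i < q\<close> agree on the
    counter, in particular the \<open>d 0\<close> that is read by the other walk.\<close>
  define g where "g n = Vw @ concat (replicate (Suc n) Dw)" for n
  have Dn: "length (foldr act (concat (replicate (Suc n) Dw)) s (d i)) = length (s (d p)) + Suc n
      \<and> (\<forall>j. foldr act (concat (replicate (Suc n) Dw)) s (v j) = s (v j))" if "i < q" for n s i
    using that
  proof (induction n arbitrary: i)
    case 0
    then show ?case using D[of 0 s] disj by (auto simp: Dw_def)
  next
    case (Suc n)
    define t where "t = foldr act (concat (replicate (Suc n) Dw)) s"
    have "foldr act (concat (replicate (Suc (Suc n)) Dw)) s = foldr act Dw t" by (simp add: t_def)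
    moreover have "length (t (d p)) = length (s (d p)) + Suc n" "\<forall>j. t (v j) = s (v j)"
      using Suc.IH[OF d(2)] by (auto simp: t_def)
    ultimately show ?case using D[of 0 t] disj Suc.prems by (auto simp: Dw_def)
  qed
  have g_eff: "length (foldr act (g n) s (d p)) = length (s (d p)) + Suc n
     \<and> foldr act (g n) s (v (b - 1)) = (length (s (d p)) + Suc n) # s (v (b - 1))" for n s
  proof -
    define t where "t = foldr act (concat (replicate (Suc n) Dw)) s"
    have t: "length (t (d i)) = length (s (d p)) + Suc n" "t (v j) = s (v j)" if "i < q" for i j
      using Dn[OF that] by (auto simp: t_def)
    have "foldr act (g n) s = foldr act Vw t" by (simp add: g_def t_def)
    moreover have "vi (v (b - 1)) = b - 1" using v(2) by (intro vi) simp
    moreover have "\<exists>i<b. v (b - 1) = v i" using v(2) by (intro exI[of _ "b - 1"]) simp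
    moreover have "\<not> (\<exists>i<b. d p = v i)" using disj by metis
    ultimately show ?thesis
      using V[of b t] t[of p] t[of 0] d(2) v(2) by (auto simp: Vw_def)
  qed
  define st where "st ns = foldr act (concat (map g ns)) (\<lambda>_. [])" for ns
  have st: "st [] = (\<lambda>_. [])" "length (st (n # ns) (d p)) = length (st ns (d p)) + Suc n"
     "st (n # ns) (v (b - 1)) = (length (st ns (d p)) + Suc n) # st ns (v (b - 1))" for n ns
    using g_eff[of n "st ns"] by (auto simp: st_def)
  \<comment> \<open>The recorded list consists of the partial sums of the numbers
    \<open>Suc n\<close>, so their sequence can be recovered from it.\<close>
  have inj: "ns = ms" if "st ns (v (b - 1)) = st ms (v (b - 1))" for ns ms
    using that
  proof (induction ns arbitrary: ms)
    case Nil
    then show ?case by (cases ms) (auto simp: st simp del: One_nat_def)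
  next
    case (Cons n ns)
    then obtain m ms' where ms: "ms = m # ms'" by (cases ms) (auto simp: st simp del: One_nat_def)
    then have "ns = ms'" using Cons by (simp add: st del: One_nat_def)
    then show ?case using Cons.prems by (simp add: ms st del: One_nat_def)
  qed
  have "U \<subseteq> pverts G"
  proof
    fix x assume "x \<in> U"
    then consider i where "x = d i" "i < q" | i where "x = v i" "i < b" by (auto simp: U_def)
    then show "x \<in> pverts G"
    proof cases
      case 1
      have "(x, d (Suc i)) \<in> parcs G \<or> (x, d p) \<in> parcs G"
      proof (cases "Suc i < q")
        case True
        then show ?thesis using d(3) 1 by simp
      next
        case False
        then have "i = q - 1" using 1 by simp
        then show ?thesis using d(4) 1 by simp
      qed
      then show ?thesis using in_arcsD1 by blast
    next
      case 2
      have "(x, d 0) \<in> parcs G \<or> (x, v (i - 1)) \<in> parcs G"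
      proof (cases i)
        case 0
        then show ?thesis using vd 2 by simp
      next
        case (Suc j)
        then show ?thesis using v(3)[of j] 2 by simp
      qed
      then show ?thesis using in_arcsD1 by blast
    qed
  qed
  then have "set (g n) \<subseteq> pverts G" for n
    by (auto simp: g_def Vw_def Dw_def U_def split: if_splits)
  then show False
    by (rule not_PI_action[OF sys PI, where g = g and ini = "\<lambda>_. []"]) (rule inj, simp add: st_def)
qed

lemma first_repetition:
  assumes "finite S" "\<And>n. f n \<in> S"
  shows "\<exists>p q. p < q \<and> f q = f (p :: nat) \<and> inj_on f {..<q}"
proof -
  have "finite (range f)" using assms by (meson finite_subset image_subsetI)
  then have "\<not> inj f" using finite_imageD infinite_UNIV_nat by blast
  then obtain i j where "i < j" "f i = f j" by (metis injI linorder_neqE_nat)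
  then have ex: "\<exists>p<j. f j = f p" by metis
  define q where "q = (LEAST q. \<exists>p<q. f q = f p)"
  have q: "\<exists>p<q. f q = f p" "\<And>m. m < q \<Longrightarrow> \<not> (\<exists>p<m. f m = f p)"
    unfolding q_def using LeastI[of "\<lambda>q. \<exists>p<q. f q = f p", OF ex] not_less_Least by blast+
  have "inj_on f {..<q}"
  proof (rule linorder_inj_onI)
    fix i j assume "i < j" "i \<in> {..<q}" "j \<in> {..<q}"
    then show "f i \<noteq> f j" using q(2)[of j] by fastforce
  qed auto
  then show ?thesis using q(1) by blast
qed

text \<open>Inside the finite set \<open>S\<close> one can walk forwards from \<open>y\<close> and
  backwards from \<open>x\<close> without end, so each walk closes up to a cycle with a tail. If
  \<open>y\<close> did not reach \<open>x\<close>, the walks would be disjoint, and the arrow from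
  \<open>x\<close> to \<open>y\<close> would join the tails.\<close>

lemma PI_no_bridge:
  fixes G :: "'v pair_pre_digraph" and K :: "'k::field itself"
  assumes og: "oriented_graph G" and PI: "PI_algebra (hk_algebra K G)"
    and xy: "(x, y) \<in> parcs G" "x \<in> S" "y \<in> S" and fin: "finite S"
    and out: "\<And>s. s \<in> S \<Longrightarrow> \<exists>t\<in>S. (s, t) \<in> parcs G" and inn: "\<And>s. s \<in> S \<Longrightarrow> \<exists>t\<in>S. (t, s) \<in> parcs G"
  shows "(y, x) \<in> (parcs G)\<^sup>*"
proof (rule ccontr)
  assume nr: "(y, x) \<notin> (parcs G)\<^sup>*"
  have "\<exists>d :: nat \<Rightarrow> 'v. d 0 = y \<and> (\<forall>n. d n \<in> S \<and> (d n, d (Suc n)) \<in> parcs G)"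
  proof -
    have "\<exists>d :: nat \<Rightarrow> 'v. \<forall>n. (d n \<in> S \<and> (n = 0 \<longrightarrow> d n = y)) \<and> (d n, d (Suc n)) \<in> parcs G"
      by (rule dependent_nat_choice) (use xy out in \<open>auto simp: Bex_def\<close>)
    then show ?thesis by auto
  qed
  then obtain d :: "nat \<Rightarrow> 'v" where d: "d 0 = y" "\<And>n. d n \<in> S" "\<And>n. (d n, d (Suc n)) \<in> parcs G" by blast
  have "\<exists>v :: nat \<Rightarrow> 'v. v 0 = x \<and> (\<forall>n. v n \<in> S \<and> (v (Suc n), v n) \<in> parcs G)"
  proof -
    have "\<exists>v :: nat \<Rightarrow> 'v. \<forall>n. (v n \<in> S \<and> (n = 0 \<longrightarrow> v n = x)) \<and> (v (Suc n), v n) \<in> parcs G"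
      by (rule dependent_nat_choice) (use xy inn in \<open>auto simp: Bex_def\<close>)
    then show ?thesis by auto
  qed
  then obtain v :: "nat \<Rightarrow> 'v" where v: "v 0 = x" "\<And>n. v n \<in> S" "\<And>n. (v (Suc n), v n) \<in> parcs G" by blast
  have dr: "(y, d n) \<in> (parcs G)\<^sup>*" for n
  proof (induction n)
    case (Suc n)
    show ?case by (rule rtrancl_into_rtrancl[OF Suc d(3)])
  qed (simp add: d(1))
  have vr: "(v n, x) \<in> (parcs G)\<^sup>*" for n
  proof (induction n)
    case (Suc n)
    show ?case by (rule converse_rtrancl_into_rtrancl[OF v(3) Suc])
  qed (simp add: v(1))
  obtain p q where pq: "p < q" "d q = d p" "inj_on d {..<q}"
    using first_repetition[where f = d, OF fin d(2)] by (elim exE conjE) (rule that)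
  obtain a b where ab: "a < b" "v b = v a" "inj_on v {..<b}"
    using first_repetition[where f = v, OF fin v(2)] by (elim exE conjE) (rule that)
  show False
  proof (rule PI_no_bridge_aux[OF og PI ab(3,1) _ _ pq(3,1)])
    show "(v a, v (b - 1)) \<in> parcs G" using v(3)[of "b - 1"] ab by simp
    show "(d (q - 1), d p) \<in> parcs G" using d(3)[of "q - 1"] pq by simp
    show "v i \<noteq> d j" for i j
      using nr dr[of j] vr[of i] by (metis rtrancl_trans)
    show "(v 0, d 0) \<in> parcs G" using d(1) v(1) xy(1) by simp
  qed (rule v(3), rule d(3))
qed

section \<open>The cyclic part and its connected components\<close>

text \<open>A path returning from the head of an arrow to its tail can be freed of repeated
  vertices, and the arrow then closes it up to a cycle.\<close>

lemma cyclic_part_arc_iff: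
  assumes "oriented_graph G"
  shows "(x, y) \<in> parcs (cyclic_part G) \<longleftrightarrow> (x, y) \<in> parcs G \<and> (y, x) \<in> (parcs G)\<^sup>*"
proof
  interpret oriented_graph G by (rule assms)
  assume "(x, y) \<in> parcs (cyclic_part G)"
  then obtain p u where xy: "(x, y) \<in> parcs G" and p: "awalk u p u" "(x, y) \<in> set p"
    by (auto simp: cyclic_part_def cycle_def)
  obtain p1 p2 where "p = p1 @ (x, y) # p2" using p(2) by (auto simp: in_set_conv_decomp)
  then have "awalk u p1 x" "awalk y p2 u" using p(1) by (auto simp: awalk_Cons_iff)
  then have "y \<rightarrow>\<^sup>*\<^bsub>with_proj G\<^esub> u" "u \<rightarrow>\<^sup>*\<^bsub>with_proj G\<^esub> x" by (auto intro: reachable_awalkI)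
  then have "y \<rightarrow>\<^sup>*\<^bsub>with_proj G\<^esub> x" by (rule reachable_trans)
  then show "(x, y) \<in> parcs G \<and> (y, x) \<in> (parcs G)\<^sup>*" using xy by (simp add: reachable_conv)
next
  interpret oriented_graph G by (rule assms)
  assume *: "(x, y) \<in> parcs G \<and> (y, x) \<in> (parcs G)\<^sup>*"
  then have "y \<rightarrow>\<^sup>*\<^bsub>with_proj G\<^esub> x" using in_arcsD1 in_arcsD2 by (auto simp: reachable_conv)
  then obtain p where p: "apath y p x" by (auto simp: reachable_apath)
  then have "awalk x ((x, y) # p) x" using * by (auto simp: apath_def awalk_Cons_iff)
  moreover have "distinct (tl (pawalk_verts x ((x, y) # p)))" using p by (simp add: apath_def)
  ultimately have "cycle ((x, y) # p)" by (auto simp: cycle_def)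
  then show "(x, y) \<in> parcs (cyclic_part G)" using * by (auto simp: cyclic_part_def intro!: exI[of _ "(x, y) # p"])
qed

lemma pverts_cyclic_part [simp]: "pverts (cyclic_part G) = pverts G"
  by (simp add: cyclic_part_def)

text \<open>The return path closes up through the arrow from \<open>x\<close> to \<open>y\<close>,
  so each of its own arrows is cyclic as well.\<close>

lemma cyclic_part_reach:
  assumes "oriented_graph G" "(x, y) \<in> parcs (cyclic_part G)"
  shows "(y, x) \<in> (parcs (cyclic_part G))\<^sup>*"
proof -
  have xy: "(x, y) \<in> parcs G" "(y, x) \<in> (parcs G)\<^sup>*"
    using assms by (auto simp: cyclic_part_arc_iff)
  have "(z, x) \<in> (parcs (cyclic_part G))\<^sup>* \<and> (y, z) \<in> (parcs G)\<^sup>*" if "(y, z) \<in> (parcs G)\<^sup>*" "(z, x) \<in> (parcs G)\<^sup>*" for z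
    using that(2,1)
  proof (induction rule: converse_rtrancl_induct)
    case (step z z')
    then have "(y, z') \<in> (parcs G)\<^sup>*" by (meson rtrancl.rtrancl_into_rtrancl)
    moreover have "(z', z) \<in> (parcs G)\<^sup>*"
      using step(2) xy(1) step.prems by (meson rtrancl.rtrancl_into_rtrancl rtrancl_trans)
    then have "(z, z') \<in> parcs (cyclic_part G)"
      using step(1) assms(1) by (simp add: cyclic_part_arc_iff)
    ultimately show ?case using step by (meson converse_rtrancl_into_rtrancl)
  qed simp
  then show ?thesis using xy(2) by blast
qed

lemma oriented_graph_subarcs:
  assumes "oriented_graph G" "pverts H \<subseteq> pverts G" "parcs H \<subseteq> parcs G" "\<And>u v. (u, v) \<in> parcs H \<Longrightarrow> u \<in> pverts H \<and> v \<in> pverts H"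
  shows "oriented_graph H"
proof -
  interpret oriented_graph G by (rule assms(1))
  show ?thesis
  proof unfold_locales
    show "finite (pverts H)" "finite (parcs H)"
      using finite_subset[OF assms(2)] finite_subset[OF assms(3)] pair_finite_verts pair_finite_arcs by auto
    show "(u, v) \<in> parcs H \<Longrightarrow> (v, u) \<notin> parcs H" for u v using assms(3) antiparallel_free by blast
    show "e \<in> parcs H \<Longrightarrow> fst e \<noteq> snd e" for e using assms(3) pair_no_loops by blast
  qed (use assms(4) in auto)
qed

lemma oriented_graph_cyclic_part: "oriented_graph G \<Longrightarrow> oriented_graph (cyclic_part G)"
proof (rule oriented_graph_subarcs)
  assume "oriented_graph G"
  then interpret oriented_graph G .
  fix u v assume "(u, v) \<in> parcs (cyclic_part G)"
  then show "u \<in> pverts (cyclic_part G) \<and> v \<in> pverts (cyclic_part G)"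
    using in_arcsD1 in_arcsD2 by (auto simp: cyclic_part_def)
qed (auto simp: cyclic_part_def)

text \<open>The arrows are the graph of a permutation, so that \<open>G\<close> is a disjoint union of oriented
  cycles and isolated vertices.\<close>

definition permutation_graph :: "'v pair_pre_digraph \<Rightarrow> bool" where
  "permutation_graph G \<longleftrightarrow> oriented_graph G \<and> (\<exists>W \<sigma>. parcs G = {(i, \<sigma> i) | i. i \<in> W} \<and> bij_betw \<sigma> W W)"

text \<open>Since out-degrees are at most one, \<open>\<sigma>\<close> is determined by the arrows.
  Return paths give each vertex of \<open>W\<close> a successor and a predecessor in
  \<open>W\<close>, and a surjection of a finite set onto itself is bijective.\<close>

lemma permutation_graph_cyclic_part:
  fixes K :: "'k::field itself"
  assumes og: "oriented_graph G" and PI: "PI_algebra (hk_algebra K G)"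
  shows "permutation_graph (cyclic_part G)"
proof -
  interpret C: oriented_graph "cyclic_part G" by (rule oriented_graph_cyclic_part[OF og])
  define E where "E = parcs (cyclic_part G)"
  have E: "(x, y) \<in> E \<longleftrightarrow> (x, y) \<in> parcs G \<and> (y, x) \<in> (parcs G)\<^sup>*" for x y
    unfolding E_def by (rule cyclic_part_arc_iff[OF og])
  have uniq: "a = b" if "(u, a) \<in> E" "(u, b) \<in> E" for u a b
    using that PI_out_degree[OF og PI] by (auto simp: E)
  define W where "W = Domain E"
  define \<sigma> where "\<sigma> i = (SOME j. (i, j) \<in> E)" for i
  have \<sigma>: "(i, j) \<in> E \<longleftrightarrow> i \<in> W \<and> j = \<sigma> i" for i j
    using uniq someI[of "\<lambda>j. (i, j) \<in> E"] by (auto simp: W_def \<sigma>_def)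
  have ne: "x \<noteq> y" if "(x, y) \<in> E" for x y
    using C.pair_no_loops[of "(x, y)"] that by (auto simp: E_def)
  have "\<sigma> i \<in> W" if "i \<in> W" for i
  proof -
    have i: "(i, \<sigma> i) \<in> E" using that \<sigma> by blast
    then have "(\<sigma> i, i) \<in> E\<^sup>*" unfolding E_def by (rule cyclic_part_reach[OF og])
    then show ?thesis using ne[OF i] by (auto simp: W_def elim: converse_rtranclE)
  qed
  moreover have "i \<in> \<sigma> ` W" if "i \<in> W" for i
  proof -
    have i: "(i, \<sigma> i) \<in> E" using that \<sigma> by blast
    then have "(\<sigma> i, i) \<in> E\<^sup>*" unfolding E_def by (rule cyclic_part_reach[OF og])
    then obtain j where "(j, i) \<in> E" using ne[OF i] by (auto elim: rtranclE)
    then show ?thesis using \<sigma> by blast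
  qed
  ultimately have "\<sigma> ` W = W" by blast
  moreover have "finite W"
    unfolding W_def E_def using C.pair_finite_arcs by (rule finite_Domain)
  ultimately have "bij_betw \<sigma> W W" by (simp add: bij_betw_def finite_surj_inj)
  moreover have "parcs (cyclic_part G) = {(i, \<sigma> i) | i. i \<in> W}"
    using \<sigma> by (auto simp: E_def[symmetric])
  ultimately show ?thesis
    using C.oriented_graph_axioms unfolding permutation_graph_def by blast
qed

lemma tasep_permutation_graph:
  assumes "permutation_graph G"
  shows "\<exists>W \<sigma>. tasep (parcs G) (\<lambda>u v. hk_class G u = hk_class G v) (pverts G) W \<sigma>"
proof -
  obtain W \<sigma> where og: "oriented_graph G" and E: "parcs G = {(i, \<sigma> i) | i. i \<in> W}" and b: "bij_betw \<sigma> W W"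
    using assms by (auto simp: permutation_graph_def)
  interpret oriented_graph G by (rule og)
  interpret hk_cong "parcs G" "\<lambda>u v. hk_class G u = hk_class G v"
    by (rule hk_cong_class) unfold_locales
  have "tasep (parcs G) (\<lambda>u v. hk_class G u = hk_class G v) (pverts G) W \<sigma>"
  proof unfold_locales
    show "(i, j) \<in> parcs G \<longleftrightarrow> i \<in> W \<and> j = \<sigma> i" for i j by (auto simp: E)
    show "finite (pverts G)" by (rule pair_finite_verts)
    show "W \<subseteq> pverts G" using in_arcsD1 E by blast
    show "\<sigma> i \<noteq> i" if "i \<in> W" for i using pair_no_loops[of "(i, \<sigma> i)"] that E by auto
    show "hk_class G [i] = hk_class G []" if "i \<notin> pverts G" for i using that by (rule hk_class_outside)
  qed (rule b)
  then show ?thesis by blast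
qed

section \<open>Connected components of an oriented graph\<close>

lemma rtrancl_sym_Un: "(x, y) \<in> (E \<union> E\<inverse>)\<^sup>* \<Longrightarrow> (y, x) \<in> (E \<union> E\<inverse>)\<^sup>*"
  by (metis converse_Un converse_converse rtrancl_converseI sup_commute)

lemma connected_iff:
  assumes "wf_digraph H" "tail H = fst" "head H = snd"
  shows "Digraph_Component.connected H \<longleftrightarrow>
    verts H \<noteq> {} \<and> (\<forall>u\<in>verts H. \<forall>v\<in>verts H. (u, v) \<in> (arcs H \<union> (arcs H)\<inverse>)\<^sup>*)"
proof -
  interpret H: wf_digraph H by (rule assms(1))
  interpret S: pair_wf_digraph "mk_symmetric H" by (rule H.wellformed_mk_symmetric)
  have arcs: "parcs (mk_symmetric H) = arcs H \<union> (arcs H)\<inverse>"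
    using assms(2,3) by (force simp: parcs_mk_symmetric)
  have "u \<rightarrow>\<^sup>*\<^bsub>with_proj (mk_symmetric H)\<^esub> v \<longleftrightarrow> (u, v) \<in> (arcs H \<union> (arcs H)\<inverse>)\<^sup>*" if "u \<in> verts H" for u v
    using S.reachable_conv'[of u v] that arcs by simp
  then show ?thesis by (auto simp: connected_def strongly_connected_def)
qed

context
  fixes G :: "'v pair_pre_digraph"
  assumes og: "oriented_graph G"
begin

interpretation oriented_graph G by (rule og)

lemma componentD:
  assumes H: "H \<in> connected_components G"
  shows "pverts H \<subseteq> pverts G" "parcs H \<subseteq> parcs G" "pverts H \<noteq> {}"
    "\<And>u v. (u, v) \<in> parcs H \<Longrightarrow> u \<in> pverts H \<and> v \<in> pverts H"
    "\<And>u v. u \<in> pverts H \<Longrightarrow> v \<in> pverts H \<Longrightarrow> (u, v) \<in> (parcs H \<union> (parcs H)\<inverse>)\<^sup>*"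
    "\<And>u v. (u, v) \<in> parcs G \<Longrightarrow> u \<in> pverts H \<or> v \<in> pverts H \<Longrightarrow> (u, v) \<in> parcs H"
proof -
  have sub: "subgraph (with_proj H) (with_proj G)" and con: "Digraph_Component.connected (with_proj H)"
    and max: "\<And>H'. H' \<noteq> with_proj H \<Longrightarrow> subgraph (with_proj H) H' \<Longrightarrow> subgraph H' (with_proj G) \<Longrightarrow> \<not> Digraph_Component.connected H'"
    using H by (auto simp: connected_components_def max_subgraph_def)
  have wfH: "wf_digraph (with_proj H)" and wfG: "wf_digraph (with_proj G)" using sub by (auto simp: subgraph_def)
  show "pverts H \<subseteq> pverts G" "parcs H \<subseteq> parcs G" using sub by (auto simp: subgraph_def)
  show arcsH: "u \<in> pverts H \<and> v \<in> pverts H" if "(u, v) \<in> parcs H" for u v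
    using wf_digraph.tail_in_verts[OF wfH, of "(u, v)"] wf_digraph.head_in_verts[OF wfH, of "(u, v)"] that by simp
  have c: "pverts H \<noteq> {} \<and> (\<forall>u\<in>pverts H. \<forall>v\<in>pverts H. (u, v) \<in> (parcs H \<union> (parcs H)\<inverse>)\<^sup>*)"
    using con connected_iff[OF wfH] by simp
  then show "pverts H \<noteq> {}" and path: "\<And>u v. u \<in> pverts H \<Longrightarrow> v \<in> pverts H \<Longrightarrow> (u, v) \<in> (parcs H \<union> (parcs H)\<inverse>)\<^sup>*"
    by auto
  fix u v assume uv: "(u, v) \<in> parcs G" "u \<in> pverts H \<or> v \<in> pverts H"
  \<comment> \<open>Adding to \<open>H\<close> an arrow that touches it gives a connected subgraph
    again, so by maximality the arrow belongs to \<open>H\<close> already.\<close>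
  define H' where "H' = \<lparr>pverts = pverts H \<union> {u, v}, parcs = insert (u, v) (parcs H)\<rparr>"
  have uvG: "u \<in> pverts G" "v \<in> pverts G" using uv in_arcsD1 in_arcsD2 by auto
  have wfH': "wf_digraph (with_proj H')" by unfold_locales (auto simp: H'_def dest: arcsH)
  have s1: "subgraph (with_proj H) (with_proj H')"
    using wfH wfH' by (auto simp: subgraph_def H'_def compatible_def)
  have s2: "subgraph (with_proj H') (with_proj G)"
    using wfH' wfG sub uv uvG by (auto simp: subgraph_def H'_def compatible_def)
  let ?E = "parcs H' \<union> (parcs H')\<inverse>"
  have mono: "(parcs H \<union> (parcs H)\<inverse>)\<^sup>* \<subseteq> ?E\<^sup>*" by (intro rtrancl_mono) (auto simp: H'_def)
  obtain w where w: "w \<in> pverts H" "w = u \<or> w = v" using uv(2) by auto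
  have "(u, v) \<in> ?E" "(v, u) \<in> ?E" by (auto simp: H'_def)
  then have "(x, w) \<in> ?E\<^sup>*" if "x \<in> pverts H'" for x
    using that w path[of x w] mono by (auto simp: H'_def)
  then have "(x, y) \<in> ?E\<^sup>*" if "x \<in> pverts H'" "y \<in> pverts H'" for x y
    using that rtrancl_sym_Un[of y w "parcs H'"] by (meson rtrancl_trans)
  then have "Digraph_Component.connected (with_proj H')"
    using connected_iff[OF wfH'] by (simp add: H'_def)
  then have "with_proj H' = with_proj H" using max s1 s2 by blast
  then have "parcs H' = parcs H" by (metis with_proj_simps(2))
  then show "(u, v) \<in> parcs H" by (auto simp: H'_def)
qed

lemma component_closed:
  assumes H: "H \<in> connected_components G" and "x \<in> pverts H" "(x, y) \<in> (parcs G \<union> (parcs G)\<inverse>)\<^sup>*"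
  shows "y \<in> pverts H"
  using assms(3,2)
proof induction
  case (step y z)
  then have "(y, z) \<in> parcs H \<or> (z, y) \<in> parcs H" using componentD(6)[OF H] by auto
  then show ?case using componentD(4)[OF H] by blast
qed

lemma component_unique:
  assumes H: "H \<in> connected_components G" "H' \<in> connected_components G" and x: "x \<in> pverts H" "x \<in> pverts H'"
  shows "H = H'"
proof -
  have sub: "pverts H1 \<subseteq> pverts H2" if H: "H1 \<in> connected_components G" "H2 \<in> connected_components G"
    and x: "x \<in> pverts H1" "x \<in> pverts H2" for H1 H2
  proof
    fix y assume "y \<in> pverts H1"
    then have "(x, y) \<in> (parcs H1 \<union> (parcs H1)\<inverse>)\<^sup>*" using componentD(5)[OF H(1)] x by blast
    moreover have "(parcs H1 \<union> (parcs H1)\<inverse>)\<^sup>* \<subseteq> (parcs G \<union> (parcs G)\<inverse>)\<^sup>*"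
      using componentD(2)[OF H(1)] by (intro rtrancl_mono) auto
    ultimately show "y \<in> pverts H2" using component_closed[OF H(2) x(2)] by blast
  qed
  have v: "pverts H = pverts H'" using sub[OF H x] sub[OF H(2,1) x(2,1)] by blast
  have "parcs H1 \<subseteq> parcs H2" if H: "H1 \<in> connected_components G" "H2 \<in> connected_components G"
    and v: "pverts H1 = pverts H2" for H1 H2
  proof (rule subrelI)
    fix x y assume "(x, y) \<in> parcs H1"
    then have "(x, y) \<in> parcs G" "x \<in> pverts H2" using componentD(2,4)[OF H(1)] v by auto
    then show "(x, y) \<in> parcs H2" using componentD(6)[OF H(2)] by blast
  qed
  then have "parcs H = parcs H'" using H v by (intro antisym) auto
  then show ?thesis using v by simp
qed

lemma component_exists:
  assumes v: "v \<in> pverts G"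
  shows "\<exists>H\<in>connected_components G. v \<in> pverts H"
proof -
  define S where "S = {w. (v, w) \<in> (parcs G \<union> (parcs G)\<inverse>)\<^sup>*}"
  define H where "H = \<lparr>pverts = S, parcs = {(x, y) \<in> parcs G. x \<in> S \<and> y \<in> S}\<rparr>"
  have SV: "S \<subseteq> pverts G"
  proof
    fix w assume "w \<in> S"
    then have "(v, w) \<in> (parcs G \<union> (parcs G)\<inverse>)\<^sup>*" by (simp add: S_def)
    then show "w \<in> pverts G" using v in_arcsD1 in_arcsD2 by (induction) auto
  qed
  have wfH: "wf_digraph (with_proj H)" by unfold_locales (auto simp: H_def)
  have wfG: "wf_digraph (with_proj G)" by unfold_locales
  have subH: "subgraph (with_proj H) (with_proj G)"
    using wfH wfG SV by (auto simp: subgraph_def H_def compatible_def)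
  have vw: "(v, w) \<in> (parcs H \<union> (parcs H)\<inverse>)\<^sup>*" if "(v, w) \<in> (parcs G \<union> (parcs G)\<inverse>)\<^sup>*" for w
    using that
  proof induction
    case (step y z)
    then have "y \<in> S" "z \<in> S" by (auto simp: S_def intro: rtrancl_into_rtrancl)
    then have "(y, z) \<in> parcs H \<union> (parcs H)\<inverse>" using step(2) by (auto simp: H_def)
    then show ?case using step by (meson rtrancl.rtrancl_into_rtrancl)
  qed simp
  have "(x, y) \<in> (parcs H \<union> (parcs H)\<inverse>)\<^sup>*" if "x \<in> S" "y \<in> S" for x y
  proof (rule rtrancl_trans)
    show "(x, v) \<in> (parcs H \<union> (parcs H)\<inverse>)\<^sup>*"
      by (rule rtrancl_sym_Un, rule vw) (use that in \<open>simp add: S_def\<close>)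
    show "(v, y) \<in> (parcs H \<union> (parcs H)\<inverse>)\<^sup>*"
      by (rule vw) (use that in \<open>simp add: S_def\<close>)
  qed
  then have conH: "Digraph_Component.connected (with_proj H)"
    using connected_iff[OF wfH] by (auto simp: H_def S_def)
  have max: "H' = with_proj H" if H': "subgraph (with_proj H) H'" "subgraph H' (with_proj G)" "Digraph_Component.connected H'" for H'
  proof -
    have wfH': "wf_digraph H'" and th: "tail H' = fst" "head H' = snd"
      using H' by (auto simp: subgraph_def compatible_def)
    have con: "\<And>x y. x \<in> verts H' \<Longrightarrow> y \<in> verts H' \<Longrightarrow> (x, y) \<in> (arcs H' \<union> (arcs H')\<inverse>)\<^sup>*"
      using H'(3) connected_iff[OF wfH' th] by blast
    have vS: "v \<in> S" by (simp add: S_def)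
    have "verts H' \<subseteq> S"
    proof
      fix w assume "w \<in> verts H'"
      moreover have "v \<in> verts H'" using H'(1) vS by (auto simp: subgraph_def H_def)
      ultimately have "(v, w) \<in> (arcs H' \<union> (arcs H')\<inverse>)\<^sup>*" using con by blast
      moreover have "(arcs H' \<union> (arcs H')\<inverse>)\<^sup>* \<subseteq> (parcs G \<union> (parcs G)\<inverse>)\<^sup>*"
        using H'(2) by (intro rtrancl_mono) (auto simp: subgraph_def)
      ultimately show "w \<in> S" by (auto simp: S_def)
    qed
    then have ve: "verts H' = pverts H" using H'(1) by (auto simp: subgraph_def H_def)
    have "arcs H' \<subseteq> parcs H"
    proof
      fix e assume e: "e \<in> arcs H'"
      then have "e \<in> parcs G" using H'(2) by (auto simp: subgraph_def)
      moreover have "fst e \<in> S" "snd e \<in> S"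
        using wf_digraph.tail_in_verts[OF wfH' e] wf_digraph.head_in_verts[OF wfH' e] th ve by (auto simp: H_def)
      ultimately show "e \<in> parcs H" by (cases e) (auto simp: H_def)
    qed
    then have "arcs H' = parcs H" using H'(1) by (auto simp: subgraph_def)
    then show ?thesis using ve th by (simp add: with_proj_def)
  qed
  have "H \<in> connected_components G"
    using subH conH max by (auto simp: connected_components_def max_subgraph_def)
  moreover have "v \<in> pverts H" by (simp add: H_def S_def)
  ultimately show ?thesis by blast
qed

lemma permutation_graph_component:
  assumes pg: "permutation_graph G" and H: "H \<in> connected_components G"
  shows "permutation_graph H"
proof -
  obtain W \<sigma> where E: "parcs G = {(i, \<sigma> i) | i. i \<in> W}" and b: "bij_betw \<sigma> W W"
    using pg by (auto simp: permutation_graph_def)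
  define W' where "W' = W \<inter> pverts H"
  have sub: "\<sigma> i \<in> pverts H \<and> i \<in> pverts H" if "i \<in> W" "i \<in> pverts H \<or> \<sigma> i \<in> pverts H" for i
  proof -
    have "(i, \<sigma> i) \<in> parcs G" using that(1) E by blast
    then have "(i, \<sigma> i) \<in> parcs H" using componentD(6)[OF H] that(2) by blast
    then show ?thesis using componentD(4)[OF H] by blast
  qed
  have "\<sigma> ` W' = W'"
  proof
    show "\<sigma> ` W' \<subseteq> W'" using sub b by (auto simp: W'_def bij_betw_def)
    show "W' \<subseteq> \<sigma> ` W'"
    proof
      fix i assume "i \<in> W'"
      then have "i \<in> \<sigma> ` W" "i \<in> pverts H" using b by (auto simp: W'_def bij_betw_def)
      then obtain j where "j \<in> W" "i = \<sigma> j" "i \<in> pverts H" by blast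
      then show "i \<in> \<sigma> ` W'" using sub by (auto simp: W'_def)
    qed
  qed
  moreover have "inj_on \<sigma> W'" using b by (auto simp: W'_def bij_betw_def intro: inj_on_subset)
  ultimately have "bij_betw \<sigma> W' W'" by (simp add: bij_betw_def)
  moreover have "parcs H = {(i, \<sigma> i) | i. i \<in> W'}"
  proof
    show "parcs H \<subseteq> {(i, \<sigma> i) | i. i \<in> W'}"
    proof (rule subrelI)
      fix x y assume xy: "(x, y) \<in> parcs H"
      then have "(x, y) \<in> parcs G" "x \<in> pverts H" using componentD(2,4)[OF H] by blast+
      then show "(x, y) \<in> {(i, \<sigma> i) | i. i \<in> W'}" using E by (auto simp: W'_def)
    qed
    show "{(i, \<sigma> i) | i. i \<in> W'} \<subseteq> parcs H"
      using componentD(6)[OF H] E by (auto simp: W'_def)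
  qed
  moreover have "oriented_graph H"
    by (rule oriented_graph_subarcs[OF og componentD(1,2,4)[OF H]])
  ultimately show ?thesis by (auto simp: permutation_graph_def)
qed

end

section \<open>Maximal ideals and the cyclic part\<close>

lemma hk_relations_cases:
  assumes "(u, v) \<in> hk_relations G"
  obtains i where "u = [i, i]" "v = [i]"
  | i j where "u = [i, j]" "v = [j, i]" "(i, j) \<notin> parcs G" "(j, i) \<notin> parcs G"
  | i j where "u = [i, j, i]" "v = [i, j]" "(i, j) \<in> parcs G"
  | i j where "u = [j, i, j]" "v = [i, j]" "(i, j) \<in> parcs G"
  using assms unfolding hk_relations_def by blast

lemma hk_kernel_class:
  assumes "\<And>x. hk_eval G x = 0 \<Longrightarrow> x \<in> I" "hk_class G u = hk_class G v"
  shows "wrd u - wrd v \<in> I"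
  using assms by (simp add: hk_eval_diff)

lemma corner_hk:
  fixes I :: "('v list \<Rightarrow>\<^sub>0 'k::alg_closed_field) set"
  assumes "permutation_graph G" "maximal_two_ideal I" "\<And>x. hk_eval G x = 0 \<Longrightarrow> x \<in> I"
  shows "\<exists>e lam. hk_class G (e @ e) = hk_class G e \<and> wrd e \<notin> I \<and> (\<forall>x. wrd e * x * wrd e - cst (lam x) * wrd e \<in> I)"
proof -
  obtain W \<sigma> where t: "tasep (parcs G) (\<lambda>u v. hk_class G u = hk_class G v) (pverts G) W \<sigma>"
    using tasep_permutation_graph[OF assms(1)] by blast
  show ?thesis
    by (rule corner_exists[OF t assms(2)]) (rule hk_kernel_class[OF assms(3)])
qed

text \<open>In a simple quotient, a vertex acting neither as \<open>0\<close> nor as \<open>1\<close> has an in-neighbour and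
  an out-neighbour with the same property.\<close>

lemma maximal_contains_cyclic_kernel:
  fixes K :: "'k::field itself" and I :: "('v list \<Rightarrow>\<^sub>0 'k) set"
  assumes og: "oriented_graph G" and PI: "PI_algebra (hk_algebra K G)"
    and maxI: "maximal_two_ideal I" and ker: "\<And>x. hk_eval G x = 0 \<Longrightarrow> x \<in> I"
    and x: "hk_eval (cyclic_part G) x = 0"
  shows "x \<in> I"
proof -
  interpret oriented_graph G by (rule og)
  interpret hk_cong "parcs G" "\<lambda>u v. hk_class G u = hk_class G v"
    by (rule hk_cong_class) unfold_locales
  note I = maximal_two_idealD(1)[OF maxI]
  have cl: "wrd u - wrd v \<in> I" if "hk_class G u = hk_class G v" for u v
    using that ker hk_kernel_class by blast
  have X1: "wrd [z] - 1 \<in> I" if "z \<notin> pverts G" for z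
    using cl[OF hk_class_outside[OF that]] by (simp add: wrd_Nil)
  define S where "S = {v. wrd [v] \<notin> I \<and> wrd [v] - 1 \<notin> I}"
  have SV: "S \<subseteq> pverts G" using X1 by (auto simp: S_def)
  \<comment> \<open>Acting as 0 or as 1, a letter outside \<open>S\<close> is central modulo
    \<open>I\<close>.\<close>
  have scal: "wrd [z] * t - t * wrd [z] \<in> I" if "z \<notin> S" for z t
  proof (cases "wrd [z] \<in> I")
    case True
    then show ?thesis by (intro two_ideal_diff[OF I] two_ideal_l[OF I] two_ideal_r[OF I])
  next
    case False
    then have "wrd [z] - 1 \<in> I" using that by (simp add: S_def)
    from two_ideal_diff[OF I two_ideal_r[OF I this, of t] two_ideal_l[OF I this, of t]]
    show ?thesis by (simp add: algebra_simps)
  qed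
  have idm: "wrd [d] * wrd [d] - wrd [d] \<in> I" for d
    using cl[OF idem[of d]] by (simp add: single_times)
  have out: "\<exists>t\<in>S. (d, t) \<in> parcs G" if d: "d \<in> S" for d
  proof (rule ccontr)
    assume no: "\<not> ?thesis"
    let ?d = "wrd [d] :: 'v list \<Rightarrow>\<^sub>0 'k"
    \<comment> \<open>Without an arrow from \<open>d\<close> into \<open>S\<close>, a copy of
      \<open>d\<close> can be put in front of any word ending in \<open>d\<close>. Hence
      \<open>(1 - d) R d = 0\<close> in the quotient \<open>R\<close>, and by primeness
      \<open>d\<close> acts as 0 or as 1.\<close>
    have letter: "wrd [z] * ?d - ?d * wrd [z] * ?d \<in> I" for z
    proof (cases "z \<in> S")
      case True
      have "hk_class G [z, d] = hk_class G [d, z, d]"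
      proof (cases "(z, d) \<in> parcs G")
        case True
        then show ?thesis by (rule sm[OF arc2])
      next
        case False
        have dz: "(d, z) \<notin> parcs G" using no True by auto
        have "hk_class G ([z] @ [d]) = hk_class G ([z] @ [d, d])" by (rule ctxl[OF sm[OF idem]])
        also have "[z] @ [d, d] = [z, d] @ [d]" by simp
        also have "hk_class G ([z, d] @ [d]) = hk_class G ([d, z] @ [d])" by (rule ctxr[OF comm[OF False dz]])
        finally show ?thesis by (simp only: append.simps)
      qed
      from cl[OF this] show ?thesis by (simp add: single_times)
    next
      case False
      have "wrd [z] * (?d - ?d * ?d) + (wrd [z] * ?d - ?d * wrd [z]) * ?d \<in> I"
        using two_ideal_r[OF I scal[OF False]] two_ideal_l[OF I two_ideal_sym[OF I idm]]
        by (intro two_ideal_add[OF I])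
      then show ?thesis by (simp add: algebra_simps)
    qed
    have word: "wrd w * ?d - ?d * wrd w * ?d \<in> I" for w
    proof (induction w)
      case Nil
      show ?case using two_ideal_sym[OF I idm[of d]] by (simp add: wrd_Nil)
    next
      case (Cons z w)
      have "wrd [z] * (wrd w * ?d - ?d * wrd w * ?d) + (wrd [z] * ?d - ?d * wrd [z] * ?d) * (wrd w * ?d)
          - ?d * wrd [z] * (wrd w * ?d - ?d * wrd w * ?d) \<in> I"
        by (intro two_ideal_diff[OF I] two_ideal_add[OF I] two_ideal_l[OF I Cons] two_ideal_r[OF I letter])
      then show ?case by (simp add: algebra_simps single_times)
    qed
    have "(1 - ?d) * t * ?d \<in> I" for t
    proof (induction t rule: poly_mapping_single_induct)
      case (add t w c)
      have "(1 - ?d) * Poly_Mapping.single w c * ?d = cst c * (wrd w * ?d - ?d * wrd w * ?d)"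
        by (simp add: algebra_simps single_times)
      then show ?case
        unfolding distrib_left distrib_right
        using two_ideal_add[OF I add(1) two_ideal_l[OF I word[of w], of "cst c"]] by simp
    qed (simp add: two_ideal_0[OF I])
    then have "1 - ?d \<in> I \<or> ?d \<in> I" by (rule maximal_two_ideal_prime[OF maxI])
    then show False using d two_ideal_sym[OF I, of 1 ?d] by (auto simp: S_def)
  qed
  \<comment> \<open>The mirror image of the preceding argument, with
    \<open>d R (1 - d) = 0\<close>.\<close>
  have inn: "\<exists>t\<in>S. (t, d) \<in> parcs G" if d: "d \<in> S" for d
  proof (rule ccontr)
    assume no: "\<not> ?thesis"
    let ?d = "wrd [d] :: 'v list \<Rightarrow>\<^sub>0 'k"
    have letter: "?d * wrd [z] - ?d * wrd [z] * ?d \<in> I" for z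
    proof (cases "z \<in> S")
      case True
      have "hk_class G [d, z] = hk_class G [d, z, d]"
      proof (cases "(d, z) \<in> parcs G")
        case True
        then show ?thesis by (rule sm[OF arc1])
      next
        case False
        have zd: "(z, d) \<notin> parcs G" using no True by auto
        have "hk_class G ([d] @ [z]) = hk_class G ([d, d] @ [z])" by (rule ctxr[OF sm[OF idem]])
        also have "[d, d] @ [z] = [d] @ [d, z]" by simp
        also have "hk_class G ([d] @ [d, z]) = hk_class G ([d] @ [z, d])" by (rule ctxl[OF comm[OF False zd]])
        finally show ?thesis by (simp only: append.simps)
      qed
      from cl[OF this] show ?thesis by (simp add: single_times)
    next
      case False
      have "(?d - ?d * ?d) * wrd [z] - ?d * (wrd [z] * ?d - ?d * wrd [z]) \<in> I"
        using two_ideal_l[OF I scal[OF False]] two_ideal_r[OF I two_ideal_sym[OF I idm]]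
        by (intro two_ideal_diff[OF I])
      then show ?thesis by (simp add: algebra_simps)
    qed
    have word: "?d * wrd w - ?d * wrd w * ?d \<in> I" for w
    proof (induction w rule: rev_induct)
      case Nil
      show ?case using two_ideal_sym[OF I idm[of d]] by (simp add: wrd_Nil)
    next
      case (snoc z w)
      have "(?d * wrd w - ?d * wrd w * ?d) * wrd [z] + (?d * wrd w) * (?d * wrd [z] - ?d * wrd [z] * ?d)
          - (?d * wrd w - ?d * wrd w * ?d) * (wrd [z] * ?d) \<in> I"
        by (intro two_ideal_diff[OF I] two_ideal_add[OF I] two_ideal_r[OF I snoc] two_ideal_l[OF I letter])
      then show ?case by (simp add: algebra_simps single_times)
    qed
    have "?d * t * (1 - ?d) \<in> I" for t
    proof (induction t rule: poly_mapping_single_induct)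
      case (add t w c)
      have "?d * Poly_Mapping.single w c * (1 - ?d) = cst c * (?d * wrd w - ?d * wrd w * ?d)"
        by (simp add: algebra_simps single_times)
      then show ?case
        unfolding distrib_left distrib_right
        using two_ideal_add[OF I add(1) two_ideal_l[OF I word[of w], of "cst c"]] by simp
    qed (simp add: two_ideal_0[OF I])
    then have "?d \<in> I \<or> 1 - ?d \<in> I" by (rule maximal_two_ideal_prime[OF maxI])
    then show False using d two_ideal_sym[OF I, of 1 ?d] by (auto simp: S_def)
  qed
  \<comment> \<open>If both ends were in \<open>S\<close>, then \<open>PI_no_bridge\<close>, applied
    to \<open>S\<close>, would put the arrow on a cycle. So one of the ends is central.\<close>
  have arc: "wrd [i, j] - wrd [j, i] \<in> I" if ij: "(i, j) \<in> parcs G" "(i, j) \<notin> parcs (cyclic_part G)" for i j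
  proof -
    have "\<not> (i \<in> S \<and> j \<in> S)"
      using PI_no_bridge[OF og PI ij(1) _ _ _ out inn] ij finite_subset[OF SV pair_finite_verts]
      by (auto simp: cyclic_part_arc_iff[OF og])
    then show ?thesis
      using scal[of i "wrd [j]"] two_ideal_sym[OF I scal[of j "wrd [i]"]] by (auto simp: single_times)
  qed
  show ?thesis
  proof (rule hk_eval_kernel[OF I _ _ x])
    fix u v assume uv: "(u, v) \<in> hk_relations (cyclic_part G)"
    have sub: "parcs (cyclic_part G) \<subseteq> parcs G" by (auto simp: cyclic_part_def)
    consider "(u, v) \<in> hk_relations G" | i j where "u = [i, j]" "v = [j, i]"
        "(i, j) \<in> parcs G" "(i, j) \<notin> parcs (cyclic_part G)"
      | i j where "u = [j, i]" "v = [i, j]" "(i, j) \<in> parcs G" "(i, j) \<notin> parcs (cyclic_part G)"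
      using uv sub unfolding hk_relations_def by (auto, blast)
    then show "wrd u - wrd v \<in> I"
    proof cases
      case 1
      then show ?thesis by (intro cl hk_relations_class) unfold_locales
    qed (use arc two_ideal_sym[OF I] in auto)
  qed (simp add: X1)
qed

lemma two_ideal_hk_kernel: "two_ideal {x :: 'v list \<Rightarrow>\<^sub>0 'k::field. hk_eval G x = 0}"
  using hk_eval_mult[of G _ _ "TYPE('k)"] by (auto simp: two_ideal_def hk_eval_add hk_algebra_def)

text \<open>Commuting idempotents satisfy the relations of an arrow in either direction, so the
  deletion of arrows only adds relations.\<close>

lemma hk_kernel_subset_cyclic:
  assumes og: "oriented_graph G" and x: "hk_eval G x = 0"
  shows "hk_eval (cyclic_part G) x = 0"
proof -
  interpret C: oriented_graph "cyclic_part G" by (rule oriented_graph_cyclic_part[OF og])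
  interpret hk_cong "parcs (cyclic_part G)" "\<lambda>u v. hk_class (cyclic_part G) u = hk_class (cyclic_part G) v"
    by (rule hk_cong_class) unfold_locales
  have "x \<in> {x. hk_eval (cyclic_part G) x = 0}"
  proof (rule hk_eval_kernel[OF two_ideal_hk_kernel _ _ x])
    fix u v assume uv: "(u, v) \<in> hk_relations G"
    have c: "hk_class (cyclic_part G) u = hk_class (cyclic_part G) v"
    proof -
      let ?c = "hk_class (cyclic_part G)"
      have nb: "?c [i, j, i] = ?c [i, j]" "?c [j, i, j] = ?c [i, j]"
        if "(i, j) \<notin> parcs (cyclic_part G)" "(j, i) \<notin> parcs (cyclic_part G)" for i j
        using ctxl[OF comm[OF that(2,1)], of "[i]"] ctxr[OF idem[of i], of "[j]"]
          ctxr[OF comm[OF that(2,1)], of "[j]"] ctxl[OF idem[of j], of "[i]"]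
        unfolding append.simps by (metis, metis)
      have no: "(j, i) \<notin> parcs (cyclic_part G)" if "(i, j) \<in> parcs G" for i j
        using oriented_graph.antiparallel_free[OF og that] by (auto simp: cyclic_part_def)
      have arc: "?c [i, j, i] = ?c [i, j] \<and> ?c [j, i, j] = ?c [i, j]" if "(i, j) \<in> parcs G" for i j
      proof (cases "(i, j) \<in> parcs (cyclic_part G)")
        case True
        then show ?thesis using arc1 arc2 by blast
      next
        case False
        then show ?thesis using nb no[OF that] by blast
      qed
      have non: "?c [i, j] = ?c [j, i]" if "(i, j) \<notin> parcs G" "(j, i) \<notin> parcs G" for i j
        by (rule comm) (use that in \<open>simp_all add: cyclic_part_def\<close>)
      from uv show ?thesis
      proof (cases rule: hk_relations_cases)
        case 1
        then show ?thesis by (simp only: idem)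
      next
        case 2
        show ?thesis unfolding 2(1,2) by (rule non[OF 2(3,4)])
      next
        case 3
        show ?thesis unfolding 3(1,2) by (rule conjunct1[OF arc[OF 3(3)]])
      next
        case 4
        show ?thesis unfolding 4(1,2) by (rule conjunct2[OF arc[OF 4(3)]])
      qed
    qed
    show "wrd u - wrd v \<in> {x. hk_eval (cyclic_part G) x = 0}" unfolding mem_Collect_eq hk_eval_diff hk_eval_simps c by simp
  next
    fix a assume "a \<notin> pverts G"
    then have "hk_class (cyclic_part G) [a] = hk_class (cyclic_part G) []" by (intro hk_class_outside) simp
    then show "wrd [a] - 1 \<in> {x. hk_eval (cyclic_part G) x = 0}"
      unfolding mem_Collect_eq hk_eval_diff hk_eval_simps wrd_Nil[symmetric] by simp
  qed
  then show ?thesis by simp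
qed

text \<open>The bijection is preimage in the free algebra followed by image: a maximal ideal pulled
  back from either algebra contains the kernel of the other.\<close>

lemma maximal_ideals_cyclic_part:
  fixes K :: "'k::field itself" and G :: "'v pair_pre_digraph"
  assumes og: "oriented_graph G" and PI: "PI_algebra (hk_algebra K G)"
  shows "\<exists>F. bij_betw F {J. maximalideal J (hk_algebra K G)} {J. maximalideal J (hk_algebra K (cyclic_part G))}"
proof -
  let ?h = "hk_eval G :: ('v list \<Rightarrow>\<^sub>0 'k) \<Rightarrow> _" and ?h' = "hk_eval (cyclic_part G) :: ('v list \<Rightarrow>\<^sub>0 'k) \<Rightarrow> _"
  interpret A: onto_hom ?h "hk_algebra K G" by (rule onto_hk_eval)
  interpret B: onto_hom ?h' "hk_algebra K (cyclic_part G)" by (rule onto_hk_eval)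
  have zA: "\<zero>\<^bsub>hk_algebra K G\<^esub> = 0" and zB: "\<zero>\<^bsub>hk_algebra K (cyclic_part G)\<^esub> = 0"
    by (simp_all add: hk_algebra_def)
  have kerA: "x \<in> ?h -` J" if "maximalideal J (hk_algebra K G)" "?h x = 0" for J x
    using A.ker_vimage[OF maximalideal.axioms(1)[OF that(1)]] that(2) by (simp add: zA)
  have kerAB: "x \<in> ?h -` J" if "maximalideal J (hk_algebra K G)" "?h' x = 0" for J x
    using maximal_contains_cyclic_kernel[OF og PI A.maximal_vimage[OF that(1)] kerA[OF that(1)] that(2)] .
  have kerB: "x \<in> ?h' -` J" if "maximalideal J (hk_algebra K (cyclic_part G))" "?h' x = 0" for J x
    using B.ker_vimage[OF maximalideal.axioms(1)[OF that(1)]] that(2) by (simp add: zB)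
  have kerBA: "x \<in> ?h' -` J" if "maximalideal J (hk_algebra K (cyclic_part G))" "?h x = 0" for J x
    using kerB[OF that(1) hk_kernel_subset_cyclic[OF og that(2)]] .
  have "bij_betw (\<lambda>J. ?h' ` (?h -` J)) {J. maximalideal J (hk_algebra K G)} {J. maximalideal J (hk_algebra K (cyclic_part G))}"
  proof (rule bij_betw_byWitness[where f' = "\<lambda>J. ?h ` (?h' -` J)"])
    show "\<forall>J\<in>{J. maximalideal J (hk_algebra K G)}. ?h ` (?h' -` (?h' ` (?h -` J))) = J"
      using B.vimage_image[OF A.two_ideal_vimage] A.image_vimage kerAB maximalideal.axioms(1) zB by fastforce
    show "\<forall>J\<in>{J. maximalideal J (hk_algebra K (cyclic_part G))}. ?h' ` (?h -` (?h ` (?h' -` J))) = J"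
      using A.vimage_image[OF B.two_ideal_vimage] B.image_vimage kerBA maximalideal.axioms(1) zA by fastforce
    show "(\<lambda>J. ?h' ` (?h -` J)) ` {J. maximalideal J (hk_algebra K G)} \<subseteq> {J. maximalideal J (hk_algebra K (cyclic_part G))}"
      using B.maximal_image[OF A.maximal_vimage] kerAB zB by auto
    show "(\<lambda>J. ?h ` (?h' -` J)) ` {J. maximalideal J (hk_algebra K (cyclic_part G))} \<subseteq> {J. maximalideal J (hk_algebra K G)}"
      using A.maximal_image[OF B.maximal_vimage] kerBA zA by auto
  qed
  then show ?thesis by blast
qed

section \<open>Maximal ideals of a disjoint union\<close>

lemma cst_left: "x * (cst c * y) = cst c * (x * y)"
  by (metis cst_comm mult.assoc)

definition klin :: "(('v list \<Rightarrow>\<^sub>0 'k::field) \<Rightarrow> 'k) \<Rightarrow> bool" where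
  "klin f \<longleftrightarrow> (\<forall>x y. f (x + y) = f x + f y) \<and> (\<forall>c x. f (cst c * x) = c * f x)"

lemma klinD: "klin f \<Longrightarrow> f (x + y) = f x + f y" "klin f \<Longrightarrow> f (cst c * x) = c * f x"
  "klin f \<Longrightarrow> f 0 = 0" "klin f \<Longrightarrow> f (Poly_Mapping.single w c) = c * f (wrd w)"
proof -
  show "klin f \<Longrightarrow> f 0 = 0" unfolding klin_def by (metis mult_zero_left mult_zero_right)
  show "klin f \<Longrightarrow> f (Poly_Mapping.single w c) = c * f (wrd w)" unfolding klin_def by (metis single_cst)
qed (auto simp: klin_def)

lemma klin_words:
  assumes f: "klin f" and z: "\<And>a b. f (wrd a * x * wrd b) = 0"
  shows "f (s * x * t) = 0"
proof -
  have w: "f (wrd a * x * t) = 0" for a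
  proof (induction t rule: poly_mapping_single_induct)
    case (add t b c)
    have "wrd a * x * Poly_Mapping.single b c = cst c * (wrd a * x * wrd b)"
      by (simp only: single_cst[of b c] cst_left mult.assoc)
    then show ?case using add by (simp add: distrib_left klinD(1-3)[OF f] z)
  qed (simp add: klinD(1-3)[OF f])
  show ?thesis
  proof (induction s rule: poly_mapping_single_induct)
    case (add s a c)
    have "Poly_Mapping.single a c * x * t = cst c * (wrd a * x * t)"
      by (simp only: single_cst[of a c] mult.assoc)
    then show ?case using add by (simp add: distrib_right klinD(1-3)[OF f] w)
  qed (simp add: klinD(1-3)[OF f])
qed

text \<open>This is the largest two-sided ideal inside the kernel of \<open>f\<close>.\<close>

lemma klin_two_ideal:
  assumes f: "klin f"
  shows "two_ideal {x. \<forall>s t. f (s * x * t) = 0}"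
  unfolding two_ideal_def
proof (intro conjI allI ballI)
  fix x a assume "a \<in> {x. \<forall>s t. f (s * x * t) = 0}"
  then have *: "f (s * a * t) = 0" for s t by simp
  show "x * a \<in> {x. \<forall>s t. f (s * x * t) = 0}" using *[of "s * x" for s] by (simp add: mult.assoc)
  show "a * x \<in> {x. \<forall>s t. f (s * x * t) = 0}" using *[of _ "x * t" for t] by (simp add: mult.assoc)
qed (auto simp: klinD(1-3)[OF f] distrib_left distrib_right)

context
  fixes I :: "('v list \<Rightarrow>\<^sub>0 'k::field) set" and e :: "'v list" and lam
  assumes I: "two_ideal I" and e: "wrd e \<notin> I" and lam: "\<And>x. wrd e * x * wrd e - cst (lam x) * wrd e \<in> I"
begin

text \<open>\<open>lam\<close> is given merely as a choice of scalars. As \<open>e\<close> is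
  outside \<open>I\<close>, the scalars are unique, and the linearity of \<open>lam\<close> follows
  from this.\<close>

lemma corner_unique:
  assumes "wrd e * x * wrd e - cst c * wrd e \<in> I"
  shows "lam x = c"
proof (rule ccontr)
  assume "lam x \<noteq> c"
  then have "c - lam x \<noteq> 0" by simp
  moreover have "cst (c - lam x) * wrd e \<in> I"
    using two_ideal_diff[OF I lam[of x] assms] by (simp add: cst_diff algebra_simps)
  ultimately show False using two_ideal_cst[OF I] e by blast
qed

lemma corner_klin: "klin lam"
  unfolding klin_def
proof (intro conjI allI)
  fix x y c
  show "lam (x + y) = lam x + lam y"
    by (rule corner_unique) (use two_ideal_plus[OF I lam[of x] lam[of y]] in \<open>simp add: cst_add algebra_simps\<close>)
  have "wrd e * (cst c * x) * wrd e = cst c * (wrd e * x * wrd e)" by (simp only: cst_left mult.assoc)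
  then show "lam (cst c * x) = c * lam x"
    using two_ideal_l[OF I lam[of x], of "cst c"]
    by (intro corner_unique) (simp only: cst_mult right_diff_distrib mult.assoc)
qed

lemma corner_null: "x \<in> I \<Longrightarrow> lam x = 0"
  by (rule corner_unique) (simp add: two_ideal_l[OF I] two_ideal_r[OF I])

lemma corner_cong: "x - y \<in> I \<Longrightarrow> lam x = lam y"
  using corner_null[of "x - y"] klinD(1)[OF corner_klin, of "x - y" y] by simp

end

lemma corner_one:
  assumes I: "two_ideal I" and e: "wrd e \<notin> I" and lam: "\<And>x. wrd e * x * wrd e - cst (lam x) * wrd e \<in> I"
    and ee: "wrd (e @ e) - wrd e \<in> I"
  shows "lam 1 = (1 :: 'k::field)"
  by (rule corner_unique[OF I e lam]) (use ee in \<open>simp add: single_times\<close>)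

lemma hk_eval_zero_classes:
  "hk_class G u = hk_class G v \<Longrightarrow> hk_eval G (wrd u - wrd v :: 'v list \<Rightarrow>\<^sub>0 'k::field) = 0"
  by (simp add: hk_eval_diff)

text \<open>What is retained of the connected components: they partition the vertices, inherit all
  arrows between their vertices, and no arrow joins two of them. Their numbering fixes the order of
  factors in products.\<close>

locale hk_components =
  fixes G :: "'v pair_pre_digraph" and C :: "nat \<Rightarrow> 'v pair_pre_digraph" and m :: nat
  assumes og: "oriented_graph G" and pgG: "permutation_graph G"
    and pgC: "i \<in> {1..m} \<Longrightarrow> permutation_graph (C i)"
    and disj: "i \<in> {1..m} \<Longrightarrow> j \<in> {1..m} \<Longrightarrow> x \<in> pverts (C i) \<Longrightarrow> x \<in> pverts (C j) \<Longrightarrow> i = j"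
    and cover: "pverts G = (\<Union>i\<in>{1..m}. pverts (C i))"
    and arcs: "i \<in> {1..m} \<Longrightarrow> (u, v) \<in> parcs (C i) \<longleftrightarrow> (u, v) \<in> parcs G \<and> u \<in> pverts (C i)"
    and sat: "i \<in> {1..m} \<Longrightarrow> (u, v) \<in> parcs G \<Longrightarrow> u \<in> pverts (C i) \<longleftrightarrow> v \<in> pverts (C i)"
begin

lemma wfG: "pair_wf_digraph G"
proof -
  interpret oriented_graph G by (rule og)
  show ?thesis by unfold_locales
qed

sublocale cl: hk_cong "parcs G" "\<lambda>u v. hk_class G u = hk_class G v"
  by (rule hk_cong_class[OF wfG])

abbreviation part :: "nat \<Rightarrow> 'v list \<Rightarrow> 'v list" where
  "part i \<equiv> filter (\<lambda>x. x \<in> pverts (C i))"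

abbreviation copart :: "nat \<Rightarrow> 'v list \<Rightarrow> 'v list" where
  "copart i \<equiv> filter (\<lambda>x. x \<notin> pverts (C i))"

text \<open>The retraction of the free algebra that sets all letters outside \<open>C i\<close> to
  1. It lifts the embedding of the algebra of \<open>C i\<close> as a tensor factor.\<close>

definition \<rho> :: "nat \<Rightarrow> ('v list \<Rightarrow>\<^sub>0 'k::field) \<Rightarrow> ('v list \<Rightarrow>\<^sub>0 'k)" where
  "\<rho> i = push (part i)"

lemma \<rho>_simps: "\<rho> i 0 = 0" "\<rho> i (Poly_Mapping.single w c) = Poly_Mapping.single (part i w) c"
  "\<rho> i (x + y) = \<rho> i x + \<rho> i y" "\<rho> i (x - y) = \<rho> i x - \<rho> i y" "\<rho> i 1 = 1"
  by (simp_all add: \<rho>_def push_add push_diff flip: wrd_Nil)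

lemma \<rho>_mult: "\<rho> i (x * y) = \<rho> i x * \<rho> i y"
proof (induction x rule: poly_mapping_single_induct)
  case (add x u a)
  have "\<rho> i (Poly_Mapping.single u a * y) = \<rho> i (Poly_Mapping.single u a) * \<rho> i y"
    by (induction y rule: poly_mapping_single_induct) (auto simp: \<rho>_simps distrib_left single_times)
  then show ?case using add by (simp add: \<rho>_simps distrib_right)
qed (simp add: \<rho>_simps)

lemma class_part: "hk_class (C i) (part i w) = hk_class (C i) w"
  by (simp add: hk_class_def)

text \<open>Erasing the letters outside a union of components turns a relation into a relation or a
  trivial equality. To conclude by \<open>hk_eval_kernel\<close>, words are regarded as elements of
  an algebra, over the rationals for definiteness, and classes are compared as basis
  elements.\<close>

lemma class_filter:
  assumes A: "\<And>u v. (u, v) \<in> parcs G \<Longrightarrow> u \<in> A \<longleftrightarrow> v \<in> A" and uv: "hk_class G u = hk_class G v"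
  shows "hk_class G (filter (\<lambda>x. x \<in> A) u) = hk_class G (filter (\<lambda>x. x \<in> A) v)"
proof -
  let ?f = "filter (\<lambda>x. x \<in> A)"
  have I: "two_ideal {x :: 'v list \<Rightarrow>\<^sub>0 rat. hk_eval G (push ?f x) = 0}"
  proof -
    have pm: "push ?f (x * y) = push ?f x * (push ?f y :: 'v list \<Rightarrow>\<^sub>0 rat)" for x y
    proof (induction x rule: poly_mapping_single_induct)
      case (add x u a)
      have "push ?f (Poly_Mapping.single u a * y) = push ?f (Poly_Mapping.single u a) * push ?f y"
        by (induction y rule: poly_mapping_single_induct) (auto simp: push_add distrib_left single_times)
      then show ?case using add by (simp add: push_add distrib_right)
    qed simp
    show ?thesis
      using two_ideal_hk_kernel[of G, where 'k = rat]
      by (auto simp: two_ideal_def push_add pm hk_eval_add)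
  qed
  have "wrd u - wrd v \<in> {x :: 'v list \<Rightarrow>\<^sub>0 rat. hk_eval G (push ?f x) = 0}"
  proof (rule hk_eval_kernel[OF I _ _ hk_eval_zero_classes[OF uv]])
    fix u v assume uv: "(u, v) \<in> hk_relations G"
    have "hk_class G (?f u) = hk_class G (?f v)"
      using uv
    proof (cases rule: hk_relations_cases)
      case (1 i)
      then show ?thesis using cl.idem[of i] by simp
    next
      case (2 i j)
      then show ?thesis using cl.comm[of i j] by simp
    next
      case (3 i j)
      then show ?thesis using cl.arc1[OF 3(3)] A[OF 3(3)] by simp
    next
      case (4 i j)
      then show ?thesis using cl.arc2[OF 4(3)] A[OF 4(3)] by simp
    qed
    then show "wrd u - wrd v \<in> {x :: 'v list \<Rightarrow>\<^sub>0 rat. hk_eval G (push ?f x) = 0}"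
      by (simp add: push_diff hk_eval_diff)
  next
    fix a assume "a \<notin> pverts G"
    then have "hk_class G (?f [a]) = hk_class G []" using hk_class_outside[of a G] by simp
    then show "wrd [a] - 1 \<in> {x :: 'v list \<Rightarrow>\<^sub>0 rat. hk_eval G (push ?f x) = 0}"
      by (simp add: push_diff hk_eval_diff flip: wrd_Nil)
  qed
  then have "Poly_Mapping.single (hk_class G (?f u)) (1::rat) = Poly_Mapping.single (hk_class G (?f v)) 1"
    by (simp add: push_diff hk_eval_diff)
  then show ?thesis by (metis keys_single singleton_inject zero_neq_one)
qed

lemma class_part_G: "i \<in> {1..m} \<Longrightarrow> hk_class G u = hk_class G v \<Longrightarrow> hk_class G (part i u) = hk_class G (part i v)"
  by (rule class_filter[OF sat])

lemma class_copart_G: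
  assumes "i \<in> {1..m}" "hk_class G u = hk_class G v"
  shows "hk_class G (copart i u) = hk_class G (copart i v)"
  using class_filter[of "- pverts (C i)", OF _ assms(2)] sat[OF assms(1)] by simp

text \<open>Relations of the component hold in the whole graph, and erasing the other letters leads
  back. So the monoid of a component is a submonoid of the whole one.\<close>

lemma class_component_iff:
  assumes i: "i \<in> {1..m}"
  shows "hk_class (C i) u = hk_class (C i) v \<longleftrightarrow> hk_class G (part i u) = hk_class G (part i v)"
proof
  interpret Ci: oriented_graph "C i" using pgC[OF i] by (simp add: permutation_graph_def)
  have wfC: "pair_wf_digraph (C i)" by unfold_locales
  have sub: "pverts (C i) \<subseteq> pverts G" using cover i by blast
  {
    assume uv: "hk_class (C i) u = hk_class (C i) v"
    have I: "two_ideal {x :: 'v list \<Rightarrow>\<^sub>0 rat. hk_eval G (\<rho> i x) = 0}"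
      using two_ideal_hk_kernel[of G, where 'k = rat] by (auto simp: two_ideal_def \<rho>_simps \<rho>_mult hk_eval_add)
    have "wrd u - wrd v \<in> {x :: 'v list \<Rightarrow>\<^sub>0 rat. hk_eval G (\<rho> i x) = 0}"
    proof (rule hk_eval_kernel[OF I _ _ hk_eval_zero_classes[OF uv]])
      fix u v assume uv: "(u, v) \<in> hk_relations (C i)"
      then have "(u, v) \<in> hk_relations G"
        using sub arcs[OF i] sat[OF i] unfolding hk_relations_def by blast
      moreover have "set u \<subseteq> pverts (C i)" "set v \<subseteq> pverts (C i)"
        using uv Ci.in_arcsD1 Ci.in_arcsD2 unfolding hk_relations_def by auto
      then have "part i u = u" "part i v = v" by (auto simp: filter_id_conv subset_iff)
      ultimately show "wrd u - wrd v \<in> {x :: 'v list \<Rightarrow>\<^sub>0 rat. hk_eval G (\<rho> i x) = 0}"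
        using hk_relations_class[OF _ wfG] by (simp add: \<rho>_simps hk_eval_diff)
    qed (simp add: \<rho>_simps hk_eval_diff flip: wrd_Nil)
    then have "Poly_Mapping.single (hk_class G (part i u)) (1::rat) = Poly_Mapping.single (hk_class G (part i v)) 1"
      by (simp add: \<rho>_simps hk_eval_diff)
    then show "hk_class G (part i u) = hk_class G (part i v)" by (metis keys_single singleton_inject zero_neq_one)
  }
  {
    assume uv: "hk_class G (part i u) = hk_class G (part i v)"
    interpret ci: hk_cong "parcs (C i)" "\<lambda>u v. hk_class (C i) u = hk_class (C i) v"
      by (rule hk_cong_class[OF wfC])
    have "wrd (part i u) - wrd (part i v) \<in> {x :: 'v list \<Rightarrow>\<^sub>0 rat. hk_eval (C i) x = 0}"
    proof (rule hk_eval_kernel[OF two_ideal_hk_kernel _ _ hk_eval_zero_classes[OF uv]])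
      fix u v assume uv: "(u, v) \<in> hk_relations G"
      have "hk_class (C i) (part i u) = hk_class (C i) (part i v)"
        using uv
      proof (cases rule: hk_relations_cases)
        case (1 a)
        then show ?thesis using ci.idem[of a] by simp
      next
        case (2 a b)
        then show ?thesis using ci.comm[of a b] arcs[OF i] by simp
      next
        case (3 a b)
        then show ?thesis using ci.arc1[of a b] sat[OF i 3(3)] arcs[OF i, of a b] by simp
      next
        case (4 a b)
        then show ?thesis using ci.arc2[of a b] sat[OF i 4(3)] arcs[OF i, of a b] by simp
      qed
      then show "wrd u - wrd v \<in> {x :: 'v list \<Rightarrow>\<^sub>0 rat. hk_eval (C i) x = 0}"
        by (simp add: hk_eval_diff class_part)
    next
      fix a assume "a \<notin> pverts G"
      then have "hk_class (C i) [a] = hk_class (C i) []" using sub by (intro hk_class_outside) auto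
      then show "wrd [a] - 1 \<in> {x :: 'v list \<Rightarrow>\<^sub>0 rat. hk_eval (C i) x = 0}"
        by (simp add: hk_eval_diff flip: wrd_Nil)
    qed
    then have "Poly_Mapping.single (hk_class (C i) u) (1::rat) = Poly_Mapping.single (hk_class (C i) v) 1"
      by (simp add: hk_eval_diff class_part)
    then show "hk_class (C i) u = hk_class (C i) v" by (metis keys_single singleton_inject zero_neq_one)
  }
qed

lemma class_to_component:
  "i \<in> {1..m} \<Longrightarrow> hk_class G u = hk_class G v \<Longrightarrow> hk_class (C i) u = hk_class (C i) v"
  using class_component_iff class_part_G by blast

lemma class_commute:
  assumes i: "i \<in> {1..m}" and u: "set u \<subseteq> pverts (C i)" and w: "set w \<inter> pverts (C i) = {}"
  shows "hk_class G (u @ w) = hk_class G (w @ u)"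
  using u
proof (induction u)
  case (Cons a u)
  have letter: "hk_class G (a # w) = hk_class G (w @ [a])"
    using w
  proof (induction w)
    case (Cons b w)
    have "(a, b) \<notin> parcs G" "(b, a) \<notin> parcs G" using sat[OF i] Cons.prems \<open>set (a # u) \<subseteq> pverts (C i)\<close> by auto
    then have "hk_class G ([a, b] @ w) = hk_class G ([b, a] @ w)" by (intro cl.ctxr cl.comm)
    also have "[b, a] @ w = [b] @ (a # w)" by simp
    also have "hk_class G ([b] @ (a # w)) = hk_class G ([b] @ (w @ [a]))"
      by (rule cl.ctxl) (use Cons in auto)
    finally show ?case by simp
  qed simp
  have "hk_class G ([a] @ (u @ w)) = hk_class G ([a] @ (w @ u))"
    by (rule cl.ctxl) (use Cons in auto)
  also have "[a] @ (w @ u) = (a # w) @ u" by simp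
  also have "hk_class G ((a # w) @ u) = hk_class G ((w @ [a]) @ u)" by (rule cl.ctxr[OF letter])
  finally show ?case by simp
qed simp

lemma class_split:
  assumes i: "i \<in> {1..m}"
  shows "hk_class G w = hk_class G (part i w @ copart i w)"
proof (induction w)
  case (Cons a w)
  have *: "hk_class G ([a] @ w) = hk_class G ([a] @ part i w @ copart i w)" by (rule cl.ctxl[OF Cons])
  show ?case
  proof (cases "a \<in> pverts (C i)")
    case False
    have "hk_class G ([a] @ part i w) = hk_class G (part i w @ [a])"
      by (rule class_commute[OF i, symmetric]) (use False in auto)
    then have "hk_class G (([a] @ part i w) @ copart i w) = hk_class G ((part i w @ [a]) @ copart i w)"
      by (rule cl.ctxr)
    then show ?thesis using * False by simp
  qed (use * in simp)
qed simp

text \<open>Letters of different components commute, so the parts are split off one after the other.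
  The induction concerns the letters that lie in none of the first \<open>k\<close>
  components.\<close>

lemma class_concat:
  "hk_class G w = hk_class G (concat (map (\<lambda>i. part i w) [1..<Suc m]))"
proof -
  have "hk_class G (filter (\<lambda>x. \<forall>i\<in>{1..k}. x \<notin> pverts (C i)) w) = hk_class G (concat (map (\<lambda>i. part i w) [Suc k..<Suc m]))"
    if "k \<le> m" for k
    using that
  proof (induction k rule: inc_induct)
    case base
    have "filter (\<lambda>x. \<forall>i\<in>{1..m}. x \<notin> pverts (C i)) w = filter (\<lambda>x. x \<notin> pverts G) w"
      by (rule filter_cong) (auto simp: cover)
    then show ?case by (simp add: hk_class_def)
  next
    case (step k)
    let ?w = "filter (\<lambda>x. \<forall>i\<in>{1..k}. x \<notin> pverts (C i)) w"
    have i: "Suc k \<in> {1..m}" using step.hyps by auto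
    have p: "part (Suc k) ?w = part (Suc k) w"
      using disj[OF i] step.hyps by (auto simp: filter_filter intro!: filter_cong) fastforce
    have q: "copart (Suc k) ?w = filter (\<lambda>x. \<forall>i\<in>{1..Suc k}. x \<notin> pverts (C i)) w"
      unfolding filter_filter by (rule filter_cong) (auto simp: atLeastAtMostSuc_conv)
    have "hk_class G ?w = hk_class G (part (Suc k) w @ filter (\<lambda>x. \<forall>i\<in>{1..Suc k}. x \<notin> pverts (C i)) w)"
      using class_split[OF i, of ?w] by (simp only: p q)
    also have "\<dots> = hk_class G (part (Suc k) w @ concat (map (\<lambda>i. part i w) [Suc (Suc k)..<Suc m]))"
      by (rule cl.ctxl[OF step.IH])
    also have "part (Suc k) w @ concat (map (\<lambda>i. part i w) [Suc (Suc k)..<Suc m]) = concat (map (\<lambda>i. part i w) [Suc k..<Suc m])"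
    proof -
      have "[Suc k..<Suc m] = Suc k # [Suc (Suc k)..<Suc m]" using step.hyps by (intro upt_conv_Cons) simp
      then show ?thesis by (simp only: list.map concat.simps)
    qed
    finally show ?case .
  qed
  from this[of 0] show ?thesis by simp
qed

lemma part_part: "i \<in> {1..m} \<Longrightarrow> j \<in> {1..m} \<Longrightarrow> part i (part j w) = (if i = j then part i w else [])"
proof (cases "i = j")
  case False
  assume "i \<in> {1..m}" "j \<in> {1..m}"
  then have "x \<notin> pverts (C i) \<or> x \<notin> pverts (C j)" for x using disj False by blast
  then show ?thesis using False by (auto simp: filter_empty_conv)
qed simp

lemma part_concat:
  assumes i: "i \<in> {1..m}"
  shows "part i (concat (map (\<lambda>j. part j (e j)) [1..<Suc m])) = part i (e i)"
proof -
  have "part i (concat (map (\<lambda>j. part j (e j)) is)) = concat (map (\<lambda>j. part i (part j (e j))) is)" for "is"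
    by (simp add: filter_concat comp_def)
  then have "part i (concat (map (\<lambda>j. part j (e j)) [1..<Suc m])) = concat (map (\<lambda>j. if i = j then part i (e i) else []) [1..<Suc m])"
    using i part_part[OF i] by (auto intro!: arg_cong[where f = concat] map_cong)
  also have "concat (map (\<lambda>j. if i = j then part i (e i) else []) [1..<Suc m]) = part i (e i)"
  proof -
    have upt: "[1..<Suc m] = [1..<i] @ i # [Suc i..<Suc m]"
      using i upt_add_eq_append[of 1 i "Suc m - i"] upt_conv_Cons[of i "Suc m"] by (simp del: upt_Suc)
    have z: "concat (map (\<lambda>j. if i = j then part i (e i) else []) xs) = []" if "i \<notin> set xs" for xs
      using that by (induction xs) auto
    have "concat (map (\<lambda>j. if i = j then part i (e i) else []) [1..<i]) = []"
      "concat (map (\<lambda>j. if i = j then part i (e i) else []) [Suc i..<Suc m]) = []"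
      by (rule z, simp)+
    then show ?thesis by (simp only: upt map_append concat_append list.map concat.simps if_True append_Nil append_Nil2) simp
  qed
  finally show ?thesis .
qed

lemma kernel_part:
  assumes "i \<in> {1..m}" "\<And>x. hk_eval (C i) x = 0 \<Longrightarrow> x \<in> I"
  shows "(x :: 'v list \<Rightarrow>\<^sub>0 'k::field) - \<rho> i x \<in> I"
proof (rule assms(2))
  show "hk_eval (C i) (x - \<rho> i x) = 0"
    by (simp add: hk_eval_diff hk_eval_def \<rho>_def push_push class_part push_diff)
qed

lemma kernel_restrict:
  assumes "i \<in> {1..m}" "hk_eval (C i) (x :: 'v list \<Rightarrow>\<^sub>0 'k::field) = 0"
  shows "hk_eval G (\<rho> i x) = 0"
proof -
  have I: "two_ideal {x :: 'v list \<Rightarrow>\<^sub>0 'k. hk_eval G (\<rho> i x) = 0}"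
    using two_ideal_hk_kernel[of G, where 'k = 'k] by (auto simp: two_ideal_def \<rho>_simps \<rho>_mult hk_eval_add)
  interpret Ci: oriented_graph "C i" using pgC[OF assms(1)] by (simp add: permutation_graph_def)
  have wfC: "pair_wf_digraph (C i)" by unfold_locales
  have "x \<in> {x. hk_eval G (\<rho> i x) = 0}"
  proof (rule hk_eval_kernel[OF I _ _ assms(2)])
    show "wrd u - wrd v \<in> {x. hk_eval G (\<rho> i x) = 0}" if "(u, v) \<in> hk_relations (C i)" for u v
      using hk_relations_class[OF that wfC] class_component_iff[OF assms(1)] by (simp add: \<rho>_simps hk_eval_diff)
  qed (simp add: \<rho>_simps hk_eval_diff flip: wrd_Nil)
  then show ?thesis by simp
qed

text \<open>The functional of a corner is multiplicative over the components; slicing along the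
  complement of the component \<open>C i\<close> therefore maps a maximal ideal into its part over \<open>C i\<close>.\<close>

lemma maximal_part:
  fixes J :: "('v list \<Rightarrow>\<^sub>0 'k::alg_closed_field) set"
  assumes maxJ: "maximal_two_ideal J" and ker: "\<And>x. hk_eval G x = 0 \<Longrightarrow> x \<in> J" and i: "i \<in> {1..m}"
  shows "maximal_two_ideal {x. \<rho> i x \<in> J}" "\<And>x. hk_eval (C i) x = 0 \<Longrightarrow> x \<in> {x. \<rho> i x \<in> J}"
proof -
  note J = maximal_two_idealD(1)[OF maxJ]
  define P where "P = {x. \<rho> i x \<in> J}"
  have P: "two_ideal P"
    by (auto simp: P_def two_ideal_def \<rho>_simps \<rho>_mult two_ideal_0[OF J] two_ideal_add[OF J]
        two_ideal_l[OF J] two_ideal_r[OF J])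
  have kerP: "x \<in> P" if "hk_eval (C i) x = 0" for x
    using kernel_restrict[OF i that] ker by (simp add: P_def)
  have cong: "wrd u - wrd v \<in> J" if "hk_class G u = hk_class G v" for u v
    by (rule ker[OF hk_eval_zero_classes[OF that]])
  obtain e lam where ee: "hk_class G (e @ e) = hk_class G e" and e: "wrd e \<notin> J"
    and lam: "\<And>x. wrd e * x * wrd e - cst (lam x) * wrd e \<in> J"
    using corner_hk[OF pgG maxJ ker] by blast
  note kl = corner_klin[OF J e lam]
  have lam_cong: "lam (wrd u) = lam (wrd v)" if "hk_class G u = hk_class G v" for u v
    by (rule corner_cong[OF J e lam cong[OF that]])
  have lam1: "lam 1 = 1" by (rule corner_one[OF J e lam cong[OF ee]])
  \<comment> \<open>\<open>e\<close> is the product of commuting idempotents, \<open>a\<close> over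
    the component and \<open>b\<close> over the rest. Both \<open>e u w e\<close> and
    \<open>e u e w e\<close> reduce to the product of \<open>a u a\<close> and
    \<open>b w b\<close>.\<close>
  have lam_mult: "lam (wrd (u @ w)) = lam (wrd u) * lam (wrd w)"
    if u: "set u \<subseteq> pverts (C i)" and w: "set w \<inter> pverts (C i) = {}" for u w
  proof (rule corner_unique[OF J e lam])
    define a where "a = part i e"
    define b where "b = copart i e"
    have aa: "hk_class G (a @ a) = hk_class G a"
      using class_part_G[OF i ee] by (simp add: a_def)
    have bb: "hk_class G (b @ b) = hk_class G b"
      using class_copart_G[OF i ee] by (simp add: b_def)
    have com: "hk_class G (x @ y) = hk_class G (y @ x)" if "set x \<subseteq> pverts (C i)" "set y \<inter> pverts (C i) = {}" for x y
      by (rule class_commute[OF i that])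
    have sa: "set a \<subseteq> pverts (C i)" and sb: "set b \<inter> pverts (C i) = {}" by (auto simp: a_def b_def)
    have split: "hk_class G x = hk_class G (part i x @ copart i x)" for x by (rule class_split[OF i])
    have pu: "part i u = u" "copart i u = []" "part i w = []" "copart i w = w"
      using u w by (auto simp: filter_id_conv filter_empty_conv)
    have "hk_class G (e @ (u @ w) @ e) = hk_class G ((a @ u @ a) @ (b @ w @ b))"
      using split[of "e @ (u @ w) @ e"] pu by (simp add: a_def b_def)
    also have "\<dots> = hk_class G ((a @ u @ (a @ a)) @ ((b @ b) @ w @ b))"
      by (intro hk_class_append) (simp_all add: aa bb)
    also have "\<dots> = hk_class G (e @ u @ e @ w @ e)"
    proof -
      have "hk_class G (e @ u @ e @ w @ e) = hk_class G ((a @ u @ a @ a) @ (b @ b @ w @ b))"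
        using split[of "e @ u @ e @ w @ e"] pu by (simp add: a_def b_def)
      then show ?thesis by simp
    qed
    finally have eq: "hk_class G (e @ (u @ w) @ e) = hk_class G (e @ u @ e @ w @ e)" .
    have eee: "hk_class G (e @ u @ e @ w @ e) = hk_class G ((e @ u @ e) @ (e @ w @ e))"
    proof -
      have "hk_class G ((e @ u) @ e @ (w @ e)) = hk_class G ((e @ u) @ (e @ e) @ (w @ e))"
        by (rule cl.ctx[OF ee[symmetric]])
      then show ?thesis by simp
    qed
    have "wrd (e @ (u @ w) @ e) - wrd ((e @ u @ e) @ (e @ w @ e)) \<in> J"
      using eq eee by (intro cong) simp
    then have "wrd e * wrd (u @ w) * wrd e - (wrd e * wrd u * wrd e) * (wrd e * wrd w * wrd e) \<in> J"
      by (simp add: single_times)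
    moreover have "(wrd e * wrd u * wrd e) * (wrd e * wrd w * wrd e) - (cst (lam (wrd u)) * wrd e) * (cst (lam (wrd w)) * wrd e) \<in> J"
      by (rule two_ideal_mult[OF J lam lam])
    moreover have "(cst (lam (wrd u)) * wrd e) * (cst (lam (wrd w)) * wrd e) - cst (lam (wrd u) * lam (wrd w)) * wrd e \<in> J"
      using two_ideal_l[OF J cong[OF ee], of "cst (lam (wrd u) * lam (wrd w))"]
      by (simp add: right_diff_distrib single_times)
    ultimately show "wrd e * wrd (u @ w) * wrd e - cst (lam (wrd u) * lam (wrd w)) * wrd e \<in> J"
      using two_ideal_trans[OF J] by blast
  qed
  have lam_split: "lam (wrd w) = lam (wrd (part i w)) * lam (wrd (copart i w))" for w
  proof -
    have "lam (wrd w) = lam (wrd (part i w @ copart i w))" by (rule lam_cong[OF class_split[OF i]])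
    also have "\<dots> = lam (wrd (part i w)) * lam (wrd (copart i w))" by (rule lam_mult) auto
    finally show ?thesis .
  qed
  \<comment> \<open>\<open>f\<close> applies \<open>lam\<close> to the letters outside
    \<open>C i\<close> and keeps the others.\<close>
  define f where "f x = (\<Sum>w\<in>Poly_Mapping.keys x.
      Poly_Mapping.single (part i w) (Poly_Mapping.lookup x w * lam (wrd (copart i w))))" for x
  have f_single: "f (Poly_Mapping.single w c) = Poly_Mapping.single (part i w) (c * lam (wrd (copart i w)))" for w c
    by (cases "c = 0") (auto simp: f_def)
  have f_add: "f (x + y) = f x + f y" for x y
    unfolding f_def by (rule setsum_keys_plus_distrib) (auto simp: distrib_right single_add)
  have f0: "f 0 = 0" by (simp add: f_def)
  \<comment> \<open>By primeness, \<open>J\<close> is detected by \<open>lam\<close>.\<close>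
  have lamJ: "y \<in> J" if "\<And>s t. lam (s * y * t) = 0" for y
  proof -
    have *: "wrd e * (s * y * t) * wrd e \<in> J" for s t
      using lam[of "s * y * t"] that by simp
    have "(wrd e * s * y) * t * wrd e \<in> J" for s t using *[of s t] by (simp add: mult.assoc)
    then have "wrd e * s * y \<in> J" for s using maximal_two_ideal_prime[OF maxJ] e by blast
    then show ?thesis using maximal_two_ideal_prime[OF maxJ] e by blast
  qed
  \<comment> \<open>Testing \<open>f x\<close> by words amounts to testing \<open>x\<close> by their
    parts over the component; hence \<open>f\<close> maps \<open>J\<close> into
    \<open>J\<close>.\<close>
  have f_slice: "lam (wrd u * f x * wrd v) = lam (wrd (copart i (u @ v))) * lam (wrd (part i u) * x * wrd (part i v))" for u v x
  proof (induction x rule: poly_mapping_single_induct)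
    case zero
    show ?case by (simp add: f0 klinD(3)[OF kl])
  next
    case (add x w c)
    have "lam (wrd u * f (Poly_Mapping.single w c) * wrd v)
        = (c * lam (wrd (copart i w))) * lam (wrd (u @ part i w @ v))"
      using klinD(4)[OF kl, of "u @ part i w @ v" "c * lam (wrd (copart i w))"]
      by (simp add: f_single single_times)
    moreover have "lam (wrd (part i u) * Poly_Mapping.single w c * wrd (part i v)) = c * lam (wrd (part i u @ w @ part i v))"
      using klinD(4)[OF kl, of "part i u @ w @ part i v" c] by (simp add: single_times)
    ultimately have "lam (wrd u * f (Poly_Mapping.single w c) * wrd v)
        = lam (wrd (copart i (u @ v))) * lam (wrd (part i u) * Poly_Mapping.single w c * wrd (part i v))"
      using lam_split[of "u @ part i w @ v"] lam_split[of "part i u @ w @ part i v"] by simp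
    then show ?case using add by (simp add: f_add distrib_left distrib_right klinD(1)[OF kl])
  qed
  have fJ: "f x \<in> P" if "x \<in> J" for x
  proof -
    have "lam (wrd u * f x * wrd v) = 0" for u v
    proof -
      have "wrd (part i u) * x * wrd (part i v) \<in> J" by (rule two_ideal_r[OF J two_ideal_l[OF J that]])
      then have "lam (wrd (part i u) * x * wrd (part i v)) = 0" by (rule corner_null[OF J e lam])
      then show ?thesis unfolding f_slice by simp
    qed
    then have "lam (s * f x * t) = 0" for s t by (rule klin_words[OF kl])
    then have "f x \<in> J" by (rule lamJ)
    moreover have "\<rho> i (f x) = f x"
      by (induction x rule: poly_mapping_single_induct) (auto simp: f0 \<rho>_simps f_add f_single)
    ultimately show ?thesis by (simp add: P_def)
  qed
  have f_part: "f (s * \<rho> i a * t) \<in> Q" if Q: "two_ideal Q" "\<rho> i a \<in> Q" for Q s a t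
  proof -
    have w: "f (Poly_Mapping.single u c * \<rho> i a * Poly_Mapping.single v d)
        = cst (c * d * lam (wrd (copart i (u @ v)))) * (wrd (part i u) * \<rho> i a * wrd (part i v))" for u v c d
    proof (induction a rule: poly_mapping_single_induct)
      case (add a w k)
      have "f (Poly_Mapping.single u c * \<rho> i (Poly_Mapping.single w k) * Poly_Mapping.single v d)
        = cst (c * d * lam (wrd (copart i (u @ v)))) * (wrd (part i u) * \<rho> i (Poly_Mapping.single w k) * wrd (part i v))"
        by (simp add: \<rho>_simps single_times f_single mult_ac)
      then show ?case using add by (simp add: \<rho>_simps f_add distrib_left distrib_right)
    qed (simp add: \<rho>_simps f0)
    have "f (Poly_Mapping.single u c * \<rho> i a * t) \<in> Q" for u c
    proof (induction t rule: poly_mapping_single_induct)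
      case (add t v d)
      have "f (Poly_Mapping.single u c * \<rho> i a * Poly_Mapping.single v d) \<in> Q"
        unfolding w by (rule two_ideal_l[OF Q(1) two_ideal_r[OF Q(1) two_ideal_l[OF Q]]])
      then show ?case using add two_ideal_add[OF Q(1)] by (simp add: distrib_left f_add)
    qed (simp add: f0 two_ideal_0[OF Q(1)])
    then show ?thesis
      by (induction s rule: poly_mapping_single_induct)
        (auto simp: distrib_right f_add f0 two_ideal_0[OF Q(1)] intro: two_ideal_add[OF Q(1)])
  qed
  have "maximal_two_ideal P"
    unfolding maximal_two_ideal_def
  proof (intro conjI allI impI)
    show "two_ideal P" by (rule P)
    show "1 \<notin> P" using maximal_two_idealD(2)[OF maxJ] by (simp add: P_def \<rho>_simps)
    fix Q assume Q: "two_ideal Q" "P \<subseteq> Q" "1 \<notin> Q"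
    show "Q = P"
    proof (rule ccontr)
      assume "Q \<noteq> P"
      then obtain a where a: "a \<in> Q" "a \<notin> P" using Q(2) by blast
      have "a - \<rho> i a \<in> P" by (rule kernel_part[OF i kerP])
      then have raQ: "\<rho> i a \<in> Q" using two_ideal_cong[OF Q(1), of a "\<rho> i a"] Q(2) a(1) by blast
      \<comment> \<open>If \<open>Q\<close> is strictly larger than \<open>P\<close>, this ideal is
        strictly larger than \<open>J\<close> and so contains 1, which puts \<open>f 1 = 1\<close>
        into \<open>Q\<close>.\<close>
      define L where "L = {x. \<forall>s t. f (s * x * t) \<in> Q}"
      have "two_ideal L"
        unfolding two_ideal_def
      proof (intro conjI ballI allI)
        fix x y assume "y \<in> L"
        then have y: "f (s * y * t) \<in> Q" for s t by (simp add: L_def)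
        show "x * y \<in> L" using y[of "s * x" for s] by (simp add: L_def mult.assoc)
        show "y * x \<in> L" using y[of _ "x * t" for t] by (simp add: L_def mult.assoc)
      qed (auto simp: L_def f0 f_add distrib_left distrib_right two_ideal_0[OF Q(1)] two_ideal_add[OF Q(1)])
      moreover have "J \<subseteq> L"
      proof
        fix x assume "x \<in> J"
        then have "s * x * t \<in> J" for s t by (rule two_ideal_r[OF J two_ideal_l[OF J]])
        then show "x \<in> L" using fJ Q(2) by (auto simp: L_def)
      qed
      moreover have "\<rho> i a \<in> L" using f_part[OF Q(1) raQ] by (simp add: L_def)
      moreover have "\<rho> i a \<notin> J" using a(2) by (simp add: P_def)
      ultimately have "1 \<in> L" using maximal_two_idealD(3)[OF maxJ] by blast
      then have "f (1 * 1 * 1) \<in> Q" unfolding L_def by blast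
      moreover have "f 1 = 1" using f_single[of "[]" 1] lam1 by (simp add: wrd_Nil)
      ultimately show False using Q(3) by simp
    qed
  qed
  then show "maximal_two_ideal {x. \<rho> i x \<in> J}" "\<And>x. hk_eval (C i) x = 0 \<Longrightarrow> x \<in> {x. \<rho> i x \<in> J}"
    using kerP by (simp_all add: P_def)
qed

text \<open>\<open>S\<close> is the ideal generated by the kernel and the images of the
  \<open>I i\<close>; this is expressed by \<open>min\<close> because \<open>S\<close> will be given
  in terms of tensors. The product \<open>ew\<close> of the words \<open>e i\<close> has a
  one-dimensional corner modulo \<open>S\<close>, with functional \<open>\<Lambda>\<close>, and
  together with \<open>S\<close> it generates everything.\<close>

lemma maximal_generated:
  fixes I :: "nat \<Rightarrow> ('v list \<Rightarrow>\<^sub>0 'k::alg_closed_field) set"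
  assumes maxI: "\<And>i. i \<in> {1..m} \<Longrightarrow> maximal_two_ideal (I i)"
    and kerI: "\<And>i x. i \<in> {1..m} \<Longrightarrow> hk_eval (C i) x = 0 \<Longrightarrow> x \<in> I i"
    and S: "two_ideal S" "\<And>x. hk_eval G x = 0 \<Longrightarrow> x \<in> S" "\<And>i x. i \<in> {1..m} \<Longrightarrow> x \<in> I i \<Longrightarrow> \<rho> i x \<in> S"
    and min: "\<And>L. two_ideal L \<Longrightarrow> (\<And>x. hk_eval G x = 0 \<Longrightarrow> x \<in> L) \<Longrightarrow>
      (\<And>i x. i \<in> {1..m} \<Longrightarrow> x \<in> I i \<Longrightarrow> \<rho> i x \<in> L) \<Longrightarrow> S \<subseteq> L"
  shows "maximal_two_ideal S"
proof -
  note I = maximal_two_idealD(1)[OF maxI]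
  have "\<forall>i\<in>{1..m}. \<exists>e lam. hk_class (C i) (e @ e) = hk_class (C i) e \<and> wrd e \<notin> I i
      \<and> (\<forall>x. wrd e * x * wrd e - cst (lam x) * wrd e \<in> I i)"
    using corner_hk[OF pgC maxI kerI] by blast
  then obtain e lam where ee: "\<And>i. i \<in> {1..m} \<Longrightarrow> hk_class (C i) (e i @ e i) = hk_class (C i) (e i)"
    and e: "\<And>i. i \<in> {1..m} \<Longrightarrow> wrd (e i) \<notin> I i"
    and lam: "\<And>i x. i \<in> {1..m} \<Longrightarrow> wrd (e i) * x * wrd (e i) - cst (lam i x) * wrd (e i) \<in> I i"
    by metis
  note kl = corner_klin[OF I e lam]
  have congI: "wrd u - wrd v \<in> I i" if "i \<in> {1..m}" "hk_class (C i) u = hk_class (C i) v" for i u v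
    by (rule kerI[OF that(1) hk_eval_zero_classes[OF that(2)]])
  have congS: "wrd u - wrd v \<in> S" if "hk_class G u = hk_class G v" for u v
    by (rule S(2)[OF hk_eval_zero_classes[OF that]])
  have lam_cong: "lam i (wrd u) = lam i (wrd v)" if "i \<in> {1..m}" "hk_class (C i) u = hk_class (C i) v" for i u v
    by (rule corner_cong[OF I e lam congI[OF that]]) (use that in auto)
  have lam1: "lam i 1 = 1" if "i \<in> {1..m}" for i
    by (rule corner_one[OF I e lam congI[OF that ee]]) (use that in auto)
  \<comment> \<open>The tensor product of the functionals \<open>lam i\<close>, written on
    words.\<close>
  define \<Lambda> where "\<Lambda> x = (\<Sum>w\<in>Poly_Mapping.keys x. Poly_Mapping.lookup x w * (\<Prod>i\<in>{1..m}. lam i (wrd w)))" for x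
  have \<Lambda>_single: "\<Lambda> (Poly_Mapping.single w c) = c * (\<Prod>i\<in>{1..m}. lam i (wrd w))" for w c
    by (cases "c = 0") (auto simp: \<Lambda>_def)
  have \<Lambda>_add: "\<Lambda> (x + y) = \<Lambda> x + \<Lambda> y" for x y
    unfolding \<Lambda>_def by (rule setsum_keys_plus_distrib) (auto simp: distrib_right)
  have \<Lambda>0: "\<Lambda> 0 = 0" by (simp add: \<Lambda>_def)
  have kl\<Lambda>: "klin \<Lambda>"
    unfolding klin_def
  proof (intro conjI allI)
    show "\<Lambda> (cst c * x) = c * \<Lambda> x" for c x
      by (induction x rule: poly_mapping_single_induct)
        (auto simp: \<Lambda>0 \<Lambda>_add \<Lambda>_single distrib_left single_times)
  qed (rule \<Lambda>_add)
  define ew where "ew = concat (map (\<lambda>i. part i (e i)) [1..<Suc m])"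
  have part_ew: "part i ew = part i (e i)" if "i \<in> {1..m}" for i
    unfolding ew_def by (rule part_concat[OF that])
  have corner_word: "wrd ew * wrd w * wrd ew - cst (\<Lambda> (wrd w)) * wrd ew \<in> S" for w
  proof -
    have "hk_class G (ew @ w @ ew) = hk_class G (concat (map (\<lambda>i. part i (ew @ w @ ew)) [1..<Suc m]))"
      by (rule class_concat)
    also have "map (\<lambda>i. part i (ew @ w @ ew)) [1..<Suc m] = map (\<lambda>i. part i (e i @ w @ e i)) [1..<Suc m]"
      by (rule map_cong) (auto simp: part_ew)
    finally have 1: "wrd (ew @ w @ ew) - wrd (concat (map (\<lambda>i. part i (e i @ w @ e i)) [1..<Suc m])) \<in> S"
      by (rule congS)
    have 2: "wrd (concat (map (\<lambda>i. part i (e i @ w @ e i)) is))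
        - cst (\<Prod>i\<leftarrow>is. lam i (wrd w)) * wrd (concat (map (\<lambda>i. part i (e i)) is)) \<in> S"
      if "set is \<subseteq> {1..m}" for "is"
      using that
    proof (induction "is")
      case Nil
      then show ?case by (simp add: cst_1 two_ideal_0[OF S(1)])
    next
      case (Cons i "is")
      have i: "i \<in> {1..m}" using Cons.prems by simp
      have "\<rho> i (wrd (e i) * wrd w * wrd (e i) - cst (lam i (wrd w)) * wrd (e i)) \<in> S"
        by (rule S(3)[OF i lam[OF i]])
      then have "wrd (part i (e i @ w @ e i)) - cst (lam i (wrd w)) * wrd (part i (e i)) \<in> S"
        by (simp add: \<rho>_simps single_times)
      from two_ideal_mult[OF S(1) this Cons.IH] show ?case using Cons.prems
        by (simp add: single_times)
    qed
    have 3: "(\<Prod>i\<leftarrow>[1..<Suc m]. lam i (wrd w)) = \<Lambda> (wrd w)"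
      unfolding \<Lambda>_single by (simp add: prod.distinct_set_conv_list[symmetric] atLeastLessThanSuc_atLeastAtMost del: upt_Suc)
    show ?thesis
    proof -
      have "set [1..<Suc m] \<subseteq> {1..m}" by auto
      from two_ideal_trans[OF S(1) 1 2[OF this]] show ?thesis
        unfolding 3 ew_def[symmetric] by (simp add: single_times)
    qed
  qed
  have corner: "wrd ew * x * wrd ew - cst (\<Lambda> x) * wrd ew \<in> S" for x
  proof (induction x rule: poly_mapping_single_induct)
    case (add x w c)
    have "wrd ew * Poly_Mapping.single w c * wrd ew - cst (\<Lambda> (Poly_Mapping.single w c)) * wrd ew
        = cst c * (wrd ew * wrd w * wrd ew - cst (\<Lambda> (wrd w)) * wrd ew)"
      by (simp add: \<Lambda>_single single_times right_diff_distrib)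
    then have "wrd ew * Poly_Mapping.single w c * wrd ew - cst (\<Lambda> (Poly_Mapping.single w c)) * wrd ew \<in> S"
      using two_ideal_l[OF S(1) corner_word] by simp
    from two_ideal_plus[OF S(1) add(1) this] show ?case
      by (simp add: \<Lambda>_add cst_add distrib_left distrib_right)
  qed (simp add: \<Lambda>0 two_ideal_0[OF S(1)])
  \<comment> \<open>The factors of \<open>ew\<close> are removed one at a time from the right. Those
    elements over the next component which multiply the remaining product \<open>y\<close> into
    \<open>L\<close> form an ideal containing \<open>I (Suc k)\<close> and \<open>e (Suc k)\<close>,
    hence 1.\<close>
  have full: "1 \<in> L" if L: "two_ideal L" "S \<subseteq> L" "wrd ew \<in> L" for L
  proof -
    have "wrd (concat (map (\<lambda>i. part i (e i)) [1..<Suc k])) \<in> L" if "k \<le> m" for k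
      using that
    proof (induction k rule: inc_induct)
      case base
      show ?case using L(3) by (simp add: ew_def)
    next
      case (step k)
      define y where "y = concat (map (\<lambda>i. part i (e i)) [1..<Suc k])"
      have k: "Suc k \<in> {1..m}" using step.hyps by auto
      define L' where "L' = {x. wrd y * \<rho> (Suc k) x \<in> L}"
      have y_comm: "wrd y * \<rho> (Suc k) s - \<rho> (Suc k) s * wrd y \<in> S" for s
      proof (induction s rule: poly_mapping_single_induct)
        case (add s w c)
        have "set y \<inter> pverts (C (Suc k)) = {}"
          using disj[OF _ k] step.hyps by (fastforce simp: y_def)
        then have "hk_class G (y @ part (Suc k) w) = hk_class G (part (Suc k) w @ y)"
          by (intro class_commute[OF k, symmetric]) auto
        from two_ideal_single[OF S(1) congS[OF this], of c]
        have "wrd y * \<rho> (Suc k) (Poly_Mapping.single w c) - \<rho> (Suc k) (Poly_Mapping.single w c) * wrd y \<in> S"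
          by (simp add: \<rho>_simps single_times)
        from two_ideal_add[OF S(1) add(1) this] show ?case by (simp add: \<rho>_simps algebra_simps)
      qed (simp add: \<rho>_simps two_ideal_0[OF S(1)])
      have L': "two_ideal L'"
        unfolding two_ideal_def
      proof (intro conjI ballI allI)
        fix x a assume "a \<in> L'"
        then have a: "wrd y * \<rho> (Suc k) a \<in> L" by (simp add: L'_def)
        have "(wrd y * \<rho> (Suc k) x - \<rho> (Suc k) x * wrd y) * \<rho> (Suc k) a + \<rho> (Suc k) x * (wrd y * \<rho> (Suc k) a) \<in> L"
          by (rule two_ideal_add[OF L(1) two_ideal_r[OF L(1) subsetD[OF L(2) y_comm]] two_ideal_l[OF L(1) a]])
        then show "x * a \<in> L'" by (simp add: L'_def \<rho>_mult algebra_simps)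
        show "a * x \<in> L'" using two_ideal_r[OF L(1) a, of "\<rho> (Suc k) x"] by (simp add: L'_def \<rho>_mult mult.assoc)
      qed (auto simp: L'_def \<rho>_simps distrib_left two_ideal_0[OF L(1)] two_ideal_add[OF L(1)])
      have "I (Suc k) \<subseteq> L'" using S(3)[OF k] L(2) two_ideal_l[OF L(1)] by (auto simp: L'_def)
      moreover have "wrd (e (Suc k)) \<in> L'"
      proof -
        have "y @ part (Suc k) (e (Suc k)) = concat (map (\<lambda>i. part i (e i)) [1..<Suc (Suc k)])"
          by (simp add: y_def)
        then show ?thesis using step.IH by (simp add: L'_def \<rho>_simps single_times)
      qed
      ultimately have "1 \<in> L'" using maximal_two_idealD(3)[OF maxI[OF k] L'] e[OF k] by blast
      then show ?case by (simp add: L'_def \<rho>_simps y_def)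
    qed
    from this[of 0] show ?thesis by (simp add: wrd_Nil)
  qed
  have \<Lambda>_class: "\<Lambda> (wrd u) = \<Lambda> (wrd v)" if "hk_class G u = hk_class G v" for u v
  proof -
    have "lam i (wrd u) = lam i (wrd v)" if "i \<in> {1..m}" for i
      by (rule lam_cong[OF that class_to_component[OF that \<open>hk_class G u = hk_class G v\<close>]])
    then have "(\<Prod>i\<in>{1..m}. lam i (wrd u)) = (\<Prod>i\<in>{1..m}. lam i (wrd v))" by (rule prod.cong[OF HOL.refl])
    then show ?thesis by (simp only: \<Lambda>_single)
  qed
  have "1 \<notin> S"
  proof
    assume "1 \<in> S"
    \<comment> \<open>The largest ideal on which \<open>\<Lambda>\<close> vanishes contains the
      generators of \<open>S\<close>, hence \<open>S\<close> by \<open>min\<close>, but not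
      1.\<close>
    define L where "L = {x. \<forall>s t. \<Lambda> (s * x * t) = 0}"
    have L: "two_ideal L" unfolding L_def by (rule klin_two_ideal[OF kl\<Lambda>])
    have LI: "x \<in> L" if "\<And>a b. \<Lambda> (wrd a * x * wrd b) = 0" for x
      unfolding L_def using klin_words[OF kl\<Lambda> that] by blast
    have "S \<subseteq> L"
    proof (rule min[OF L])
      fix x :: "'v list \<Rightarrow>\<^sub>0 'k" assume x: "hk_eval G x = 0"
      have wL: "wrd u - wrd v \<in> L" if "hk_class G u = hk_class G v" for u v
      proof (rule LI)
        fix a b
        have "\<Lambda> (wrd (a @ u @ b)) = \<Lambda> (wrd (a @ v @ b))" by (rule \<Lambda>_class[OF cl.ctx[OF that]])
        moreover have "\<Lambda> (x - y) = \<Lambda> x - \<Lambda> y" for x y using \<Lambda>_add[of "x - y" y] by simp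
        ultimately show "\<Lambda> (wrd a * (wrd u - wrd v) * wrd b) = 0"
          by (simp add: left_diff_distrib right_diff_distrib single_times)
      qed
      show "x \<in> L"
      proof (rule hk_eval_kernel[OF L _ _ x])
        show "wrd u - wrd v \<in> L" if "(u, v) \<in> hk_relations G" for u v
          by (rule wL[OF hk_relations_class[OF that wfG]])
        show "wrd [a] - 1 \<in> L" if "a \<notin> pverts G" for a
          using wL[OF hk_class_outside[OF that]] by (simp add: wrd_Nil)
      qed
    next
      fix i x assume i: "i \<in> {1..m}" and x: "x \<in> I i"
      show "\<rho> i x \<in> L"
      proof (rule LI)
        fix a b
        \<comment> \<open>Only the factor with index \<open>i\<close> depends on \<open>y\<close>,
          and \<open>lam i\<close> vanishes on \<open>I i\<close>.\<close>
        have "\<Lambda> (wrd a * \<rho> i y * wrd b) = (\<Prod>j\<in>{1..m} - {i}. lam j (wrd (a @ b))) * lam i (wrd a * y * wrd b)" for y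
        proof (induction y rule: poly_mapping_single_induct)
          case (add y w c)
          have ne: "lam j (wrd (a @ part i w @ b)) = lam j (wrd (a @ b))" if "j \<in> {1..m} - {i}" for j
          proof -
            have j: "j \<in> {1..m}" "j \<noteq> i" using that by auto
            have "part j (part i w) = []" using part_part[OF j(1) i] j(2) by simp
            then have "part j (a @ part i w @ b) = part j (a @ b)" by simp
            then have "hk_class (C j) (a @ part i w @ b) = hk_class (C j) (a @ b)"
              using class_part[of j] by metis
            then show ?thesis by (rule lam_cong[OF j(1)])
          qed
          have eq: "lam i (wrd (a @ part i w @ b)) = lam i (wrd (a @ w @ b))"
            by (rule lam_cong[OF i]) (simp add: hk_class_def)
          have "\<Lambda> (wrd a * \<rho> i (Poly_Mapping.single w c) * wrd b)
              = c * (\<Prod>j\<in>{1..m}. lam j (wrd (a @ part i w @ b)))"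
            by (simp add: \<rho>_simps single_times \<Lambda>_single)
          also have "\<dots> = c * (lam i (wrd (a @ w @ b)) * (\<Prod>j\<in>{1..m} - {i}. lam j (wrd (a @ b))))"
            using i ne eq by (simp add: prod.remove)
          also have "lam i (wrd a * Poly_Mapping.single w c * wrd b) = c * lam i (wrd (a @ w @ b))"
            using klinD(4)[OF kl[OF i i i], of "a @ w @ b" c] by (simp add: single_times)
          then have "c * (lam i (wrd (a @ w @ b)) * (\<Prod>j\<in>{1..m} - {i}. lam j (wrd (a @ b))))
            = (\<Prod>j\<in>{1..m} - {i}. lam j (wrd (a @ b))) * lam i (wrd a * Poly_Mapping.single w c * wrd b)"
            by simp
          finally show ?case using add
            by (simp add: \<rho>_simps distrib_left distrib_right \<Lambda>_add klinD(1)[OF kl[OF i i i]])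
        qed (simp add: \<rho>_simps \<Lambda>0 klinD(3)[OF kl[OF i i i]])
        moreover have "wrd a * x * wrd b \<in> I i" by (rule two_ideal_r[OF I[OF i] two_ideal_l[OF I[OF i] x]])
        then have "lam i (wrd a * x * wrd b) = 0" by (rule corner_null[OF I[OF i] e[OF i] lam[OF i]])
        ultimately show "\<Lambda> (wrd a * \<rho> i x * wrd b) = 0" by simp
      qed
    qed
    then have "1 \<in> L" using \<open>1 \<in> S\<close> by blast
    then have "\<Lambda> (1 * 1 * 1) = 0" unfolding L_def by blast
    moreover have "\<Lambda> 1 = 1" using \<Lambda>_single[of "[]" 1] lam1 by (simp add: wrd_Nil)
    ultimately show False by simp
  qed
  moreover have "Q = S" if Q: "two_ideal Q" "S \<subseteq> Q" "1 \<notin> Q" for Q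
  proof (rule ccontr)
    assume "Q \<noteq> S"
    then obtain a where a: "a \<in> Q" "a \<notin> S" using Q(2) by blast
    \<comment> \<open>Otherwise \<open>ew s a t ew\<close> lies in \<open>S\<close> for all
      \<open>s\<close> and \<open>t\<close>. Applying \<open>full\<close> to the left annihilator of
      \<open>a t ew\<close> and then to the right annihilator of \<open>a\<close>, both modulo
      \<open>S\<close>, gives \<open>a\<close> in \<open>S\<close>.\<close>
    have "\<exists>s t. \<Lambda> (s * a * t) \<noteq> 0"
    proof (rule ccontr)
      assume "\<not> ?thesis"
      then have *: "wrd ew * (s * a * t) * wrd ew \<in> S" for s t
        using corner[of "s * a * t"] by simp
      have "a * t * wrd ew \<in> S" for t
      proof -
        let ?L = "{x. \<forall>s. x * s * (a * t * wrd ew) \<in> S}"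
        have "two_ideal ?L" by (rule two_ideal_left_annihilator[OF S(1)])
        moreover have "S \<subseteq> ?L" using two_ideal_r[OF S(1)] by blast
        moreover have "wrd ew \<in> ?L" using *[of _ t] by (simp add: mult.assoc)
        ultimately have "1 \<in> ?L" by (rule full)
        then have "1 * 1 * (a * t * wrd ew) \<in> S" by blast
        then show ?thesis by simp
      qed
      moreover have "two_ideal {x. \<forall>t. a * t * x \<in> S}" by (rule two_ideal_right_annihilator[OF S(1)])
      moreover have "S \<subseteq> {x. \<forall>t. a * t * x \<in> S}" using two_ideal_l[OF S(1)] by blast
      ultimately have "1 \<in> {x. \<forall>t. a * t * x \<in> S}" by (intro full) auto
      then have "a * 1 * 1 \<in> S" by blast
      then show False using a(2) by simp
    qed
    then obtain s t where st: "\<Lambda> (s * a * t) \<noteq> 0" by blast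
    have "wrd ew * (s * a * t) * wrd ew \<in> Q"
      by (rule two_ideal_r[OF Q(1) two_ideal_l[OF Q(1) two_ideal_r[OF Q(1) two_ideal_l[OF Q(1) a(1)]]]])
    then have "cst (\<Lambda> (s * a * t)) * wrd ew \<in> Q"
      using two_ideal_cong[OF Q(1) subsetD[OF Q(2) corner]] by blast
    then have "wrd ew \<in> Q" using two_ideal_cst[OF Q(1)] st by blast
    then show False using full[OF Q(1,2)] Q(3) by blast
  qed
  ultimately show ?thesis using S(1) by (auto simp: maximal_two_ideal_def)
qed

end

section \<open>Tensor products of monoid algebras\<close>

lemma ma_mult_diff:
  "ma_mult M (f - f') g = ma_mult M f g - ma_mult M f' g"
  "ma_mult M f (g - g') = ma_mult M f g - ma_mult M f g'"
proof -
  show "ma_mult M (f - f') g = ma_mult M f g - ma_mult M f' g"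
    using ma_mult_add_left[of M "f - f'" f' g] by (simp add: eq_diff_eq)
  show "ma_mult M f (g - g') = ma_mult M f g - ma_mult M f g'"
    using ma_mult_add_right[of M f "g - g'" g'] by (simp add: eq_diff_eq)
qed

lemma map_times_diff: "Poly_Mapping.map ((*) c) (f - g) = Poly_Mapping.map ((*) c) f - Poly_Mapping.map ((*) (c::'k::field)) g"
  using map_times_add[of c "f - g" g] by simp

lemma map_times_times: "Poly_Mapping.map ((*) c) (Poly_Mapping.map ((*) d) f) = Poly_Mapping.map ((*) (c * d :: 'k::field)) f"
  by (intro poly_mapping_eqI) (simp add: lookup_map_times)

section \<open>The multilinearity relations as an ideal\<close>

context
  fixes K :: "'k::field itself" and M :: "'i \<Rightarrow> 'x monoid" and I :: "'i set"
  assumes M: "\<And>i. Group.monoid (M i)"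
begin

definition fam :: "'i \<Rightarrow> ('k, 'x \<Rightarrow>\<^sub>0 'k) module" where
  "fam i = monoid_algebra (M i)"

abbreviation tf :: "('k, ('i \<Rightarrow> 'x \<Rightarrow>\<^sub>0 'k) \<Rightarrow>\<^sub>0 'k) module" where
  "tf \<equiv> tensor_free I fam"

abbreviation nul :: "(('i \<Rightarrow> 'x \<Rightarrow>\<^sub>0 'k) \<Rightarrow>\<^sub>0 'k) set" where
  "nul \<equiv> tensor_null I fam"

abbreviation tuples :: "('i \<Rightarrow> 'x \<Rightarrow>\<^sub>0 'k) set" where
  "tuples \<equiv> \<Pi>\<^sub>E i\<in>I. carrier (fam i)"

lemma fam_simps [simp]:
  "carrier (fam i) = {f. Poly_Mapping.keys f \<subseteq> carrier (M i)}"
  "x \<oplus>\<^bsub>fam i\<^esub> y = x + y" "c \<odot>\<^bsub>fam i\<^esub> x = Poly_Mapping.map ((*) c) x"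
  by (simp_all add: fam_def)

lemma ring_fam: "ring (fam i)"
  unfolding fam_def by (rule ring_monoid_algebra[OF M])

lemma monoid_fam: "Group.monoid (fam i)"
  using ring_fam by (rule ring.is_monoid)

lemma tuple_carrier: "carrier (product_group I fam) = tuples"
  by (simp add: product_group_def)

lemma tuple_mem: "t \<in> tuples \<Longrightarrow> i \<in> I \<Longrightarrow> t i \<in> carrier (fam i)"
  by (rule PiE_mem)

lemma monoid_tuples: "Group.monoid (product_group I fam)"
proof (rule monoidI)
  note mon = monoid.m_closed[OF monoid_fam] monoid.one_closed[OF monoid_fam]
    monoid.m_assoc[OF monoid_fam] monoid.l_one[OF monoid_fam] monoid.r_one[OF monoid_fam]
  show "x \<otimes>\<^bsub>product_group I fam\<^esub> y \<otimes>\<^bsub>product_group I fam\<^esub> z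
      = x \<otimes>\<^bsub>product_group I fam\<^esub> (y \<otimes>\<^bsub>product_group I fam\<^esub> z)"
    if "x \<in> carrier (product_group I fam)" "y \<in> carrier (product_group I fam)" "z \<in> carrier (product_group I fam)" for x y z
  proof -
    have "x i \<otimes>\<^bsub>fam i\<^esub> y i \<otimes>\<^bsub>fam i\<^esub> z i = x i \<otimes>\<^bsub>fam i\<^esub> (y i \<otimes>\<^bsub>fam i\<^esub> z i)" if "i \<in> I" for i
      using \<open>x \<in> _\<close> \<open>y \<in> _\<close> \<open>z \<in> _\<close> unfolding tuple_carrier by (intro mon(3) tuple_mem that)
    then show ?thesis by (simp add: product_group_def cong: restrict_cong)
  qed
  show "x \<otimes>\<^bsub>product_group I fam\<^esub> y \<in> carrier (product_group I fam)"
    if "x \<in> carrier (product_group I fam)" "y \<in> carrier (product_group I fam)" for x y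
  proof -
    have "x i \<otimes>\<^bsub>fam i\<^esub> y i \<in> carrier (fam i)" if "i \<in> I" for i
      using \<open>x \<in> _\<close> \<open>y \<in> _\<close> unfolding tuple_carrier by (intro mon(1) tuple_mem that)
    then show ?thesis by (simp add: product_group_def del: fam_simps)
  qed
  show "\<one>\<^bsub>product_group I fam\<^esub> \<in> carrier (product_group I fam)"
    using mon(2) by (simp add: product_group_def del: fam_simps)
  show "\<one>\<^bsub>product_group I fam\<^esub> \<otimes>\<^bsub>product_group I fam\<^esub> x = x"
    "x \<otimes>\<^bsub>product_group I fam\<^esub> \<one>\<^bsub>product_group I fam\<^esub> = x"
    if x: "x \<in> carrier (product_group I fam)" for x
  proof -
    have xi: "x i \<in> carrier (fam i)" if "i \<in> I" for i
      using x that unfolding tuple_carrier by (rule tuple_mem)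
    have ex: "x i = undefined" if "i \<notin> I" for i
      using x that by (auto simp: product_group_def del: fam_simps)
    show "\<one>\<^bsub>product_group I fam\<^esub> \<otimes>\<^bsub>product_group I fam\<^esub> x = x"
      "x \<otimes>\<^bsub>product_group I fam\<^esub> \<one>\<^bsub>product_group I fam\<^esub> = x"
      using mon(4,5)[OF xi] ex by (auto simp: product_group_def fun_eq_iff simp del: fam_simps)
  qed
qed

lemma tf_simps:
  "carrier tf = {f. Poly_Mapping.keys f \<subseteq> tuples}"
  "f \<oplus>\<^bsub>tf\<^esub> g = f + g" "\<zero>\<^bsub>tf\<^esub> = 0" "c \<odot>\<^bsub>tf\<^esub> f = Poly_Mapping.map ((*) c) f"
  "\<one>\<^bsub>tf\<^esub> = Poly_Mapping.single (\<lambda>i\<in>I. \<one>\<^bsub>fam i\<^esub>) 1"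
  by (simp_all add: tensor_free_def product_group_def)

lemma tf_mult: "f \<otimes>\<^bsub>tf\<^esub> g = ma_mult (product_group I fam) f g"
  by (simp add: tensor_free_def)

lemma tuple_mult: "s \<otimes>\<^bsub>product_group I fam\<^esub> t = (\<lambda>i\<in>I. s i \<otimes>\<^bsub>fam i\<^esub> t i)"
  by (simp add: product_group_def)

lemma tuple_mult_closed: "s \<in> tuples \<Longrightarrow> t \<in> tuples \<Longrightarrow> (\<lambda>i\<in>I. s i \<otimes>\<^bsub>fam i\<^esub> t i) \<in> tuples"
  using monoid.m_closed[OF monoid_tuples, of s t] by (simp add: tuple_carrier tuple_mult)

lemma tuple_upd: "t \<in> tuples \<Longrightarrow> i \<in> I \<Longrightarrow> x \<in> carrier (fam i) \<Longrightarrow> t(i := x) \<in> tuples"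
  using PiE_fun_upd[of x "\<lambda>i. carrier (fam i)" i t I] by (simp add: insert_absorb del: fam_simps)

lemma ring_tf: "ring tf"
  unfolding tensor_free_def by (rule ring_monoid_algebra[OF monoid_tuples])

lemma nul_0: "0 \<in> nul" and nul_add: "a \<in> nul \<Longrightarrow> b \<in> nul \<Longrightarrow> a + b \<in> nul"
  and nul_smult: "a \<in> nul \<Longrightarrow> Poly_Mapping.map ((*) c) a \<in> nul"
  unfolding tensor_null_def using lin_span.zero[of tf] lin_span.add[of a tf _ b] lin_span.smult[of a tf _ c]
  by (simp_all add: tf_simps)

lemma nul_uminus: "a \<in> nul \<Longrightarrow> - a \<in> nul"
  using nul_smult[of a "-1"] by (simp add: map_times_uminus)

lemma nul_diff: "a \<in> nul \<Longrightarrow> b \<in> nul \<Longrightarrow> a - b \<in> nul"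
  using nul_add[of a "- b"] nul_uminus by simp

lemma nul_rel_add:
  assumes "t \<in> tuples" "i \<in> I" "x \<in> carrier (fam i)" "y \<in> carrier (fam i)"
  shows "Poly_Mapping.single (t(i := x + y)) c - Poly_Mapping.single (t(i := x)) c - Poly_Mapping.single (t(i := y)) c \<in> nul"
proof -
  have "Poly_Mapping.single (t(i := x \<oplus>\<^bsub>fam i\<^esub> y)) 1 - Poly_Mapping.single (t(i := x)) 1 - Poly_Mapping.single (t(i := y)) 1
      \<in> tensor_relations I fam"
    using assms unfolding tensor_relations_def by blast
  then have "Poly_Mapping.single (t(i := x + y)) 1 - Poly_Mapping.single (t(i := x)) 1 - Poly_Mapping.single (t(i := y)) 1 \<in> nul"
    unfolding tensor_null_def by (intro lin_span.base) simp
  from nul_smult[OF this, of c] show ?thesis by (simp add: map_times_diff)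
qed

lemma nul_rel_smult:
  assumes "t \<in> tuples" "i \<in> I" "x \<in> carrier (fam i)"
  shows "Poly_Mapping.single (t(i := Poly_Mapping.map ((*) a) x)) c - Poly_Mapping.single (t(i := x)) (c * a) \<in> nul"
proof -
  have "Poly_Mapping.single (t(i := a \<odot>\<^bsub>fam i\<^esub> x)) 1 - Poly_Mapping.single (t(i := x)) a \<in> tensor_relations I fam"
    using assms unfolding tensor_relations_def by blast
  then have "Poly_Mapping.single (t(i := Poly_Mapping.map ((*) a) x)) 1 - Poly_Mapping.single (t(i := x)) a \<in> nul"
    unfolding tensor_null_def by (intro lin_span.base) simp
  from nul_smult[OF this, of c] show ?thesis by (simp add: map_times_diff)
qed

lemma nul_induct [consumes 1, case_names zero rel_add rel_smult add smult]:
  assumes "n \<in> nul" "P 0"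
    "\<And>t i x y. t \<in> tuples \<Longrightarrow> i \<in> I \<Longrightarrow> x \<in> carrier (fam i) \<Longrightarrow> y \<in> carrier (fam i) \<Longrightarrow>
      P (Poly_Mapping.single (t(i := x + y)) 1 - Poly_Mapping.single (t(i := x)) 1 - Poly_Mapping.single (t(i := y)) 1)"
    "\<And>t i a x. t \<in> tuples \<Longrightarrow> i \<in> I \<Longrightarrow> x \<in> carrier (fam i) \<Longrightarrow>
      P (Poly_Mapping.single (t(i := Poly_Mapping.map ((*) a) x)) 1 - Poly_Mapping.single (t(i := x)) a)"
    "\<And>a b. a \<in> nul \<Longrightarrow> b \<in> nul \<Longrightarrow> P a \<Longrightarrow> P b \<Longrightarrow> P (a + b)" "\<And>a c. a \<in> nul \<Longrightarrow> P a \<Longrightarrow> P (Poly_Mapping.map ((*) c) a)"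
  shows "P n"
proof -
  have "n \<in> lin_span tf (tensor_relations I fam)" using assms(1) by (simp add: tensor_null_def)
  then show ?thesis
  proof induction
    case (base a)
    then show ?case
      unfolding tensor_relations_def
      using assms(3,4) by (auto simp del: fam_simps(1))
  next
    case (add a b)
    then show ?case using assms(5)[of a b] by (simp add: tensor_null_def tf_simps)
  next
    case (smult a c)
    then show ?case using assms(6)[of a c] by (simp add: tensor_null_def tf_simps)
  qed (simp add: tf_simps assms(2))
qed

lemma nul_carrier: "n \<in> nul \<Longrightarrow> Poly_Mapping.keys n \<subseteq> tuples"
proof (induction rule: nul_induct)
  case (rel_add t i x y)
  then have "x + y \<in> carrier (fam i)" by (simp add: keys_add_subset)
  then have "t(i := x + y) \<in> tuples" "t(i := x) \<in> tuples" "t(i := y) \<in> tuples"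
    using tuple_upd[OF rel_add(1,2)] rel_add(3,4) by blast+
  then show ?case
    by (auto simp del: fam_simps dest!: subsetD[OF keys_diff] split: if_splits)
next
  case (rel_smult t i a x)
  then have "Poly_Mapping.map ((*) a) x \<in> carrier (fam i)" using keys_map_times[of a x] by auto
  then have "t(i := Poly_Mapping.map ((*) a) x) \<in> tuples" "t(i := x) \<in> tuples"
    using tuple_upd[OF rel_smult(1,2)] rel_smult(3) by blast+
  then show ?case
    by (auto simp del: fam_simps dest!: subsetD[OF keys_diff] split: if_splits)
next
  case (add a b)
  then show ?case by (simp add: keys_add_subset del: fam_simps)
next
  case (smult a c)
  then show ?case using keys_map_times[of c a] by blast
qed simp

lemma tuple_mult_upd:
  assumes "i \<in> I"
  shows "(\<lambda>j\<in>I. s j \<otimes>\<^bsub>fam j\<^esub> (t(i := x)) j) = (\<lambda>j\<in>I. s j \<otimes>\<^bsub>fam j\<^esub> t j)(i := s i \<otimes>\<^bsub>fam i\<^esub> x)"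
    "(\<lambda>j\<in>I. (t(i := x)) j \<otimes>\<^bsub>fam j\<^esub> s j) = (\<lambda>j\<in>I. t j \<otimes>\<^bsub>fam j\<^esub> s j)(i := x \<otimes>\<^bsub>fam i\<^esub> s i)"
  using assms by (auto simp: fun_eq_iff)

text \<open>Multiplication by a tuple acts in each coordinate separately and linearly, so it takes a
  relation at coordinate \<open>i\<close> to a relation at coordinate \<open>i\<close>.\<close>

lemma nul_mult:
  assumes n: "n \<in> nul" and f: "Poly_Mapping.keys f \<subseteq> tuples"
  shows "f \<otimes>\<^bsub>tf\<^esub> n \<in> nul" "n \<otimes>\<^bsub>tf\<^esub> f \<in> nul"
proof -
  have fam_mult: "x \<otimes>\<^bsub>fam i\<^esub> (y + z) = x \<otimes>\<^bsub>fam i\<^esub> y + x \<otimes>\<^bsub>fam i\<^esub> z"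
    "(y + z) \<otimes>\<^bsub>fam i\<^esub> x = y \<otimes>\<^bsub>fam i\<^esub> x + z \<otimes>\<^bsub>fam i\<^esub> x"
    "x \<otimes>\<^bsub>fam i\<^esub> Poly_Mapping.map ((*) a) y = Poly_Mapping.map ((*) a) (x \<otimes>\<^bsub>fam i\<^esub> y)"
    "Poly_Mapping.map ((*) a) y \<otimes>\<^bsub>fam i\<^esub> x = Poly_Mapping.map ((*) a) (y \<otimes>\<^bsub>fam i\<^esub> x)" for x y z a i
    by (simp_all add: fam_def ma_mult_add_left ma_mult_add_right ma_mult_smult_left ma_mult_smult_right)
  have mc: "s i \<otimes>\<^bsub>fam i\<^esub> x \<in> carrier (fam i)" "x \<otimes>\<^bsub>fam i\<^esub> s i \<in> carrier (fam i)"
    if "s \<in> tuples" "i \<in> I" "x \<in> carrier (fam i)" for s i x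
    using monoid.m_closed[OF monoid_fam] that PiE_mem[OF that(1,2)] by (auto simp del: fam_simps)
  have left: "Poly_Mapping.single s c \<otimes>\<^bsub>tf\<^esub> n \<in> nul" if s: "s \<in> tuples" for s c
    using n
  proof (induction rule: nul_induct)
    case (rel_add t i x y)
    show ?case
      using nul_rel_add[OF tuple_mult_closed[OF s rel_add(1)] rel_add(2) mc(1)[OF s rel_add(2,3)] mc(1)[OF s rel_add(2,4)], of c]
      unfolding tf_mult ma_mult_diff ma_mult_single tuple_mult tuple_mult_upd[OF rel_add(2)] fam_mult by simp
  next
    case (rel_smult t i a x)
    show ?case
      using nul_rel_smult[OF tuple_mult_closed[OF s rel_smult(1)] rel_smult(2) mc(1)[OF s rel_smult(2,3)], of a c]
      unfolding tf_mult ma_mult_diff ma_mult_single tuple_mult tuple_mult_upd[OF rel_smult(2)] fam_mult by simp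
  qed (simp_all add: tf_mult ma_mult_add_right ma_mult_smult_right nul_0 nul_add nul_smult)
  have right: "n \<otimes>\<^bsub>tf\<^esub> Poly_Mapping.single s c \<in> nul" if s: "s \<in> tuples" for s c
    using n
  proof (induction rule: nul_induct)
    case (rel_add t i x y)
    show ?case
      using nul_rel_add[OF tuple_mult_closed[OF rel_add(1) s] rel_add(2) mc(2)[OF s rel_add(2,3)] mc(2)[OF s rel_add(2,4)], of c]
      unfolding tf_mult ma_mult_diff ma_mult_single tuple_mult tuple_mult_upd[OF rel_add(2)] fam_mult by simp
  next
    case (rel_smult t i a x)
    show ?case
      using nul_rel_smult[OF tuple_mult_closed[OF rel_smult(1) s] rel_smult(2) mc(2)[OF s rel_smult(2,3)], of a c]
      unfolding tf_mult ma_mult_diff ma_mult_single tuple_mult tuple_mult_upd[OF rel_smult(2)] fam_mult by (simp add: mult.commute)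
  qed (simp_all add: tf_mult ma_mult_add_left ma_mult_smult_left nul_0 nul_add nul_smult)
  show "f \<otimes>\<^bsub>tf\<^esub> n \<in> nul"
    using f by (induction f rule: keys_subset_induct)
      (use left in \<open>simp_all add: tf_mult ma_mult_add_left nul_0 nul_add del: fam_simps\<close>)
  show "n \<otimes>\<^bsub>tf\<^esub> f \<in> nul"
    using f by (induction f rule: keys_subset_induct)
      (use right in \<open>simp_all add: tf_mult ma_mult_add_right nul_0 nul_add del: fam_simps\<close>)
qed

lemma ideal_nul: "ideal nul tf"
proof (rule idealI[OF ring_tf])
  show "subgroup nul (add_monoid tf)"
  proof (rule group.subgroupI)
    show "group (add_monoid tf)" by (rule abelian_group.a_group[OF ring.is_abelian_group[OF ring_tf]])
    show "nul \<subseteq> carrier (add_monoid tf)" using nul_carrier by (auto simp: tf_simps)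
    show "nul \<noteq> {}" using nul_0 by auto
    show "inv\<^bsub>add_monoid tf\<^esub> a \<in> nul" if "a \<in> nul" for a
    proof -
      have "\<ominus>\<^bsub>tf\<^esub> a = - a"
        using nul_carrier[OF that] nul_carrier[OF nul_uminus[OF that]]
        by (intro abelian_group.minus_equality[OF ring.is_abelian_group[OF ring_tf]]) (auto simp: tf_simps)
      then show ?thesis using nul_uminus[OF that] by (simp add: a_inv_def)
    qed
    show "a \<otimes>\<^bsub>add_monoid tf\<^esub> b \<in> nul" if "a \<in> nul" "b \<in> nul" for a b
      using nul_add[OF that] by (simp add: tf_simps)
  qed
qed (auto simp: tf_simps intro: nul_mult simp del: fam_simps)

section \<open>The tensor product computed on representatives\<close>

abbreviation tp :: "('k, (('i \<Rightarrow> 'x \<Rightarrow>\<^sub>0 'k) \<Rightarrow>\<^sub>0 'k) set) module" where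
  "tp \<equiv> tensor_product I fam"

definition coset :: "(('i \<Rightarrow> 'x \<Rightarrow>\<^sub>0 'k) \<Rightarrow>\<^sub>0 'k) \<Rightarrow> (('i \<Rightarrow> 'x \<Rightarrow>\<^sub>0 'k) \<Rightarrow>\<^sub>0 'k) set" where
  "coset f = nul +>\<^bsub>tf\<^esub> f"

lemma coset_iff: "g \<in> coset f \<longleftrightarrow> g - f \<in> nul"
  unfolding coset_def a_r_coset_def r_coset_def by (auto simp: tf_simps intro: exI[of _ "g - f"]) (metis diff_add_cancel)

lemma coset_eq_iff: "coset f = coset g \<longleftrightarrow> f - g \<in> nul"
proof
  assume "coset f = coset g"
  then have "f \<in> coset g" using nul_0 coset_iff[of f f] by simp
  then show "f - g \<in> nul" by (simp add: coset_iff)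
next
  assume fg: "f - g \<in> nul"
  have "h - f \<in> nul \<longleftrightarrow> h - g \<in> nul" for h
    using nul_add[of "h - f" "f - g"] nul_diff[of "h - g" "f - g"] fg by auto
  then show "coset f = coset g" by (auto simp: coset_iff)
qed

lemma tp_carrier: "carrier tp = coset ` {f. Poly_Mapping.keys f \<subseteq> tuples}"
  by (auto simp: tensor_product_def ring.defs module.defs FactRing_def A_RCOSETS_def' coset_def tf_simps)

lemma tp_add:
  "Poly_Mapping.keys f \<subseteq> tuples \<Longrightarrow> Poly_Mapping.keys g \<subseteq> tuples \<Longrightarrow> coset f \<oplus>\<^bsub>tp\<^esub> coset g = coset (f + g)"
  using abelian_subgroup.a_rcos_sum[OF abelian_subgroupI3[OF ideal.axioms(1)[OF ideal_nul] ring.is_abelian_group[OF ring_tf]], of f g]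
  by (simp add: tensor_product_def ring.defs module.defs FactRing_def coset_def tf_simps del: fam_simps)

lemma tp_mult:
  "Poly_Mapping.keys f \<subseteq> tuples \<Longrightarrow> Poly_Mapping.keys g \<subseteq> tuples \<Longrightarrow> coset f \<otimes>\<^bsub>tp\<^esub> coset g = coset (f \<otimes>\<^bsub>tf\<^esub> g)"
  using ideal.rcoset_mult_add[OF ideal_nul, of f g]
  by (simp add: tensor_product_def ring.defs module.defs FactRing_def coset_def tf_simps del: fam_simps)

lemma tp_one: "\<one>\<^bsub>tp\<^esub> = coset (Poly_Mapping.single (\<lambda>i\<in>I. \<one>\<^bsub>fam i\<^esub>) 1)"
  by (simp add: tensor_product_def ring.defs module.defs FactRing_def coset_def tf_simps)

lemma tp_zero: "\<zero>\<^bsub>tp\<^esub> = coset 0"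
proof -
  have "coset 0 = nul" by (auto simp: coset_iff)
  then show ?thesis by (simp add: tensor_product_def ring.defs module.defs FactRing_def)
qed

lemma tp_smult: "c \<odot>\<^bsub>tp\<^esub> coset f = coset (Poly_Mapping.map ((*) c) f)"
proof -
  have "c \<odot>\<^bsub>tp\<^esub> coset f = (\<Union>x\<in>coset f. coset (Poly_Mapping.map ((*) c) x))"
    by (simp add: tensor_product_def ring.defs module.defs coset_def tf_simps)
  also have "\<dots> = coset (Poly_Mapping.map ((*) c) f)"
  proof -
    have "coset (Poly_Mapping.map ((*) c) x) = coset (Poly_Mapping.map ((*) c) f)" if "x \<in> coset f" for x
      using that nul_smult[of "x - f" c] by (simp add: coset_iff coset_eq_iff map_times_diff)
    moreover have "f \<in> coset f" using nul_0 by (simp add: coset_iff)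
    ultimately show ?thesis by blast
  qed
  finally show ?thesis .
qed

lemma finsum_tp:
  assumes "finite S" "\<And>i. i \<in> S \<Longrightarrow> Poly_Mapping.keys (g i) \<subseteq> tuples" "\<And>i. i \<in> S \<Longrightarrow> s i = coset (g i)"
  shows "finsum tp s S = coset (sum g S)"
proof -
  interpret abelian_monoid tp
  proof (rule abelian_monoidI)
    show "\<zero>\<^bsub>tp\<^esub> \<in> carrier tp" unfolding tp_zero tp_carrier by (rule imageI) simp
  qed (unfold tp_carrier, auto simp: tp_zero tp_add keys_add_subset add_ac simp del: fam_simps)
  have "finsum tp s S = coset (sum g S) \<and> Poly_Mapping.keys (sum g S) \<subseteq> tuples"
    using assms
  proof (induction S)
    case empty
    then show ?case by (simp add: tp_zero)
  next
    case (insert i S)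
    have "s j \<in> carrier tp" if "j \<in> insert i S" for j
      using insert.prems that unfolding tp_carrier by auto
    then have "finsum tp s (insert i S) = s i \<oplus>\<^bsub>tp\<^esub> finsum tp s S"
      using insert.hyps by (intro finsum_insert) auto
    also have "\<dots> = coset (g i + sum g S)"
      using insert tp_add[of "g i" "sum g S"] by simp
    finally show ?case using insert by (simp add: keys_add_subset del: fam_simps)
  qed
  then show ?thesis by blast
qed

text \<open>Multilinear maps are determined by tuples of basis elements. The form given here is
  adapted to showing that \<open>\<Psi>\<close> inverts the multiplication map induced by
  \<open>\<mu>\<close>.\<close>

lemma single_minus_basis:
  assumes fin: "finite I" and B: "\<And>f g. \<Psi> (f + g) = \<Psi> f + \<Psi> g" "\<And>c f. \<Psi> (Poly_Mapping.map ((*) c) f) = Poly_Mapping.map ((*) c) (\<Psi> f)"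
    and \<mu>: "\<And>t i x y. t \<in> tuples \<Longrightarrow> i \<in> I \<Longrightarrow> x \<in> carrier (fam i) \<Longrightarrow> y \<in> carrier (fam i) \<Longrightarrow> \<mu> (t(i := x + y)) = \<mu> (t(i := x)) + \<mu> (t(i := y))"
      "\<And>t i x c. t \<in> tuples \<Longrightarrow> i \<in> I \<Longrightarrow> x \<in> carrier (fam i) \<Longrightarrow> \<mu> (t(i := Poly_Mapping.map ((*) c) x)) = Poly_Mapping.map ((*) c) (\<mu> (t(i := x)))"
    and basis: "\<And>t. t \<in> tuples \<Longrightarrow> (\<And>i. i \<in> I \<Longrightarrow> \<exists>x. t i = Poly_Mapping.single x 1) \<Longrightarrow> Poly_Mapping.single t 1 - \<Psi> (\<mu> t) \<in> nul"
    and t: "t \<in> tuples"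
  shows "Poly_Mapping.single t (1::'k) - \<Psi> (\<mu> t :: 'y \<Rightarrow>\<^sub>0 'k) \<in> nul"
proof -
  define D where "D t = Poly_Mapping.single t (1::'k) - \<Psi> (\<mu> t)" for t
  have D_add: "D (t(i := x + y)) \<in> nul"
    if "t \<in> tuples" "i \<in> I" "x \<in> carrier (fam i)" "y \<in> carrier (fam i)" "D (t(i := x)) \<in> nul" "D (t(i := y)) \<in> nul" for t i x y
    using nul_add[OF nul_rel_add[OF that(1-4), of 1] nul_add[OF that(5,6)]]
    by (simp only: D_def \<mu>(1)[OF that(1-4)] B) (simp add: algebra_simps)
  have D_smult: "D (t(i := Poly_Mapping.map ((*) c) x)) \<in> nul"
    if "t \<in> tuples" "i \<in> I" "x \<in> carrier (fam i)" "D (t(i := x)) \<in> nul" for t i x c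
    using nul_add[OF nul_rel_smult[OF that(1-3), of c 1] nul_smult[OF that(4), of c]]
    by (simp only: D_def \<mu>(2)[OF that(1-3)] B map_times_diff) (simp add: algebra_simps)
  \<comment> \<open>\<open>J\<close> collects the coordinates that are still arbitrary; all others
    are basis elements.\<close>
  have "D t \<in> nul" if "finite J" "J \<subseteq> I" "t \<in> tuples" "\<And>i. i \<in> I - J \<Longrightarrow> \<exists>x. t i = Poly_Mapping.single x 1" for J t
    using that
  proof (induction J arbitrary: t rule: finite_induct)
    case empty
    then show ?case unfolding D_def by (intro basis) auto
  next
    case (insert i J)
    have i: "i \<in> I" using insert by auto
    have ti: "Poly_Mapping.keys (t i) \<subseteq> carrier (M i)" using PiE_mem[OF insert.prems(2) i] by simp
    define E where "E x = D (t(i := x))" for x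
    have "E x \<in> nul" if "Poly_Mapping.keys x \<subseteq> carrier (M i)" for x
      using that
    proof (induction x rule: keys_subset_induct)
      have single: "E (Poly_Mapping.single k 1) \<in> nul" if "k \<in> carrier (M i)" for k
        unfolding E_def
      proof (rule insert.IH)
        show "J \<subseteq> I" using insert.prems by auto
        show "t(i := Poly_Mapping.single k 1) \<in> tuples" using insert.prems that i by (intro tuple_upd) auto
        show "\<exists>x. (t(i := Poly_Mapping.single k 1)) j = Poly_Mapping.single x 1" if "j \<in> I - J" for j
          using insert.prems(3)[of j] that by auto
      qed
      have mult: "E (Poly_Mapping.single k v) \<in> nul" if "k \<in> carrier (M i)" for k v
        using D_smult[OF insert.prems(2) i _ single[OF that, unfolded E_def], of v] that by (simp add: E_def)
      {
        \<comment> \<open>The zero vector is treated as 0 times a basis element, for which the unit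
          of the monoid serves.\<close>
        case zero
        have "\<one>\<^bsub>M i\<^esub> \<in> carrier (M i)" by (rule monoid.one_closed[OF M])
        from mult[OF this, of 0] show ?case by (simp only: single_zero)
      next
        case (add x k v)
        show ?case
          unfolding E_def using add mult[OF add(3), of v] by (intro D_add[OF insert.prems(2) i]) (auto simp: E_def)
      }
    qed
    from this[OF ti] show ?case by (simp add: E_def)
  qed
  from this[OF fin order_refl t] show ?thesis by (simp add: D_def)
qed

end

section \<open>The tensor decomposition\<close>

lemma prod_list_upd:
  fixes g :: "nat \<Rightarrow> 'a::ring_1"
  assumes "distinct is" "i \<in> set is"
  shows "prod_list (map (g(i := a + b)) is) = prod_list (map (g(i := a)) is) + prod_list (map (g(i := b)) is)"
    "(\<And>x. z * x = x * z) \<Longrightarrow> prod_list (map (g(i := z * a)) is) = z * prod_list (map (g(i := a)) is)"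
proof -
  have upd: "map (g(i := x)) js = map g js" if "i \<notin> set js" for x js
    using that by (induction js) auto
  show "prod_list (map (g(i := a + b)) is) = prod_list (map (g(i := a)) is) + prod_list (map (g(i := b)) is)"
    using assms
  proof (induction "is")
    case (Cons j js)
    show ?case
    proof (cases "j = i")
      case True
      then show ?thesis using Cons.prems by (simp add: upd distrib_right fun_upd_same del: fun_upd_apply)
    next
      case False
      then show ?thesis using Cons by (simp add: distrib_left)
    qed
  qed simp
  assume z: "\<And>x. z * x = x * z"
  show "prod_list (map (g(i := z * a)) is) = z * prod_list (map (g(i := a)) is)"
    using assms
  proof (induction "is")
    case (Cons j js)
    show ?case
    proof (cases "j = i")
      case True
      then show ?thesis using Cons.prems by (simp add: upd mult.assoc fun_upd_same del: fun_upd_apply)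
    next
      case False
      then have "prod_list (map (g(i := z * a)) (j # js)) = g j * (z * prod_list (map (g(i := a)) js))"
        using Cons False by (simp add: fun_upd_other del: fun_upd_apply)
      also have "\<dots> = z * (g j * prod_list (map (g(i := a)) js))" by (metis mult.assoc z)
      finally show ?thesis using False by (simp add: fun_upd_other del: fun_upd_apply)
    qed
  qed simp
qed

section \<open>The multiplication map from the tensor product and its inverse\<close>

context hk_components
begin

context
  fixes K :: "'k::alg_closed_field itself"
begin

abbreviation "II \<equiv> {1..m}"
abbreviation "HM \<equiv> (\<lambda>i. hk_monoid (C i))"
abbreviation AA :: "nat \<Rightarrow> ('k, 'v list set \<Rightarrow>\<^sub>0 'k) module" where "AA \<equiv> fam HM"
abbreviation BB :: "('k, 'v list set \<Rightarrow>\<^sub>0 'k) module" where "BB \<equiv> hk_algebra K G"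
abbreviation TT :: "(nat \<Rightarrow> 'v list set \<Rightarrow>\<^sub>0 'k) set" where "TT \<equiv> \<Pi>\<^sub>E i\<in>II. carrier (AA i)"

lemma AA_eq: "AA i = hk_algebra K (C i)"
  by (simp add: fam_def[OF monoid_hk] hk_algebra_def)

interpretation B: onto_hom "hk_eval G" BB
  by (rule onto_hk_eval)

lemma onto_component: "onto_hom (hk_eval (C i)) (AA i)"
  unfolding AA_eq by (rule onto_hk_eval)

text \<open>On lifts to the free algebra the inclusion of a factor becomes \<open>\<rho> i\<close>,
  so statements on \<open>hk_incl\<close> reduce to computations with words.\<close>

lemma hk_incl_eval:
  assumes i: "i \<in> II"
  shows "hk_incl K G (hk_eval (C i) x) = hk_eval G (\<rho> i (x :: 'v list \<Rightarrow>\<^sub>0 'k))"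
proof -
  interpret Ci: oriented_graph "C i" using pgC[OF i] by (simp add: permutation_graph_def)
  have cls: "presentation_cong (pverts G) (hk_relations G) `` hk_class (C i) w = hk_class G (part i w)" for w
  proof -
    have sub: "pverts (C i) \<subseteq> pverts G" using cover i by blast
    have "part i w \<in> hk_class (C i) w" unfolding hk_class_def by (rule pcls_self) simp
    moreover have "hk_class (C i) w \<subseteq> presentation_cong (pverts G) (hk_relations G) `` {filter (\<lambda>x. x \<in> pverts G) (part i w)}"
    proof
      fix u assume "u \<in> hk_class (C i) w"
      then have wu: "(part i w, u) \<in> presentation_cong (pverts (C i)) (hk_relations (C i))"
        by (simp add: hk_class_def)
      then have u: "u \<in> lists (pverts (C i))" using presentation_cong_lists by blast
      then have pu: "part i u = u" and gu: "filter (\<lambda>x. x \<in> pverts G) u = u"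
        using sub by (auto simp: filter_id_conv in_lists_conv_set)
      have "hk_class (C i) w = hk_class (C i) u" using wu pu by (simp add: hk_class_eq_iff)
      then have "hk_class G (part i w) = hk_class G u" using class_component_iff[OF i, of w u] pu by simp
      then show "u \<in> presentation_cong (pverts G) (hk_relations G) `` {filter (\<lambda>x. x \<in> pverts G) (part i w)}"
        using gu by (simp add: hk_class_eq_iff)
    qed
    ultimately show ?thesis unfolding hk_class_def[of G] by (intro pcls_Image) auto
  qed
  have keys: "Poly_Mapping.keys (hk_eval (C i) x) \<subseteq> range (hk_class (C i))"
    unfolding hk_eval_def using push_keys[of "hk_class (C i)" x] by blast
  have "hk_incl K G (hk_eval (C i) x) = push (\<lambda>X. presentation_cong (pverts G) (hk_relations G) `` X) (hk_eval (C i) x)"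
    unfolding hk_incl_def hk_algebra_def
    by (subst lin_ext_monoid_algebra[OF monoid_hk]) (use keys cls in \<open>auto simp: push_def hk_monoid_carrier\<close>)
  also have "\<dots> = hk_eval G (\<rho> i x)"
    by (simp add: hk_eval_def \<rho>_def push_push cls)
  finally show ?thesis .
qed

definition \<mu> :: "(nat \<Rightarrow> 'v list set \<Rightarrow>\<^sub>0 'k) \<Rightarrow> ('v list set \<Rightarrow>\<^sub>0 'k)" where
  "\<mu> t = list_product BB (map (\<lambda>i. hk_incl K G (t i)) [1..<Suc m])"

lemma \<mu>_lift:
  assumes "\<And>i. i \<in> II \<Longrightarrow> t i = hk_eval (C i) (\<tau> i)"
  shows "\<mu> t = hk_eval G (prod_list (map (\<lambda>i. \<rho> i (\<tau> i)) [1..<Suc m]))"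
proof -
  have "list_product BB (map (\<lambda>i. hk_incl K G (t i)) is) = hk_eval G (prod_list (map (\<lambda>i. \<rho> i (\<tau> i)) is))"
    if "set is \<subseteq> II" for "is"
    using that
  proof (induction "is")
    case Nil
    show ?case using B.h_one by (simp add: list_product_def)
  next
    case (Cons i "is")
    have "list_product BB (map (\<lambda>i. hk_incl K G (t i)) (i # is))
        = hk_incl K G (t i) \<otimes>\<^bsub>BB\<^esub> list_product BB (map (\<lambda>i. hk_incl K G (t i)) is)"
      by (simp add: list_product_def)
    then show ?case using Cons assms[of i] hk_incl_eval[of i "\<tau> i"] B.h_mult by simp
  qed
  moreover have "set [1..<Suc m] \<subseteq> II" by auto
  ultimately show ?thesis unfolding \<mu>_def by blast
qed

lemma lift_exists:
  assumes "t \<in> TT"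
  shows "\<exists>\<tau>. \<forall>i\<in>II. t i = hk_eval (C i) (\<tau> i)"
proof -
  have "\<exists>x. t i = hk_eval (C i) x" if "i \<in> II" for i
    using onto_hom.h_onto[OF onto_component[of i], of "t i"] PiE_mem[OF assms that] by metis
  then show ?thesis by metis
qed

lemma \<mu>_closed: "t \<in> TT \<Longrightarrow> Poly_Mapping.keys (\<mu> t) \<subseteq> carrier (hk_monoid G)"
  using lift_exists[of t] \<mu>_lift[of t] B.h_closed by (fastforce simp: hk_algebra_def simp del: upt_Suc)

lemma \<mu>_multilinear:
  assumes t: "t \<in> TT" and i: "i \<in> II" and x: "x \<in> carrier (AA i)" and y: "y \<in> carrier (AA i)"
  shows "\<mu> (t(i := x + y)) = \<mu> (t(i := x)) + \<mu> (t(i := y))"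
    "\<mu> (t(i := Poly_Mapping.map ((*) c) x)) = Poly_Mapping.map ((*) c) (\<mu> (t(i := x)))"
proof -
  obtain \<tau> where \<tau>: "\<And>i. i \<in> II \<Longrightarrow> t i = hk_eval (C i) (\<tau> i)" using lift_exists[OF t] by blast
  obtain \<xi> \<eta> where \<xi>: "x = hk_eval (C i) \<xi>" and \<eta>: "y = hk_eval (C i) \<eta>"
    using onto_hom.h_onto[OF onto_component] x y by metis
  have upd: "\<mu> (t(i := hk_eval (C i) z)) = hk_eval G (prod_list (map ((\<lambda>i. \<rho> i (\<tau> i))(i := \<rho> i z)) [1..<Suc m]))" for z
  proof -
    have "\<mu> (t(i := hk_eval (C i) z)) = hk_eval G (prod_list (map (\<lambda>j. \<rho> j ((\<tau>(i := z)) j)) [1..<Suc m]))"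
      by (rule \<mu>_lift) (use \<tau> in auto)
    also have "(\<lambda>j. \<rho> j ((\<tau>(i := z)) j)) = (\<lambda>i. \<rho> i (\<tau> i))(i := \<rho> i z)" by auto
    finally show ?thesis .
  qed
  have mem: "distinct [1..<Suc m]" "i \<in> set [1..<Suc m]" using i by auto
  show "\<mu> (t(i := x + y)) = \<mu> (t(i := x)) + \<mu> (t(i := y))"
    using upd[of "\<xi> + \<eta>"] unfolding \<xi> \<eta> upd
    by (simp only: hk_eval_add[of "C i", symmetric] upd \<rho>_simps prod_list_upd(1)[OF mem] hk_eval_add[of G])
  have "\<mu> (t(i := Poly_Mapping.map ((*) c) x)) = \<mu> (t(i := hk_eval (C i) (cst c * \<xi>)))"
    by (simp add: \<xi> hk_eval_cst)
  also have "\<dots> = hk_eval G (prod_list (map ((\<lambda>i. \<rho> i (\<tau> i))(i := cst c * \<rho> i \<xi>)) [1..<Suc m]))"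
    by (simp only: upd \<rho>_mult \<rho>_simps filter.simps)
  also have "\<dots> = Poly_Mapping.map ((*) c) (\<mu> (t(i := x)))"
    unfolding \<xi> upd by (simp only: prod_list_upd(2)[OF mem cst_comm] hk_eval_cst)
  finally show "\<mu> (t(i := Poly_Mapping.map ((*) c) x)) = Poly_Mapping.map ((*) c) (\<mu> (t(i := x)))" .
qed

lemma \<rho>_commute:
  assumes "i \<in> II" "j \<in> II" "i \<noteq> j"
  shows "hk_eval G (\<rho> i x * \<rho> j y - \<rho> j y * \<rho> i (x :: 'v list \<Rightarrow>\<^sub>0 'k)) = 0"
proof -
  have disjoint: "hk_class G (part i u @ part j w) = hk_class G (part j w @ part i u)" for u w
    by (rule class_commute[OF assms(1)]) (use disj[OF assms(1,2)] assms(3) in auto)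
  have single: "hk_eval G (\<rho> i (Poly_Mapping.single u a) * \<rho> j y - \<rho> j y * \<rho> i (Poly_Mapping.single u (a::'k))) = 0" for u a
  proof (induction y rule: poly_mapping_single_induct)
    case (add y w b)
    then show ?case
      by (simp add: \<rho>_simps distrib_left distrib_right hk_eval_add hk_eval_diff single_times disjoint mult.commute)
  qed (simp add: \<rho>_simps)
  show ?thesis
  proof (induction x rule: poly_mapping_single_induct)
    case (add x u a)
    then show ?case using single[of u a] by (simp add: \<rho>_simps distrib_left distrib_right hk_eval_add hk_eval_diff)
  qed (simp add: \<rho>_simps)
qed

text \<open>Factors from different components commute only after evaluation, so the rearrangement
  takes place modulo the kernel of \<open>hk_eval G\<close>.\<close>

lemma \<mu>_mult:
  assumes s: "s \<in> TT" and t: "t \<in> TT"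
  shows "\<mu> (\<lambda>i\<in>II. s i \<otimes>\<^bsub>AA i\<^esub> t i) = \<mu> s \<otimes>\<^bsub>BB\<^esub> \<mu> t"
proof -
  obtain \<sigma> where \<sigma>: "\<And>i. i \<in> II \<Longrightarrow> s i = hk_eval (C i) (\<sigma> i)" using lift_exists[OF s] by blast
  obtain \<tau> where \<tau>: "\<And>i. i \<in> II \<Longrightarrow> t i = hk_eval (C i) (\<tau> i)" using lift_exists[OF t] by blast
  have I: "two_ideal {x :: 'v list \<Rightarrow>\<^sub>0 'k. hk_eval G x = 0}" by (rule two_ideal_hk_kernel)
  have com: "prod_list (map (\<lambda>i. \<rho> i (\<sigma> i)) is) * \<rho> j y - \<rho> j y * prod_list (map (\<lambda>i. \<rho> i (\<sigma> i)) is) \<in> {x. hk_eval G x = 0}"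
    if "set is \<subseteq> II" "j \<in> II" "j \<notin> set is" for "is" j y
    using that
  proof (induction "is")
    case (Cons i "is")
    let ?p = "prod_list (map (\<lambda>i. \<rho> i (\<sigma> i)) is)"
    have "\<rho> i (\<sigma> i) * \<rho> j y - \<rho> j y * \<rho> i (\<sigma> i) \<in> {x. hk_eval G x = 0}"
      using Cons.prems \<rho>_commute[of i j] by auto
    then have "\<rho> i (\<sigma> i) * (?p * \<rho> j y - \<rho> j y * ?p) + (\<rho> i (\<sigma> i) * \<rho> j y - \<rho> j y * \<rho> i (\<sigma> i)) * ?p \<in> {x. hk_eval G x = 0}"
      by (intro two_ideal_add[OF I] two_ideal_l[OF I Cons.IH] two_ideal_r[OF I]) (use Cons.prems in auto)
    then show ?case by (simp add: algebra_simps)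
  qed simp
  have prod: "prod_list (map (\<lambda>i. \<rho> i (\<sigma> i * \<tau> i)) is) - prod_list (map (\<lambda>i. \<rho> i (\<sigma> i)) is) * prod_list (map (\<lambda>i. \<rho> i (\<tau> i)) is) \<in> {x. hk_eval G x = 0}"
    if "set is \<subseteq> II" "distinct is" for "is"
    using that
  proof (induction "is")
    case (Cons i "is")
    let ?p = "prod_list (map (\<lambda>i. \<rho> i (\<sigma> i)) is)" and ?q = "prod_list (map (\<lambda>i. \<rho> i (\<tau> i)) is)"
      and ?r = "prod_list (map (\<lambda>i. \<rho> i (\<sigma> i * \<tau> i)) is)"
    have "\<rho> i (\<sigma> i) * (\<rho> i (\<tau> i) * (?r - ?p * ?q)) - \<rho> i (\<sigma> i) * ((?p * \<rho> i (\<tau> i) - \<rho> i (\<tau> i) * ?p) * ?q) \<in> {x. hk_eval G x = 0}"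
    proof (intro two_ideal_diff[OF I])
      show "\<rho> i (\<sigma> i) * (\<rho> i (\<tau> i) * (?r - ?p * ?q)) \<in> {x. hk_eval G x = 0}"
        using Cons by (intro two_ideal_l[OF I]) auto
      show "\<rho> i (\<sigma> i) * ((?p * \<rho> i (\<tau> i) - \<rho> i (\<tau> i) * ?p) * ?q) \<in> {x. hk_eval G x = 0}"
        by (intro two_ideal_l[OF I two_ideal_r[OF I com]]) (use Cons.prems in auto)
    qed
    then show ?case by (simp add: \<rho>_mult algebra_simps)
  qed simp
  have "\<mu> (\<lambda>i\<in>II. s i \<otimes>\<^bsub>AA i\<^esub> t i) = hk_eval G (prod_list (map (\<lambda>i. \<rho> i (\<sigma> i * \<tau> i)) [1..<Suc m]))"
    by (rule \<mu>_lift) (simp add: \<sigma> \<tau> onto_hom.h_mult[OF onto_component])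
  also have "\<dots> = hk_eval G (prod_list (map (\<lambda>i. \<rho> i (\<sigma> i)) [1..<Suc m]) * prod_list (map (\<lambda>i. \<rho> i (\<tau> i)) [1..<Suc m]))"
    using prod[of "[1..<Suc m]"] by (simp add: hk_eval_diff atLeastLessThanSuc_atLeastAtMost del: upt_Suc)
  also have "\<dots> = \<mu> s \<otimes>\<^bsub>BB\<^esub> \<mu> t"
    using \<mu>_lift[of s \<sigma>] \<mu>_lift[of t \<tau>] \<sigma> \<tau> B.h_mult by simp
  finally show ?thesis .
qed

lemma \<mu>_one: "\<mu> (\<lambda>i\<in>II. \<one>\<^bsub>AA i\<^esub>) = \<one>\<^bsub>BB\<^esub>"
proof -
  have "\<mu> (\<lambda>i\<in>II. \<one>\<^bsub>AA i\<^esub>) = hk_eval G (prod_list (map (\<lambda>i. \<rho> i 1) [1..<Suc m]))"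
    by (rule \<mu>_lift) (simp add: onto_hom.h_one[OF onto_component])
  also have "prod_list (map (\<lambda>i. \<rho> i (1 :: 'v list \<Rightarrow>\<^sub>0 'k)) is) = 1" for "is"
    by (induction "is") (auto simp: \<rho>_simps)
  finally show ?thesis unfolding B.h_one .
qed

definition \<mu>_lin :: "((nat \<Rightarrow> 'v list set \<Rightarrow>\<^sub>0 'k) \<Rightarrow>\<^sub>0 'k) \<Rightarrow> ('v list set \<Rightarrow>\<^sub>0 'k)" where
  "\<mu>_lin f = (\<Sum>t\<in>Poly_Mapping.keys f. Poly_Mapping.map ((*) (Poly_Mapping.lookup f t)) (\<mu> t))"

lemma \<mu>_lin_single: "\<mu>_lin (Poly_Mapping.single t c) = Poly_Mapping.map ((*) c) (\<mu> t)"
  by (cases "c = 0") (auto simp: \<mu>_lin_def)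

lemma \<mu>_lin_0: "\<mu>_lin 0 = 0"
  by (simp add: \<mu>_lin_def)

lemma map_times_add_scalar: "Poly_Mapping.map ((*) (a + b)) f = Poly_Mapping.map ((*) a) f + Poly_Mapping.map ((*) (b :: 'k)) f"
  by (intro poly_mapping_eqI) (simp add: lookup_map_times lookup_add distrib_right)

lemma \<mu>_lin_add: "\<mu>_lin (f + g) = \<mu>_lin f + \<mu>_lin g"
  unfolding \<mu>_lin_def by (rule setsum_keys_plus_distrib) (rule map_times_zero_left, rule map_times_add_scalar)

lemma \<mu>_lin_diff: "\<mu>_lin (f - g) = \<mu>_lin f - \<mu>_lin g"
  using \<mu>_lin_add[of "f - g" g] by simp

lemma \<mu>_lin_smult: "\<mu>_lin (Poly_Mapping.map ((*) c) f) = Poly_Mapping.map ((*) c) (\<mu>_lin f)"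
  by (induction f rule: poly_mapping_single_induct)
    (auto simp: \<mu>_lin_0 map_times_add \<mu>_lin_add \<mu>_lin_single map_times_times)

lemma \<mu>_lin_closed: "Poly_Mapping.keys f \<subseteq> TT \<Longrightarrow> Poly_Mapping.keys (\<mu>_lin f) \<subseteq> carrier (hk_monoid G)"
proof (induction f rule: keys_subset_induct)
  case (add f t c)
  then show ?case
    using order_trans[OF keys_map_times \<mu>_closed[OF add(3)]] by (simp add: \<mu>_lin_add \<mu>_lin_single keys_add_subset)
qed (simp add: \<mu>_lin_0)

lemma \<mu>_lin_nul: "n \<in> tensor_null II AA \<Longrightarrow> \<mu>_lin n = 0"
proof (induction rule: nul_induct[where M = HM and I = II, OF monoid_hk, consumes 1, case_names zero rel_add rel_smult add smult])
  case (rel_add t i x y)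
  show ?case by (simp only: \<mu>_lin_diff \<mu>_lin_single map_times_1 \<mu>_multilinear(1)[OF rel_add]) simp
next
  case (rel_smult t i a x)
  show ?case by (simp only: \<mu>_lin_diff \<mu>_lin_single map_times_1 \<mu>_multilinear(2)[OF rel_smult rel_smult(3)]) simp
qed (simp_all add: \<mu>_lin_0 \<mu>_lin_add \<mu>_lin_smult)

lemma \<mu>_lin_mult:
  assumes "Poly_Mapping.keys f \<subseteq> TT" "Poly_Mapping.keys g \<subseteq> TT"
  shows "\<mu>_lin (f \<otimes>\<^bsub>tensor_free II AA\<^esub> g) = \<mu>_lin f \<otimes>\<^bsub>BB\<^esub> \<mu>_lin g"
  using assms(1)
proof (induction f rule: keys_subset_induct)
  case (add f s a)
  have "\<mu>_lin (Poly_Mapping.single s a \<otimes>\<^bsub>tensor_free II AA\<^esub> g) = \<mu>_lin (Poly_Mapping.single s a) \<otimes>\<^bsub>BB\<^esub> \<mu>_lin g"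
    using assms(2)
  proof (induction g rule: keys_subset_induct)
    case (add g t b)
    have "\<mu>_lin (Poly_Mapping.single s a \<otimes>\<^bsub>tensor_free II AA\<^esub> Poly_Mapping.single t b)
       = \<mu>_lin (Poly_Mapping.single s a) \<otimes>\<^bsub>BB\<^esub> \<mu>_lin (Poly_Mapping.single t b)"
      using \<mu>_mult[OF \<open>s \<in> TT\<close> \<open>t \<in> TT\<close>]
      by (simp add: tf_mult[OF monoid_hk] tuple_mult[OF monoid_hk] \<mu>_lin_single hk_algebra_def
          ma_mult_smult_left ma_mult_smult_right map_times_times mult.commute)
    then show ?case using add
      by (simp add: tf_mult[OF monoid_hk] ma_mult_add_right \<mu>_lin_add hk_algebra_def)
  qed (simp add: tf_mult[OF monoid_hk] \<mu>_lin_0 hk_algebra_def)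
  then show ?case using add
    by (simp add: tf_mult[OF monoid_hk] ma_mult_add_left \<mu>_lin_add hk_algebra_def)
qed (simp add: tf_mult[OF monoid_hk] \<mu>_lin_0 hk_algebra_def)

definition \<phi> :: "((nat \<Rightarrow> 'v list set \<Rightarrow>\<^sub>0 'k) \<Rightarrow>\<^sub>0 'k) set \<Rightarrow> ('v list set \<Rightarrow>\<^sub>0 'k)" where
  "\<phi> = tensor_mult_map BB m (\<lambda>i. hk_incl K G)"

abbreviation cos :: "((nat \<Rightarrow> 'v list set \<Rightarrow>\<^sub>0 'k) \<Rightarrow>\<^sub>0 'k) \<Rightarrow> ((nat \<Rightarrow> 'v list set \<Rightarrow>\<^sub>0 'k) \<Rightarrow>\<^sub>0 'k) set" where
  "cos \<equiv> coset HM II"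

text \<open>\<open>\<mu>_lin\<close> vanishes on the relations by multilinearity, so the image of a
  coset is a singleton and \<open>the_elem\<close> is well defined there.\<close>

lemma \<phi>_coset:
  assumes f: "Poly_Mapping.keys f \<subseteq> TT"
  shows "\<phi> (cos f) = \<mu>_lin f"
proof -
  have lin: "lin_ext BB \<mu> g = \<mu>_lin g" if "Poly_Mapping.keys g \<subseteq> TT" for g
    unfolding hk_algebra_def \<mu>_lin_def
    by (rule lin_ext_monoid_algebra[OF monoid_hk]) (use that \<mu>_closed in blast)
  have "lin_ext BB \<mu> g = \<mu>_lin f" if "g \<in> cos f" for g
  proof -
    have n: "g - f \<in> tensor_null II AA" using that by (simp add: coset_iff[OF monoid_hk])
    have "Poly_Mapping.keys (g - f + f) \<subseteq> TT"
      by (rule keys_add_subset[OF nul_carrier[OF monoid_hk n] f])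
    then show ?thesis using lin[of g] \<mu>_lin_nul[OF n] by (simp add: \<mu>_lin_diff)
  qed
  moreover have "f \<in> cos f" by (simp add: coset_iff[OF monoid_hk] nul_0[OF monoid_hk])
  ultimately have "lin_ext BB \<mu> ` cos f = {\<mu>_lin f}" by force
  moreover have "\<phi> (cos f) = the_elem (lin_ext BB \<mu> ` cos f)"
    unfolding \<phi>_def tensor_mult_map_def \<mu>_def[abs_def] ..
  ultimately show ?thesis by simp
qed

text \<open>The projection of the monoid onto that of a component; by
  \<open>class_to_component\<close> the choice of a representative does not matter.\<close>

definition comp_class :: "nat \<Rightarrow> 'v list set \<Rightarrow> 'v list set" where
  "comp_class i X = hk_class (C i) (SOME w. hk_class G w = X)"

lemma comp_class: "i \<in> II \<Longrightarrow> comp_class i (hk_class G w) = hk_class (C i) w"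
  unfolding comp_class_def
  by (rule class_to_component, assumption) (rule someI[where P = "\<lambda>v. hk_class G v = hk_class G w" and x = w], rule HOL.refl)

text \<open>The inverse of the multiplication map on basis elements, sending a class to the tensor
  of its parts.\<close>

definition basis_tuple :: "'v list set \<Rightarrow> nat \<Rightarrow> 'v list set \<Rightarrow>\<^sub>0 'k" where
  "basis_tuple X = (\<lambda>i\<in>II. Poly_Mapping.single (comp_class i X) 1)"

lemma basis_tuple_TT: "basis_tuple (hk_class G w) \<in> TT"
  by (auto simp: basis_tuple_def fam_simps[OF monoid_hk] comp_class hk_monoid_carrier)

lemma prod_list_part: "prod_list (map (\<lambda>i. \<rho> i (wrd (w i) :: 'v list \<Rightarrow>\<^sub>0 'k)) is) = wrd (concat (map (\<lambda>i. part i (w i)) is))"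
  by (induction "is") (auto simp: \<rho>_simps single_times wrd_Nil)

lemma \<mu>_basis_tuple: "\<mu> (basis_tuple (hk_class G w)) = Poly_Mapping.single (hk_class G w) 1"
proof -
  have "\<mu> (basis_tuple (hk_class G w)) = hk_eval G (prod_list (map (\<lambda>i. \<rho> i (wrd w)) [1..<Suc m]))"
    by (rule \<mu>_lift) (simp add: basis_tuple_def comp_class)
  also have "\<dots> = Poly_Mapping.single (hk_class G w) 1"
    using class_concat[of w] by (simp only: prod_list_part hk_eval_simps)
  finally show ?thesis .
qed

lemma \<mu>_lin_section:
  assumes "Poly_Mapping.keys b \<subseteq> carrier (hk_monoid G)"
  shows "\<mu>_lin (push basis_tuple b) = b" "Poly_Mapping.keys (push basis_tuple b) \<subseteq> TT"
proof -
  show "\<mu>_lin (push basis_tuple b) = b"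
    using assms
  proof (induction b rule: keys_subset_induct)
    case (add b X c)
    then obtain w where "X = hk_class G w" by (auto simp: hk_monoid_carrier)
    then show ?case using add by (simp add: push_add \<mu>_lin_add \<mu>_lin_single \<mu>_basis_tuple)
  qed (simp add: \<mu>_lin_0)
  show "Poly_Mapping.keys (push basis_tuple b) \<subseteq> TT"
    using push_keys[of basis_tuple b] assms basis_tuple_TT by (force simp: hk_monoid_carrier)
qed

text \<open>A tuple of basis elements is recovered from its product \<open>W\<close>, whose part
  over \<open>C i\<close> is that of the \<open>i\<close>-th word. Multilinearity extends this to
  all tuples.\<close>

lemma section_\<mu>_lin:
  assumes "Poly_Mapping.keys f \<subseteq> TT"
  shows "f - push basis_tuple (\<mu>_lin f) \<in> tensor_null II AA"
proof -
  have smult: "\<mu> (t(i := Poly_Mapping.map ((*) c) x)) = Poly_Mapping.map ((*) c) (\<mu> (t(i := x)))"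
    if "t \<in> TT" "i \<in> II" "x \<in> carrier (AA i)" for t i x c
    by (rule \<mu>_multilinear(2)[OF that that(3)])
  have single: "Poly_Mapping.single t 1 - push basis_tuple (\<mu> t) \<in> tensor_null II AA" if t: "t \<in> TT" for t
  proof (rule single_minus_basis[OF monoid_hk _ push_add _ _ _ _ t])
    show "push basis_tuple (Poly_Mapping.map ((*) c) f) = Poly_Mapping.map ((*) c) (push basis_tuple f)"
      for c :: 'k and f :: "'v list set \<Rightarrow>\<^sub>0 'k"
      by (rule map_times_push[symmetric])
    fix t assume t: "t \<in> TT" and bas: "\<And>i. i \<in> II \<Longrightarrow> \<exists>x. t i = Poly_Mapping.single x (1 :: 'k)"
    have "\<exists>w. t i = hk_eval (C i) (wrd w)" if "i \<in> II" for i
    proof -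
      obtain x where x: "t i = Poly_Mapping.single x 1" using bas[OF \<open>i \<in> II\<close>] by blast
      moreover have "Poly_Mapping.keys (t i) \<subseteq> carrier (hk_monoid (C i))"
        using PiE_mem[OF t that] by (simp add: fam_simps[OF monoid_hk])
      ultimately show ?thesis by (auto simp: hk_monoid_carrier)
    qed
    then obtain w where w: "\<And>i. i \<in> II \<Longrightarrow> t i = hk_eval (C i) (wrd (w i))" by metis
    define W where "W = concat (map (\<lambda>i. part i (w i)) [1..<Suc m])"
    have "\<mu> t = hk_eval G (prod_list (map (\<lambda>i. \<rho> i (wrd (w i))) [1..<Suc m]))"
      by (rule \<mu>_lift[OF w])
    then have \<mu>t: "\<mu> t = Poly_Mapping.single (hk_class G W) 1"
      by (simp only: prod_list_part W_def[symmetric] hk_eval_simps)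
    have "basis_tuple (hk_class G W) i = t i" if "i \<in> II" for i
    proof -
      have "hk_class (C i) W = hk_class (C i) (w i)"
        using class_part[of i W] class_part[of i "w i"] part_concat[OF that, of w] by (simp only: W_def)
      then show ?thesis using that by (simp add: basis_tuple_def comp_class w)
    qed
    moreover have "basis_tuple (hk_class G W) i = t i" if "i \<notin> II" for i
      using that PiE_arb[OF t that] by (auto simp: basis_tuple_def)
    ultimately have "basis_tuple (hk_class G W) = t" by blast
    then show "Poly_Mapping.single t 1 - push basis_tuple (\<mu> t) \<in> tensor_null II AA"
      by (simp add: \<mu>t nul_0[OF monoid_hk])
  qed (rule finite_atLeastAtMost, (rule \<mu>_multilinear(1) smult; assumption)+)
  show ?thesis
    using assms
  proof (induction f rule: keys_subset_induct)
    case (add f t c)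
    from nul_add[OF monoid_hk add(1) nul_smult[OF monoid_hk single[OF add(3)], of c]]
    show ?case by (simp add: \<mu>_lin_add \<mu>_lin_single push_add map_times_diff map_times_push algebra_simps)
  qed (simp add: \<mu>_lin_0 nul_0[OF monoid_hk])
qed

lemma \<phi>_iso: "\<phi> \<in> algebra_iso (tensor_product II AA) BB"
proof -
  note tpc = tp_carrier[OF monoid_hk]
  have sm: "c \<odot>\<^bsub>BB\<^esub> x = Poly_Mapping.map ((*) c) x" for c x by (simp add: hk_algebra_def)
  have cl: "\<mu>_lin f \<in> carrier BB" if "Poly_Mapping.keys f \<subseteq> TT" for f
    using \<mu>_lin_closed[OF that] by (simp add: hk_algebra_def)
  have one: "Poly_Mapping.keys (Poly_Mapping.single (\<lambda>i\<in>II. \<one>\<^bsub>AA i\<^esub>) (1::'k)) \<subseteq> TT"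
    using monoid.one_closed[OF monoid_fam[OF monoid_hk]] by (auto simp del: fam_simps[OF monoid_hk])
  have hom: "\<phi> \<in> ring_hom (tensor_product II AA) BB"
  proof (rule ring_hom_memI)
    fix x y assume "x \<in> carrier (tensor_product II AA)" "y \<in> carrier (tensor_product II AA)"
    then obtain f g where fg: "x = cos f" "y = cos g" "Poly_Mapping.keys f \<subseteq> TT" "Poly_Mapping.keys g \<subseteq> TT"
      unfolding tpc by blast
    have fg': "Poly_Mapping.keys (f \<otimes>\<^bsub>tensor_free II AA\<^esub> g) \<subseteq> TT"
      using ma_mult_closed[OF monoid_tuples[where M = HM and I = II, OF monoid_hk], of f g] fg(3,4)
      by (simp add: tf_mult[OF monoid_hk] tuple_carrier[OF monoid_hk])
    show "\<phi> (x \<otimes>\<^bsub>tensor_product II AA\<^esub> y) = \<phi> x \<otimes>\<^bsub>BB\<^esub> \<phi> y"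
      unfolding fg(1,2) tp_mult[OF monoid_hk fg(3,4)] \<phi>_coset[OF fg(3)] \<phi>_coset[OF fg(4)] \<phi>_coset[OF fg']
      by (rule \<mu>_lin_mult[OF fg(3,4)])
    show "\<phi> (x \<oplus>\<^bsub>tensor_product II AA\<^esub> y) = \<phi> x \<oplus>\<^bsub>BB\<^esub> \<phi> y"
      unfolding fg(1,2) tp_add[OF monoid_hk fg(3,4)] \<phi>_coset[OF fg(3)] \<phi>_coset[OF fg(4)]
        \<phi>_coset[OF keys_add_subset[OF fg(3,4)]]
      by (simp add: \<mu>_lin_add hk_algebra_def)
  next
    show "\<phi> x \<in> carrier BB" if "x \<in> carrier (tensor_product II AA)" for x
      using that cl \<phi>_coset unfolding tpc by auto
    show "\<phi> \<one>\<^bsub>tensor_product II AA\<^esub> = \<one>\<^bsub>BB\<^esub>"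
      unfolding tp_one[OF monoid_hk] \<phi>_coset[OF one] \<mu>_lin_single \<mu>_one by simp
  qed
  moreover have "bij_betw \<phi> (carrier (tensor_product II AA)) (carrier BB)"
    unfolding bij_betw_def
  proof
    show "inj_on \<phi> (carrier (tensor_product II AA))"
    proof (rule inj_onI)
      fix x y assume "x \<in> carrier (tensor_product II AA)" "y \<in> carrier (tensor_product II AA)" and eq: "\<phi> x = \<phi> y"
      then obtain f g where fg: "x = cos f" "y = cos g" "Poly_Mapping.keys f \<subseteq> TT" "Poly_Mapping.keys g \<subseteq> TT"
        unfolding tpc by blast
      have "\<mu>_lin f = \<mu>_lin g"
        using eq unfolding fg(1,2) \<phi>_coset[OF fg(3)] \<phi>_coset[OF fg(4)] .
      then have "f - g \<in> tensor_null II AA"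
        using nul_diff[OF monoid_hk section_\<mu>_lin[OF fg(3)] section_\<mu>_lin[OF fg(4)]] by simp
      then show "x = y" by (simp add: fg coset_eq_iff[OF monoid_hk])
    qed
    show "\<phi> ` carrier (tensor_product II AA) = carrier BB"
    proof
      show "\<phi> ` carrier (tensor_product II AA) \<subseteq> carrier BB" using hom by (auto simp: ring_hom_def)
      show "carrier BB \<subseteq> \<phi> ` carrier (tensor_product II AA)"
      proof
        fix b assume "b \<in> carrier BB"
        then have "Poly_Mapping.keys b \<subseteq> carrier (hk_monoid G)" by (simp add: hk_algebra_def)
        note sec = \<mu>_lin_section[OF this]
        show "b \<in> \<phi> ` carrier (tensor_product II AA)"
          unfolding tpc using sec \<phi>_coset[OF sec(2)] by (metis (mono_tags, lifting) image_eqI mem_Collect_eq)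
      qed
    qed
  qed
  moreover have "\<phi> (c \<odot>\<^bsub>tensor_product II AA\<^esub> x) = c \<odot>\<^bsub>BB\<^esub> \<phi> x" if x: "x \<in> carrier (tensor_product II AA)" for c x
  proof -
    obtain f where f: "x = cos f" "Poly_Mapping.keys f \<subseteq> TT" using x unfolding tpc by blast
    have cf: "Poly_Mapping.keys (Poly_Mapping.map ((*) c) f) \<subseteq> TT" by (rule order_trans[OF keys_map_times f(2)])
    show ?thesis
      unfolding f(1) tp_smult[OF monoid_hk] \<phi>_coset[OF f(2)] \<phi>_coset[OF cf] sm by (rule \<mu>_lin_smult)
  qed
  ultimately show ?thesis by (auto simp: algebra_iso_def ring_iso_def)
qed

section \<open>Tensor ideals and their preimages in the free algebra\<close>

definition ideal_tuples :: "(nat \<Rightarrow> ('v list set \<Rightarrow>\<^sub>0 'k) set) \<Rightarrow> (nat \<Rightarrow> 'v list set \<Rightarrow>\<^sub>0 'k) set" where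
  "ideal_tuples P = {t \<in> TT. \<exists>i\<in>II. t i \<in> P i}"

lemma tensor_subspace_eq:
  assumes "\<And>i. i \<in> II \<Longrightarrow> U i \<subseteq> carrier (AA i)"
  shows "tensor_subspace II AA U = cos ` {f. Poly_Mapping.keys f \<subseteq> (\<Pi>\<^sub>E i\<in>II. U i)}"
proof -
  define V where "V = (\<Pi>\<^sub>E i\<in>II. U i)"
  have V: "V \<subseteq> TT" unfolding V_def by (rule PiE_mono) (use assms in blast)
  have pure: "pure_tensor II AA t = cos (Poly_Mapping.single t 1)" for t
    by (simp only: pure_tensor_def coset_def[OF monoid_hk])
  have sub: "x \<in> cos ` {f. Poly_Mapping.keys f \<subseteq> V}" if "x \<in> tensor_subspace II AA U" for x
    using that unfolding tensor_subspace_def V_def[symmetric]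
  proof induction
    case zero
    show ?case unfolding tp_zero[OF monoid_hk] by (rule imageI) simp
  next
    case (base x)
    then obtain t where "x = cos (Poly_Mapping.single t 1)" "t \<in> V" unfolding pure by blast
    then show ?case by (intro image_eqI[where x = "Poly_Mapping.single t 1"]) auto
  next
    case (add x y)
    then obtain f g where fg: "x = cos f" "y = cos g" "Poly_Mapping.keys f \<subseteq> V" "Poly_Mapping.keys g \<subseteq> V"
      by blast
    show ?case
      unfolding fg(1,2) tp_add[OF monoid_hk order_trans[OF fg(3) V] order_trans[OF fg(4) V]]
      by (rule imageI) (simp add: keys_add_subset fg)
  next
    case (smult x c)
    then obtain f where f: "x = cos f" "Poly_Mapping.keys f \<subseteq> V" by blast
    show ?case
      unfolding f(1) tp_smult[OF monoid_hk] using f(2) keys_map_times[of c f] by (intro imageI) blast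
  qed
  have "cos f \<in> tensor_subspace II AA U" if "Poly_Mapping.keys f \<subseteq> V" for f
    using that
  proof (induction f rule: keys_subset_induct)
    case zero
    show ?case unfolding tensor_subspace_def tp_zero[OF monoid_hk, symmetric] by (rule lin_span.zero)
  next
    case (add f t c)
    have "cos (Poly_Mapping.single t 1) \<in> tensor_subspace II AA U"
      using add(3) unfolding tensor_subspace_def pure[symmetric] V_def by (intro lin_span.base imageI)
    then have "cos (Poly_Mapping.map ((*) c) (Poly_Mapping.single t 1)) \<in> tensor_subspace II AA U"
      unfolding tensor_subspace_def tp_smult[OF monoid_hk, symmetric] by (rule lin_span.smult)
    then have "cos f \<oplus>\<^bsub>tensor_product II AA\<^esub> cos (Poly_Mapping.single t c) \<in> tensor_subspace II AA U"
      using add(1) unfolding tensor_subspace_def by (intro lin_span.add) simp_all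
    moreover have "cos f \<oplus>\<^bsub>tensor_product II AA\<^esub> cos (Poly_Mapping.single t c) = cos (f + Poly_Mapping.single t c)"
      by (rule tp_add[OF monoid_hk]) (use add(2,3) V in auto)
    ultimately show ?case by simp
  qed
  with sub show ?thesis unfolding V_def by blast
qed

text \<open>Tuples with an entry in one of the \<open>P i\<close> can be sorted by the index of such
  an entry. This turns their span into the sum of subspaces defining the tensor ideal.\<close>

lemma tensor_ideal_image:
  assumes P: "\<And>i. i \<in> II \<Longrightarrow> P i \<subseteq> carrier (AA i)"
  shows "\<phi> ` tensor_ideal II AA P = \<mu>_lin ` {f. Poly_Mapping.keys f \<subseteq> ideal_tuples P}"
proof -
  define V where "V i = {t \<in> TT. t i \<in> P i}" for i
  have V_TT: "V i \<subseteq> TT" for i by (auto simp: V_def)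
  have U: "(\<Pi>\<^sub>E j\<in>II. ((\<lambda>j. carrier (AA j))(i := P i)) j) = V i" if i: "i \<in> II" for i
  proof -
    define W where "W = (\<lambda>j. carrier (AA j))(i := P i)"
    have Wi: "W i = P i" unfolding W_def by (rule fun_upd_same)
    have Wj: "W j = carrier (AA j)" if "j \<noteq> i" for j unfolding W_def using that by (rule fun_upd_other)
    have "W j \<subseteq> carrier (AA j)" for j using P[OF i] Wi Wj by (cases "j = i") blast+
    then have "(\<Pi>\<^sub>E j\<in>II. W j) \<subseteq> TT" by (intro PiE_mono)
    moreover have "t i \<in> P i" if "t \<in> (\<Pi>\<^sub>E j\<in>II. W j)" for t using PiE_mem[OF that i] Wi by blast
    moreover have "t \<in> (\<Pi>\<^sub>E j\<in>II. W j)" if "t \<in> V i" for t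
    proof (rule PiE_I)
      show "t j \<in> W j" if "j \<in> II" for j
        using \<open>t \<in> V i\<close> Wi Wj PiE_mem[of t II "\<lambda>j. carrier (AA j)" j] that unfolding V_def by (cases "j = i") blast+
      show "t j = undefined" if "j \<notin> II" for j using \<open>t \<in> V i\<close> PiE_arb that unfolding V_def by blast
    qed
    ultimately show ?thesis unfolding V_def W_def[symmetric] by blast
  qed
  have sub: "tensor_subspace II AA ((\<lambda>j. carrier (AA j))(i := P i)) = cos ` {f. Poly_Mapping.keys f \<subseteq> V i}"
    if i: "i \<in> II" for i
    unfolding U[OF i, symmetric] by (rule tensor_subspace_eq) (use P[OF i] in auto)
  have fin: "\<phi> (finsum (tensor_product II AA) s II) = \<mu>_lin (sum g II) \<and> Poly_Mapping.keys (sum g II) \<subseteq> ideal_tuples P"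
    if g: "\<And>i. i \<in> II \<Longrightarrow> Poly_Mapping.keys (g i) \<subseteq> V i" and s: "\<And>i. i \<in> II \<Longrightarrow> s i = cos (g i)" for s g
  proof
    have "V i \<subseteq> ideal_tuples P" if "i \<in> II" for i using that unfolding V_def ideal_tuples_def by blast
    then show k: "Poly_Mapping.keys (sum g II) \<subseteq> ideal_tuples P"
      using g by (intro order_trans[OF Poly_Mapping.keys_sum] UN_least) blast
    have "finsum (tensor_product II AA) s II = cos (sum g II)"
      by (rule finsum_tp[OF monoid_hk]) (use g s V_TT in blast)+
    moreover have "Poly_Mapping.keys (sum g II) \<subseteq> TT" using k unfolding ideal_tuples_def by blast
    ultimately show "\<phi> (finsum (tensor_product II AA) s II) = \<mu>_lin (sum g II)" by (simp only: \<phi>_coset)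
  qed
  have split: "\<exists>g. (\<forall>i\<in>II. Poly_Mapping.keys (g i) \<subseteq> V i) \<and> f = sum g II" if "Poly_Mapping.keys f \<subseteq> ideal_tuples P" for f
    using that
  proof (induction f rule: keys_subset_induct)
    case zero
    show ?case by (rule exI[of _ "\<lambda>_. 0"]) simp
  next
    case (add f t c)
    then obtain g where g: "\<And>i. i \<in> II \<Longrightarrow> Poly_Mapping.keys (g i) \<subseteq> V i" "f = sum g II"
      by blast
    obtain i where i: "i \<in> II" "t \<in> V i" using add(3) by (auto simp: V_def ideal_tuples_def)
    have "Poly_Mapping.keys ((g(i := g i + Poly_Mapping.single t c)) j) \<subseteq> V j" if "j \<in> II" for j
      using g(1)[OF that] keys_add_subset[OF g(1)[OF i(1)], of "Poly_Mapping.single t c"] i(2) by auto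
    moreover have "sum (g(i := g i + Poly_Mapping.single t c)) II = f + Poly_Mapping.single t c"
      using i(1) unfolding g(2) by (simp add: sum.remove[of _ i] add_ac)
    ultimately show ?case by metis
  qed
  show ?thesis
  proof (intro equalityI subsetI)
    fix y assume "y \<in> \<phi> ` tensor_ideal II AA P"
    then obtain s where y: "y = \<phi> (finsum (tensor_product II AA) s II)"
      and s: "\<And>i. i \<in> II \<Longrightarrow> s i \<in> cos ` {f. Poly_Mapping.keys f \<subseteq> V i}"
      unfolding tensor_ideal_def using sub by blast
    from s have "\<forall>i\<in>II. \<exists>f. Poly_Mapping.keys f \<subseteq> V i \<and> s i = cos f" by blast
    then obtain g where "\<And>i. i \<in> II \<Longrightarrow> Poly_Mapping.keys (g i) \<subseteq> V i" "\<And>i. i \<in> II \<Longrightarrow> s i = cos (g i)" by metis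
    from fin[OF this] y show "y \<in> \<mu>_lin ` {f. Poly_Mapping.keys f \<subseteq> ideal_tuples P}" by blast
  next
    fix y assume "y \<in> \<mu>_lin ` {f. Poly_Mapping.keys f \<subseteq> ideal_tuples P}"
    then obtain g where g: "\<And>i. i \<in> II \<Longrightarrow> Poly_Mapping.keys (g i) \<subseteq> V i" and y: "y = \<mu>_lin (sum g II)"
      using split by blast
    have "y = \<phi> (finsum (tensor_product II AA) (\<lambda>i. cos (g i)) II)" using fin[OF g] y by simp
    moreover have "cos (g i) \<in> tensor_subspace II AA ((\<lambda>j. carrier (AA j))(i := P i))" if "i \<in> II" for i
      unfolding sub[OF that] using g[OF that] by blast
    ultimately show "y \<in> \<phi> ` tensor_ideal II AA P" unfolding tensor_ideal_def by blast
  qed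
qed

definition lift_ideal :: "(nat \<Rightarrow> ('v list set \<Rightarrow>\<^sub>0 'k) set) \<Rightarrow> ('v list \<Rightarrow>\<^sub>0 'k) set" where
  "lift_ideal P = hk_eval G -` \<mu>_lin ` {f. Poly_Mapping.keys f \<subseteq> ideal_tuples P}"

text \<open>The tuple with \<open>x\<close> evaluated at position \<open>i\<close> and 1 elsewhere
  does it.\<close>

lemma lift_ideal_component:
  assumes i: "i \<in> II" and x: "hk_eval (C i) x \<in> P i"
  shows "\<rho> i x \<in> lift_ideal P"
proof -
  define t where "t = (\<lambda>j\<in>II. hk_eval (C j) (((\<lambda>_. 1)(i := x)) j))"
  have "hk_eval (C j) y \<in> carrier (AA j)" for j and y :: "'v list \<Rightarrow>\<^sub>0 'k"
    by (rule onto_hom.h_closed[OF onto_component])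
  then have "t \<in> TT" unfolding t_def by (intro restrict_PiE_iff[THEN iffD2]) blast
  moreover have "t i \<in> P i" using i x by (simp add: t_def)
  ultimately have t: "t \<in> ideal_tuples P" using i by (auto simp: ideal_tuples_def)
  have "prod_list (map (\<lambda>j. \<rho> j (((\<lambda>_. 1)(i := x)) j)) js) = (if i \<in> set js then \<rho> i x else 1)" if "distinct js" for js
    using that by (induction js) (auto simp: \<rho>_simps)
  then have "prod_list (map (\<lambda>j. \<rho> j (((\<lambda>_. 1)(i := x)) j)) [1..<Suc m]) = \<rho> i x"
    using i by (simp del: upt_Suc)
  moreover have "\<mu> t = hk_eval G (prod_list (map (\<lambda>j. \<rho> j (((\<lambda>_. 1)(i := x)) j)) [1..<Suc m]))"
    by (rule \<mu>_lift) (simp add: t_def)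
  ultimately have "hk_eval G (\<rho> i x) = \<mu>_lin (Poly_Mapping.single t 1)" by (simp only: \<mu>_lin_single map_times_1)
  then show ?thesis using t by (auto simp: lift_ideal_def)
qed

lemma lift_ideal_two_ideal:
  assumes P: "\<And>i. i \<in> II \<Longrightarrow> ideal (P i) (AA i)"
  shows "two_ideal (lift_ideal P)"
proof -
  have sub: "ideal_tuples P \<subseteq> TT" by (auto simp: ideal_tuples_def)
  have prod: "(\<lambda>i\<in>II. s i \<otimes>\<^bsub>AA i\<^esub> t i) \<in> ideal_tuples P"
    if "s \<in> ideal_tuples P \<and> t \<in> TT \<or> s \<in> TT \<and> t \<in> ideal_tuples P" for s t
  proof -
    have "(\<lambda>i\<in>II. s i \<otimes>\<^bsub>AA i\<^esub> t i) \<in> TT"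
      using that sub by (intro tuple_mult_closed[OF monoid_hk]) blast+
    moreover have "\<exists>i\<in>II. s i \<otimes>\<^bsub>AA i\<^esub> t i \<in> P i"
      using that ideal.I_l_closed[OF P] ideal.I_r_closed[OF P] PiE_mem unfolding ideal_tuples_def by blast
    ultimately show ?thesis by (auto simp: ideal_tuples_def)
  qed
  have keys: "Poly_Mapping.keys (f \<otimes>\<^bsub>tensor_free II AA\<^esub> g) \<subseteq> ideal_tuples P"
    if "\<And>s t. s \<in> Poly_Mapping.keys f \<Longrightarrow> t \<in> Poly_Mapping.keys g \<Longrightarrow>
      s \<in> ideal_tuples P \<and> t \<in> TT \<or> s \<in> TT \<and> t \<in> ideal_tuples P" for f g
    unfolding tf_mult[OF monoid_hk] ma_mult_def tuple_mult[OF monoid_hk]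
    using prod[OF that]
    by (intro order_trans[OF Poly_Mapping.keys_sum] UN_least) auto
  have elem: "\<exists>b. Poly_Mapping.keys b \<subseteq> TT \<and> hk_eval G x = \<mu>_lin b" for x
    using \<mu>_lin_section[of "hk_eval G x"] B.h_closed[of x] by (metis hk_algebra_def mem_Collect_eq monoid_algebra_simps(1))
  show ?thesis
    unfolding two_ideal_def
  proof (intro conjI ballI allI)
    show "0 \<in> lift_ideal P" unfolding lift_ideal_def by (auto simp: hk_eval_simps intro!: image_eqI[of _ _ 0] simp: \<mu>_lin_0)
  next
    fix a b assume "a \<in> lift_ideal P" "b \<in> lift_ideal P"
    then obtain f g where "hk_eval G a = \<mu>_lin f" "hk_eval G b = \<mu>_lin g"
      "Poly_Mapping.keys f \<subseteq> ideal_tuples P" "Poly_Mapping.keys g \<subseteq> ideal_tuples P"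
      by (auto simp: lift_ideal_def)
    then show "a + b \<in> lift_ideal P"
      using keys_add_subset[of f _ g] by (auto simp: lift_ideal_def hk_eval_add \<mu>_lin_add[symmetric])
  next
    fix x a assume "a \<in> lift_ideal P"
    then obtain f where f: "hk_eval G a = \<mu>_lin f" "Poly_Mapping.keys f \<subseteq> ideal_tuples P"
      by (auto simp: lift_ideal_def)
    obtain b where b: "Poly_Mapping.keys b \<subseteq> TT" "hk_eval G x = \<mu>_lin b" using elem by blast
    have fT: "Poly_Mapping.keys f \<subseteq> TT" using f(2) sub by blast
    have "hk_eval G (x * a) = \<mu>_lin (b \<otimes>\<^bsub>tensor_free II AA\<^esub> f)"
      using \<mu>_lin_mult[OF b(1) fT] by (simp only: B.h_mult f(1) b(2))
    moreover have "Poly_Mapping.keys (b \<otimes>\<^bsub>tensor_free II AA\<^esub> f) \<subseteq> ideal_tuples P"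
      by (rule keys) (use b f in blast)
    ultimately show "x * a \<in> lift_ideal P" unfolding lift_ideal_def by blast
    have "hk_eval G (a * x) = \<mu>_lin (f \<otimes>\<^bsub>tensor_free II AA\<^esub> b)"
      using \<mu>_lin_mult[OF fT b(1)] by (simp only: B.h_mult f(1) b(2))
    moreover have "Poly_Mapping.keys (f \<otimes>\<^bsub>tensor_free II AA\<^esub> b) \<subseteq> ideal_tuples P"
      by (rule keys) (use b f in blast)
    ultimately show "a * x \<in> lift_ideal P" unfolding lift_ideal_def by blast
  qed
qed

lemma two_ideal_prod_list:
  assumes "two_ideal L" "i \<in> set is" "g i \<in> L"
  shows "prod_list (map g is) \<in> (L :: ('v list \<Rightarrow>\<^sub>0 'k) set)"
  using assms(2)
proof (induction "is")
  case (Cons j js)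
  then show ?case using two_ideal_l[OF assms(1)] two_ideal_r[OF assms(1) assms(3)] by auto
qed simp

text \<open>A tuple with an entry in \<open>P i\<close> is evaluated by a product with one factor in
  \<open>L\<close>. This is the leastness demanded by \<open>maximal_generated\<close>.\<close>

lemma lift_ideal_least:
  assumes L: "two_ideal L" and ker: "\<And>x. hk_eval G x = 0 \<Longrightarrow> x \<in> L"
    and PL: "\<And>i x. i \<in> II \<Longrightarrow> hk_eval (C i) x \<in> P i \<Longrightarrow> \<rho> i x \<in> L"
  shows "lift_ideal P \<subseteq> L"
proof
  have lift: "\<exists>y\<in>L. hk_eval G y = \<mu>_lin f" if "Poly_Mapping.keys f \<subseteq> ideal_tuples P" for f
    using that
  proof (induction f rule: keys_subset_induct)
    case zero
    show ?case using two_ideal_0[OF L] by (intro bexI[of _ 0]) (simp_all add: \<mu>_lin_0 hk_eval_simps)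
  next
    case (add f t c)
    then obtain y where y: "y \<in> L" "hk_eval G y = \<mu>_lin f" by blast
    obtain i where t: "t \<in> TT" and i: "i \<in> II" "t i \<in> P i" using add(3) by (auto simp: ideal_tuples_def)
    obtain \<tau> where \<tau>: "\<And>i. i \<in> II \<Longrightarrow> t i = hk_eval (C i) (\<tau> i)" using lift_exists[OF t] by blast
    let ?p = "prod_list (map (\<lambda>i. \<rho> i (\<tau> i)) [1..<Suc m])"
    have "?p \<in> L"
      by (rule two_ideal_prod_list[OF L, of i]) (use i \<tau> PL[OF i(1), of "\<tau> i"] in auto)
    then have "y + cst c * ?p \<in> L" by (intro two_ideal_add[OF L] y(1) two_ideal_l[OF L])
    moreover have "hk_eval G (y + cst c * ?p) = \<mu>_lin (f + Poly_Mapping.single t c)"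
      using \<mu>_lift[OF \<tau>] by (simp only: hk_eval_add hk_eval_cst y(2) \<mu>_lin_add \<mu>_lin_single)
    ultimately show ?case by blast
  qed
  fix x assume "x \<in> lift_ideal P"
  then obtain f where f: "hk_eval G x = \<mu>_lin f" "Poly_Mapping.keys f \<subseteq> ideal_tuples P"
    by (auto simp: lift_ideal_def)
  then obtain y where "y \<in> L" "hk_eval G y = hk_eval G x" using lift[OF f(2)] by metis
  then show "x \<in> L" using two_ideal_add[OF L ker[of "x - y"], of y] by (simp add: hk_eval_diff)
qed

lemma image_lift_ideal:
  "hk_eval G ` lift_ideal P = \<mu>_lin ` {f. Poly_Mapping.keys f \<subseteq> ideal_tuples P}"
proof -
  have "y \<in> range (hk_eval G)" if "y \<in> \<mu>_lin ` {f. Poly_Mapping.keys f \<subseteq> ideal_tuples P}" for y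
  proof -
    have "y \<in> carrier BB" using that \<mu>_lin_closed unfolding ideal_tuples_def by (fastforce simp: hk_algebra_def)
    then show ?thesis using B.h_onto[of y] by blast
  qed
  then show ?thesis unfolding lift_ideal_def by (auto simp: image_vimage_eq)
qed

lemma maximal_lift_ideal:
  assumes P: "\<And>i. i \<in> II \<Longrightarrow> maximalideal (P i) (AA i)"
  shows "maximal_two_ideal (lift_ideal P)"
proof (rule maximal_generated[where I = "\<lambda>i. hk_eval (C i) -` P i"])
  show "maximal_two_ideal (hk_eval (C i) -` P i)" if "i \<in> II" for i
    by (rule onto_hom.maximal_vimage[OF onto_component P[OF that]])
  show "x \<in> hk_eval (C i) -` P i" if "i \<in> II" "hk_eval (C i) x = 0" for i x
    using onto_hom.ker_vimage[OF onto_component maximalideal.axioms(1)[OF P[OF that(1)]], of x] that(2)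
    by (simp add: fam_def[OF monoid_hk])
  show "two_ideal (lift_ideal P)" by (rule lift_ideal_two_ideal[OF maximalideal.axioms(1)[OF P]])
  show "x \<in> lift_ideal P" if "hk_eval G x = 0" for x
    using that unfolding lift_ideal_def by (auto intro!: image_eqI[of _ _ 0] simp: \<mu>_lin_0)
  show "\<rho> i x \<in> lift_ideal P" if "i \<in> II" "x \<in> hk_eval (C i) -` P i" for i x
    using lift_ideal_component that by blast
  show "lift_ideal P \<subseteq> L" if "two_ideal L" "\<And>x. hk_eval G x = 0 \<Longrightarrow> x \<in> L"
    "\<And>i x. i \<in> II \<Longrightarrow> x \<in> hk_eval (C i) -` P i \<Longrightarrow> \<rho> i x \<in> L" for L
    by (rule lift_ideal_least[OF that(1,2)]) (use that(3) in auto)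
qed

theorem maximalideal_tensor_ideal:
  assumes P: "\<And>i. i \<in> II \<Longrightarrow> maximalideal (P i) (AA i)"
  shows "maximalideal (\<phi> ` tensor_ideal II AA P) BB"
proof -
  note ideal = maximalideal.axioms(1)[OF P]
  have "P i \<subseteq> carrier (AA i)" if "i \<in> II" for i
    by (rule additive_subgroup.a_subset[OF ideal.axioms(1)[OF ideal[OF that]]])
  from tensor_ideal_image[OF this] have "\<phi> ` tensor_ideal II AA P = hk_eval G ` lift_ideal P"
    by (simp only: image_lift_ideal)
  moreover have "x \<in> lift_ideal P" if "hk_eval G x = \<zero>\<^bsub>BB\<^esub>" for x
    using that unfolding lift_ideal_def by (auto intro!: image_eqI[of _ _ 0] simp: \<mu>_lin_0 hk_algebra_def)
  ultimately show ?thesis using B.maximal_image[OF maximal_lift_ideal[OF P]] by simp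
qed

text \<open>The \<open>P i\<close> are the restrictions of \<open>J\<close> to the factors. Their
  tensor ideal is contained in \<open>J\<close> and is already maximal, so the two coincide.\<close>

theorem maximalideal_is_tensor_ideal:
  assumes J: "maximalideal J BB"
  shows "\<exists>P. (\<forall>i\<in>II. maximalideal (P i) (AA i)) \<and> J = \<phi> ` tensor_ideal II AA P"
proof -
  define L where "L = hk_eval G -` J"
  have max: "maximal_two_ideal L" unfolding L_def by (rule B.maximal_vimage[OF J])
  have ker: "x \<in> L" if "hk_eval G x = 0" for x
    using B.ker_vimage[OF maximalideal.axioms(1)[OF J], of x] that by (simp add: L_def hk_algebra_def)
  define P where "P i = hk_eval (C i) ` {x. \<rho> i x \<in> L}" for i
  note part = maximal_part[OF max ker]
  have P: "maximalideal (P i) (AA i)" if "i \<in> II" for i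
    unfolding P_def by (rule onto_hom.maximal_image[OF onto_component part(1)[OF _ that]])
      (use part(2)[OF _ that] in \<open>simp_all add: fam_def[OF monoid_hk]\<close>)
  have PL: "\<rho> i x \<in> L" if i: "i \<in> II" and x: "hk_eval (C i) x \<in> P i" for i x
  proof -
    have "hk_eval (C i) -` P i = {x. \<rho> i x \<in> L}"
      unfolding P_def by (rule onto_hom.vimage_image[OF onto_component maximal_two_idealD(1)[OF part(1)[OF _ i]]])
        (use part(2)[OF _ i] in \<open>simp_all add: fam_def[OF monoid_hk]\<close>)
    then show ?thesis using x by blast
  qed
  have sub: "lift_ideal P \<subseteq> L" by (rule lift_ideal_least[OF maximal_two_idealD(1)[OF max] ker PL])
  have "L = lift_ideal P"
    using maximal_lift_ideal[OF P] sub maximal_two_idealD(1,2)[OF max] unfolding maximal_two_ideal_def by blast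
  then have "J = hk_eval G ` lift_ideal P"
    using B.image_vimage[OF maximalideal.axioms(1)[OF J]] by (simp add: L_def)
  moreover have "P i \<subseteq> carrier (AA i)" if "i \<in> II" for i
    by (rule additive_subgroup.a_subset[OF ideal.axioms(1)[OF maximalideal.axioms(1)[OF P[OF that]]]])
  ultimately have "J = \<phi> ` tensor_ideal II AA P" by (simp only: image_lift_ideal tensor_ideal_image)
  then show ?thesis using P by blast
qed

end

end

theorem theorem7p1:
  fixes K :: "'k::alg_closed_field itself"
    and \<Theta> :: "'v pair_pre_digraph"
    and m :: nat
    and \<Theta>c :: "nat \<Rightarrow> 'v pair_pre_digraph"
  assumes "oriented_graph \<Theta>"
    and "PI_algebra (hk_algebra K \<Theta>)"
    and "bij_betw \<Theta>c {1..m} (connected_components (cyclic_part \<Theta>))"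
  shows "let \<Theta>' = cyclic_part \<Theta>;
             A = (\<lambda>i. hk_algebra K (\<Theta>c i));
             \<phi> = tensor_mult_map (hk_algebra K \<Theta>') m (\<lambda>i. hk_incl K \<Theta>')
         in
           (\<exists>F. bij_betw F {J. maximalideal J (hk_algebra K \<Theta>)}
                           {J. maximalideal J (hk_algebra K \<Theta>')})
         \<and> \<phi> \<in> algebra_iso (tensor_product {1..m} A) (hk_algebra K \<Theta>')
         \<and> (\<forall>J. maximalideal J (hk_algebra K \<Theta>') \<longrightarrow>
              (\<exists>P. (\<forall>i\<in>{1..m}. maximalideal (P i) (A i)) \<and> J = \<phi> ` tensor_ideal {1..m} A P))
         \<and> (\<forall>P. (\<forall>i\<in>{1..m}. maximalideal (P i) (A i)) \<longrightarrow>
              maximalideal (\<phi> ` tensor_ideal {1..m} A P) (hk_algebra K \<Theta>'))"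
proof -
  have og: "oriented_graph (cyclic_part \<Theta>)" by (rule oriented_graph_cyclic_part[OF assms(1)])
  have pg: "permutation_graph (cyclic_part \<Theta>)" by (rule permutation_graph_cyclic_part[OF assms(1,2)])
  have comp: "\<Theta>c i \<in> connected_components (cyclic_part \<Theta>)" if "i \<in> {1..m}" for i
    using bij_betwE[OF assms(3)] that by blast
  interpret H: hk_components "cyclic_part \<Theta>" \<Theta>c m
  proof (rule hk_components.intro)
    note D = componentD[OF og comp]
    show "permutation_graph (\<Theta>c i)" if "i \<in> {1..m}" for i
      by (rule permutation_graph_component[OF og pg comp[OF that]])
    show "i = j" if i: "i \<in> {1..m}" and j: "j \<in> {1..m}" and x: "x \<in> pverts (\<Theta>c i)" "x \<in> pverts (\<Theta>c j)" for i j x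
      using component_unique[OF og comp[OF i] comp[OF j] x] inj_onD[OF bij_betw_imp_inj_on[OF assms(3)] _ i j] by blast
    show "pverts (cyclic_part \<Theta>) = (\<Union>i\<in>{1..m}. pverts (\<Theta>c i))"
    proof (intro equalityI subsetI)
      fix v assume "v \<in> pverts (cyclic_part \<Theta>)"
      then obtain H where "H \<in> connected_components (cyclic_part \<Theta>)" "v \<in> pverts H"
        using component_exists[OF og] by blast
      then show "v \<in> (\<Union>i\<in>{1..m}. pverts (\<Theta>c i))"
        unfolding bij_betw_imp_surj_on[OF assms(3), symmetric] by blast
    qed (use D(1) in blast)
    show "(u, v) \<in> parcs (\<Theta>c i) \<longleftrightarrow> (u, v) \<in> parcs (cyclic_part \<Theta>) \<and> u \<in> pverts (\<Theta>c i)" if "i \<in> {1..m}" for i u v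
      using D(2,4,6)[OF that] by blast
    show "u \<in> pverts (\<Theta>c i) \<longleftrightarrow> v \<in> pverts (\<Theta>c i)" if "i \<in> {1..m}" "(u, v) \<in> parcs (cyclic_part \<Theta>)" for i u v
      using D(4,6)[OF that(1)] that(2) by blast
  qed (fact og pg)+
  have A: "fam (\<lambda>i. hk_monoid (\<Theta>c i)) = (\<lambda>i. hk_algebra K (\<Theta>c i))"
    by (rule ext) (rule H.AA_eq)
  note iso = H.\<phi>_iso[where K = K, unfolded H.\<phi>_def A]
    and is_tensor = H.maximalideal_is_tensor_ideal[where K = K, unfolded H.\<phi>_def A]
    and tensor = H.maximalideal_tensor_ideal[where K = K, unfolded H.\<phi>_def A]
  show ?thesis
    unfolding Let_def
    using maximal_ideals_cyclic_part[OF assms(1,2)] iso is_tensor tensor by blast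
qed

end
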